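(* Let $W_i=(\psi_{2,i},Y_i(0),Y_i(1))$, $i\ge1$, be i.i.d. with $E[Y(d)^2]<\infty$ for $d=0,1$, and let $\psi_{1,i}=f(\psi_{2,i})$ for some measurable function $f$ (both $\psi_1,\psi_2$ are finite-dimensional real vectors). Let $q\in(0,1]$ and $p\in(0,1)$ be rational constants. Suppose $T_{1:n}\sim\mathrm{Loc}(\psi_1,q)$ and $D_{1:n}\sim\mathrm{Loc}(\psi_2,p)$ (defined in the context). Let $Y_i=T_i[D_iY_i(1)+(1-D_i)Y_i(0)]$, $n_T=\sum_{i=1}^nT_i$, $\mathrm{ATE}=E[Y(1)-Y(0)]$, and $$\hat\theta=\frac1n\sum_{i=1}^n\frac{T_i}{q}\left(\frac{D_iY_i}{p}-\frac{(1-D_i)Y_i}{1-p}\right).$$ Let $\tau=Y(1)-Y(0)$ and $\bar Y=(1-p)Y(1)+pY(0)$. Then $\sqrt{n_T}(\hat\theta-\mathrm{ATE})$ converges in distribution to $\mathcal{N}(0,V)$ as $n\to\infty$, where $$V=q\,\mathrm{Var}(\tau)+(1-q)E[\mathrm{Var}(\tau\mid\psi_1)]+\frac{E[\mathrm{Var}(\bar Y\mid\psi_2)]}{p(1-p)}.$$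
   Context: Local randomization. For each $n$ let $\pi_n$ be a random element independent of $W_{1:n}$ (used for tie-breaking in group formation). Sampling: write $q=a/k$ with integers $1\le a\le k$. $T_{1:n}\sim\mathrm{Loc}(\psi_1,q)$ means there is a partition $\mathcal{G}_n^T$ of $\{1,\dots,n\}$ that is a function of $(\psi_{1,1:n},\pi_n)$ such that: (1) tight matching: $n^{-1}\sum_{g\in\mathcal{G}_n^T}\sum_{i\in g}|\psi_{1,i}-\bar\psi_{1,g}|_2^2=o_p(1)$, where $\bar\psi_{1,g}=|g|^{-1}\sum_{i\in g}\psi_{1,i}$; (2) complete randomization: each group has exactly $k$ units, except for at most one remainder group with fewer than $k$ units. Conditional on $(W_{1:n},\pi_n)$, the vectors $(T_i)_{i\in g}$ are independent across groups; in a full group, $(T_i)_{i\in g}$ is uniform over binary vectors in $\{0,1\}^{k}$ with exactly $a$ ones; in the remainder group the $T_i$ are i.i.d. Bernoulli$(q)$. Assignment: $D_{1:n}\sim\mathrm{Loc}(\psi_2,p)$ is defined in the same way for the sampled units: the partition $\mathcal{G}_n^D$ is a partition of $\{i:T_i=1\}$ that is a function of $(\psi_{2,1:n},T_{1:n},\pi_n)$, it satisfies $n^{-1}\sum_{g\in\mathcal{G}_n^D}\sum_{i\in g}|\psi_{2,i}-\bar\psi_{2,g}|_2^2=o_p(1)$, and the complete randomization in (2), with $p$ (and its own numerator and denominator) in place of $q$ and $D$ in place of $T$, holds conditional on $(W_{1:n},\pi_n,T_{1:n})$. (Values of $D_i$ for $T_i=0$ are irrelevant.) *)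

theory Defs
  imports "HOL-Probability.Probability"
begin

section \<open>Conditioning and convergence\<close>

abbreviation sigma_of :: "'o measure \<Rightarrow> 'a measure \<Rightarrow> ('o \<Rightarrow> 'a) \<Rightarrow> 'o measure" where
  "sigma_of M N X \<equiv> vimage_algebra (space M) X N"

definition cond_pr :: "'o measure \<Rightarrow> 'o measure \<Rightarrow> ('o \<Rightarrow> bool) \<Rightarrow> 'o \<Rightarrow> real" where
  "cond_pr M F P = real_cond_exp M F (indicator {\<omega> \<in> space M. P \<omega>})"

definition cond_var :: "'o measure \<Rightarrow> 'o measure \<Rightarrow> ('o \<Rightarrow> real) \<Rightarrow> 'o \<Rightarrow> real" where
  "cond_var M F X = real_cond_exp M F (\<lambda>\<omega>. (X \<omega> - real_cond_exp M F X \<omega>)\<^sup>2)"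

definition small_op_1 :: "'o measure \<Rightarrow> (nat \<Rightarrow> 'o \<Rightarrow> real) \<Rightarrow> bool" where
  "small_op_1 M X \<longleftrightarrow>
     (\<forall>\<epsilon>>0. (\<lambda>n. measure M {\<omega> \<in> space M. \<bar>X n \<omega>\<bar> > \<epsilon>}) \<longlonglongrightarrow> 0)"

text \<open>The second argument is the variance, not the standard deviation. The case \<^term>\<open>v = 0\<close> is
  separated because \<^const>\<open>normal_density\<close> vanishes identically for a zero standard deviation.\<close>
definition normal_law :: "real \<Rightarrow> real \<Rightarrow> real measure" where
  "normal_law \<mu> v =
     (if v = 0 then return borel \<mu> else density lborel (normal_density \<mu> (sqrt v)))"

section \<open>Local randomization\<close>

text \<open>The vector \<open>X\<^sub>1, \<dots>, X\<^sub>n\<close>, as an element of the product space indexed by \<^term>\<open>{1..n}\<close>.\<close>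
definition upto_n :: "nat \<Rightarrow> (nat \<Rightarrow> 'o \<Rightarrow> 'a) \<Rightarrow> 'o \<Rightarrow> nat \<Rightarrow> 'a" where
  "upto_n n X \<omega> = (\<lambda>i\<in>{1..n}. X i \<omega>)"

definition group_mean :: "(nat \<Rightarrow> 'v::euclidean_space) \<Rightarrow> nat set \<Rightarrow> 'v" where
  "group_mean x g = (1 / real (card g)) *\<^sub>R (\<Sum>i\<in>g. x i)"

definition tight_matching ::
  "'o measure \<Rightarrow> (nat \<Rightarrow> 'o \<Rightarrow> 'v::euclidean_space) \<Rightarrow> (nat \<Rightarrow> 'o \<Rightarrow> nat set set) \<Rightarrow> bool" where
  "tight_matching M \<psi> G \<longleftrightarrow>
     small_op_1 M (\<lambda>n \<omega>. (1 / real n) *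
       (\<Sum>g\<in>G n \<omega>. \<Sum>i\<in>g. (norm (\<psi> i \<omega> - group_mean (\<lambda>j. \<psi> j \<omega>) g))\<^sup>2))"

text \<open>Complete randomization of the binary variables \<open>Z i\<close> within the random groups
  \<^term>\<open>G \<omega>\<close>, conditionally on the sigma-algebra \<open>F\<close> (which makes \<open>G\<close> measurable), with \<open>a\<close> ones
  in every group of size \<open>k\<close>. The conditional laws are given by their mass functions. Since the
  groups are random, each clause fixes a deterministic partition or group and restricts to the
  event that it is the realized one.\<close>
definition complete_randomization ::
  "'o measure \<Rightarrow> 'o measure \<Rightarrow> ('o \<Rightarrow> nat set set) \<Rightarrow> (nat \<Rightarrow> 'o \<Rightarrow> bool) \<Rightarrow> nat \<Rightarrow> nat \<Rightarrow> bool"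
where
  "complete_randomization M F G Z a k \<longleftrightarrow>
     (\<forall>\<omega>\<in>space M. (\<forall>g\<in>G \<omega>. card g \<le> k) \<and> card {g \<in> G \<omega>. card g < k} \<le> 1) \<and>
     \<comment> \<open>independence across groups\<close>
     (\<forall>P z. AE \<omega> in M. G \<omega> = P \<longrightarrow>
        cond_pr M F (\<lambda>\<omega>'. \<forall>g\<in>P. \<forall>i\<in>g. Z i \<omega>' = z i) \<omega> =
        (\<Prod>g\<in>P. cond_pr M F (\<lambda>\<omega>'. \<forall>i\<in>g. Z i \<omega>' = z i) \<omega>)) \<and>
     \<comment> \<open>uniform law on the vectors with exactly \<open>a\<close> ones in a full group\<close>
     (\<forall>g z. AE \<omega> in M. g \<in> G \<omega> \<and> card g = k \<longrightarrow>
        cond_pr M F (\<lambda>\<omega>'. \<forall>i\<in>g. Z i \<omega>' = z i) \<omega> =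
        (if card {i \<in> g. z i} = a then 1 / real (k choose a) else 0)) \<and>
     \<comment> \<open>i.i.d. Bernoulli variables in the remainder group\<close>
     (\<forall>g z. AE \<omega> in M. g \<in> G \<omega> \<and> card g < k \<longrightarrow>
        cond_pr M F (\<lambda>\<omega>'. \<forall>i\<in>g. Z i \<omega>' = z i) \<omega> =
        (\<Prod>i\<in>g. pmf (bernoulli_pmf (real a / real k)) (z i)))"

text \<open>The units \<^term>\<open>U n \<omega>\<close> are partitioned into groups by a measurable function \<open>h n\<close> of the
  design information \<^term>\<open>S n \<omega>\<close>, which takes values in the measurable space \<^term>\<open>I n\<close>;
  \<^term>\<open>F n\<close> is the sigma-algebra conditionally on which the variables \<^term>\<open>Z n i\<close> are randomized.
  Partitions of subsets of \<^term>\<open>{1..n}\<close> form a finite set, which is given the discrete structure.\<close>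
definition local_randomization ::
  "'o measure \<Rightarrow> (nat \<Rightarrow> 'o \<Rightarrow> nat set) \<Rightarrow> (nat \<Rightarrow> 'o \<Rightarrow> 'v::euclidean_space) \<Rightarrow>
   (nat \<Rightarrow> 's measure) \<Rightarrow> (nat \<Rightarrow> 'o \<Rightarrow> 's) \<Rightarrow> (nat \<Rightarrow> 'o measure) \<Rightarrow>
   (nat \<Rightarrow> nat \<Rightarrow> 'o \<Rightarrow> bool) \<Rightarrow> real \<Rightarrow> bool"
where
  "local_randomization M U \<psi> I S F Z q \<longleftrightarrow>
     (\<exists>a k :: nat. 1 \<le> a \<and> a \<le> k \<and> q = real a / real k \<and>
       (\<exists>h. (\<forall>n. h n \<in> measurable (I n) (count_space (Pow (Pow {1..n})))) \<and>
            (\<forall>n. \<forall>\<omega>\<in>space M. partition_on (U n \<omega>) (h n (S n \<omega>))) \<and>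
            tight_matching M \<psi> (\<lambda>n \<omega>. h n (S n \<omega>)) \<and>
            (\<forall>n. complete_randomization M (F n) (\<lambda>\<omega>. h n (S n \<omega>)) (Z n) a k)))"

text \<open>In the next two definitions \<open>W\<close> is the sequence of unit-level data, and \<open>\<pi> n\<close> is the
  tie-breaking randomness at sample size \<open>n\<close>, with values in \<open>R n\<close>. The arrays \<^term>\<open>T n i\<close>
  and \<^term>\<open>D n i\<close> depend on the sample size \<open>n\<close>.\<close>

definition Loc_sampling ::
  "'o measure \<Rightarrow> (nat \<Rightarrow> 'o \<Rightarrow> 'w::topological_space) \<Rightarrow> (nat \<Rightarrow> 'r measure) \<Rightarrow> (nat \<Rightarrow> 'o \<Rightarrow> 'r) \<Rightarrow>
   (nat \<Rightarrow> 'o \<Rightarrow> 'v::euclidean_space) \<Rightarrow> (nat \<Rightarrow> nat \<Rightarrow> 'o \<Rightarrow> bool) \<Rightarrow> real \<Rightarrow> bool"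
where
  "Loc_sampling M W R \<pi> \<psi> T q \<longleftrightarrow>
     local_randomization M (\<lambda>n \<omega>. {1..n}) \<psi>
       (\<lambda>n. PiM {1..n} (\<lambda>_. borel) \<Otimes>\<^sub>M R n)
       (\<lambda>n \<omega>. (upto_n n \<psi> \<omega>, \<pi> n \<omega>))
       (\<lambda>n. sigma_of M (PiM {1..n} (\<lambda>_. borel) \<Otimes>\<^sub>M R n) (\<lambda>\<omega>. (upto_n n W \<omega>, \<pi> n \<omega>)))
       T q"

definition Loc_assignment ::
  "'o measure \<Rightarrow> (nat \<Rightarrow> 'o \<Rightarrow> 'w::topological_space) \<Rightarrow> (nat \<Rightarrow> 'r measure) \<Rightarrow> (nat \<Rightarrow> 'o \<Rightarrow> 'r) \<Rightarrow>
   (nat \<Rightarrow> nat \<Rightarrow> 'o \<Rightarrow> bool) \<Rightarrow> (nat \<Rightarrow> 'o \<Rightarrow> 'v::euclidean_space) \<Rightarrow>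
   (nat \<Rightarrow> nat \<Rightarrow> 'o \<Rightarrow> bool) \<Rightarrow> real \<Rightarrow> bool"
where
  "Loc_assignment M W R \<pi> T \<psi> D p \<longleftrightarrow>
     local_randomization M (\<lambda>n \<omega>. {i \<in> {1..n}. T n i \<omega>}) \<psi>
       (\<lambda>n. PiM {1..n} (\<lambda>_. borel) \<Otimes>\<^sub>M (PiM {1..n} (\<lambda>_. count_space UNIV) \<Otimes>\<^sub>M R n))
       (\<lambda>n \<omega>. (upto_n n \<psi> \<omega>, upto_n n (T n) \<omega>, \<pi> n \<omega>))
       (\<lambda>n. sigma_of M
          (PiM {1..n} (\<lambda>_. borel) \<Otimes>\<^sub>M (PiM {1..n} (\<lambda>_. count_space UNIV) \<Otimes>\<^sub>M R n))
          (\<lambda>\<omega>. (upto_n n W \<omega>, upto_n n (T n) \<omega>, \<pi> n \<omega>)))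
       D p"

section \<open>The estimator\<close>

definition observed_outcome ::
  "(nat \<Rightarrow> nat \<Rightarrow> 'o \<Rightarrow> bool) \<Rightarrow> (nat \<Rightarrow> nat \<Rightarrow> 'o \<Rightarrow> bool) \<Rightarrow> (nat \<Rightarrow> 'o \<Rightarrow> real) \<Rightarrow>
   (nat \<Rightarrow> 'o \<Rightarrow> real) \<Rightarrow> nat \<Rightarrow> nat \<Rightarrow> 'o \<Rightarrow> real"
where
  "observed_outcome T D Y0 Y1 n i \<omega> =
     of_bool (T n i \<omega>) *
       (of_bool (D n i \<omega>) * Y1 i \<omega> + (1 - of_bool (D n i \<omega>)) * Y0 i \<omega>)"

definition num_sampled :: "(nat \<Rightarrow> nat \<Rightarrow> 'o \<Rightarrow> bool) \<Rightarrow> nat \<Rightarrow> 'o \<Rightarrow> real" where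
  "num_sampled T n \<omega> = (\<Sum>i=1..n. of_bool (T n i \<omega>))"

definition theta_hat ::
  "real \<Rightarrow> real \<Rightarrow> (nat \<Rightarrow> nat \<Rightarrow> 'o \<Rightarrow> bool) \<Rightarrow> (nat \<Rightarrow> nat \<Rightarrow> 'o \<Rightarrow> bool) \<Rightarrow>
   (nat \<Rightarrow> nat \<Rightarrow> 'o \<Rightarrow> real) \<Rightarrow> nat \<Rightarrow> 'o \<Rightarrow> real"
where
  "theta_hat q p T D Y n \<omega> =
     (1 / real n) * (\<Sum>i=1..n. of_bool (T n i \<omega>) / q *
       (of_bool (D n i \<omega>) * Y n i \<omega> / p - (1 - of_bool (D n i \<omega>)) * Y n i \<omega> / (1 - p)))"

end

theory Submission
  imports Defs
begin

text \<open>Write \<open>m d\<close> for the regression of \<open>Y(d)\<close> on \<open>\<psi>\<^sub>2\<close> and \<open>c\<close> for the regression of \<open>\<tau>\<close> on \<open>\<psi>\<^sub>1\<close>.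
  The scaled error \<open>n (\<theta> - ATE)\<close> of the estimator is the sum of three leading terms and a remainder. The leading terms
  are weighted sums of the outcome residuals \<open>Y(d) - m d \<psi>\<^sub>2\<close>, which are centred and independent given all \<open>\<psi>\<^sub>2\<close>
  and the design; of \<open>m 1 \<psi>\<^sub>2 - m 0 \<psi>\<^sub>2 - c \<psi>\<^sub>1\<close>, centred and independent given all \<open>\<psi>\<^sub>1\<close> and \<open>T\<close>; and of the
  i.i.d. variables \<open>c \<psi>\<^sub>1 - ATE\<close>. The remainder consists of \<open>\<Sum>(T - q) c \<psi>\<^sub>1\<close> and \<open>\<Sum>T (D - p) b \<psi>\<^sub>2\<close> with
  \<open>b = (1 - p) m 1 + p m 0\<close>. For Lipschitz functions in place of \<open>c\<close> and \<open>b\<close> these sums have second moment \<open>o(n)\<close>, because the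
  deviations of the design add up to zero in every full group and the matching is tight; the general case follows by density of the bounded Lipschitz functions in
  \<open>L\<^sup>2\<close>, since the second moment of such a sum is at most a constant times \<open>n\<close> times the squared norm.

  For the leading terms, Lindeberg's argument replaces the factors \<open>exp (\<i> u X)\<close> of the characteristic function one at a time by
  \<open>exp (- u\<^sup>2 s / 2)\<close> with \<open>s\<close> the conditional variance. Averages of the conditional variances converge by
  the law of large numbers, so the characteristic function factors in the limit, one stage of conditioning at a time.\<close>

section \<open>Square-integrable functions\<close>

text \<open>Termwise \<open>D Y1 / p - (1 - D) Y0 / (1 - p)\<close> equals
  \<open>\<tau> + (D - p) Ybar / (p (1 - p))\<close>: this is where \<open>Ybar\<close> and the
  weights of the remainder come from. The obstacle is that the groups, hence all T and D, depend on
  the whole sample, so the summands are not independent. What survives is that, given the data, the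
  mass function of the realized design depends only on \<psi>1 (for T) or on \<psi>2 (for T and D
  together, because \<psi>1 = f \<psi>2) and on the tie-breaker. For each n the design has finitely
  many values, so conditioning becomes a finite sum of mass functions integrated against a product
  law, and regressions are handled as functions on the range of \<psi>. Characteristic functions
  keep the factor carried through a stage bounded by 1; each stage is stated as a difference tending
  to 0, since that factor is not yet known to converge. Tightness holds in probability only, so the
  Lipschitz functions are also taken bounded. The random factor \<open>sqrt (n_T / n)\<close>
  becomes \<open>sqrt q\<close> at the end, whence the variance
  \<open>q * (v1 + v2 + v3)\<close>.\<close>

lemma integrable_mult_of_squares:
  fixes f g :: "'a \<Rightarrow> real"
  assumes [measurable]: "f \<in> borel_measurable M" "g \<in> borel_measurable M"
    and "integrable M (\<lambda>x. (f x)\<^sup>2)" "integrable M (\<lambda>x. (g x)\<^sup>2)"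
  shows "integrable M (\<lambda>x. f x * g x)"
proof (rule Bochner_Integration.integrable_bound)
  show "integrable M (\<lambda>x. (f x)\<^sup>2 + (g x)\<^sup>2)" using assms by auto
  show "AE x in M. norm (f x * g x) \<le> norm ((f x)\<^sup>2 + (g x)\<^sup>2)"
  proof (rule AE_I2)
    fix x
    have "2 * (\<bar>f x\<bar> * \<bar>g x\<bar>) \<le> (f x)\<^sup>2 + (g x)\<^sup>2"
      using zero_le_power2[of "\<bar>f x\<bar> - \<bar>g x\<bar>"] by (simp add: power2_diff)
    moreover have "0 \<le> \<bar>f x\<bar> * \<bar>g x\<bar>" by simp
    ultimately show "norm (f x * g x) \<le> norm ((f x)\<^sup>2 + (g x)\<^sup>2)"
      unfolding real_norm_def abs_mult by linarith
  qed
qed simp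

lemma integrable_power2_add:
  fixes f g :: "'a \<Rightarrow> real"
  assumes [measurable]: "f \<in> borel_measurable M" "g \<in> borel_measurable M"
    and "integrable M (\<lambda>x. (f x)\<^sup>2)" "integrable M (\<lambda>x. (g x)\<^sup>2)"
  shows "integrable M (\<lambda>x. (f x + g x)\<^sup>2)"
  unfolding power2_sum using assms integrable_mult_of_squares[OF assms]
  by (auto simp: mult.assoc)

lemma integrable_power2_cmult:
  fixes f :: "'a \<Rightarrow> real"
  assumes "integrable M (\<lambda>x. (f x)\<^sup>2)"
  shows "integrable M (\<lambda>x. (c * f x)\<^sup>2)"
  using assms by (simp add: power_mult_distrib)

lemma integrable_power2_diff:
  fixes f g :: "'a \<Rightarrow> real"
  assumes [measurable]: "f \<in> borel_measurable M" "g \<in> borel_measurable M"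
    and "integrable M (\<lambda>x. (f x)\<^sup>2)" "integrable M (\<lambda>x. (g x)\<^sup>2)"
  shows "integrable M (\<lambda>x. (f x - g x)\<^sup>2)"
  using integrable_power2_add[of f M "\<lambda>x. - g x"] assms by simp

lemma sum_squared_le: "(a + b)\<^sup>2 \<le> 2 * a\<^sup>2 + 2 * (b::real)\<^sup>2"
  using zero_le_power2[of "a - b"] by (simp add: power2_sum power2_diff)

lemma integral_power2_add_le:
  fixes f g :: "'a \<Rightarrow> real"
  assumes [measurable]: "f \<in> borel_measurable M" "g \<in> borel_measurable M"
    and "integrable M (\<lambda>x. (f x)\<^sup>2)" "integrable M (\<lambda>x. (g x)\<^sup>2)"
  shows "(\<integral>x. (f x + g x)\<^sup>2 \<partial>M) \<le> 2 * (\<integral>x. (f x)\<^sup>2 \<partial>M) + 2 * (\<integral>x. (g x)\<^sup>2 \<partial>M)"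
proof -
  have "(\<integral>x. (f x + g x)\<^sup>2 \<partial>M) \<le> (\<integral>x. 2 * (f x)\<^sup>2 + 2 * (g x)\<^sup>2 \<partial>M)"
    by (intro integral_mono integrable_power2_add Bochner_Integration.integrable_add
        integrable_mult_right assms sum_squared_le)
  also have "\<dots> = 2 * (\<integral>x. (f x)\<^sup>2 \<partial>M) + 2 * (\<integral>x. (g x)\<^sup>2 \<partial>M)"
    using assms by simp
  finally show ?thesis .
qed

lemma power2_sum_le_card:
  fixes f :: "'a \<Rightarrow> real"
  assumes "finite A"
  shows "(\<Sum>i\<in>A. f i)\<^sup>2 \<le> card A * (\<Sum>i\<in>A. (f i)\<^sup>2)"
  using Cauchy_Schwarz_ineq_sum[of "\<lambda>_. 1" f A] by simp

text \<open>The bound is the nonnegativity of the variance of \<bar>f\<bar>; integrability comes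
  from pairing f with the constant 1.\<close>

lemma (in prob_space) expectation_abs_le_sqrt:
  fixes f :: "'a \<Rightarrow> real"
  assumes [measurable]: "f \<in> borel_measurable M" and f2: "integrable M (\<lambda>x. (f x)\<^sup>2)"
  shows "integrable M f" "expectation (\<lambda>x. \<bar>f x\<bar>) \<le> sqrt (expectation (\<lambda>x. (f x)\<^sup>2))"
proof -
  show int: "integrable M f"
    using integrable_mult_of_squares[of f M "\<lambda>_. 1"] f2 by simp
  have "(expectation (\<lambda>x. \<bar>f x\<bar>))\<^sup>2 \<le> expectation (\<lambda>x. (f x)\<^sup>2)"
    using variance_positive[of "\<lambda>x. \<bar>f x\<bar>"] variance_eq[of "\<lambda>x. \<bar>f x\<bar>"] f2 int by simp
  then show "expectation (\<lambda>x. \<bar>f x\<bar>) \<le> sqrt (expectation (\<lambda>x. (f x)\<^sup>2))"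
    by (rule real_le_rsqrt)
qed

lemma integral_mult_le_sqrt:
  fixes f g :: "'a \<Rightarrow> real"
  assumes [measurable]: "f \<in> borel_measurable M" "g \<in> borel_measurable M"
    and f2: "integrable M (\<lambda>x. (f x)\<^sup>2)" and g2: "integrable M (\<lambda>x. (g x)\<^sup>2)"
  shows "(\<integral>x. \<bar>f x * g x\<bar> \<partial>M) \<le> sqrt ((\<integral>x. (f x)\<^sup>2 \<partial>M) * (\<integral>x. (g x)\<^sup>2 \<partial>M))"
proof (rule real_le_rsqrt)
  have nn: "(\<integral>\<^sup>+x. ennreal (h x) \<partial>M) = ennreal (\<integral>x. h x \<partial>M)"
    if "integrable M h" "\<And>x. 0 \<le> h x" for h
    using that by (intro nn_integral_eq_integral) auto
  have fg: "integrable M (\<lambda>x. \<bar>f x * g x\<bar>)"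
    using integrable_mult_of_squares[OF assms] by simp
  have "(\<integral>\<^sup>+x. ennreal \<bar>f x\<bar> * ennreal \<bar>g x\<bar> \<partial>M)\<^sup>2
      \<le> (\<integral>\<^sup>+x. (ennreal \<bar>f x\<bar>)\<^sup>2 \<partial>M) * (\<integral>\<^sup>+x. (ennreal \<bar>g x\<bar>)\<^sup>2 \<partial>M)"
    by (intro Cauchy_Schwarz_nn_integral) auto
  also have "(\<lambda>x. ennreal \<bar>f x\<bar> * ennreal \<bar>g x\<bar>) = (\<lambda>x. ennreal \<bar>f x * g x\<bar>)"
    by (simp add: abs_mult ennreal_mult)
  also have "(\<lambda>x. (ennreal \<bar>f x\<bar>)\<^sup>2) = (\<lambda>x. ennreal ((f x)\<^sup>2))" by (simp add: ennreal_power)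
  also have "(\<lambda>x. (ennreal \<bar>g x\<bar>)\<^sup>2) = (\<lambda>x. ennreal ((g x)\<^sup>2))" by (simp add: ennreal_power)
  finally show "(\<integral>x. \<bar>f x * g x\<bar> \<partial>M)\<^sup>2 \<le> (\<integral>x. (f x)\<^sup>2 \<partial>M) * (\<integral>x. (g x)\<^sup>2 \<partial>M)"
    using nn[OF f2] nn[OF g2] nn[OF fg]
    by (simp add: ennreal_power flip: ennreal_mult)
qed

section \<open>Conditional expectations as functions of the conditioning variable\<close>

text \<open>The Doob-Dynkin factorization. Level sets of the approximating simple functions are
  preimages under X, so each simple function factors, and the factors are passed to the
  limit.\<close>

lemma factor_through_vimage_algebra:
  fixes f :: "'a \<Rightarrow> real"
  assumes X: "X \<in> \<Omega> \<rightarrow> space N" and f: "f \<in> borel_measurable (vimage_algebra \<Omega> X N)"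
  obtains h where "h \<in> borel_measurable N" "\<And>x. x \<in> \<Omega> \<Longrightarrow> f x = h (X x)"
proof -
  obtain s where s: "\<And>i::nat. simple_function (vimage_algebra \<Omega> X N) (s i)"
    "\<And>x. x \<in> \<Omega> \<Longrightarrow> (\<lambda>i. s i x) \<longlonglongrightarrow> f x"
    using borel_measurable_implies_sequence_metric[OF f, of 0] by (auto simp: Ball_def)
  have "\<exists>g. g \<in> borel_measurable N \<and> (\<forall>x\<in>\<Omega>. s i x = g (X x))" for i
  proof -
    have fin: "finite (s i ` \<Omega>)" and sets: "s i -` {y} \<inter> \<Omega> \<in> sets (vimage_algebra \<Omega> X N)" for y
      using simple_functionD[OF s(1)[of i]] by auto
    have "\<exists>B. B \<in> sets N \<and> s i -` {y} \<inter> \<Omega> = X -` B \<inter> \<Omega>" for y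
      using sets[of y] unfolding sets_vimage_algebra2[OF X] by fastforce
    then obtain B where B: "\<And>y. B y \<in> sets N" "\<And>y. s i -` {y} \<inter> \<Omega> = X -` B y \<inter> \<Omega>"
      by metis
    \<comment> \<open>The sets \<open>B y\<close> are determined only on the range of X and may
      overlap elsewhere; at a point \<open>X x\<close> the only one that is hit belongs to
      \<open>y = s i x\<close>.\<close>
    define g where "g v = (\<Sum>y\<in>s i ` \<Omega>. y * indicator (B y) v)" for v
    have "s i x = g (X x)" if x: "x \<in> \<Omega>" for x
    proof -
      have "indicator (B y) (X x) = (if s i x = y then 1 else (0::real))" for y
        using B(2)[of y] x by (auto simp: indicator_def)
      then have "g (X x) = (\<Sum>y\<in>s i ` \<Omega>. if s i x = y then y else 0)"
        unfolding g_def by (intro sum.cong) simp_all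
      then show ?thesis using fin x by simp
    qed
    moreover have "g \<in> borel_measurable N" unfolding g_def using B by measurable
    ultimately show ?thesis by auto
  qed
  then obtain g where g: "\<And>i. g i \<in> borel_measurable N" "\<And>i x. x \<in> \<Omega> \<Longrightarrow> s i x = g i (X x)"
    by metis
  \<comment> \<open>The total function \<open>lim\<close> is measurable even though the sequence may
    diverge off the range of X.\<close>
  have "(\<lambda>v. lim (\<lambda>i. g i v)) \<in> borel_measurable N" using g(1) by measurable
  moreover have "f x = lim (\<lambda>i. g i (X x))" if "x \<in> \<Omega>" for x
    using s(2)[OF that] g(2)[OF that] by (simp add: limI)
  ultimately show ?thesis using that by blast
qed

lemma (in prob_space) subalgebra_sigma_of:
  "X \<in> measurable M N \<Longrightarrow> subalgebra M (sigma_of M N X)"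
  unfolding subalgebra_def using sets_image_in_sets[of M "space M" X N] by auto

lemma (in prob_space) sigma_finite_subalgebra_sigma_of:
  assumes "X \<in> measurable M N"
  shows "sigma_finite_subalgebra M (sigma_of M N X)"
  by (intro finite_measure_subalgebra_is_sigma_finite)
     (unfold_locales, use assms subalgebra_sigma_of in auto)

section \<open>Lipschitz functions are dense in the square-integrable functions\<close>

text \<open>Membership in the closure, in square norm, of the bounded Lipschitz functions. The bound
  B is part of the notion because it later controls the remainder group and the truncation of the
  matching statistic.\<close>

definition lipschitz_approximable :: "'a::metric_space measure \<Rightarrow> ('a \<Rightarrow> real) \<Rightarrow> bool" where
  "lipschitz_approximable \<mu> c \<longleftrightarrow> c \<in> borel_measurable \<mu> \<and> integrable \<mu> (\<lambda>x. (c x)\<^sup>2) \<and>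
     (\<forall>e>0. \<exists>h L B. h \<in> borel_measurable \<mu> \<and> (\<forall>x y. \<bar>h x - h y\<bar> \<le> L * dist x y) \<and>
        (\<forall>x. \<bar>h x\<bar> \<le> B) \<and> (\<integral>x. (c x - h x)\<^sup>2 \<partial>\<mu>) < e)"

lemma lipschitz_approximableE:
  assumes "lipschitz_approximable \<mu> c" "e > 0"
  obtains h L B where "h \<in> borel_measurable \<mu>" "\<And>x y. \<bar>h x - h y\<bar> \<le> L * dist x y"
    "\<And>x. \<bar>h x\<bar> \<le> B" "(\<integral>x. (c x - h x)\<^sup>2 \<partial>\<mu>) < e"
  using assms unfolding lipschitz_approximable_def by blast

context
  fixes \<mu> :: "'a::metric_space measure"
  assumes fin: "finite_measure \<mu>" and sets_\<mu>: "sets \<mu> = sets borel"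
begin

interpretation finite_measure \<mu> by (rule fin)

lemma bounded_square_integrable:
  fixes h :: "'a \<Rightarrow> real"
  assumes [measurable]: "h \<in> borel_measurable \<mu>" and "\<And>x. \<bar>h x\<bar> \<le> B"
  shows "integrable \<mu> (\<lambda>x. (h x)\<^sup>2)"
  by (rule integrable_const_bound[where B = "B\<^sup>2"]) (use assms in \<open>auto intro!: AE_I2 order_trans[OF assms(2) abs_ge_self] simp: abs_le_square_iff[symmetric]\<close>)

lemma lipschitz_approximable_limit:
  assumes [measurable]: "c \<in> borel_measurable \<mu>" and c2: "integrable \<mu> (\<lambda>x. (c x)\<^sup>2)"
    and d: "\<And>e. e > 0 \<Longrightarrow> \<exists>d. lipschitz_approximable \<mu> d \<and> (\<integral>x. (c x - d x)\<^sup>2 \<partial>\<mu>) < e"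
  shows "lipschitz_approximable \<mu> c"
  unfolding lipschitz_approximable_def
proof (intro conjI allI impI)
  fix e :: real assume "e > 0"
  \<comment> \<open>Errors are squared norms, so the triangle inequality doubles each of them:
    \<open>2 * (e / 4) + 2 * (e / 4) = e\<close>.\<close>
  then obtain d where d1: "lipschitz_approximable \<mu> d" and d2: "(\<integral>x. (c x - d x)\<^sup>2 \<partial>\<mu>) < e / 4"
    using d[of "e/4"] by auto
  have [measurable]: "d \<in> borel_measurable \<mu>" and dd: "integrable \<mu> (\<lambda>x. (d x)\<^sup>2)"
    using d1 by (auto simp: lipschitz_approximable_def)
  obtain h L B where h[measurable]: "h \<in> borel_measurable \<mu>"
    and L: "\<forall>x y. \<bar>h x - h y\<bar> \<le> L * dist x y" and B: "\<forall>x. \<bar>h x\<bar> \<le> B"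
    and hd: "(\<integral>x. (d x - h x)\<^sup>2 \<partial>\<mu>) < e / 4"
    using lipschitz_approximableE[OF d1, of "e / 4"] \<open>e > 0\<close> by auto
  have h2: "integrable \<mu> (\<lambda>x. (h x)\<^sup>2)" using bounded_square_integrable[OF h] B by auto
  have "(\<integral>x. (c x - h x)\<^sup>2 \<partial>\<mu>) = (\<integral>x. ((c x - d x) + (d x - h x))\<^sup>2 \<partial>\<mu>)" by simp
  also have "\<dots> \<le> 2 * (\<integral>x. (c x - d x)\<^sup>2 \<partial>\<mu>) + 2 * (\<integral>x. (d x - h x)\<^sup>2 \<partial>\<mu>)"
    by (rule integral_power2_add_le) (use c2 dd h2 in \<open>auto intro: integrable_power2_diff\<close>)
  also have "\<dots> < e" using d2 hd by simp
  finally show "\<exists>h L B. h \<in> borel_measurable \<mu> \<and> (\<forall>x y. \<bar>h x - h y\<bar> \<le> L * dist x y) \<and>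
        (\<forall>x. \<bar>h x\<bar> \<le> B) \<and> (\<integral>x. (c x - h x)\<^sup>2 \<partial>\<mu>) < e"
    using h L B by blast
qed (use c2 in auto)

lemma lipschitz_approximable_add:
  assumes c: "lipschitz_approximable \<mu> c" and d: "lipschitz_approximable \<mu> d"
  shows "lipschitz_approximable \<mu> (\<lambda>x. c x + d x)"
  unfolding lipschitz_approximable_def
proof (intro conjI allI impI)
  have [measurable]: "c \<in> borel_measurable \<mu>" "d \<in> borel_measurable \<mu>"
    and c2: "integrable \<mu> (\<lambda>x. (c x)\<^sup>2)" and d2: "integrable \<mu> (\<lambda>x. (d x)\<^sup>2)"
    using c d by (auto simp: lipschitz_approximable_def)
  show "(\<lambda>x. c x + d x) \<in> borel_measurable \<mu>" by measurable
  show "integrable \<mu> (\<lambda>x. (c x + d x)\<^sup>2)" using c2 d2 by (intro integrable_power2_add) auto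
  fix e :: real assume "e > 0"
  then have e4: "e / 4 > 0" by simp
  obtain h L B where h[measurable]: "h \<in> borel_measurable \<mu>"
    and L: "\<And>x y. \<bar>h x - h y\<bar> \<le> L * dist x y" and B: "\<And>x. \<bar>h x\<bar> \<le> B"
    and hc: "(\<integral>x. (c x - h x)\<^sup>2 \<partial>\<mu>) < e / 4"
    by (rule lipschitz_approximableE[OF c e4]) (rule that)
  obtain h' L' B' where h'[measurable]: "h' \<in> borel_measurable \<mu>"
    and L': "\<And>x y. \<bar>h' x - h' y\<bar> \<le> L' * dist x y" and B': "\<And>x. \<bar>h' x\<bar> \<le> B'"
    and hd: "(\<integral>x. (d x - h' x)\<^sup>2 \<partial>\<mu>) < e / 4"
    by (rule lipschitz_approximableE[OF d e4]) (rule that)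
  have "integrable \<mu> (\<lambda>x. (h x)\<^sup>2)" "integrable \<mu> (\<lambda>x. (h' x)\<^sup>2)"
    using bounded_square_integrable[OF h B] bounded_square_integrable[OF h' B'] by auto
  then have "(\<integral>x. ((c x - h x) + (d x - h' x))\<^sup>2 \<partial>\<mu>)
      \<le> 2 * (\<integral>x. (c x - h x)\<^sup>2 \<partial>\<mu>) + 2 * (\<integral>x. (d x - h' x)\<^sup>2 \<partial>\<mu>)"
    by (intro integral_power2_add_le integrable_power2_diff c2 d2) auto
  also have "\<dots> < e" using hc hd by simp
  also have "(\<lambda>x. ((c x - h x) + (d x - h' x))\<^sup>2) = (\<lambda>x. (c x + d x - (h x + h' x))\<^sup>2)"
    by (simp add: algebra_simps)
  finally have "(\<integral>x. (c x + d x - (h x + h' x))\<^sup>2 \<partial>\<mu>) < e" .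
  moreover have "\<bar>(h x + h' x) - (h y + h' y)\<bar> \<le> (L + L') * dist x y" for x y
    using L[of x y] L'[of x y] by (simp add: algebra_simps)
  moreover have "\<bar>h x + h' x\<bar> \<le> B + B'" for x using B[of x] B'[of x] by simp
  ultimately show "\<exists>h L B. h \<in> borel_measurable \<mu> \<and> (\<forall>x y. \<bar>h x - h y\<bar> \<le> L * dist x y) \<and>
        (\<forall>x. \<bar>h x\<bar> \<le> B) \<and> (\<integral>x. (c x + d x - h x)\<^sup>2 \<partial>\<mu>) < e"
    by (intro exI[of _ "\<lambda>x. h x + h' x"] exI[of _ "L + L'"] exI[of _ "B + B'"]) auto
qed

lemma lipschitz_approximable_cmult:
  assumes c: "lipschitz_approximable \<mu> c"
  shows "lipschitz_approximable \<mu> (\<lambda>x. r * c x)"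
  unfolding lipschitz_approximable_def
proof (intro conjI allI impI)
  have [measurable]: "c \<in> borel_measurable \<mu>" and c2: "integrable \<mu> (\<lambda>x. (c x)\<^sup>2)"
    using c by (auto simp: lipschitz_approximable_def)
  show "(\<lambda>x. r * c x) \<in> borel_measurable \<mu>" by measurable
  show "integrable \<mu> (\<lambda>x. (r * c x)\<^sup>2)" using c2 by (intro integrable_power2_cmult) auto
  fix e :: real assume "e > 0"
  \<comment> \<open>The summand 1 covers r = 0.\<close>
  then have "e / (r\<^sup>2 + 1) > 0" by (auto intro!: divide_pos_pos add_nonneg_pos)
  then obtain h L B where h[measurable]: "h \<in> borel_measurable \<mu>"
    and L: "\<And>x y. \<bar>h x - h y\<bar> \<le> L * dist x y" and B: "\<And>x. \<bar>h x\<bar> \<le> B"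
    and hc: "(\<integral>x. (c x - h x)\<^sup>2 \<partial>\<mu>) < e / (r\<^sup>2 + 1)"
    by (rule lipschitz_approximableE[OF c]) (rule that)
  have "(\<integral>x. (r * c x - r * h x)\<^sup>2 \<partial>\<mu>) = r\<^sup>2 * (\<integral>x. (c x - h x)\<^sup>2 \<partial>\<mu>)"
    by (simp add: power_mult_distrib flip: right_diff_distrib)
  also have "\<dots> \<le> (r\<^sup>2 + 1) * (\<integral>x. (c x - h x)\<^sup>2 \<partial>\<mu>)"
    by (intro mult_right_mono) auto
  also have "\<dots> < e"
    using hc by (simp add: pos_less_divide_eq add_nonneg_pos mult.commute)
  finally have "(\<integral>x. (r * c x - r * h x)\<^sup>2 \<partial>\<mu>) < e" .
  moreover have "\<bar>r * h x - r * h y\<bar> \<le> (\<bar>r\<bar> * L) * dist x y" for x y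
    using mult_left_mono[OF L[of x y], of "\<bar>r\<bar>"]
    by (simp add: abs_mult mult.assoc flip: right_diff_distrib)
  moreover have "\<bar>r * h x\<bar> \<le> \<bar>r\<bar> * B" for x using B[of x] by (simp add: abs_mult mult_left_mono)
  ultimately show "\<exists>h L B. h \<in> borel_measurable \<mu> \<and> (\<forall>x y. \<bar>h x - h y\<bar> \<le> L * dist x y) \<and>
        (\<forall>x. \<bar>h x\<bar> \<le> B) \<and> (\<integral>x. (r * c x - h x)\<^sup>2 \<partial>\<mu>) < e"
    by (intro exI[of _ "\<lambda>x. r * h x"] exI[of _ "\<bar>r\<bar> * L"] exI[of _ "\<bar>r\<bar> * B"]) auto
qed

text \<open>Dominated convergence: since the approximants stay below \<bar>c\<bar>, the squared
  errors stay below \<open>4 * (c x)\<^sup>2\<close>.\<close>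

lemma lipschitz_approximable_seq:
  assumes c[measurable]: "c \<in> borel_measurable \<mu>" and c2: "integrable \<mu> (\<lambda>x. (c x)\<^sup>2)"
    and d: "\<And>i::nat. lipschitz_approximable \<mu> (d i)"
    and lim: "\<And>x. (\<lambda>i. d i x) \<longlonglongrightarrow> c x" and le: "\<And>i x. \<bar>d i x\<bar> \<le> \<bar>c x\<bar>"
  shows "lipschitz_approximable \<mu> c"
proof (rule lipschitz_approximable_limit[OF c c2])
  have [measurable]: "d i \<in> borel_measurable \<mu>" for i
    using d by (auto simp: lipschitz_approximable_def)
  have "(\<lambda>i. \<integral>x. (c x - d i x)\<^sup>2 \<partial>\<mu>) \<longlonglongrightarrow> (\<integral>x. 0 \<partial>\<mu>)"
  proof (rule integral_dominated_convergence[where w = "\<lambda>x. 4 * (c x)\<^sup>2"])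
    show "AE x in \<mu>. (\<lambda>i. (c x - d i x)\<^sup>2) \<longlonglongrightarrow> 0"
      using lim by (auto intro!: AE_I2 tendsto_eq_intros)
    show "AE x in \<mu>. norm ((c x - d i x)\<^sup>2) \<le> 4 * (c x)\<^sup>2" for i
    proof (rule AE_I2)
      fix x
      have "\<bar>c x - d i x\<bar> \<le> \<bar>2 * c x\<bar>" using le[of i x] by simp
      then show "norm ((c x - d i x)\<^sup>2) \<le> 4 * (c x)\<^sup>2"
        unfolding abs_le_square_iff by (simp add: power_mult_distrib)
    qed
  qed (use c2 in auto)
  then have *: "(\<lambda>i. \<integral>x. (c x - d i x)\<^sup>2 \<partial>\<mu>) \<longlonglongrightarrow> 0" by simp
  fix e :: real assume "e > 0"
  from order_tendstoD(2)[OF * this] obtain i where "(\<integral>x. (c x - d i x)\<^sup>2 \<partial>\<mu>) < e"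
    by (auto simp: eventually_sequentially)
  then show "\<exists>d. lipschitz_approximable \<mu> d \<and> (\<integral>x. (c x - d x)\<^sup>2 \<partial>\<mu>) < e" using d by auto
qed

lemma lipschitz_approximable_lipschitz:
  assumes "h \<in> borel_measurable \<mu>" "\<And>x y. \<bar>h x - h y\<bar> \<le> L * dist x y" "\<And>x. \<bar>h x\<bar> \<le> B"
  shows "lipschitz_approximable \<mu> h"
  unfolding lipschitz_approximable_def
  using assms bounded_square_integrable[OF assms(1,3)]
  by (intro conjI allI impI exI[of _ h] exI[of _ L] exI[of _ B]) auto

text \<open>The functions \<open>min 1 (i * distance to the complement)\<close> are Lipschitz and
  converge to the indicator because the complement is closed. The whole space is separate since
  \<open>infdist\<close> to the empty set is 0.\<close>

lemma lipschitz_approximable_open: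
  assumes "open U"
  shows "lipschitz_approximable \<mu> (indicator U)"
proof (cases "U = UNIV")
  case True
  then show ?thesis by (intro lipschitz_approximable_lipschitz[where L = 0 and B = 1]) auto
next
  case False
  define d where "d i x = min 1 (real i * infdist x (- U))" for i x
  have [measurable]: "d i \<in> borel_measurable \<mu>" for i
    unfolding d_def measurable_cong_sets[OF sets_\<mu> refl]
    by (intro borel_measurable_continuous_onI continuous_intros)
  have ms: "(indicator U :: 'a \<Rightarrow> real) \<in> borel_measurable \<mu>"
    using assms sets_\<mu> by (intro borel_measurable_indicator) auto
  show ?thesis
  proof (rule lipschitz_approximable_seq[where d = d, OF ms])
    show "integrable \<mu> (\<lambda>x. (indicator U x :: real)\<^sup>2)"
      using bounded_square_integrable[OF ms, of 1] by auto
    show "lipschitz_approximable \<mu> (d i)" for i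
    proof (rule lipschitz_approximable_lipschitz[where L = "real i" and B = 1])
      fix x y :: 'a
      have "\<bar>infdist x (-U) - infdist y (-U)\<bar> \<le> dist x y"
        using infdist_triangle[of x "-U" y] infdist_triangle[of y "-U" x] by (simp add: dist_commute)
      then have "\<bar>real i * infdist x (-U) - real i * infdist y (-U)\<bar> \<le> real i * dist x y"
        by (simp add: abs_mult mult_left_mono flip: right_diff_distrib)
      then show "\<bar>d i x - d i y\<bar> \<le> real i * dist x y" unfolding d_def by linarith
      show "\<bar>d i x\<bar> \<le> 1" by (simp add: d_def infdist_nonneg)
    qed simp
    fix x :: 'a
    have cl: "closed (- U)" "- U \<noteq> {}" using assms False by auto
    show "\<bar>d i x\<bar> \<le> \<bar>indicator U x\<bar>" for i
      by (cases "x \<in> U") (auto simp: d_def infdist_nonneg)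
    show "(\<lambda>i. d i x) \<longlonglongrightarrow> indicator U x"
    proof (cases "x \<in> U")
      case True
      then have pos: "infdist x (-U) > 0"
        using in_closed_iff_infdist_zero[OF cl, of x] infdist_nonneg[of x "-U"] by auto
      obtain n0 where n0: "1 / infdist x (-U) < real n0" using reals_Archimedean2 by auto
      have "d i x = 1" if "i \<ge> n0" for i
      proof -
        have "1 < real n0 * infdist x (-U)" using n0 pos by (simp add: divide_less_eq)
        also have "\<dots> \<le> real i * infdist x (-U)" using that pos by (simp add: mult_right_mono)
        finally show ?thesis by (simp add: d_def)
      qed
      then show ?thesis using True by (intro tendsto_eventually) (auto simp: eventually_sequentially)
    qed (auto simp: d_def)
  qed
qed

text \<open>Dynkin's argument, the open sets being an intersection-stable generator. For a disjoint
  family, indicators of finite partial unions are sums, and they increase to the indicator of the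
  full union.\<close>

lemma lipschitz_approximable_indicator:
  assumes "A \<in> sets \<mu>"
  shows "lipschitz_approximable \<mu> (indicator A)"
proof -
  have ms: "(indicator A :: 'a \<Rightarrow> real) \<in> borel_measurable \<mu>"
    "integrable \<mu> (\<lambda>x. (indicator A x :: real)\<^sup>2)" if "A \<in> sets \<mu>" for A
    using that bounded_square_integrable[of "indicator A" 1] by auto
  have sig: "B \<in> sets \<mu>" if "B \<in> sigma_sets UNIV {U. open U}" for B
    using that sets_\<mu> by (simp add: sets_borel)
  have "A \<in> sigma_sets UNIV {U. open U}" using assms sets_\<mu> by (simp add: sets_borel)
  have "Int_stable {U :: 'a set. open U}" "{U :: 'a set. open U} \<subseteq> Pow UNIV"
    by (auto simp: Int_stable_def)
  from this \<open>A \<in> sigma_sets UNIV {U. open U}\<close> show ?thesis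
  proof (induct rule: sigma_sets_induct_disjoint)
    case (basic A)
    then show ?case by (auto intro: lipschitz_approximable_open)
  next
    case empty
    show ?case by (rule lipschitz_approximable_open) simp
  next
    case (compl A)
    have "lipschitz_approximable \<mu> (\<lambda>x. indicator UNIV x + (-1) * indicator A x)"
      by (intro lipschitz_approximable_add lipschitz_approximable_cmult compl lipschitz_approximable_open) auto
    also have "(\<lambda>x. indicator UNIV x + (-1) * indicator A x) = (indicator (UNIV - A) :: 'a \<Rightarrow> real)"
      by (auto simp: indicator_def fun_eq_iff)
    finally show ?case .
  next
    case (union A)
    define d where "d n x = (indicator (\<Union>i<n. A i) x :: real)" for n x
    have lt: "lipschitz_approximable \<mu> (d n)" for n
    proof (induction n)
      case 0
      have "d 0 = indicator {}" by (simp add: d_def fun_eq_iff)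
      then show ?case using lipschitz_approximable_open[of "{}"] by (metis open_empty)
    next
      case (Suc n)
      have "x \<notin> A i" if "x \<in> A n" "i < n" for x i
        using disjoint_family_onD[OF union(1), of n i] that by auto
      then have "d (Suc n) = (\<lambda>x. d n x + indicator (A n) x)"
        by (auto simp: d_def indicator_def less_Suc_eq fun_eq_iff)
      then show ?case using lipschitz_approximable_add[OF Suc union(3)[of n]] by simp
    qed
    have "(\<Union>i. A i) \<in> sets \<mu>" using union(2) sig by auto
    note ms[OF this]
    then show ?case
    proof (rule lipschitz_approximable_seq[OF _ _ lt])
      fix x
      show "\<bar>d i x\<bar> \<le> \<bar>indicator (\<Union> (range A)) x\<bar>" for i by (auto simp: d_def indicator_def)
      show "(\<lambda>i. d i x) \<longlonglongrightarrow> indicator (\<Union> (range A)) x"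
        unfolding d_def by (rule LIMSEQ_indicator_UN)
    qed
  qed
qed

text \<open>Square integrability is kept inside the conclusion so that the induction carries it: it
  passes from a function to its nonnegative summands and to the approximants below it.\<close>

lemma lipschitz_approximable_nonneg:
  assumes "c \<in> borel_measurable \<mu>" "\<And>x. 0 \<le> c x"
  shows "integrable \<mu> (\<lambda>x. (c x)\<^sup>2) \<longrightarrow> lipschitz_approximable \<mu> c"
  using assms
proof (induct rule: borel_measurable_induct_real)
  case (set A)
  then show ?case using lipschitz_approximable_indicator by auto
next
  case (mult u r)
  show ?case
  \<comment> \<open>For r = 0 the square integrability of the product says nothing about u, and the
    induction hypothesis cannot be used.\<close>
  proof (cases "r = 0")
    case True
    then show ?thesis by (auto intro!: lipschitz_approximable_lipschitz[where L=0 and B=0])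
  next
    case False
    then show ?thesis using mult lipschitz_approximable_cmult by (auto simp: power_mult_distrib)
  qed
next
  case (add u v)
  note [measurable] = add(1,4)
  show ?case
  proof
    assume int: "integrable \<mu> (\<lambda>x. (v x + u x)\<^sup>2)"
    have "integrable \<mu> (\<lambda>x. (u x)\<^sup>2)"
      by (rule Bochner_Integration.integrable_bound[OF int])
         (use add in \<open>auto intro!: AE_I2 power_mono\<close>)
    moreover have "integrable \<mu> (\<lambda>x. (v x)\<^sup>2)"
      by (rule Bochner_Integration.integrable_bound[OF int])
         (use add in \<open>auto intro!: AE_I2 power_mono\<close>)
    ultimately show "lipschitz_approximable \<mu> (\<lambda>x. v x + u x)"
      using add lipschitz_approximable_add by auto
  qed
next
  case (seq U)
  note [measurable] = seq(1)
  have sp: "space \<mu> = UNIV" using sets_eq_imp_space_eq[OF sets_\<mu>] by simp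
  have le: "U i x \<le> c x" for i x
    using seq(4) seq(5)[of x] sp by (auto intro!: incseq_le simp: incseq_def le_fun_def)
  show ?case
  proof
    assume int: "integrable \<mu> (\<lambda>x. (c x)\<^sup>2)"
    have "integrable \<mu> (\<lambda>x. (U i x)\<^sup>2)" for i
      by (rule Bochner_Integration.integrable_bound[OF int])
         (use le seq(2) in \<open>auto intro!: AE_I2 power_mono\<close>)
    then have lt: "lipschitz_approximable \<mu> (U i)" for i using seq(3) by auto
    have "c \<in> borel_measurable \<mu>" by fact
    then show "lipschitz_approximable \<mu> c"
    proof (rule lipschitz_approximable_seq[OF _ int lt])
      fix x
      show "(\<lambda>i. U i x) \<longlonglongrightarrow> c x" using seq(5)[of x] sp by auto
      show "\<bar>U i x\<bar> \<le> \<bar>c x\<bar>" for i using le[of i x] seq(2)[of i x] by simp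
    qed
  qed
qed

lemma lipschitz_approximable_square_integrable:
  assumes [measurable]: "c \<in> borel_measurable \<mu>" and c2: "integrable \<mu> (\<lambda>x. (c x)\<^sup>2)"
  shows "lipschitz_approximable \<mu> c"
proof -
  have "integrable \<mu> (\<lambda>x. (max 0 (c x))\<^sup>2)" "integrable \<mu> (\<lambda>x. (max 0 (- c x))\<^sup>2)"
    by (rule Bochner_Integration.integrable_bound[OF c2]; auto intro!: AE_I2 simp: max_def)+
  then have "lipschitz_approximable \<mu> (\<lambda>x. max 0 (c x))"
    "lipschitz_approximable \<mu> (\<lambda>x. max 0 (- c x))"
    using lipschitz_approximable_nonneg[of "\<lambda>x. max 0 (c x)"]
      lipschitz_approximable_nonneg[of "\<lambda>x. max 0 (- c x)"] by auto
  then have "lipschitz_approximable \<mu> (\<lambda>x. max 0 (c x) + (-1) * max 0 (- c x))"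
    by (intro lipschitz_approximable_add lipschitz_approximable_cmult)
  also have "(\<lambda>x. max 0 (c x) + (-1) * max 0 (- c x)) = c" by auto
  finally show ?thesis .
qed

end

section \<open>Complete randomization within groups\<close>

text \<open>The conditional probability that B is exactly the set of selected units of the group g;
  the second branch is the Bernoulli law of the remainder group.\<close>

definition group_mass :: "nat \<Rightarrow> nat \<Rightarrow> nat set \<Rightarrow> nat set \<Rightarrow> real" where
  "group_mass a k g B =
     (if card g = k then if card B = a then 1 / real (k choose a) else 0
      else \<Prod>i\<in>g. if i \<in> B then real a / real k else 1 - real a / real k)"

text \<open>The conditional probability that A is the selected set when P is the realized partition.
  The value 0 for sets not covered by P makes it meaningful for every A, so A can be fixed while P
  varies.\<close>

definition partition_mass :: "nat \<Rightarrow> nat \<Rightarrow> nat set set \<Rightarrow> nat set \<Rightarrow> real" where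
  "partition_mass a k P A = (if A \<subseteq> \<Union>P then \<Prod>g\<in>P. group_mass a k g (A \<inter> g) else 0)"

text \<open>Choosing a subset of a disjoint union is choosing a subset of each block independently.
  This expresses independence across groups as a factorization of finite sums.\<close>

lemma sum_Pow_Union_prod:
  fixes F :: "'a set \<Rightarrow> 'a set \<Rightarrow> real"
  assumes "finite P" "disjoint P" "\<And>g. g \<in> P \<Longrightarrow> finite g"
  shows "(\<Sum>A\<in>Pow (\<Union>P). \<Prod>g\<in>P. F g (A \<inter> g)) = (\<Prod>g\<in>P. \<Sum>B\<in>Pow g. F g B)"
  using assms
proof (induction P)
  case empty
  then show ?case by simp
next
  case (insert h P)
  have dj: "h \<inter> \<Union>P = {}" using insert.prems(1) insert.hyps(2)
    by (auto simp: disjoint_def)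
  have bij: "bij_betw (\<lambda>(B, A). B \<union> A) (Pow h \<times> Pow (\<Union>P)) (Pow (\<Union>(insert h P)))"
    by (rule bij_betw_byWitness[where f' = "\<lambda>A. (A \<inter> h, A \<inter> \<Union>P)"]) (use dj in auto)
  have "(\<Sum>A\<in>Pow (\<Union>(insert h P)). \<Prod>g\<in>insert h P. F g (A \<inter> g))
      = (\<Sum>(B, A)\<in>Pow h \<times> Pow (\<Union>P). \<Prod>g\<in>insert h P. F g ((B \<union> A) \<inter> g))"
    by (subst sum.reindex_bij_betw[OF bij, symmetric]) (simp add: case_prod_unfold)
  also have "\<dots> = (\<Sum>(B, A)\<in>Pow h \<times> Pow (\<Union>P). F h B * (\<Prod>g\<in>P. F g (A \<inter> g)))"
  proof (intro sum.cong refl, clarify)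
    fix B A assume BA: "B \<subseteq> h" "A \<subseteq> \<Union>P"
    then have "(B \<union> A) \<inter> h = B" using dj by auto
    moreover have "(B \<union> A) \<inter> g = A \<inter> g" if "g \<in> P" for g using that BA dj by auto
    ultimately show "(\<Prod>g\<in>insert h P. F g ((B \<union> A) \<inter> g)) = F h B * (\<Prod>g\<in>P. F g (A \<inter> g))"
      using insert.hyps by simp
  qed
  also have "\<dots> = (\<Sum>B\<in>Pow h. F h B) * (\<Sum>A\<in>Pow (\<Union>P). \<Prod>g\<in>P. F g (A \<inter> g))"
    by (simp add: sum_product sum.cartesian_product)
  also have "\<dots> = (\<Prod>g\<in>insert h P. \<Sum>B\<in>Pow g. F g B)"
    using insert by (simp add: disjoint_def)
  finally show ?case .
qed

text \<open>In a full group, deleting i matches the a-subsets containing i with the (a-1)-subsets of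
  the rest, so their share among all a-subsets is a / k. In the remainder group the sum expands into
  a product over units whose factor at i is 0.\<close>

lemma group_mass_mean_zero:
  assumes ak: "1 \<le> a" "a \<le> k" and g: "finite g" "i \<in> g"
  shows "(\<Sum>B\<in>Pow g. group_mass a k g B * (of_bool (i \<in> B) - real a / real k)) = 0"
proof (cases "card g = k")
  case True
  have fin: "finite {B. B \<subseteq> g \<and> card B = a}" using g by auto
  have "(\<Sum>B\<in>Pow g. group_mass a k g B * (of_bool (i \<in> B) - real a / real k))
      = (\<Sum>B\<in>{B. B \<subseteq> g \<and> card B = a}. (of_bool (i \<in> B) - real a / real k) / real (k choose a))"
    using True g by (intro sum.mono_neutral_cong_right) (auto simp: group_mass_def)
  also have "\<dots> = (real (card {B. B \<subseteq> g \<and> card B = a \<and> i \<in> B})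
      - real (k choose a) * (real a / real k)) / real (k choose a)"
    using fin True n_subsets[OF g(1), of a]
    by (simp add: sum_subtractf Int_def conj_ac flip: sum_divide_distrib)
  also have "card {B. B \<subseteq> g \<and> card B = a \<and> i \<in> B} = (k - 1) choose (a - 1)"
  proof -
    have "bij_betw (insert i) {B. B \<subseteq> g - {i} \<and> card B = a - 1} {B. B \<subseteq> g \<and> card B = a \<and> i \<in> B}"
    proof (rule bij_betw_byWitness[where f' = "\<lambda>B. B - {i}"])
      show "insert i ` {B. B \<subseteq> g - {i} \<and> card B = a - 1} \<subseteq> {B. B \<subseteq> g \<and> card B = a \<and> i \<in> B}"
      proof clarify
        fix B assume B: "B \<subseteq> g - {i}" "card B = a - 1"
        then have "finite B" "i \<notin> B" using g finite_subset by auto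
        then show "insert i B \<subseteq> g \<and> card (insert i B) = a \<and> i \<in> insert i B"
          using B g ak by auto
      qed
      show "(\<lambda>B. B - {i}) ` {B. B \<subseteq> g \<and> card B = a \<and> i \<in> B} \<subseteq> {B. B \<subseteq> g - {i} \<and> card B = a - 1}"
        using g by (auto simp: card_Diff_singleton)
    qed auto
    from bij_betw_same_card[OF this]
    have "card {B. B \<subseteq> g \<and> card B = a \<and> i \<in> B} = card {B. B \<subseteq> g - {i} \<and> card B = a - 1}"
      by simp
    then show ?thesis using n_subsets[of "g - {i}" "a - 1"] g True by simp
  qed
  also have "real ((k - 1) choose (a - 1)) = real (k choose a) * (real a / real k)"
  proof -
    have "a * (k choose a) = k * ((k - 1) choose (a - 1))"
      using ak by (simp add: times_binomial_minus1_eq)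
    then have "real a * real (k choose a) = real k * real ((k - 1) choose (a - 1))"
      by (metis of_nat_mult)
    then show ?thesis using ak by (simp add: field_simps)
  qed
  finally show ?thesis by simp
next
  case False
  define r where "r = real a / real k"
  \<comment> \<open>The deviation of unit i is absorbed into its own Bernoulli weight: u for
    selected units, v for the others. Then \<open>u i + v i = r (1 - r) - (1 - r) r = 0\<close>,
    which \<open>prod_add\<close> turns into a vanishing product.\<close>
  define u where "u j = (if j = i then r * (1 - r) else r)" for j
  define v where "v j = (if j = i then (1 - r) * (- r) else 1 - r)" for j
  have "group_mass a k g B * (of_bool (i \<in> B) - r) = (\<Prod>j\<in>B. u j) * (\<Prod>j\<in>g - B. v j)"
    if B: "B \<subseteq> g" for B
  proof -
    have "(\<Prod>j\<in>B. u j) * (\<Prod>j\<in>g - B. v j) = (\<Prod>j\<in>g. if j \<in> B then u j else v j)"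
    proof -
      have "(\<Prod>j\<in>g. if j \<in> B then u j else v j)
          = (\<Prod>j\<in>B. if j \<in> B then u j else v j) * (\<Prod>j\<in>g - B. if j \<in> B then u j else v j)"
        using prod.subset_diff[OF B g(1), of "\<lambda>j. if j \<in> B then u j else v j"] by (simp add: mult.commute)
      then show ?thesis by simp
    qed
    also have "\<dots> = (\<Prod>j\<in>g. (if j \<in> B then r else 1 - r) * (if j = i then of_bool (i \<in> B) - r else 1))"
      by (intro prod.cong) (auto simp: u_def v_def)
    also have "\<dots> = group_mass a k g B * (of_bool (i \<in> B) - r)"
    proof -
      have "group_mass a k g B = (\<Prod>j\<in>g. if j \<in> B then r else 1 - r)"
        unfolding group_mass_def r_def using False by simp
      then show ?thesis using g by (simp add: prod.distrib)
    qed
    finally show ?thesis by simp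
  qed
  then have "(\<Sum>B\<in>Pow g. group_mass a k g B * (of_bool (i \<in> B) - r))
      = (\<Sum>B\<in>Pow g. (\<Prod>j\<in>B. u j) * (\<Prod>j\<in>g - B. v j))"
    by (intro sum.cong) auto
  also have "\<dots> = (\<Prod>j\<in>g. u j + v j)" using g by (simp add: prod_add)
  also have "\<dots> = 0" using g by (intro prod_zero) (auto simp: u_def v_def algebra_simps)
  finally show ?thesis by (simp add: r_def)
qed

text \<open>The two deviations are attached to the factors of their own groups. The sum then factors
  over groups, and the factor of g already vanishes by \<open>group_mass_mean_zero\<close>.\<close>

lemma partition_mass_uncorrelated:
  assumes ak: "1 \<le> a" "a \<le> k" and P: "finite P" "disjoint P" "\<And>g. g \<in> P \<Longrightarrow> finite g"
    and g: "g \<in> P" "g' \<in> P" "g \<noteq> g'" and i: "i \<in> g" and j: "j \<in> g'"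
  shows "(\<Sum>A\<in>Pow (\<Union>P). partition_mass a k P A *
    ((of_bool (i \<in> A) - real a / real k) * (of_bool (j \<in> A) - real a / real k))) = 0"
proof -
  define r where "r = real a / real k"
  define F where "F h B = group_mass a k h B * ((if h = g then of_bool (i \<in> B) - r else 1) *
     (if h = g' then of_bool (j \<in> B) - r else 1))" for h B
  have "(\<Sum>A\<in>Pow (\<Union>P). partition_mass a k P A * ((of_bool (i \<in> A) - r) * (of_bool (j \<in> A) - r)))
     = (\<Sum>A\<in>Pow (\<Union>P). \<Prod>h\<in>P. F h (A \<inter> h))"
    using P(1) g i j by (intro sum.cong) (auto simp: partition_mass_def F_def prod.distrib)
  also have "\<dots> = (\<Prod>h\<in>P. \<Sum>B\<in>Pow h. F h B)" by (rule sum_Pow_Union_prod[OF P])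
  also have "\<dots> = 0"
  proof (rule prod_zero[OF P(1)], rule bexI[OF _ g(1)])
    show "(\<Sum>B\<in>Pow g. F g B) = 0"
      using group_mass_mean_zero[OF ak P(3)[OF g(1)] i] g(3) by (simp add: F_def r_def)
  qed
  finally show ?thesis by (simp add: r_def)
qed

text \<open>One randomization at a fixed sample size. It is instantiated twice: for sampling, with U
  the whole of {1..n}, and for assignment, with U the random set of sampled units and F enlarged by
  T.\<close>

locale randomized_groups = prob_space M for M :: "'o measure" +
  fixes F :: "'o measure" and U :: "'o \<Rightarrow> nat set" and G :: "'o \<Rightarrow> nat set set"
    and Z :: "nat \<Rightarrow> 'o \<Rightarrow> bool" and a k n :: nat
  assumes subalg: "subalgebra M F"
    and G: "G \<in> measurable F (count_space (Pow (Pow {1..n})))"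
    and part: "\<And>\<omega>. \<omega> \<in> space M \<Longrightarrow> partition_on (U \<omega>) (G \<omega>)"
    and ak: "1 \<le> a" "a \<le> k"
    and Z: "\<And>i. i \<in> {1..n} \<Longrightarrow> Z i \<in> measurable M (count_space UNIV)"
    and rand: "complete_randomization M F G Z a k"
begin

sublocale sigma_finite_subalgebra M F
  by (rule finite_measure_subalgebra_is_sigma_finite) (unfold_locales, rule subalg)

text \<open>Restricting to U discards the irrelevant values of Z, such as D at unsampled units, so
  that the realized design is a finite-valued object.\<close>

definition "Zset \<omega> = {i \<in> U \<omega>. Z i \<omega>}"

lemma space_F: "space F = space M" using subalg by (simp add: subalgebra_def)

lemma G_in: "\<omega> \<in> space M \<Longrightarrow> G \<omega> \<in> Pow (Pow {1..n})"
  using measurable_space[OF G] space_F by auto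

lemma U_eq: "\<omega> \<in> space M \<Longrightarrow> U \<omega> = \<Union>(G \<omega>)"
  using part by (auto simp: partition_on_def)

lemma U_subset: "\<omega> \<in> space M \<Longrightarrow> U \<omega> \<subseteq> {1..n}"
  using U_eq G_in by blast

lemma card_group: "\<omega> \<in> space M \<Longrightarrow> g \<in> G \<omega> \<Longrightarrow> card g \<le> k"
  using rand by (auto simp: complete_randomization_def)

lemma G_event: "{\<omega> \<in> space M. Q (G \<omega>)} \<in> sets F"
proof -
  have "G -` (Pow (Pow {1..n}) \<inter> {P. Q P}) \<inter> space F \<in> sets F"
    by (rule measurable_sets[OF G]) auto
  also have "G -` (Pow (Pow {1..n}) \<inter> {P. Q P}) \<inter> space F = {\<omega> \<in> space M. Q (G \<omega>)}"
    using G_in space_F by auto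
  finally show ?thesis .
qed

lemma finite_Union_partition:
  assumes "P \<in> Pow (Pow {1..n})"
  shows "finite P" "finite (\<Union>P)" "g \<in> P \<Longrightarrow> finite g"
proof -
  show "finite P" by (rule finite_subset[of P "Pow {1..n}"]) (use assms in auto)
  show "finite (\<Union>P)" by (rule finite_subset[of _ "{1..n}"]) (use assms in auto)
  show "g \<in> P \<Longrightarrow> finite g" by (rule finite_subset[of _ "{1..n}"]) (use assms in auto)
qed

lemma F_sets: "A \<in> sets F \<Longrightarrow> A \<in> sets M" using subalg by (auto simp: subalgebra_def)

lemma Z_event:
  assumes "S \<subseteq> {1..n}"
  shows "{\<omega> \<in> space M. \<forall>i\<in>S. Z i \<omega> = z i} \<in> sets M"
proof -
  have "{\<omega> \<in> space M. Z i \<omega> = z i} \<in> sets M" if "i \<in> S" for i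
  proof -
    have "Z i -` {z i} \<inter> space M \<in> sets M" using that assms by (intro measurable_sets[OF Z]) auto
    then show ?thesis by (simp add: vimage_def Int_def conj_commute)
  qed
  then show ?thesis using finite_subset[OF assms] by (intro sets.sets_Collect_finite_All) auto
qed

lemma Zset_iff:
  assumes "\<omega> \<in> space M" "G \<omega> = P" "A \<subseteq> \<Union>P"
  shows "Zset \<omega> = A \<longleftrightarrow> (\<forall>g\<in>P. \<forall>i\<in>g. Z i \<omega> = (i \<in> A))"
  using assms U_eq[OF assms(1)] by (auto simp: Zset_def)

text \<open>P is finite, so the exceptional null sets of the clauses for its groups can be united;
  every group is full or smaller by \<open>card_group\<close>, which selects the branch of
  \<open>group_mass\<close>.\<close>

lemma cond_pr_partition:
  assumes P: "P \<subseteq> Pow {1..n}" and A: "A \<subseteq> \<Union>P"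
  shows "AE \<omega> in M. G \<omega> = P \<longrightarrow>
    cond_pr M F (\<lambda>\<omega>'. \<forall>g\<in>P. \<forall>i\<in>g. Z i \<omega>' = (i \<in> A)) \<omega> = partition_mass a k P A"
proof -
  have "finite P" using P finite_subset by auto
  have q01: "0 \<le> real a / real k" "real a / real k \<le> 1" using ak by (auto simp: divide_simps)
  have "AE \<omega> in M. G \<omega> = P \<longrightarrow>
      cond_pr M F (\<lambda>\<omega>'. \<forall>i\<in>g. Z i \<omega>' = (i \<in> A)) \<omega> = group_mass a k g (A \<inter> g)" if "g \<in> P" for g
  proof -
    have eqs: "{i \<in> g. i \<in> A} = A \<inter> g" by auto
    have eqp: "(\<Prod>i\<in>g. pmf (bernoulli_pmf (real a / real k)) (i \<in> A))
        = (\<Prod>i\<in>g. if i \<in> A \<inter> g then real a / real k else 1 - real a / real k)"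
      using q01 by (intro prod.cong) auto
    have "AE \<omega> in M. g \<in> G \<omega> \<and> card g = k \<longrightarrow>
        cond_pr M F (\<lambda>\<omega>'. \<forall>i\<in>g. Z i \<omega>' = (i \<in> A)) \<omega> =
        (if card {i \<in> g. i \<in> A} = a then 1 / real (k choose a) else 0)"
      by (rule rand[unfolded complete_randomization_def, THEN conjunct2, THEN conjunct2, THEN conjunct1, THEN spec, THEN spec])
    moreover have "AE \<omega> in M. g \<in> G \<omega> \<and> card g < k \<longrightarrow>
        cond_pr M F (\<lambda>\<omega>'. \<forall>i\<in>g. Z i \<omega>' = (i \<in> A)) \<omega> =
        (\<Prod>i\<in>g. pmf (bernoulli_pmf (real a / real k)) (i \<in> A))"
      by (rule rand[unfolded complete_randomization_def, THEN conjunct2, THEN conjunct2, THEN conjunct2, THEN spec, THEN spec])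
    ultimately show ?thesis
      using AE_space
    proof eventually_elim
      case (elim \<omega>)
      show ?case
      proof
        assume "G \<omega> = P"
        then have "card g \<le> k" "g \<in> G \<omega>" using card_group elim that by auto
        then show "cond_pr M F (\<lambda>\<omega>'. \<forall>i\<in>g. Z i \<omega>' = (i \<in> A)) \<omega> = group_mass a k g (A \<inter> g)"
          using elim eqs eqp unfolding group_mass_def by (auto simp: order.order_iff_strict)
      qed
    qed
  qed
  then have "AE \<omega> in M. \<forall>g\<in>P. G \<omega> = P \<longrightarrow>
      cond_pr M F (\<lambda>\<omega>'. \<forall>i\<in>g. Z i \<omega>' = (i \<in> A)) \<omega> = group_mass a k g (A \<inter> g)"
    using \<open>finite P\<close> by (intro AE_finite_allI) auto
  moreover have "AE \<omega> in M. G \<omega> = P \<longrightarrow>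
        cond_pr M F (\<lambda>\<omega>'. \<forall>g\<in>P. \<forall>i\<in>g. Z i \<omega>' = (i \<in> A)) \<omega> =
        (\<Prod>g\<in>P. cond_pr M F (\<lambda>\<omega>'. \<forall>i\<in>g. Z i \<omega>' = (i \<in> A)) \<omega>)"
    by (rule rand[unfolded complete_randomization_def, THEN conjunct2, THEN conjunct1, THEN spec, THEN spec])
  ultimately show ?thesis
  proof eventually_elim
    case (elim \<omega>)
    then show ?case using A by (simp add: partition_mass_def)
  qed
qed

text \<open>The indicator of G = P times \<Phi> is F-measurable, so it may be integrated against the
  conditional probability in place of the event. From here on the randomization enters only through
  such integrated identities.\<close>

lemma expectation_on_partition:
  fixes \<Phi> :: "'o \<Rightarrow> real"
  assumes P: "P \<subseteq> Pow {1..n}" and A: "A \<subseteq> \<Union>P"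
    and \<Phi>[measurable]: "\<Phi> \<in> borel_measurable F" and int: "integrable M \<Phi>"
  shows "expectation (\<lambda>\<omega>. of_bool (G \<omega> = P \<and> Zset \<omega> = A) * \<Phi> \<omega>)
       = partition_mass a k P A * expectation (\<lambda>\<omega>. of_bool (G \<omega> = P) * \<Phi> \<omega>)"
proof -
  let ?E = "{\<omega> \<in> space M. \<forall>g\<in>P. \<forall>i\<in>g. Z i \<omega> = (i \<in> A)}"
  have E[measurable]: "?E \<in> sets M"
    using Z_event[of "\<Union>P" "\<lambda>i. i \<in> A"] P by auto
  have [measurable]: "{\<omega> \<in> space M. G \<omega> = P} \<in> sets F" by (rule G_event)
  define f where "f \<omega> = indicator {\<omega> \<in> space M. G \<omega> = P} \<omega> * \<Phi> \<omega>" for \<omega>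
  have fF[measurable]: "f \<in> borel_measurable F" unfolding f_def by measurable
  have f_int: "integrable M f" unfolding f_def
    using integrable_mult_indicator[OF F_sets[OF G_event[of "\<lambda>P'. P' = P"]] int] by simp
  have "expectation (\<lambda>\<omega>. of_bool (G \<omega> = P \<and> Zset \<omega> = A) * \<Phi> \<omega>)
      = expectation (\<lambda>\<omega>. f \<omega> * indicator ?E \<omega>)"
  proof (intro Bochner_Integration.integral_cong refl)
    fix \<omega> assume "\<omega> \<in> space M"
    then show "of_bool (G \<omega> = P \<and> Zset \<omega> = A) * \<Phi> \<omega> = f \<omega> * indicator ?E \<omega>"
      using Zset_iff[of \<omega> P A] A by (cases "G \<omega> = P") (simp_all add: f_def indicator_def)
  qed
  also have "\<dots> = expectation (\<lambda>\<omega>. f \<omega> * real_cond_exp M F (indicator ?E) \<omega>)"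
    using integrable_mult_indicator[OF E f_int]
    by (intro real_cond_exp_intg(2)[symmetric]) (auto simp: mult.commute)
  also have "\<dots> = expectation (\<lambda>\<omega>. partition_mass a k P A * f \<omega>)"
  proof (rule integral_cong_AE)
    show "AE \<omega> in M. f \<omega> * real_cond_exp M F (indicator ?E) \<omega> = partition_mass a k P A * f \<omega>"
      using cond_pr_partition[OF P A] by eventually_elim (auto simp: f_def cond_pr_def indicator_def)
  qed (use f_int in auto)
  also have "\<dots> = partition_mass a k P A * expectation (\<lambda>\<omega>. of_bool (G \<omega> = P) * \<Phi> \<omega>)"
  proof -
    have "expectation f = expectation (\<lambda>\<omega>. of_bool (G \<omega> = P) * \<Phi> \<omega>)"
      by (intro Bochner_Integration.integral_cong refl) (auto simp: f_def indicator_def)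
    then show ?thesis by simp
  qed
  finally show ?thesis .
qed

text \<open>Any condition on the pair of realized partition and selected set is a finite union of
  events fixing both, hence measurable whatever Q is.\<close>

lemma integrable_partition_event:
  fixes \<Phi> :: "'o \<Rightarrow> real"
  assumes int: "integrable M \<Phi>"
  shows "integrable M (\<lambda>\<omega>. of_bool (Q (G \<omega>) (Zset \<omega>)) * \<Phi> \<omega>)"
proof -
  let ?S = "(\<Union>P\<in>Pow (Pow {1..n}). \<Union>A\<in>Pow (\<Union>P). {\<omega> \<in> space M. G \<omega> = P \<and> (\<forall>i\<in>\<Union>P. Z i \<omega> = (i \<in> A)) \<and> Q P A})"
  have "?S \<in> sets M"
  proof (intro sets.finite_UN)
    fix P A assume P: "P \<in> Pow (Pow {1..n})" and A: "A \<in> Pow (\<Union>P)"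
    have "{\<omega> \<in> space M. G \<omega> = P} \<inter> {\<omega> \<in> space M. \<forall>i\<in>\<Union>P. Z i \<omega> = (i \<in> A)} \<in> sets M"
      using P by (intro sets.Int F_sets[OF G_event] Z_event) auto
    then show "{\<omega> \<in> space M. G \<omega> = P \<and> (\<forall>i\<in>\<Union>P. Z i \<omega> = (i \<in> A)) \<and> Q P A} \<in> sets M"
      by (cases "Q P A") (auto simp: Int_def conj_ac)
  qed (simp_all only: finite_Pow_iff finite_Union_partition(2) finite_atLeastAtMost)
  from integrable_mult_indicator[OF this int] show ?thesis
  proof (rule Bochner_Integration.integrable_cong[THEN iffD1, rotated -1, OF _ refl])
    fix \<omega> assume \<omega>: "\<omega> \<in> space M"
    have Zs: "Zset \<omega> \<subseteq> \<Union>(G \<omega>)" using U_eq[OF \<omega>] by (auto simp: Zset_def)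
    have "\<omega> \<in> ?S \<longleftrightarrow> Q (G \<omega>) (Zset \<omega>)"
    proof
      assume "\<omega> \<in> ?S"
      then obtain A where A: "A \<subseteq> \<Union>(G \<omega>)" "\<forall>i\<in>\<Union>(G \<omega>). Z i \<omega> = (i \<in> A)" "Q (G \<omega>) A" by auto
      then have "Zset \<omega> = A" using Zset_iff[OF \<omega> refl A(1)] by auto
      then show "Q (G \<omega>) (Zset \<omega>)" using A(3) by simp
    next
      assume Q: "Q (G \<omega>) (Zset \<omega>)"
      have "\<forall>i\<in>\<Union>(G \<omega>). Z i \<omega> = (i \<in> Zset \<omega>)" using U_eq[OF \<omega>] by (auto simp: Zset_def)
      then show "\<omega> \<in> ?S" using Q Zs G_in[OF \<omega>] \<omega> by blast
    qed
    then show "indicator ?S \<omega> *\<^sub>R \<Phi> \<omega> = of_bool (Q (G \<omega>) (Zset \<omega>)) * \<Phi> \<omega>"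
      by (auto simp: indicator_def)
  qed
qed

text \<open>Summation of \<open>expectation_on_partition\<close> over the finitely many partitions;
  partitions not covering A contribute 0 on both sides. The result has the form required by the
  \<open>design\<close> assumption of \<open>finite_design\<close>.\<close>

lemma expectation_Zset:
  fixes \<Phi> :: "'o \<Rightarrow> real"
  assumes \<Phi>[measurable]: "\<Phi> \<in> borel_measurable F" and int: "integrable M \<Phi>"
  shows "expectation (\<lambda>\<omega>. of_bool (Zset \<omega> = A) * \<Phi> \<omega>)
       = expectation (\<lambda>\<omega>. partition_mass a k (G \<omega>) A * \<Phi> \<omega>)"
proof -
  let ?PP = "Pow (Pow {1..n})"
  have i: "integrable M (\<lambda>\<omega>. of_bool (G \<omega> = P) * \<Phi> \<omega>)" for P
    using integrable_partition_event[OF int, of "\<lambda>P' A'. P' = P"] by simp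
  have eq: "expectation (\<lambda>\<omega>. of_bool (G \<omega> = P \<and> Zset \<omega> = A) * \<Phi> \<omega>)
      = expectation (\<lambda>\<omega>. partition_mass a k P A * (of_bool (G \<omega> = P) * \<Phi> \<omega>))" if "P \<in> ?PP" for P
  proof (cases "A \<subseteq> \<Union>P")
    case True
    then show ?thesis using expectation_on_partition[OF _ True \<Phi> int] that by simp
  next
    case False
    then have "expectation (\<lambda>\<omega>. of_bool (G \<omega> = P \<and> Zset \<omega> = A) * \<Phi> \<omega>) = expectation (\<lambda>\<omega>. 0)"
      by (intro Bochner_Integration.integral_cong refl) (auto simp: Zset_def U_eq)
    then show ?thesis using False by (simp add: partition_mass_def)
  qed
  have "expectation (\<lambda>\<omega>. of_bool (Zset \<omega> = A) * \<Phi> \<omega>)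
      = expectation (\<lambda>\<omega>. \<Sum>P\<in>?PP. of_bool (G \<omega> = P \<and> Zset \<omega> = A) * \<Phi> \<omega>)"
    using G_in by (intro Bochner_Integration.integral_cong refl)
      (simp add: of_bool_conj mult.assoc flip: sum_distrib_right)
  also have "\<dots> = (\<Sum>P\<in>?PP. expectation (\<lambda>\<omega>. partition_mass a k P A * (of_bool (G \<omega> = P) * \<Phi> \<omega>)))"
    using integrable_partition_event[OF int, of "\<lambda>P' A'. P' = _ \<and> A' = A"] eq
    by (subst Bochner_Integration.integral_sum) auto
  also have "\<dots> = expectation (\<lambda>\<omega>. \<Sum>P\<in>?PP. partition_mass a k P A * (of_bool (G \<omega> = P) * \<Phi> \<omega>))"
    using i by (subst Bochner_Integration.integral_sum) auto
  also have "\<dots> = expectation (\<lambda>\<omega>. partition_mass a k (G \<omega>) A * \<Phi> \<omega>)"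
  proof (intro Bochner_Integration.integral_cong refl)
    fix \<omega> assume "\<omega> \<in> space M"
    have "(\<Sum>P\<in>?PP. partition_mass a k P A * (of_bool (G \<omega> = P) * \<Phi> \<omega>))
        = (\<Sum>P\<in>?PP. if G \<omega> = P then partition_mass a k P A * \<Phi> \<omega> else 0)"
      by (intro sum.cong) auto
    then show "(\<Sum>P\<in>?PP. partition_mass a k P A * (of_bool (G \<omega> = P) * \<Phi> \<omega>)) = partition_mass a k (G \<omega>) A * \<Phi> \<omega>"
      using G_in[OF \<open>\<omega> \<in> space M\<close>] by simp
  qed
  finally show ?thesis .
qed

text \<open>A configuration with a wrong count in a full group has mass 0, hence is almost surely
  not realized, and there are finitely many configurations.\<close>

lemma AE_full_group:
  "AE \<omega> in M. \<forall>g\<in>G \<omega>. card g = k \<longrightarrow> card (Zset \<omega> \<inter> g) = a"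
proof -
  have "AE \<omega> in M. \<not> (G \<omega> = P \<and> Zset \<omega> = A)"
    if P: "P \<subseteq> Pow {1..n}" and A: "A \<subseteq> \<Union>P" and g: "g \<in> P" "card g = k" "card (A \<inter> g) \<noteq> a" for P A g
  proof -
    have "partition_mass a k P A = 0"
      unfolding partition_mass_def using g finite_Union_partition(1)[of P] P
      by (auto simp: group_mass_def intro!: prod_zero bexI[of _ g])
    then have 0: "expectation (\<lambda>\<omega>. of_bool (G \<omega> = P \<and> Zset \<omega> = A)) = (0::real)"
      using expectation_on_partition[OF P A borel_measurable_const[of 1] integrable_const] by simp
    have "AE \<omega> in M. of_bool (G \<omega> = P \<and> Zset \<omega> = A) = (0::real)"
      using integrable_partition_event[of "\<lambda>_. 1" "\<lambda>P' A'. P' = P \<and> A' = A"] 0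
      by (subst integral_nonneg_eq_0_iff_AE[symmetric]) auto
    then show ?thesis by eventually_elim auto
  qed
  then have "AE \<omega> in M. card g = k \<longrightarrow> card (A \<inter> g) \<noteq> a \<longrightarrow> \<not> (G \<omega> = P \<and> Zset \<omega> = A)"
    if "P \<in> Pow (Pow {1..n})" "A \<in> Pow (\<Union>P)" "g \<in> P" for P A g
    using that by (cases "card g = k \<and> card (A \<inter> g) \<noteq> a") auto
  then have "AE \<omega> in M. \<forall>P\<in>Pow (Pow {1..n}). \<forall>A\<in>Pow (\<Union>P). \<forall>g\<in>P.
      card g = k \<longrightarrow> card (A \<inter> g) \<noteq> a \<longrightarrow> \<not> (G \<omega> = P \<and> Zset \<omega> = A)"
    using finite_Union_partition by (intro AE_finite_allI) auto
  then show ?thesis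
    using AE_space
  proof eventually_elim
    case (elim \<omega>)
    then show ?case using G_in[OF elim(2)] U_eq[OF elim(2)] by (auto simp: Zset_def)
  qed
qed

end

section \<open>Second moments of sums weighted by the deviations of the design\<close>

context randomized_groups
begin

definition "share = real a / real k"

definition group_sum :: "(nat \<Rightarrow> 'o \<Rightarrow> real) \<Rightarrow> nat set \<Rightarrow> 'o \<Rightarrow> real" where
  "group_sum x g \<omega> = (\<Sum>i\<in>g. (of_bool (Z i \<omega>) - share) * x i \<omega>)"

lemma share_bounds: "0 < share" "share \<le> 1"
  using ak by (auto simp: share_def divide_simps)

lemma dev_le: "\<bar>of_bool b - share\<bar> \<le> 1"
  using share_bounds by (cases b) auto

text \<open>A function of the realized design is a finite combination of indicators. Integrals of
  products with data can then be computed one configuration at a time.\<close>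

lemma design_expand:
  fixes c :: "nat set set \<Rightarrow> nat set \<Rightarrow> real"
  assumes "\<omega> \<in> space M"
  shows "c (G \<omega>) (Zset \<omega>) * y =
    (\<Sum>P\<in>Pow (Pow {1..n}). \<Sum>A\<in>Pow (\<Union>P). c P A * (of_bool (G \<omega> = P \<and> Zset \<omega> = A) * y))"
proof -
  have fin: "finite (Pow (Pow {1..n}))" by simp
  have Zs: "Zset \<omega> \<in> Pow (\<Union>(G \<omega>))" using U_eq[OF assms] by (auto simp: Zset_def)
  have "(\<Sum>A\<in>Pow (\<Union>P). c P A * (of_bool (G \<omega> = P \<and> Zset \<omega> = A) * y))
      = (if G \<omega> = P then c P (Zset \<omega>) * y else 0)" if "P \<in> Pow (Pow {1..n})" for P
  proof (cases "G \<omega> = P")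
    case True
    then have "(\<Sum>A\<in>Pow (\<Union>P). c P A * (of_bool (G \<omega> = P \<and> Zset \<omega> = A) * y))
       = (\<Sum>A\<in>Pow (\<Union>P). if Zset \<omega> = A then c P A * y else 0)"
      by (intro sum.cong) auto
    then show ?thesis using True Zs finite_Union_partition(2)[OF that] by simp
  qed simp
  then have "(\<Sum>P\<in>Pow (Pow {1..n}). \<Sum>A\<in>Pow (\<Union>P). c P A * (of_bool (G \<omega> = P \<and> Zset \<omega> = A) * y))
     = (\<Sum>P\<in>Pow (Pow {1..n}). if G \<omega> = P then c P (Zset \<omega>) * y else 0)"
    by (intro sum.cong) auto
  also have "\<dots> = c (G \<omega>) (Zset \<omega>) * y" using G_in[OF assms] by (simp only: sum.delta' sum.delta fin) simp
  finally show ?thesis by simp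
qed

lemma integrable_design:
  fixes c :: "nat set set \<Rightarrow> nat set \<Rightarrow> real"
  assumes "integrable M \<Phi>"
  shows "integrable M (\<lambda>\<omega>. c (G \<omega>) (Zset \<omega>) * \<Phi> \<omega>)"
proof -
  have "integrable M (\<lambda>\<omega>. \<Sum>P\<in>Pow (Pow {1..n}). \<Sum>A\<in>Pow (\<Union>P).
      c P A * (of_bool (G \<omega> = P \<and> Zset \<omega> = A) * \<Phi> \<omega>))"
    using integrable_partition_event[OF assms, of "\<lambda>P' A'. P' = _ \<and> A' = _"]
    by (intro Bochner_Integration.integrable_sum integrable_mult_right)
  then show ?thesis
    by (rule Bochner_Integration.integrable_cong[THEN iffD1, rotated -1])
       (auto simp: design_expand[of _ c])
qed

text \<open>The inner sum averages c over the selection at a fixed partition, without any data. An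
  identity between finite sums under \<open>partition_mass\<close> thus becomes an identity between
  expectations.\<close>

lemma expectation_design:
  fixes c :: "nat set set \<Rightarrow> nat set \<Rightarrow> real"
  assumes \<Phi>: "\<Phi> \<in> borel_measurable F" "integrable M \<Phi>"
  shows "expectation (\<lambda>\<omega>. c (G \<omega>) (Zset \<omega>) * \<Phi> \<omega>) =
    (\<Sum>P\<in>Pow (Pow {1..n}). (\<Sum>A\<in>Pow (\<Union>P). partition_mass a k P A * c P A) *
       expectation (\<lambda>\<omega>. of_bool (G \<omega> = P) * \<Phi> \<omega>))"
proof -
  note int = integrable_partition_event[OF \<Phi>(2), of "\<lambda>P' A'. P' = _ \<and> A' = _"]
  have "expectation (\<lambda>\<omega>. c (G \<omega>) (Zset \<omega>) * \<Phi> \<omega>) =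
    expectation (\<lambda>\<omega>. \<Sum>P\<in>Pow (Pow {1..n}). \<Sum>A\<in>Pow (\<Union>P).
      c P A * (of_bool (G \<omega> = P \<and> Zset \<omega> = A) * \<Phi> \<omega>))"
    by (intro Bochner_Integration.integral_cong refl design_expand)
  also have "\<dots> = (\<Sum>P\<in>Pow (Pow {1..n}). \<Sum>A\<in>Pow (\<Union>P).
      c P A * expectation (\<lambda>\<omega>. of_bool (G \<omega> = P \<and> Zset \<omega> = A) * \<Phi> \<omega>))"
    using int
    by (simp only: Bochner_Integration.integral_sum Bochner_Integration.integrable_sum
        integrable_mult_right integral_mult_right_zero)
  also have "\<dots> = (\<Sum>P\<in>Pow (Pow {1..n}). \<Sum>A\<in>Pow (\<Union>P).
      (partition_mass a k P A * c P A) * expectation (\<lambda>\<omega>. of_bool (G \<omega> = P) * \<Phi> \<omega>))"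
    by (intro sum.cong refl, subst expectation_on_partition[OF _ _ \<Phi>]) auto
  finally show ?thesis by (simp add: sum_distrib_right)
qed

lemma sum_U:
  fixes y :: "nat \<Rightarrow> real"
  assumes "\<omega> \<in> space M"
  shows "(\<Sum>i\<in>U \<omega>. y i) = (\<Sum>g\<in>G \<omega>. \<Sum>i\<in>g. y i)"
  unfolding U_eq[OF assms]
  using sum.Union_disjoint[of "G \<omega>" y] part[OF assms] finite_Union_partition(3)[OF G_in[OF assms]]
  by (auto simp: partition_on_def disjoint_def)

lemma same_group_count:
  assumes \<omega>: "\<omega> \<in> space M" and g: "g \<in> G \<omega>" "i \<in> g"
  shows "(\<Sum>h\<in>G \<omega>. of_bool (i \<in> h \<and> j \<in> h)) = (of_bool (j \<in> g) :: real)"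
proof -
  have "(\<Sum>h\<in>G \<omega>. of_bool (i \<in> h \<and> j \<in> h)) = (\<Sum>h\<in>G \<omega>. if h = g then of_bool (j \<in> g) else (0::real))"
    using part[OF \<omega>] g by (intro sum.cong refl) (auto simp: partition_on_def disjoint_def)
  then show ?thesis using g finite_Union_partition(1)[OF G_in[OF \<omega>]] by simp
qed

lemma sum_group_squares:
  fixes y :: "nat \<Rightarrow> real"
  assumes \<omega>: "\<omega> \<in> space M"
  shows "(\<Sum>g\<in>G \<omega>. (\<Sum>i\<in>g. y i)\<^sup>2)
    = (\<Sum>i\<in>{1..n}. \<Sum>j\<in>{1..n}. (\<Sum>h\<in>G \<omega>. of_bool (i \<in> h \<and> j \<in> h)) * (y i * y j))"
proof -
  have "(\<Sum>i\<in>g. y i)\<^sup>2 = (\<Sum>i\<in>{1..n}. \<Sum>j\<in>{1..n}. of_bool (i \<in> g \<and> j \<in> g) * (y i * y j))"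
    if "g \<in> G \<omega>" for g
  proof -
    have "g \<subseteq> {1..n}" using that G_in[OF \<omega>] by auto
    then have "(\<Sum>i\<in>g. y i) = (\<Sum>i\<in>{1..n}. of_bool (i \<in> g) * y i)"
      by (intro sum.mono_neutral_cong_left) auto
    then show ?thesis
      by (simp only: power2_eq_square sum_product of_bool_conj) (simp only: ac_simps)
  qed
  then have "(\<Sum>g\<in>G \<omega>. (\<Sum>i\<in>g. y i)\<^sup>2)
      = (\<Sum>g\<in>G \<omega>. \<Sum>i\<in>{1..n}. \<Sum>j\<in>{1..n}. of_bool (i \<in> g \<and> j \<in> g) * (y i * y j))"
    by simp
  also have "\<dots> = (\<Sum>i\<in>{1..n}. \<Sum>j\<in>{1..n}. \<Sum>g\<in>G \<omega>. of_bool (i \<in> g \<and> j \<in> g) * (y i * y j))"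
    by (subst sum.swap, rule sum.cong[OF refl], rule sum.swap)
  finally show ?thesis by (simp add: sum_distrib_right)
qed

text \<open>Cross products between different groups average to 0 by
  \<open>partition_mass_uncorrelated\<close>. Both squares are double sums over {1..n} whose
  coefficients say "both units in U" (\<open>c1\<close>) and "both units in one group"
  (\<open>c2\<close>), so only the difference of the coefficients has to be averaged.\<close>

lemma second_moment:
  assumes xF: "\<And>i. i \<in> {1..n} \<Longrightarrow> x i \<in> borel_measurable F"
    and x2: "\<And>i. i \<in> {1..n} \<Longrightarrow> integrable M (\<lambda>\<omega>. (x i \<omega>)\<^sup>2)"
  shows "integrable M (\<lambda>\<omega>. (group_sum x (U \<omega>) \<omega>)\<^sup>2)"
    and "integrable M (\<lambda>\<omega>. \<Sum>g\<in>G \<omega>. (group_sum x g \<omega>)\<^sup>2)"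
    and "expectation (\<lambda>\<omega>. (group_sum x (U \<omega>) \<omega>)\<^sup>2) = expectation (\<lambda>\<omega>. \<Sum>g\<in>G \<omega>. (group_sum x g \<omega>)\<^sup>2)"
proof -
  define d where "d i A = of_bool (i \<in> A) - share" for i :: nat and A
  define c1 where "c1 i j P A = of_bool (i \<in> \<Union>P \<and> j \<in> \<Union>P) * (d i A * d j A)" for i j P A
  define c2 where "c2 i j P A = (\<Sum>h\<in>P. of_bool (i \<in> h \<and> j \<in> h)) * (d i A * d j A)" for i j P A
  have prod_F: "(\<lambda>\<omega>. x i \<omega> * x j \<omega>) \<in> borel_measurable F"
    and prod_int: "integrable M (\<lambda>\<omega>. x i \<omega> * x j \<omega>)" if "i \<in> {1..n}" "j \<in> {1..n}" for i j
    using that xF x2 by (auto intro!: integrable_mult_of_squares measurable_from_subalg[OF subalg])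
  have gs: "group_sum x g \<omega> = (\<Sum>i\<in>g. d i (Zset \<omega>) * x i \<omega>)" if "g \<subseteq> U \<omega>" for g \<omega>
    unfolding group_sum_def by (intro sum.cong) (use that in \<open>auto simp: d_def Zset_def\<close>)
  have e1: "(group_sum x (U \<omega>) \<omega>)\<^sup>2 = (\<Sum>i\<in>{1..n}. \<Sum>j\<in>{1..n}. c1 i j (G \<omega>) (Zset \<omega>) * (x i \<omega> * x j \<omega>))"
    if \<omega>: "\<omega> \<in> space M" for \<omega>
  proof -
    have "group_sum x (U \<omega>) \<omega> = (\<Sum>i\<in>{1..n}. of_bool (i \<in> \<Union>(G \<omega>)) * (d i (Zset \<omega>) * x i \<omega>))"
      unfolding gs[OF subset_refl] using U_subset[OF \<omega>] U_eq[OF \<omega>]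
      by (intro sum.mono_neutral_cong_left) auto
    then show ?thesis
      by (simp only: power2_eq_square sum_product c1_def of_bool_conj) (simp only: ac_simps)
  qed
  have e2: "(\<Sum>g\<in>G \<omega>. (group_sum x g \<omega>)\<^sup>2)
      = (\<Sum>i\<in>{1..n}. \<Sum>j\<in>{1..n}. c2 i j (G \<omega>) (Zset \<omega>) * (x i \<omega> * x j \<omega>))"
    if \<omega>: "\<omega> \<in> space M" for \<omega>
  proof -
    have "(\<Sum>g\<in>G \<omega>. (group_sum x g \<omega>)\<^sup>2) = (\<Sum>g\<in>G \<omega>. (\<Sum>i\<in>g. d i (Zset \<omega>) * x i \<omega>)\<^sup>2)"
      using U_eq[OF \<omega>] by (intro sum.cong refl, subst gs) auto
    then show ?thesis unfolding sum_group_squares[OF \<omega>] c2_def by (simp only: ac_simps)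
  qed
  have i1: "integrable M (\<lambda>\<omega>. \<Sum>i\<in>{1..n}. \<Sum>j\<in>{1..n}. c1 i j (G \<omega>) (Zset \<omega>) * (x i \<omega> * x j \<omega>))"
    and i2: "integrable M (\<lambda>\<omega>. \<Sum>i\<in>{1..n}. \<Sum>j\<in>{1..n}. c2 i j (G \<omega>) (Zset \<omega>) * (x i \<omega> * x j \<omega>))"
    by (intro Bochner_Integration.integrable_sum integrable_design prod_int; assumption)+
  show r1: "integrable M (\<lambda>\<omega>. (group_sum x (U \<omega>) \<omega>)\<^sup>2)"
    by (rule Bochner_Integration.integrable_cong[THEN iffD1, OF refl _ i1]) (simp only: e1)
  show r2: "integrable M (\<lambda>\<omega>. \<Sum>g\<in>G \<omega>. (group_sum x g \<omega>)\<^sup>2)"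
    by (rule Bochner_Integration.integrable_cong[THEN iffD1, OF refl _ i2]) (simp only: e2)
  have z: "expectation (\<lambda>\<omega>. (c1 i j (G \<omega>) (Zset \<omega>) - c2 i j (G \<omega>) (Zset \<omega>)) * (x i \<omega> * x j \<omega>)) = 0"
    if ij: "i \<in> {1..n}" "j \<in> {1..n}" for i j
  proof -
    have "(\<Sum>A\<in>Pow (\<Union>P). partition_mass a k P A * (c1 i j P A - c2 i j P A)) *
       expectation (\<lambda>\<omega>. of_bool (G \<omega> = P) * (x i \<omega> * x j \<omega>)) = 0" for P
    \<comment> \<open>Only a realized P is known to be disjoint; for any other P the second factor
      is 0.\<close>
    proof (cases "\<exists>\<omega>\<in>space M. G \<omega> = P")
      case False
      then have "expectation (\<lambda>\<omega>. of_bool (G \<omega> = P) * (x i \<omega> * x j \<omega>)) = expectation (\<lambda>\<omega>. 0)"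
        by (intro Bochner_Integration.integral_cong) auto
      then show ?thesis by simp
    next
      case True
      then obtain \<omega> where \<omega>: "\<omega> \<in> space M" and P: "G \<omega> = P" by auto
      have disj: "disjoint P" using part[OF \<omega>] P by (auto simp: partition_on_def)
      have fin: "finite P" "\<And>g. g \<in> P \<Longrightarrow> finite g" using finite_Union_partition G_in[OF \<omega>] P by auto
      have "(\<Sum>A\<in>Pow (\<Union>P). partition_mass a k P A * (c1 i j P A - c2 i j P A)) = 0"
      proof (cases "i \<in> \<Union>P \<and> j \<in> \<Union>P")
        case True
        then obtain g g' where g: "g \<in> P" "i \<in> g" and g': "g' \<in> P" "j \<in> g'" by auto
        have cnt: "(\<Sum>h\<in>P. of_bool (i \<in> h \<and> j \<in> h)) = (of_bool (j \<in> g) :: real)"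
          using same_group_count[OF \<omega>, of g i j] P g by simp
        show ?thesis
        proof (cases "g = g'")
          case True
          then show ?thesis using cnt \<open>i \<in> \<Union>P \<and> j \<in> \<Union>P\<close> g' by (simp add: c1_def c2_def)
        next
          case False
          then have "j \<notin> g" using disj g g' by (auto simp: disjoint_def)
          then have eq: "c1 i j P A - c2 i j P A
              = (of_bool (i \<in> A) - real a / real k) * (of_bool (j \<in> A) - real a / real k)" for A
            using cnt \<open>i \<in> \<Union>P \<and> j \<in> \<Union>P\<close> by (simp add: c1_def c2_def d_def share_def)
          show ?thesis
            unfolding eq by (rule partition_mass_uncorrelated[OF ak fin(1) disj fin(2) g(1) g'(1) False g(2) g'(2)])
        qed
      next
        case False
        then have "c1 i j P A - c2 i j P A = 0" for A
          by (auto simp: c1_def c2_def intro!: sum.neutral)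
        then show ?thesis by simp
      qed
      then show ?thesis by simp
    qed
    then show ?thesis
      unfolding expectation_design[OF prod_F[OF ij] prod_int[OF ij], of "\<lambda>P A. c1 i j P A - c2 i j P A"]
      by (intro sum.neutral ballI)
  qed
  have "expectation (\<lambda>\<omega>. (group_sum x (U \<omega>) \<omega>)\<^sup>2) - expectation (\<lambda>\<omega>. \<Sum>g\<in>G \<omega>. (group_sum x g \<omega>)\<^sup>2)
      = expectation (\<lambda>\<omega>. (group_sum x (U \<omega>) \<omega>)\<^sup>2 - (\<Sum>g\<in>G \<omega>. (group_sum x g \<omega>)\<^sup>2))"
    using r1 r2 by simp
  also have "\<dots> = expectation (\<lambda>\<omega>. \<Sum>i\<in>{1..n}. \<Sum>j\<in>{1..n}.
      (c1 i j (G \<omega>) (Zset \<omega>) - c2 i j (G \<omega>) (Zset \<omega>)) * (x i \<omega> * x j \<omega>))"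
    by (intro Bochner_Integration.integral_cong refl)
       (simp only: e1 e2 left_diff_distrib sum_subtractf)
  also have "\<dots> = (\<Sum>i\<in>{1..n}. \<Sum>j\<in>{1..n}. expectation (\<lambda>\<omega>.
      (c1 i j (G \<omega>) (Zset \<omega>) - c2 i j (G \<omega>) (Zset \<omega>)) * (x i \<omega> * x j \<omega>)))"
    using integrable_design[OF prod_int, of _ _ "\<lambda>P A. c1 _ _ P A - c2 _ _ P A"]
    by (subst Bochner_Integration.integral_sum; (intro Bochner_Integration.integrable_sum sum.cong refl)?)
       (auto intro!: Bochner_Integration.integral_sum)
  also have "\<dots> = 0" using z by (intro sum.neutral ballI) auto
  finally show "expectation (\<lambda>\<omega>. (group_sum x (U \<omega>) \<omega>)\<^sup>2) = expectation (\<lambda>\<omega>. \<Sum>g\<in>G \<omega>. (group_sum x g \<omega>)\<^sup>2)"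
    by simp
qed

lemma group_sum_squared_le:
  fixes y :: "nat \<Rightarrow> real"
  assumes "finite g"
  shows "(\<Sum>i\<in>g. (of_bool (Z i \<omega>) - share) * y i)\<^sup>2 \<le> card g * (\<Sum>i\<in>g. (y i)\<^sup>2)"
proof -
  have "((of_bool (Z i \<omega>) - share) * y i)\<^sup>2 \<le> (y i)\<^sup>2" for i
  proof -
    have "\<bar>(of_bool (Z i \<omega>) - share) * y i\<bar> \<le> \<bar>y i\<bar>"
      using mult_right_mono[OF dev_le, of "\<bar>y i\<bar>"] by (simp add: abs_mult)
    then show ?thesis unfolding abs_le_square_iff .
  qed
  then have "(\<Sum>i\<in>g. ((of_bool (Z i \<omega>) - share) * y i)\<^sup>2) \<le> (\<Sum>i\<in>g. (y i)\<^sup>2)"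
    by (intro sum_mono)
  then show ?thesis
    using power2_sum_le_card[OF assms, of "\<lambda>i. (of_bool (Z i \<omega>) - share) * y i"]
    by (meson mult_left_mono of_nat_0_le_iff order_trans)
qed

text \<open>Cauchy-Schwarz inside a group costs its size, at most k. The bound uses no matching at
  all, which lets it control the approximation error uniformly over designs.\<close>

lemma second_moment_le:
  assumes xF: "\<And>i. i \<in> {1..n} \<Longrightarrow> x i \<in> borel_measurable F"
    and x2: "\<And>i. i \<in> {1..n} \<Longrightarrow> integrable M (\<lambda>\<omega>. (x i \<omega>)\<^sup>2)"
  shows "expectation (\<lambda>\<omega>. (group_sum x (U \<omega>) \<omega>)\<^sup>2) \<le> k * (\<Sum>i\<in>{1..n}. expectation (\<lambda>\<omega>. (x i \<omega>)\<^sup>2))"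
proof -
  have "expectation (\<lambda>\<omega>. \<Sum>g\<in>G \<omega>. (group_sum x g \<omega>)\<^sup>2) \<le> expectation (\<lambda>\<omega>. k * (\<Sum>i\<in>{1..n}. (x i \<omega>)\<^sup>2))"
  proof (intro integral_mono second_moment(2) integrable_mult_right Bochner_Integration.integrable_sum assms)
    fix \<omega> assume \<omega>: "\<omega> \<in> space M"
    have "(\<Sum>g\<in>G \<omega>. (group_sum x g \<omega>)\<^sup>2) \<le> (\<Sum>g\<in>G \<omega>. k * (\<Sum>i\<in>g. (x i \<omega>)\<^sup>2))"
    proof (rule sum_mono)
      fix g assume g: "g \<in> G \<omega>"
      have "(group_sum x g \<omega>)\<^sup>2 \<le> card g * (\<Sum>i\<in>g. (x i \<omega>)\<^sup>2)"
        unfolding group_sum_def using finite_Union_partition(3)[OF G_in[OF \<omega>] g] by (rule group_sum_squared_le)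
      also have "\<dots> \<le> k * (\<Sum>i\<in>g. (x i \<omega>)\<^sup>2)"
        using card_group[OF \<omega> g] by (intro mult_right_mono sum_nonneg) auto
      finally show "(group_sum x g \<omega>)\<^sup>2 \<le> k * (\<Sum>i\<in>g. (x i \<omega>)\<^sup>2)" .
    qed
    also have "\<dots> = k * (\<Sum>i\<in>U \<omega>. (x i \<omega>)\<^sup>2)" by (simp add: sum_U[OF \<omega>] sum_distrib_left)
    also have "\<dots> \<le> k * (\<Sum>i\<in>{1..n}. (x i \<omega>)\<^sup>2)"
      using U_subset[OF \<omega>] by (intro mult_left_mono sum_mono2) auto
    finally show "(\<Sum>g\<in>G \<omega>. (group_sum x g \<omega>)\<^sup>2) \<le> k * (\<Sum>i\<in>{1..n}. (x i \<omega>)\<^sup>2)" .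
  qed
  also have "\<dots> = k * (\<Sum>i\<in>{1..n}. expectation (\<lambda>\<omega>. (x i \<omega>)\<^sup>2))"
    using x2 by (simp add: Bochner_Integration.integral_sum)
  finally show ?thesis using second_moment(3)[OF assms] by simp
qed

text \<open>In a full group the deviations sum to zero, so any constant can be subtracted from \<open>x\<close> there;
  the single remainder group is bounded trivially.\<close>
lemma second_moment_matched:
  fixes \<gamma> :: "nat set \<Rightarrow> 'o \<Rightarrow> real" and B :: real
  assumes xF: "\<And>i. i \<in> {1..n} \<Longrightarrow> x i \<in> borel_measurable F"
    and B: "\<And>i \<omega>. \<bar>x i \<omega>\<bar> \<le> B"
    and H: "integrable M H"
      "\<And>\<omega>. \<omega> \<in> space M \<Longrightarrow> (\<Sum>g\<in>G \<omega>. \<Sum>i\<in>g. (x i \<omega> - \<gamma> g \<omega>)\<^sup>2) \<le> H \<omega>"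
  shows "expectation (\<lambda>\<omega>. (group_sum x (U \<omega>) \<omega>)\<^sup>2) \<le> k * expectation H + (k * B)\<^sup>2"
proof -
  have xx: "(x i \<omega>)\<^sup>2 \<le> B\<^sup>2" for i \<omega>
    using order_trans[OF B abs_ge_self, of i \<omega>] unfolding abs_le_square_iff .
  have x2: "integrable M (\<lambda>\<omega>. (x i \<omega>)\<^sup>2)" if "i \<in> {1..n}" for i
    using measurable_from_subalg[OF subalg xF[OF that]] xx
    by (intro integrable_const_bound[where B = "B\<^sup>2"]) auto
  have "expectation (\<lambda>\<omega>. \<Sum>g\<in>G \<omega>. (group_sum x g \<omega>)\<^sup>2) \<le> expectation (\<lambda>\<omega>. k * H \<omega> + (k * B)\<^sup>2)"
  proof (rule integral_mono_AE)
    show "AE \<omega> in M. (\<Sum>g\<in>G \<omega>. (group_sum x g \<omega>)\<^sup>2) \<le> k * H \<omega> + (k * B)\<^sup>2"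
      using AE_full_group AE_space
    proof eventually_elim
      case (elim \<omega>)
      note \<omega> = elim(2)
      let ?full = "{g \<in> G \<omega>. card g = k}" and ?rem = "{g \<in> G \<omega>. card g < k}"
      have finG: "finite (G \<omega>)" using finite_Union_partition(1)[OF G_in[OF \<omega>]] .
      have fing: "finite g" if "g \<in> G \<omega>" for g using finite_Union_partition(3)[OF G_in[OF \<omega>] that] .
      have Gsplit: "G \<omega> = ?full \<union> ?rem" using card_group[OF \<omega>] by (auto simp: order.order_iff_strict)
      have full: "(group_sum x g \<omega>)\<^sup>2 \<le> k * (\<Sum>i\<in>g. (x i \<omega> - \<gamma> g \<omega>)\<^sup>2)" if g: "g \<in> ?full" for g
      proof -
        have "Zset \<omega> \<inter> g = {i \<in> g. Z i \<omega>}" using g U_eq[OF \<omega>] by (auto simp: Zset_def)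
        then have "card {i \<in> g. Z i \<omega>} = a" using elim(1) g by auto
        moreover have "real a = k * share" using ak by (simp add: share_def)
        ultimately have "(\<Sum>i\<in>g. of_bool (Z i \<omega>) - share) = 0"
          using g fing by (simp add: sum_subtractf Int_def)
        then have "group_sum x g \<omega> = (\<Sum>i\<in>g. (of_bool (Z i \<omega>) - share) * (x i \<omega> - \<gamma> g \<omega>))"
          unfolding group_sum_def
          by (simp add: right_diff_distrib sum_subtractf flip: sum_distrib_right)
        then show ?thesis
          using group_sum_squared_le[of g \<omega> "\<lambda>i. x i \<omega> - \<gamma> g \<omega>"] fing g by auto
      qed
      have rem: "(group_sum x g \<omega>)\<^sup>2 \<le> (k * B)\<^sup>2" if g: "g \<in> ?rem" for g
      proof -
        have "(group_sum x g \<omega>)\<^sup>2 \<le> card g * (\<Sum>i\<in>g. (x i \<omega>)\<^sup>2)"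
          unfolding group_sum_def using fing g by (intro group_sum_squared_le) auto
        also have "\<dots> \<le> card g * (\<Sum>i\<in>g. B\<^sup>2)" by (intro mult_left_mono sum_mono xx) auto
        also have "\<dots> = (card g)\<^sup>2 * B\<^sup>2" by (simp add: power2_eq_square)
        also have "\<dots> \<le> k\<^sup>2 * B\<^sup>2" using g by (intro mult_right_mono) (auto intro: power_mono)
        finally show ?thesis by (simp add: power_mult_distrib)
      qed
      have card1: "card ?rem \<le> 1"
        using rand \<omega> by (auto simp: complete_randomization_def)
      have "(\<Sum>g\<in>G \<omega>. (group_sum x g \<omega>)\<^sup>2)
          = (\<Sum>g\<in>?full. (group_sum x g \<omega>)\<^sup>2) + (\<Sum>g\<in>?rem. (group_sum x g \<omega>)\<^sup>2)"
        by (subst Gsplit, rule sum.union_disjoint) (use finG in auto)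
      also have "(\<Sum>g\<in>?full. (group_sum x g \<omega>)\<^sup>2) \<le> (\<Sum>g\<in>?full. k * (\<Sum>i\<in>g. (x i \<omega> - \<gamma> g \<omega>)\<^sup>2))"
        by (intro sum_mono full)
      also have "\<dots> \<le> (\<Sum>g\<in>G \<omega>. k * (\<Sum>i\<in>g. (x i \<omega> - \<gamma> g \<omega>)\<^sup>2))"
        using finG by (intro sum_mono2) (auto intro!: mult_nonneg_nonneg sum_nonneg)
      also have "\<dots> \<le> k * H \<omega>"
        using H(2)[OF \<omega>] by (simp add: mult_left_mono flip: sum_distrib_left)
      also have "(\<Sum>g\<in>?rem. (group_sum x g \<omega>)\<^sup>2) \<le> card ?rem * (k * B)\<^sup>2"
        by (rule sum_bounded_above[OF rem])
      also have "\<dots> \<le> 1 * (k * B)\<^sup>2"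
        using card1 by (intro mult_right_mono) auto
      finally show ?case by simp
    qed
  qed (use second_moment(2)[OF xF x2] H(1) in auto)
  also have "\<dots> = k * expectation H + (k * B)\<^sup>2" using H(1) by (simp add: prob_space)
  finally show ?thesis using second_moment(3)[OF xF x2] by simp
qed

end

section \<open>Conditional independence given the design\<close>

text \<open>m is a regression function of g on pr: m composed with pr is a version of the
  conditional expectation. A genuine function on N can be evaluated at \<open>pr (W i)\<close> for
  every unit, and bounded tests keep all products integrable.\<close>

definition cond_exp_fn :: "'w measure \<Rightarrow> 'v measure \<Rightarrow> ('w \<Rightarrow> 'v) \<Rightarrow> ('w \<Rightarrow> real) \<Rightarrow> ('v \<Rightarrow> real) \<Rightarrow> bool" where
  "cond_exp_fn \<mu> N pr g m \<longleftrightarrow> integrable \<mu> g \<and> m \<in> borel_measurable N \<and> integrable \<mu> (\<lambda>w. m (pr w)) \<and>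
     (\<forall>H\<in>borel_measurable N. (\<exists>B. \<forall>v. \<bar>H v\<bar> \<le> B) \<longrightarrow>
        (\<integral>w. g w * H (pr w) \<partial>\<mu>) = (\<integral>w. m (pr w) * H (pr w) \<partial>\<mu>))"

lemma cond_exp_fnD:
  assumes "cond_exp_fn \<mu> N pr g m" "H \<in> borel_measurable N" "\<And>v. \<bar>H v\<bar> \<le> B"
  shows "(\<integral>w. g w * H (pr w) \<partial>\<mu>) = (\<integral>w. m (pr w) * H (pr w) \<partial>\<mu>)"
  using assms unfolding cond_exp_fn_def by blast

text \<open>The random variable \<open>\<xi>\<close> is the realized design. Given the data it depends only on the
  projections \<open>pr (W i)\<close> and the tie-breaking variable, through the mass function \<open>\<kappa>\<close>.\<close>
locale finite_design = prob_space M for M :: "'o measure" +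
  fixes \<mu> :: "'w measure" and W :: "nat \<Rightarrow> 'o \<Rightarrow> 'w" and R :: "'r measure" and \<pi> :: "'o \<Rightarrow> 'r"
    and n :: nat and N :: "'v measure" and pr :: "'w \<Rightarrow> 'v"
    and \<xi> :: "'o \<Rightarrow> 'd" and S :: "'d set" and \<kappa> :: "'d \<Rightarrow> (nat \<Rightarrow> 'v) \<times> 'r \<Rightarrow> real"
  assumes prob_\<mu>: "prob_space \<mu>"
    and W[measurable]: "\<And>i. i \<in> {1..n} \<Longrightarrow> W i \<in> measurable M \<mu>"
    and law_W: "\<And>i. i \<in> {1..n} \<Longrightarrow> distr M \<mu> (W i) = \<mu>"
    and \<pi>[measurable]: "\<pi> \<in> measurable M R"
    and law: "distr M (PiM {1..n} (\<lambda>_. \<mu>) \<Otimes>\<^sub>M R) (\<lambda>\<omega>. (upto_n n W \<omega>, \<pi> \<omega>)) =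
      PiM {1..n} (\<lambda>_. \<mu>) \<Otimes>\<^sub>M distr M R \<pi>"
    and pr[measurable]: "pr \<in> measurable \<mu> N"
    and finS: "finite S" and \<xi>S: "\<And>\<omega>. \<omega> \<in> space M \<Longrightarrow> \<xi> \<omega> \<in> S"
    and \<xi>[measurable]: "\<And>z. z \<in> S \<Longrightarrow> {\<omega> \<in> space M. \<xi> \<omega> = z} \<in> sets M"
    and \<kappa>[measurable]: "\<And>z. z \<in> S \<Longrightarrow> \<kappa> z \<in> borel_measurable (PiM {1..n} (\<lambda>_. N) \<Otimes>\<^sub>M R)"
    and \<kappa>_le: "\<And>z x. \<bar>\<kappa> z x\<bar> \<le> 1"
    and design: "\<And>z \<Phi>. z \<in> S \<Longrightarrow> \<Phi> \<in> borel_measurable (PiM {1..n} (\<lambda>_. \<mu>) \<Otimes>\<^sub>M R) \<Longrightarrow>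
      integrable M (\<lambda>\<omega>. \<Phi> (upto_n n W \<omega>, \<pi> \<omega>)) \<Longrightarrow>
      expectation (\<lambda>\<omega>. of_bool (\<xi> \<omega> = z) * \<Phi> (upto_n n W \<omega>, \<pi> \<omega>)) =
      expectation (\<lambda>\<omega>. \<kappa> z (\<lambda>i\<in>{1..n}. pr (W i \<omega>), \<pi> \<omega>) * \<Phi> (upto_n n W \<omega>, \<pi> \<omega>))"
begin

lemma upto_W[measurable]: "upto_n n W \<in> measurable M (PiM {1..n} (\<lambda>_. \<mu>))"
  unfolding upto_n_def[abs_def] by measurable

lemma integrable_W: "i \<in> {1..n} \<Longrightarrow> integrable \<mu> g \<Longrightarrow> integrable M (\<lambda>\<omega>. g (W i \<omega>) :: real)"
  using integrable_distr[OF W, of i g] law_W by simp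

lemma expectation_W:
  assumes "i \<in> {1..n}" "g \<in> borel_measurable \<mu>"
  shows "expectation (\<lambda>\<omega>. g (W i \<omega>)) = (\<integral>w. (g w :: real) \<partial>\<mu>)"
  using integral_distr[OF W assms(2), of i] law_W assms(1) by simp

lemma upto_n_apply: "i \<in> {1..n} \<Longrightarrow> upto_n n X \<omega> i = X i \<omega>"
  by (simp add: upto_n_def)

text \<open>Fubini isolates the coordinate \<open>i\<close>, where the conditional expectation replaces \<open>g\<close> by \<open>m\<close>.\<close>
lemma swap_kernel:
  assumes i: "i \<in> {1..n}" and z: "z \<in> S" and ce: "cond_exp_fn \<mu> N pr g m"
    and \<zeta>[measurable]: "\<zeta> \<in> borel_measurable (PiM {1..n} (\<lambda>_. \<mu>))" and \<zeta>_le: "\<And>w. \<bar>\<zeta> w\<bar> \<le> (1::real)"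
    and \<zeta>_pr: "\<And>w. w \<in> space (PiM ({1..n} - {i}) (\<lambda>_. \<mu>)) \<Longrightarrow>
       \<exists>H\<in>borel_measurable N. (\<forall>v. \<bar>H v\<bar> \<le> 1) \<and> (\<forall>y. \<zeta> (w(i := y)) = H (pr y))"
  shows "expectation (\<lambda>\<omega>. \<kappa> z (\<lambda>j\<in>{1..n}. pr (W j \<omega>), \<pi> \<omega>) * (g (W i \<omega>) * \<zeta> (upto_n n W \<omega>)))
       = expectation (\<lambda>\<omega>. \<kappa> z (\<lambda>j\<in>{1..n}. pr (W j \<omega>), \<pi> \<omega>) * (m (pr (W i \<omega>)) * \<zeta> (upto_n n W \<omega>)))"
proof -
  interpret \<mu>: prob_space \<mu> by (rule prob_\<mu>)
  interpret PS: product_sigma_finite "\<lambda>_::nat. \<mu>" by standard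
  interpret PP: prob_space "PiM {1..n} (\<lambda>_::nat. \<mu>)" by (intro prob_space_PiM prob_\<mu>)
  interpret Q: prob_space "distr M R \<pi>" by (rule prob_space_distr[OF \<pi>])
  interpret PQ: pair_prob_space "PiM {1..n} (\<lambda>_::nat. \<mu>)" "distr M R \<pi>" ..
  let ?P = "PiM {1..n} (\<lambda>_::nat. \<mu>)" and ?Q = "distr M R \<pi>" and ?J = "{1..n} - {i}"
  have [measurable]: "g \<in> borel_measurable \<mu>" "m \<in> borel_measurable N"
    using ce by (auto simp: cond_exp_fn_def)
  note [measurable] = \<kappa>[OF z]
  have mi[measurable]: "(\<lambda>w. w i) \<in> measurable ?P \<mu>" using i by measurable
  define K where "K w r = \<kappa> z (\<lambda>j\<in>{1..n}. pr (w j), r)" for w r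
  have [measurable]: "(\<lambda>(w, r). K w r) \<in> borel_measurable (?P \<Otimes>\<^sub>M R)"
    unfolding K_def by measurable
  \<comment> \<open>Kept general in \<phi> because it is applied both to g and to m composed with
    pr.\<close>
  have step: "expectation (\<lambda>\<omega>. K (upto_n n W \<omega>) (\<pi> \<omega>) * (\<phi> (W i \<omega>) * \<zeta> (upto_n n W \<omega>)))
      = (\<integral>r. (\<integral>x. (\<integral>y. K (x(i := y)) r * (\<phi> y * \<zeta> (x(i := y))) \<partial>\<mu>) \<partial>PiM ?J (\<lambda>_. \<mu>)) \<partial>?Q)"
    if \<phi>: "integrable \<mu> \<phi>" for \<phi> :: "'w \<Rightarrow> real"
  proof -
    note [measurable] = borel_measurable_integrable[OF \<phi>]
    have int_i: "integrable ?P (\<lambda>w. \<phi> (w i))"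
    proof -
      have "distr ?P \<mu> (\<lambda>w. w i) = \<mu>" using i by (intro distr_PiM_component prob_\<mu>) auto
      then show ?thesis using integrable_distr[OF mi, of \<phi>] \<phi> by simp
    qed
    have bound: "norm (K w r * (\<phi> (w i) * \<zeta> w)) \<le> norm (\<phi> (w i))" for w r
    proof -
      have "\<bar>K w r\<bar> * (\<bar>\<phi> (w i)\<bar> * \<bar>\<zeta> w\<bar>) \<le> 1 * (\<bar>\<phi> (w i)\<bar> * 1)"
        using \<kappa>_le \<zeta>_le unfolding K_def by (intro mult_mono) auto
      then show ?thesis by (simp add: abs_mult)
    qed
    have fst_int: "integrable (?P \<Otimes>\<^sub>M ?Q) (\<lambda>(w, r). \<phi> (w i))"
      using int_i integrable_distr[of fst "?P \<Otimes>\<^sub>M ?Q" ?P "\<lambda>w. \<phi> (w i)"] Q.distr_pair_fst[of ?P]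
      by (simp add: case_prod_unfold)
    have "(\<lambda>(w, r). K w r * (\<phi> (w i) * \<zeta> w)) \<in> borel_measurable (?P \<Otimes>\<^sub>M R)"
      unfolding K_def by measurable
    also have "borel_measurable (?P \<Otimes>\<^sub>M R) = borel_measurable (?P \<Otimes>\<^sub>M ?Q)"
      by (intro measurable_cong_sets sets_pair_measure_cong) auto
    finally have meas_Q: "(\<lambda>(w, r). K w r * (\<phi> (w i) * \<zeta> w)) \<in> borel_measurable (?P \<Otimes>\<^sub>M ?Q)" .
    have int: "integrable (?P \<Otimes>\<^sub>M ?Q) (\<lambda>(w, r). K w r * (\<phi> (w i) * \<zeta> w))"
      by (rule Bochner_Integration.integrable_bound[OF fst_int meas_Q]) (use bound in auto)
    have "expectation (\<lambda>\<omega>. K (upto_n n W \<omega>) (\<pi> \<omega>) * (\<phi> (W i \<omega>) * \<zeta> (upto_n n W \<omega>)))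
        = expectation (\<lambda>\<omega>. (\<lambda>(w, r). K w r * (\<phi> (w i) * \<zeta> w)) (upto_n n W \<omega>, \<pi> \<omega>))"
      using i by (simp add: upto_n_apply)
    also have "\<dots> = (\<integral>p. (\<lambda>(w, r). K w r * (\<phi> (w i) * \<zeta> w)) p \<partial>distr M (?P \<Otimes>\<^sub>M R) (\<lambda>\<omega>. (upto_n n W \<omega>, \<pi> \<omega>)))"
      by (rule integral_distr[symmetric]) measurable
    also have "\<dots> = (\<integral>p. (\<lambda>(w, r). K w r * (\<phi> (w i) * \<zeta> w)) p \<partial>(?P \<Otimes>\<^sub>M ?Q))"
      unfolding law ..
    also have "\<dots> = (\<integral>r. (\<integral>w. K w r * (\<phi> (w i) * \<zeta> w) \<partial>?P) \<partial>?Q)"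
      by (rule PQ.integral_snd[OF int, symmetric])
    also have "\<dots> = (\<integral>r. (\<integral>x. (\<integral>y. K (x(i := y)) r * (\<phi> y * \<zeta> (x(i := y))) \<partial>\<mu>) \<partial>PiM ?J (\<lambda>_. \<mu>)) \<partial>?Q)"
    proof (rule Bochner_Integration.integral_cong[OF refl])
      fix r assume "r \<in> space ?Q"
      then have r[measurable]: "r \<in> space R" by simp
      have ins: "insert i ?J = {1..n}" using i by auto
      have meas_r: "(\<lambda>w. K w r * (\<phi> (w i) * \<zeta> w)) \<in> borel_measurable ?P"
        unfolding K_def by measurable
      have "integrable ?P (\<lambda>w. K w r * (\<phi> (w i) * \<zeta> w))"
        by (rule Bochner_Integration.integrable_bound[OF int_i meas_r]) (use bound in auto)
      then show "(\<integral>w. K w r * (\<phi> (w i) * \<zeta> w) \<partial>?P)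
         = (\<integral>x. (\<integral>y. K (x(i := y)) r * (\<phi> y * \<zeta> (x(i := y))) \<partial>\<mu>) \<partial>PiM ?J (\<lambda>_. \<mu>))"
        using PS.product_integral_insert[of ?J i "\<lambda>w. K w r * (\<phi> (w i) * \<zeta> w)"]
        unfolding ins by simp
    qed
    finally show ?thesis .
  qed
  have inner: "(\<integral>y. K (x(i := y)) r * (g y * \<zeta> (x(i := y))) \<partial>\<mu>)
      = (\<integral>y. K (x(i := y)) r * (m (pr y) * \<zeta> (x(i := y))) \<partial>\<mu>)"
    if x: "x \<in> space (PiM ?J (\<lambda>_. \<mu>))" and r: "r \<in> space R" for x r
  proof -
    obtain H2 where H2[measurable]: "H2 \<in> borel_measurable N" and H2le: "\<And>v. \<bar>H2 v\<bar> \<le> 1"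
      and H2eq: "\<And>y. \<zeta> (x(i := y)) = H2 (pr y)"
      using \<zeta>_pr[OF x] by auto
    \<comment> \<open>With the other coordinates and the tie-breaker frozen, both the mass function
      and \<zeta> see the coordinate y only through \<open>pr y\<close>; their product
      \<open>H1 v * H2 v\<close> is a bounded test function for \<open>cond_exp_fn\<close>.\<close>
    define x' where "x' = (\<lambda>j\<in>?J. pr (x j))"
    have x': "x' \<in> space (PiM ?J (\<lambda>_. N))"
      using x measurable_space[OF pr] by (auto simp: x'_def space_PiM)
    define H1 where "H1 v = \<kappa> z (x'(i := v), r)" for v
    have Keq: "K (x(i := y)) r = H1 (pr y)" for y
      unfolding K_def H1_def x'_def
      by (rule arg_cong[where f = "\<lambda>u. \<kappa> z (u, r)"]) (use i in \<open>auto simp: fun_eq_iff\<close>)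
    have "(\<lambda>v. x'(i := v)) \<in> measurable N (PiM (insert i ?J) (\<lambda>_. N))"
      by (rule measurable_component_update[OF x']) auto
    moreover have "insert i ?J = {1..n}" using i by auto
    ultimately have [measurable]: "(\<lambda>v. x'(i := v)) \<in> measurable N (PiM {1..n} (\<lambda>_. N))" by simp
    have [measurable]: "H1 \<in> borel_measurable N" unfolding H1_def using r by measurable
    have "\<bar>H1 v * H2 v\<bar> \<le> 1" for v
      using mult_mono[OF \<kappa>_le[of z "(x'(i := v), r)"] H2le[of v]] by (simp add: H1_def abs_mult)
    then have "(\<integral>y. g y * (H1 (pr y) * H2 (pr y)) \<partial>\<mu>) = (\<integral>y. m (pr y) * (H1 (pr y) * H2 (pr y)) \<partial>\<mu>)"
      by (intro cond_exp_fnD[OF ce, of "\<lambda>v. H1 v * H2 v" 1]) measurable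
    then show ?thesis by (simp add: Keq H2eq ac_simps)
  qed
  have eq: "expectation (\<lambda>\<omega>. K (upto_n n W \<omega>) (\<pi> \<omega>) * (g (W i \<omega>) * \<zeta> (upto_n n W \<omega>)))
      = expectation (\<lambda>\<omega>. K (upto_n n W \<omega>) (\<pi> \<omega>) * (m (pr (W i \<omega>)) * \<zeta> (upto_n n W \<omega>)))"
    unfolding step[of g, OF cond_exp_fn_def[THEN iffD1, OF ce, THEN conjunct1]]
      step[of "\<lambda>w. m (pr w)", OF cond_exp_fn_def[THEN iffD1, OF ce, THEN conjunct2, THEN conjunct2, THEN conjunct1]]
    by (intro Bochner_Integration.integral_cong refl inner) auto
  have "K (upto_n n W \<omega>) (\<pi> \<omega>) = \<kappa> z (\<lambda>j\<in>{1..n}. pr (W j \<omega>), \<pi> \<omega>)" for \<omega>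
    unfolding K_def by (rule arg_cong[where f = "\<lambda>u. \<kappa> z (u, _)"]) (auto simp: upto_n_def)
  then show ?thesis using eq by simp
qed

lemma sum_of_bool_design: "\<omega> \<in> space M \<Longrightarrow> (\<Sum>z\<in>S. of_bool (\<xi> \<omega> = z) * (h z :: real)) = h (\<xi> \<omega>)"
  using \<xi>S[of \<omega>] finS by (subst sum.remove[of _ "\<xi> \<omega>"]) (auto intro!: sum.neutral)

lemma integrable_design_event:
  assumes "z \<in> S" "integrable M (h :: 'o \<Rightarrow> real)"
  shows "integrable M (\<lambda>\<omega>. of_bool (\<xi> \<omega> = z) * h \<omega>)"
proof -
  have "integrable M (\<lambda>\<omega>. indicator {\<omega> \<in> space M. \<xi> \<omega> = z} \<omega> *\<^sub>R h \<omega>)"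
    using assms by (intro integrable_mult_indicator \<xi>)
  then show ?thesis
    by (rule Bochner_Integration.integrable_cong[THEN iffD1, rotated -1]) auto
qed

lemma integrable_design_choice:
  assumes "\<And>z. z \<in> S \<Longrightarrow> integrable M (h z :: 'o \<Rightarrow> real)"
  shows "integrable M (\<lambda>\<omega>. h (\<xi> \<omega>) \<omega>)"
proof -
  have "integrable M (\<lambda>\<omega>. \<Sum>z\<in>S. of_bool (\<xi> \<omega> = z) * h z \<omega>)"
    by (intro Bochner_Integration.integrable_sum integrable_design_event assms)
  then show ?thesis
    by (rule Bochner_Integration.integrable_cong[THEN iffD1, rotated -1])
       (auto simp: sum_of_bool_design[of _ "\<lambda>z. h z _"])
qed

lemma measurable_design_choice:
  fixes h :: "'d \<Rightarrow> 'o \<Rightarrow> 'b::topological_space"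
  assumes "\<And>z. z \<in> S \<Longrightarrow> h z \<in> borel_measurable M"
  shows "(\<lambda>\<omega>. h (\<xi> \<omega>) \<omega>) \<in> borel_measurable M"
proof -
  have "\<xi> \<in> measurable M (count_space S)"
    using finS \<xi>S \<xi> by (subst measurable_count_space_eq2) (auto simp: vimage_def Int_def conj_commute)
  from measurable_compose_countable'[of S h, OF assms this countable_finite[OF finS]]
  show ?thesis .
qed

lemma expectation_design_choice:
  assumes h: "\<And>z. z \<in> S \<Longrightarrow> integrable M (h z :: 'o \<Rightarrow> real)"
  shows "expectation (\<lambda>\<omega>. h (\<xi> \<omega>) \<omega>) = (\<Sum>z\<in>S. expectation (\<lambda>\<omega>. of_bool (\<xi> \<omega> = z) * h z \<omega>))"
proof -
  have "expectation (\<lambda>\<omega>. h (\<xi> \<omega>) \<omega>) = expectation (\<lambda>\<omega>. \<Sum>z\<in>S. of_bool (\<xi> \<omega> = z) * h z \<omega>)"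
    by (intro Bochner_Integration.integral_cong refl) (simp add: sum_of_bool_design[of _ "\<lambda>z. h z _"])
  then show ?thesis using integrable_design_event[OF _ h] by (simp add: Bochner_Integration.integral_sum)
qed

text \<open>Splitting over the finitely many design values and replacing each indicator by its mass
  function reduces to \<open>swap_kernel\<close> at fixed z. Hence g, m and \<zeta> may all depend
  on the realized design.\<close>

lemma swap_real:
  assumes i: "i \<in> {1..n}" and ce: "\<And>z. z \<in> S \<Longrightarrow> cond_exp_fn \<mu> N pr (g z) (m z)"
    and \<zeta>: "\<And>z. z \<in> S \<Longrightarrow> \<zeta> z \<in> borel_measurable (PiM {1..n} (\<lambda>_. \<mu>))" and \<zeta>_le: "\<And>z w. \<bar>\<zeta> z w\<bar> \<le> (1::real)"
    and \<zeta>_pr: "\<And>z w. z \<in> S \<Longrightarrow> w \<in> space (PiM ({1..n} - {i}) (\<lambda>_. \<mu>)) \<Longrightarrow>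
       \<exists>H\<in>borel_measurable N. (\<forall>v. \<bar>H v\<bar> \<le> 1) \<and> (\<forall>y. \<zeta> z (w(i := y)) = H (pr y))"
  shows "expectation (\<lambda>\<omega>. g (\<xi> \<omega>) (W i \<omega>) * \<zeta> (\<xi> \<omega>) (upto_n n W \<omega>))
       = expectation (\<lambda>\<omega>. m (\<xi> \<omega>) (pr (W i \<omega>)) * \<zeta> (\<xi> \<omega>) (upto_n n W \<omega>))"
proof -
  have int: "integrable M (\<lambda>\<omega>. \<phi> (W i \<omega>) * \<zeta> z (upto_n n W \<omega>))"
    if "integrable \<mu> \<phi>" "z \<in> S" for \<phi> z
  proof (rule Bochner_Integration.integrable_bound[OF integrable_W[OF i that(1)]])
    note [measurable] = \<zeta>[OF that(2)] borel_measurable_integrable[OF that(1)]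
    show "(\<lambda>\<omega>. \<phi> (W i \<omega>) * \<zeta> z (upto_n n W \<omega>)) \<in> borel_measurable M" using i by measurable
    show "AE \<omega> in M. norm (\<phi> (W i \<omega>) * \<zeta> z (upto_n n W \<omega>)) \<le> norm (\<phi> (W i \<omega>))"
      using \<zeta>_le by (auto simp: abs_mult intro!: AE_I2 mult_left_le)
  qed
  have des: "expectation (\<lambda>\<omega>. of_bool (\<xi> \<omega> = z) * (\<phi> (W i \<omega>) * \<zeta> z (upto_n n W \<omega>)))
     = expectation (\<lambda>\<omega>. \<kappa> z (\<lambda>i\<in>{1..n}. pr (W i \<omega>), \<pi> \<omega>) * (\<phi> (W i \<omega>) * \<zeta> z (upto_n n W \<omega>)))"
    if "integrable \<mu> \<phi>" and z: "z \<in> S" for \<phi> z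
  proof -
    note [measurable] = \<zeta>[OF that(2)] borel_measurable_integrable[OF that(1)]
    have [measurable]: "(\<lambda>w. w i) \<in> measurable (PiM {1..n} (\<lambda>_. \<mu>)) \<mu>" using i by measurable
    have "(\<lambda>(w, r). \<phi> (w i) * \<zeta> z w) \<in> borel_measurable (PiM {1..n} (\<lambda>_. \<mu>) \<Otimes>\<^sub>M R)" by measurable
    from design[OF z this] show ?thesis using int[OF that] i by (simp add: upto_n_apply)
  qed
  have gi: "integrable \<mu> (g z)" "integrable \<mu> (\<lambda>w. m z (pr w))" if "z \<in> S" for z
    using ce[OF that] by (auto simp: cond_exp_fn_def)
  have "expectation (\<lambda>\<omega>. g (\<xi> \<omega>) (W i \<omega>) * \<zeta> (\<xi> \<omega>) (upto_n n W \<omega>))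
      = (\<Sum>z\<in>S. expectation (\<lambda>\<omega>. of_bool (\<xi> \<omega> = z) * (g z (W i \<omega>) * \<zeta> z (upto_n n W \<omega>))))"
    by (intro expectation_design_choice int gi)
  also have "\<dots> = (\<Sum>z\<in>S. expectation (\<lambda>\<omega>. of_bool (\<xi> \<omega> = z) * (m z (pr (W i \<omega>)) * \<zeta> z (upto_n n W \<omega>))))"
    using des[OF gi(1)] des[OF gi(2)] swap_kernel[OF i _ ce \<zeta> \<zeta>_le \<zeta>_pr]
    by (intro sum.cong refl) simp
  also have "\<dots> = expectation (\<lambda>\<omega>. m (\<xi> \<omega>) (pr (W i \<omega>)) * \<zeta> (\<xi> \<omega>) (upto_n n W \<omega>))"
    by (intro expectation_design_choice[symmetric] int[OF gi(2)])
  finally show ?thesis .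
qed

end

section \<open>A central limit bound by telescoping\<close>

text \<open>The second-order Taylor remainder of \<open>iexp\<close>. The quadratic bound,
  \<open>2 * x\<^sup>2 / 2!\<close>, gives an integrable majorant under two moments; the cubic one,
  with 3! = 6, gives pointwise decay.\<close>

definition rem_iexp :: "real \<Rightarrow> real" where
  "rem_iexp x = min (x\<^sup>2) (\<bar>x\<bar> ^ 3 / 6)"

text \<open>The first-order remainder of \<open>exp (- y)\<close> for nonnegative y, again with one
  bound for domination (linear) and one for decay (quadratic).\<close>

definition rem_exp :: "real \<Rightarrow> real" where
  "rem_exp y = min y (y\<^sup>2)"

lemma rem_iexp_bound: "norm (iexp x - (1 + \<i> * x - x\<^sup>2 / 2)) \<le> rem_iexp x"
proof -
  have eq: "(\<Sum>k\<le>2. (\<i> * complex_of_real x)^k / fact k) = 1 + \<i> * x - x\<^sup>2 / 2"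
    by (simp add: numeral_eq_Suc atMost_Suc power_mult_distrib algebra_simps)
  have "Suc 2 = 3" "fact 3 = (6::real)" "fact 2 = (2::real)" by (simp_all add: fact_numeral)
  then show ?thesis
    using iexp_approx1[of x 2] iexp_approx2[of x 2] unfolding eq rem_iexp_def by simp
qed

lemma rem_exp_bound:
  assumes "0 \<le> y"
  shows "\<bar>exp (- y) - (1 - y)\<bar> \<le> rem_exp y"
proof -
  have lower: "1 - y \<le> exp (- y)" using exp_ge_add_one_self[of "- y"] by simp
  have "exp (- y) \<le> 1" using assms by simp
  moreover have "exp (- y) \<le> 1 - y + y\<^sup>2"
  proof -
    \<comment> \<open>The product is \<open>1 + y^3\<close>; together with
      \<open>1 + y \<le> exp y\<close> this bounds \<open>exp (- y)\<close> by
      \<open>1 - y + y\<^sup>2\<close>.\<close>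
    have "1 \<le> (1 + y) * (1 - y + y\<^sup>2)"
      using assms by (simp add: algebra_simps power2_eq_square)
    also have "\<dots> \<le> exp y * (1 - y + y\<^sup>2)"
    proof (rule mult_right_mono)
      show "1 + y \<le> exp y" by (rule exp_ge_add_one_self)
      have "0 \<le> (1 - y / 2)\<^sup>2 + 3 / 4 * y\<^sup>2" by simp
      then show "0 \<le> 1 - y + y\<^sup>2" by (simp add: power2_eq_square algebra_simps)
    qed
    finally show ?thesis by (simp add: exp_minus field_simps)
  qed
  ultimately show ?thesis using lower by (simp add: rem_exp_def)
qed

lemma integral_norm_le:
  fixes f :: "'a \<Rightarrow> 'b::{banach, second_countable_topology}"
  assumes "integrable M f" "integrable M g" "\<And>x. x \<in> space M \<Longrightarrow> norm (f x) \<le> g x"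
  shows "norm (\<integral>x. f x \<partial>M) \<le> (\<integral>x. g x \<partial>M)"
  by (rule order_trans[OF Bochner_Integration.integral_norm_bound
      integral_mono[OF integrable_norm[OF assms(1)] assms(2,3)]])

lemma exp_neg_sum: "exp (- (a * (b + c))) = exp (- (a * b)) * exp (- (a * c))" for a b c :: real
  by (simp add: distrib_left flip: exp_add)

lemma rem_iexp_mono:
  assumes "\<bar>x\<bar> \<le> \<bar>y\<bar>"
  shows "rem_iexp x \<le> rem_iexp y"
proof -
  have "x\<^sup>2 \<le> y\<^sup>2" "\<bar>x\<bar> ^ 3 \<le> \<bar>y\<bar> ^ 3"
    using assms by (simp_all add: abs_le_square_iff[symmetric] power_mono)
  then show ?thesis unfolding rem_iexp_def by linarith
qed

lemma rem_exp_mono: "0 \<le> x \<Longrightarrow> x \<le> y \<Longrightarrow> rem_exp x \<le> rem_exp y"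
  unfolding rem_exp_def by (intro min.mono power_mono)

lemma rem_iexp_nonneg: "0 \<le> rem_iexp x" by (simp add: rem_iexp_def)
lemma rem_exp_nonneg: "0 \<le> y \<Longrightarrow> 0 \<le> rem_exp y" by (simp add: rem_exp_def)

lemma rem_measurable[measurable]:
  "rem_iexp \<in> borel_measurable borel" "rem_exp \<in> borel_measurable borel"
  unfolding rem_iexp_def[abs_def] rem_exp_def[abs_def] by measurable

lemma integrable_rem_iexp:
  assumes "f \<in> borel_measurable M" "integrable M (\<lambda>x. (f x)\<^sup>2)"
  shows "integrable M (\<lambda>x. rem_iexp (f x))"
  by (rule Bochner_Integration.integrable_bound[OF assms(2)])
     (use assms(1) in \<open>auto simp: rem_iexp_def intro!: AE_I2\<close>)

lemma integrable_rem_exp: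
  assumes "integrable M f" "\<And>x. 0 \<le> f x"
  shows "integrable M (\<lambda>x. rem_exp (f x))"
  by (rule Bochner_Integration.integrable_bound[OF assms(1)])
     (use assms in \<open>auto simp: rem_exp_def intro!: AE_I2\<close>)

text \<open>This replaces Lindeberg's condition. The quadratic bound dominates n times the remainder
  by \<open>t\<^sup>2 * (g w)\<^sup>2\<close>, the cubic bound makes it of order
  \<open>1 / sqrt n\<close> at each point, and dominated convergence concludes.\<close>

lemma rem_iexp_vanishes:
  assumes [measurable]: "g \<in> borel_measurable \<mu>" and g2: "integrable \<mu> (\<lambda>w. (g w)\<^sup>2)"
  shows "(\<lambda>n. real n * (\<integral>w. rem_iexp (t / sqrt n * g w) \<partial>\<mu>)) \<longlonglongrightarrow> 0"
proof -
  have "(\<lambda>n. \<integral>w. real n * rem_iexp (t / sqrt n * g w) \<partial>\<mu>) \<longlonglongrightarrow> (\<integral>w. 0 \<partial>\<mu>)"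
  proof (rule integral_dominated_convergence[where w = "\<lambda>w. t\<^sup>2 * (g w)\<^sup>2"])
    show "AE w in \<mu>. (\<lambda>n. real n * rem_iexp (t / sqrt n * g w)) \<longlonglongrightarrow> 0"
    proof (rule AE_I2)
      fix w
      have "(\<lambda>n. 1 / sqrt (real n)) \<longlonglongrightarrow> 0"
        by (intro tendsto_divide_0[OF tendsto_const] filterlim_at_top_imp_at_infinity
            filterlim_compose[OF sqrt_at_top filterlim_real_sequentially])
      from tendsto_mult[OF tendsto_const[of "\<bar>t * g w\<bar> ^ 3 / 6"] this]
      have lim: "(\<lambda>n. \<bar>t * g w\<bar> ^ 3 / 6 * (1 / sqrt (real n))) \<longlonglongrightarrow> 0" by simp
      show "(\<lambda>n. real n * rem_iexp (t / sqrt n * g w)) \<longlonglongrightarrow> 0"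
      proof (rule tendsto_0_le[where K = 1, OF lim always_eventually], intro allI)
        fix n :: nat
        have "real n * rem_iexp (t / sqrt n * g w) \<le> real n * (\<bar>t / sqrt n * g w\<bar> ^ 3 / 6)"
          by (intro mult_left_mono) (auto simp: rem_iexp_def)
        also have "\<dots> = \<bar>t * g w\<bar> ^ 3 / 6 * (1 / sqrt (real n))"
          by (cases "n = 0") (simp_all add: abs_mult power_mult_distrib power_divide power3_eq_cube field_simps)
        finally show "norm (real n * rem_iexp (t / sqrt n * g w)) \<le> norm (\<bar>t * g w\<bar> ^ 3 / 6 * (1 / sqrt (real n))) * 1"
          using rem_iexp_nonneg[of "t / sqrt n * g w"] by simp
      qed
    qed
    show "AE w in \<mu>. norm (real n * rem_iexp (t / sqrt n * g w)) \<le> t\<^sup>2 * (g w)\<^sup>2" for n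
    proof (rule AE_I2)
      fix w
      have "real n * rem_iexp (t / sqrt n * g w) \<le> real n * (t / sqrt n * g w)\<^sup>2"
        by (intro mult_left_mono) (auto simp: rem_iexp_def)
      also have "\<dots> \<le> t\<^sup>2 * (g w)\<^sup>2"
        by (cases "n = 0") (simp_all add: power_mult_distrib power_divide)
      finally show "norm (real n * rem_iexp (t / sqrt n * g w)) \<le> t\<^sup>2 * (g w)\<^sup>2"
        using rem_iexp_nonneg[of "t / sqrt n * g w"] by simp
    qed
  qed (use g2 in auto)
  then show ?thesis by simp
qed

lemma rem_exp_vanishes:
  assumes g: "integrable \<mu> g" and nn: "\<And>w. 0 \<le> g w"
  shows "(\<lambda>n. real n * (\<integral>w. rem_exp ((t / sqrt n)\<^sup>2 / 2 * g w) \<partial>\<mu>)) \<longlonglongrightarrow> 0"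
proof -
  note [measurable] = borel_measurable_integrable[OF g]
  have "(\<lambda>n. \<integral>w. real n * rem_exp ((t / sqrt n)\<^sup>2 / 2 * g w) \<partial>\<mu>) \<longlonglongrightarrow> (\<integral>w. 0 \<partial>\<mu>)"
  proof (rule integral_dominated_convergence[where w = "\<lambda>w. t\<^sup>2 / 2 * g w"])
    show "AE w in \<mu>. (\<lambda>n. real n * rem_exp ((t / sqrt n)\<^sup>2 / 2 * g w)) \<longlonglongrightarrow> 0"
    proof (rule AE_I2)
      fix w
      have lim: "(\<lambda>n. (t\<^sup>2 / 2 * g w)\<^sup>2 * (1 / real n)) \<longlonglongrightarrow> 0"
        using tendsto_mult[OF tendsto_const[of "(t\<^sup>2 / 2 * g w)\<^sup>2"] lim_1_over_n] by simp
      show "(\<lambda>n. real n * rem_exp ((t / sqrt n)\<^sup>2 / 2 * g w)) \<longlonglongrightarrow> 0"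
      proof (rule tendsto_0_le[where K = 1, OF lim always_eventually], intro allI)
        fix n :: nat
        have "real n * rem_exp ((t / sqrt n)\<^sup>2 / 2 * g w) \<le> real n * ((t / sqrt n)\<^sup>2 / 2 * g w)\<^sup>2"
          by (intro mult_left_mono) (auto simp: rem_exp_def)
        also have "\<dots> = (t\<^sup>2 / 2 * g w)\<^sup>2 * (1 / real n)"
          by (cases "n = 0") (simp_all add: power_mult_distrib power_divide power2_eq_square)
        finally show "norm (real n * rem_exp ((t / sqrt n)\<^sup>2 / 2 * g w)) \<le> norm ((t\<^sup>2 / 2 * g w)\<^sup>2 * (1 / real n)) * 1"
          using rem_exp_nonneg[of "(t / sqrt n)\<^sup>2 / 2 * g w"] nn by simp
      qed
    qed
    show "AE w in \<mu>. norm (real n * rem_exp ((t / sqrt n)\<^sup>2 / 2 * g w)) \<le> t\<^sup>2 / 2 * g w" for n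
    proof (rule AE_I2)
      fix w
      have "real n * rem_exp ((t / sqrt n)\<^sup>2 / 2 * g w) \<le> real n * ((t / sqrt n)\<^sup>2 / 2 * g w)"
        by (intro mult_left_mono) (auto simp: rem_exp_def)
      also have "\<dots> \<le> t\<^sup>2 / 2 * g w"
        using nn by (cases "n = 0") (simp_all add: power_divide)
      finally show "norm (real n * rem_exp ((t / sqrt n)\<^sup>2 / 2 * g w)) \<le> t\<^sup>2 / 2 * g w"
        using rem_exp_nonneg[of "(t / sqrt n)\<^sup>2 / 2 * g w"] nn by simp
    qed
  qed (use g in auto)
  then show ?thesis by simp
qed

section \<open>Replacing the summands of a characteristic function one at a time\<close>

context finite_design
begin

text \<open>The other coordinates are frozen at arbitrary full data, so only coordinate i has to
  enter through pr. This leaves room for the factors of the telescoping product that have not been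
  replaced and depend on all data of the other units.\<close>

definition adapted :: "nat \<Rightarrow> ('d \<Rightarrow> (nat \<Rightarrow> 'w) \<Rightarrow> complex) \<Rightarrow> bool" where
  "adapted i \<zeta> \<longleftrightarrow> (\<forall>z\<in>S. \<zeta> z \<in> borel_measurable (PiM {1..n} (\<lambda>_. \<mu>))) \<and> (\<forall>z w. norm (\<zeta> z w) \<le> 1) \<and>
     (\<forall>z\<in>S. \<forall>w\<in>space (PiM ({1..n} - {i}) (\<lambda>_. \<mu>)).
       \<exists>H\<in>borel_measurable N. (\<forall>v. norm (H v) \<le> 1) \<and> (\<forall>y. \<zeta> z (w(i := y)) = H (pr y)))"

lemma adapted_measurable:
  assumes "adapted i \<zeta>"
  shows "(\<lambda>\<omega>. \<zeta> (\<xi> \<omega>) (upto_n n W \<omega>)) \<in> borel_measurable M"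
proof (rule measurable_design_choice)
  fix z assume "z \<in> S"
  then have [measurable]: "\<zeta> z \<in> borel_measurable (PiM {1..n} (\<lambda>_. \<mu>))"
    using assms by (auto simp: adapted_def)
  show "(\<lambda>\<omega>. \<zeta> z (upto_n n W \<omega>)) \<in> borel_measurable M" by measurable
qed

lemma integrable_choice_W:
  assumes "i \<in> {1..n}" "\<And>z. z \<in> S \<Longrightarrow> integrable \<mu> (g z)"
  shows "integrable M (\<lambda>\<omega>. g (\<xi> \<omega>) (W i \<omega>) :: real)"
  by (rule integrable_design_choice[where h = "\<lambda>z \<omega>. g z (W i \<omega>)"]) (intro integrable_W assms)

lemma integrable_times_adapted:
  assumes "integrable M f" "adapted i \<zeta>"
  shows "integrable M (\<lambda>\<omega>. complex_of_real (f \<omega>) * \<zeta> (\<xi> \<omega>) (upto_n n W \<omega>))"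
proof (rule Bochner_Integration.integrable_bound[OF assms(1)])
  show "(\<lambda>\<omega>. complex_of_real (f \<omega>) * \<zeta> (\<xi> \<omega>) (upto_n n W \<omega>)) \<in> borel_measurable M"
    using adapted_measurable[OF assms(2)] borel_measurable_integrable[OF assms(1)] by measurable
  show "AE \<omega> in M. norm (complex_of_real (f \<omega>) * \<zeta> (\<xi> \<omega>) (upto_n n W \<omega>)) \<le> norm (f \<omega>)"
    using assms(2) by (auto simp: norm_mult adapted_def intro!: AE_I2 mult_left_le)
qed

lemma swap_complex:
  assumes i: "i \<in> {1..n}" and ce: "\<And>z. z \<in> S \<Longrightarrow> cond_exp_fn \<mu> N pr (g z) (m z)" and \<zeta>: "adapted i \<zeta>"
  shows "expectation (\<lambda>\<omega>. complex_of_real (g (\<xi> \<omega>) (W i \<omega>)) * \<zeta> (\<xi> \<omega>) (upto_n n W \<omega>))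
       = expectation (\<lambda>\<omega>. complex_of_real (m (\<xi> \<omega>) (pr (W i \<omega>))) * \<zeta> (\<xi> \<omega>) (upto_n n W \<omega>))"
proof -
  have gi: "integrable M (\<lambda>\<omega>. g (\<xi> \<omega>) (W i \<omega>))" "integrable M (\<lambda>\<omega>. m (\<xi> \<omega>) (pr (W i \<omega>)))"
    using ce integrable_choice_W[OF i, of g] integrable_choice_W[OF i, of "\<lambda>z w. m z (pr w)"]
    by (auto simp: cond_exp_fn_def)
  have part: "expectation (\<lambda>\<omega>. g (\<xi> \<omega>) (W i \<omega>) * \<phi> (\<zeta> (\<xi> \<omega>) (upto_n n W \<omega>)))
       = expectation (\<lambda>\<omega>. m (\<xi> \<omega>) (pr (W i \<omega>)) * \<phi> (\<zeta> (\<xi> \<omega>) (upto_n n W \<omega>)))"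
    if [measurable]: "\<phi> \<in> borel_measurable borel" and le: "\<And>c. \<bar>\<phi> c\<bar> \<le> norm c" for \<phi> :: "complex \<Rightarrow> real"
  proof (rule swap_real[OF i ce, where \<zeta> = "\<lambda>z w. \<phi> (\<zeta> z w)"])
    show "(\<lambda>w. \<phi> (\<zeta> z w)) \<in> borel_measurable (PiM {1..n} (\<lambda>_. \<mu>))" if "z \<in> S" for z
      using \<zeta> that by (intro measurable_compose[OF _ \<open>\<phi> \<in> _\<close>]) (auto simp: adapted_def)
    show "\<bar>\<phi> (\<zeta> z w)\<bar> \<le> 1" for z w
      using \<zeta> le[of "\<zeta> z w"] by (auto simp: adapted_def intro: order_trans)
    fix z w assume "z \<in> S" "w \<in> space (PiM ({1..n} - {i}) (\<lambda>_. \<mu>))"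
    then obtain H where [measurable]: "H \<in> borel_measurable N" and H: "\<And>v. norm (H v) \<le> 1"
      "\<And>y. \<zeta> z (w(i := y)) = H (pr y)" using \<zeta> unfolding adapted_def by meson
    have "(\<lambda>v. \<phi> (H v)) \<in> borel_measurable N" by measurable
    moreover have "\<bar>\<phi> (H v)\<bar> \<le> 1" for v using le[of "H v"] H(1)[of v] by simp
    ultimately show "\<exists>H\<in>borel_measurable N. (\<forall>v. \<bar>H v\<bar> \<le> 1) \<and> (\<forall>y. \<phi> (\<zeta> z (w(i := y))) = H (pr y))"
      using H(2) by (intro bexI[of _ "\<lambda>v. \<phi> (H v)"]) auto
  qed
  show ?thesis
  proof (rule complex_eqI)
    show "Re (expectation (\<lambda>\<omega>. complex_of_real (g (\<xi> \<omega>) (W i \<omega>)) * \<zeta> (\<xi> \<omega>) (upto_n n W \<omega>)))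
       = Re (expectation (\<lambda>\<omega>. complex_of_real (m (\<xi> \<omega>) (pr (W i \<omega>))) * \<zeta> (\<xi> \<omega>) (upto_n n W \<omega>)))"
      using part[of Re] integrable_times_adapted[OF gi(1) \<zeta>] integrable_times_adapted[OF gi(2) \<zeta>]
      by (simp add: abs_Re_le_cmod flip: integral_Re)
    show "Im (expectation (\<lambda>\<omega>. complex_of_real (g (\<xi> \<omega>) (W i \<omega>)) * \<zeta> (\<xi> \<omega>) (upto_n n W \<omega>)))
       = Im (expectation (\<lambda>\<omega>. complex_of_real (m (\<xi> \<omega>) (pr (W i \<omega>))) * \<zeta> (\<xi> \<omega>) (upto_n n W \<omega>)))"
      using part[of Im] integrable_times_adapted[OF gi(1) \<zeta>] integrable_times_adapted[OF gi(2) \<zeta>]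
      by (simp add: abs_Im_le_cmod flip: integral_Im)
  qed
qed

text \<open>To second order, \<open>iexp (u * x)\<close> and the variance factor have the same
  conditional mean: the linear term is centred given pr and the quadratic term averages to s. Only
  the two Taylor remainders are left, because \<zeta> is bounded by 1.\<close>

lemma replace_one:
  assumes i: "i \<in> {1..n}" and ce1: "\<And>z. z \<in> S \<Longrightarrow> cond_exp_fn \<mu> N pr (x z) (\<lambda>_. 0)"
    and ce2: "\<And>z. z \<in> S \<Longrightarrow> cond_exp_fn \<mu> N pr (\<lambda>w. (x z w)\<^sup>2) (s z)"
    and s_nonneg: "\<And>z v. 0 \<le> s z v" and \<zeta>: "adapted i \<zeta>"
  shows "norm (expectation (\<lambda>\<omega>. \<zeta> (\<xi> \<omega>) (upto_n n W \<omega>) * iexp (u * x (\<xi> \<omega>) (W i \<omega>)))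
      - expectation (\<lambda>\<omega>. \<zeta> (\<xi> \<omega>) (upto_n n W \<omega>) * exp (- (u\<^sup>2 / 2 * s (\<xi> \<omega>) (pr (W i \<omega>))))))
    \<le> expectation (\<lambda>\<omega>. rem_iexp (u * x (\<xi> \<omega>) (W i \<omega>)))
      + expectation (\<lambda>\<omega>. rem_exp (u\<^sup>2 / 2 * s (\<xi> \<omega>) (pr (W i \<omega>))))"
proof -
  define X where "X \<omega> = x (\<xi> \<omega>) (W i \<omega>)" for \<omega>
  define \<sigma> where "\<sigma> \<omega> = s (\<xi> \<omega>) (pr (W i \<omega>))" for \<omega>
  define Z where "Z \<omega> = \<zeta> (\<xi> \<omega>) (upto_n n W \<omega>)" for \<omega>
  have X1: "integrable M X" and X2: "integrable M (\<lambda>\<omega>. (X \<omega>)\<^sup>2)" and s1: "integrable M \<sigma>"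
    using ce1 ce2 integrable_choice_W[OF i, of x] integrable_choice_W[OF i, of "\<lambda>z w. (x z w)\<^sup>2"]
      integrable_choice_W[OF i, of "\<lambda>z w. s z (pr w)"]
    by (auto simp: cond_exp_fn_def X_def[abs_def] \<sigma>_def[abs_def])
  note [measurable] = borel_measurable_integrable[OF X1] borel_measurable_integrable[OF s1]
  have Zm[measurable]: "Z \<in> borel_measurable M"
    unfolding Z_def[abs_def] by (rule adapted_measurable[OF \<zeta>])
  have Zle: "norm (Z \<omega>) \<le> 1" for \<omega> using \<zeta> by (auto simp: adapted_def Z_def)
  have \<sigma>nn: "0 \<le> \<sigma> \<omega>" for \<omega> by (simp add: \<sigma>_def s_nonneg)
  have iz: "integrable M (\<lambda>\<omega>. complex_of_real (f \<omega>) * Z \<omega>)" if "integrable M f" for f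
    unfolding Z_def by (rule integrable_times_adapted[OF that \<zeta>])
  have E1: "expectation (\<lambda>\<omega>. complex_of_real (X \<omega>) * Z \<omega>) = 0"
    using swap_complex[OF i ce1 \<zeta>] by (simp add: X_def Z_def)
  have E2: "expectation (\<lambda>\<omega>. complex_of_real ((X \<omega>)\<^sup>2) * Z \<omega>) = expectation (\<lambda>\<omega>. complex_of_real (\<sigma> \<omega>) * Z \<omega>)"
    using swap_complex[OF i ce2 \<zeta>] by (simp add: X_def Z_def \<sigma>_def)
  have bd: "integrable M (\<lambda>\<omega>. Z \<omega> * h \<omega>)" if [measurable]: "h \<in> borel_measurable M" and "\<And>\<omega>. norm (h \<omega>) \<le> 1" for h
    by (rule integrable_const_bound[where B = 1]) (use that Zle in \<open>auto simp: norm_mult intro!: AE_I2 mult_le_one\<close>)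
  have ia: "integrable M (\<lambda>\<omega>. Z \<omega> * iexp (u * X \<omega>))" by (rule bd) auto
  have ib: "integrable M (\<lambda>\<omega>. Z \<omega> * complex_of_real (exp (- (u\<^sup>2 / 2 * \<sigma> \<omega>))))"
    by (rule bd) (auto simp: \<sigma>nn simp del: of_real_exp)
  \<comment> \<open>The difference of the two Taylor polynomials, weighted by Z. Its expectation is
    0 by \<open>swap_complex\<close>, so it can be subtracted before taking norms.\<close>
  define D where "D \<omega> = \<i> * u * (complex_of_real (X \<omega>) * Z \<omega>)
      - u\<^sup>2 / 2 * (complex_of_real ((X \<omega>)\<^sup>2) * Z \<omega>) + u\<^sup>2 / 2 * (complex_of_real (\<sigma> \<omega>) * Z \<omega>)" for \<omega>
  have iD: "integrable M D" unfolding D_def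
    by (intro Bochner_Integration.integrable_add Bochner_Integration.integrable_diff integrable_mult_right iz X1 X2 s1)
  have ED: "expectation D = 0"
    unfolding D_def using iz[OF X1] iz[OF X2] iz[OF s1] E1 E2
    by (simp del: of_real_power of_real_mult)
  have "expectation (\<lambda>\<omega>. Z \<omega> * iexp (u * X \<omega>)) - expectation (\<lambda>\<omega>. Z \<omega> * complex_of_real (exp (- (u\<^sup>2 / 2 * \<sigma> \<omega>))))
      = expectation (\<lambda>\<omega>. Z \<omega> * iexp (u * X \<omega>) - Z \<omega> * complex_of_real (exp (- (u\<^sup>2 / 2 * \<sigma> \<omega>))) - D \<omega>)"
    using ia ib iD ED by simp
  also have "norm \<dots> \<le> expectation (\<lambda>\<omega>. rem_iexp (u * X \<omega>) + rem_exp (u\<^sup>2 / 2 * \<sigma> \<omega>))"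
  proof (rule integral_norm_le)
    show "integrable M (\<lambda>\<omega>. Z \<omega> * iexp (u * X \<omega>) - Z \<omega> * complex_of_real (exp (- (u\<^sup>2 / 2 * \<sigma> \<omega>))) - D \<omega>)"
      using ia ib iD by simp
    show "integrable M (\<lambda>\<omega>. rem_iexp (u * X \<omega>) + rem_exp (u\<^sup>2 / 2 * \<sigma> \<omega>))"
      using X2 s1 \<sigma>nn
      by (intro Bochner_Integration.integrable_add integrable_rem_iexp integrable_rem_exp integrable_power2_cmult) auto
    fix \<omega>
    define A where "A = iexp (u * X \<omega>) - (1 + \<i> * (u * X \<omega>) - (u * X \<omega>)\<^sup>2 / 2)"
    define B where "B = exp (- (u\<^sup>2 / 2 * \<sigma> \<omega>)) - (1 - u\<^sup>2 / 2 * \<sigma> \<omega>)"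
    have "Z \<omega> * iexp (u * X \<omega>) - Z \<omega> * complex_of_real (exp (- (u\<^sup>2 / 2 * \<sigma> \<omega>))) - D \<omega> = Z \<omega> * (A - complex_of_real B)"
      by (simp add: A_def B_def D_def algebra_simps power2_eq_square)
    then have "norm (Z \<omega> * iexp (u * X \<omega>) - Z \<omega> * complex_of_real (exp (- (u\<^sup>2 / 2 * \<sigma> \<omega>))) - D \<omega>)
        = norm (Z \<omega>) * norm (A - complex_of_real B)" by (simp add: norm_mult)
    also have "\<dots> \<le> 1 * (norm A + \<bar>B\<bar>)"
      using norm_triangle_ineq4[of A "complex_of_real B"] Zle by (intro mult_mono) auto
    also have "\<dots> \<le> rem_iexp (u * X \<omega>) + rem_exp (u\<^sup>2 / 2 * \<sigma> \<omega>)"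
      using rem_iexp_bound[of "u * X \<omega>"] rem_exp_bound[of "u\<^sup>2 / 2 * \<sigma> \<omega>"] \<sigma>nn
      by (simp add: A_def B_def)
    finally show "norm (Z \<omega> * iexp (u * X \<omega>) - Z \<omega> * complex_of_real (exp (- (u\<^sup>2 / 2 * \<sigma> \<omega>))) - D \<omega>)
      \<le> rem_iexp (u * X \<omega>) + rem_exp (u\<^sup>2 / 2 * \<sigma> \<omega>)" .
  qed
  also have "\<dots> = expectation (\<lambda>\<omega>. rem_iexp (u * X \<omega>)) + expectation (\<lambda>\<omega>. rem_exp (u\<^sup>2 / 2 * \<sigma> \<omega>))"
    using X2 s1 \<sigma>nn
    by (intro Bochner_Integration.integral_add integrable_rem_iexp integrable_rem_exp integrable_power2_cmult) auto
  finally show ?thesis by (simp add: X_def \<sigma>_def Z_def)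
qed

text \<open>The hybrid \<open>T m\<close> carries the first m original factors and variance factors
  for the rest; neighbouring hybrids differ in one factor, which \<open>replace_one\<close> handles.
  Domination by g and h makes all n steps cost the same integral over \<mu>.\<close>

lemma clt_bound:
  assumes ce1: "\<And>z i. z \<in> S \<Longrightarrow> i \<in> {1..n} \<Longrightarrow> cond_exp_fn \<mu> N pr (x z i) (\<lambda>_. 0)"
    and ce2: "\<And>z i. z \<in> S \<Longrightarrow> i \<in> {1..n} \<Longrightarrow> cond_exp_fn \<mu> N pr (\<lambda>w. (x z i w)\<^sup>2) (s z i)"
    and s_nonneg: "\<And>z i v. 0 \<le> s z i v"
    and xG: "\<And>z i w. \<bar>x z i w\<bar> \<le> \<bar>g w\<bar>" and sG: "\<And>z i w. s z i (pr w) \<le> h w"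
    and g: "g \<in> borel_measurable \<mu>" "integrable \<mu> (\<lambda>w. (g w)\<^sup>2)" and h: "integrable \<mu> h"
    and \<zeta>: "\<And>i. i \<in> {1..n} \<Longrightarrow> adapted i \<zeta>"
  shows "norm (expectation (\<lambda>\<omega>. \<zeta> (\<xi> \<omega>) (upto_n n W \<omega>) * iexp (u * (\<Sum>i=1..n. x (\<xi> \<omega>) i (W i \<omega>))))
      - expectation (\<lambda>\<omega>. \<zeta> (\<xi> \<omega>) (upto_n n W \<omega>) * exp (- (u\<^sup>2 / 2 * (\<Sum>i=1..n. s (\<xi> \<omega>) i (pr (W i \<omega>)))))))
    \<le> real n * ((\<integral>w. rem_iexp (u * g w) \<partial>\<mu>) + (\<integral>w. rem_exp (u\<^sup>2 / 2 * h w) \<partial>\<mu>))" (is "_ \<le> real n * ?b")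
proof -
  \<comment> \<open>The hybrid with index m left out of both sums, which is what makes it adapted at
    m. Its product with the original factor of m is \<open>T m\<close>, with the variance factor
    \<open>T (m - 1)\<close>.\<close>
  define Zm where "Zm m z w = \<zeta> z w * iexp (u * (\<Sum>j\<in>{1..<m}. x z j (w j))) *
      complex_of_real (exp (- (u\<^sup>2 / 2 * (\<Sum>j\<in>{m<..n}. s z j (pr (w j))))))" for m z w
  define T where "T m \<omega> = \<zeta> (\<xi> \<omega>) (upto_n n W \<omega>) * iexp (u * (\<Sum>j\<in>{1..m}. x (\<xi> \<omega>) j (W j \<omega>))) *
      complex_of_real (exp (- (u\<^sup>2 / 2 * (\<Sum>j\<in>{m<..n}. s (\<xi> \<omega>) j (pr (W j \<omega>))))))" for m \<omega>
  have h_nonneg: "0 \<le> h w" for w using s_nonneg sG[of undefined undefined w] order_trans by blast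
  have ad: "adapted m (Zm m)" if m: "m \<in> {1..n}" for m
    unfolding adapted_def
  proof (intro conjI ballI allI)
    fix z assume z: "z \<in> S"
    have "x z j \<in> borel_measurable \<mu>" "s z j \<in> borel_measurable N" if "j \<in> {1..n}" for j
      using ce1[OF z that] ce2[OF z that] by (auto simp: cond_exp_fn_def)
    then have cm: "(\<lambda>w. x z j (w j)) \<in> borel_measurable (PiM {1..n} (\<lambda>_. \<mu>))"
      "(\<lambda>w. s z j (pr (w j))) \<in> borel_measurable (PiM {1..n} (\<lambda>_. \<mu>))" if "j \<in> {1..n}" for j
      using that by (auto intro!: measurable_compose[OF measurable_component_singleton[OF that]]
          measurable_compose[OF pr])
    have [measurable]: "(\<lambda>w. \<Sum>j\<in>{1..<m}. x z j (w j)) \<in> borel_measurable (PiM {1..n} (\<lambda>_. \<mu>))"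
      "(\<lambda>w. \<Sum>j\<in>{m<..n}. s z j (pr (w j))) \<in> borel_measurable (PiM {1..n} (\<lambda>_. \<mu>))"
      by (rule borel_measurable_sum, rule cm, use m in simp)+
    have [measurable]: "\<zeta> z \<in> borel_measurable (PiM {1..n} (\<lambda>_. \<mu>))"
      using \<zeta>[OF m] z by (auto simp: adapted_def)
    show "Zm m z \<in> borel_measurable (PiM {1..n} (\<lambda>_. \<mu>))"
      unfolding Zm_def[abs_def] by measurable
    fix w assume "w \<in> space (PiM ({1..n} - {m}) (\<lambda>_. \<mu>))"
    then obtain H where H[measurable]: "H \<in> borel_measurable N" and H1: "\<And>v. norm (H v) \<le> 1"
      and H2: "\<And>y. \<zeta> z (w(m := y)) = H (pr y)"
      using \<zeta>[OF m] z unfolding adapted_def by meson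
    define c where "c = iexp (u * (\<Sum>j\<in>{1..<m}. x z j (w j))) *
      complex_of_real (exp (- (u\<^sup>2 / 2 * (\<Sum>j\<in>{m<..n}. s z j (pr (w j))))))"
    have "norm c \<le> 1"
      unfolding c_def norm_mult using s_nonneg by (simp add: sum_nonneg del: of_real_exp)
    then have "norm (H v * c) \<le> 1" for v
      using H1[of v] by (simp add: norm_mult mult_le_one)
    moreover have "Zm m z (w(m := y)) = H (pr y) * c" for y
      by (simp add: Zm_def c_def H2 mult.assoc)
    ultimately show "\<exists>H\<in>borel_measurable N. (\<forall>v. norm (H v) \<le> 1) \<and> (\<forall>y. Zm m z (w(m := y)) = H (pr y))"
      by (intro bexI[of _ "\<lambda>v. H v * c"]) auto
  next
    fix z w
    have "norm (\<zeta> z w) \<le> 1" using \<zeta>[OF m] by (auto simp: adapted_def)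
    moreover have "norm (complex_of_real (exp (- (u\<^sup>2 / 2 * (\<Sum>j\<in>{m<..n}. s z j (pr (w j))))))) \<le> 1"
      using s_nonneg by (simp add: sum_nonneg del: of_real_exp)
    ultimately show "norm (Zm m z w) \<le> 1"
      unfolding Zm_def norm_mult by (simp add: mult_le_one del: of_real_exp)
  qed
  have step: "norm (expectation (T m) - expectation (T (m - 1))) \<le> ?b" if m: "m \<in> {1..n}" for m
  proof -
    have sets: "{1..m} = insert m {1..<m}" "{1..m - 1} = {1..<m}" "{m - 1<..n} = insert m {m<..n}"
      using m by auto
    have apply_W: "Zm m (\<xi> \<omega>) (upto_n n W \<omega>) = \<zeta> (\<xi> \<omega>) (upto_n n W \<omega>)
        * iexp (u * (\<Sum>j\<in>{1..<m}. x (\<xi> \<omega>) j (W j \<omega>))) *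
      complex_of_real (exp (- (u\<^sup>2 / 2 * (\<Sum>j\<in>{m<..n}. s (\<xi> \<omega>) j (pr (W j \<omega>))))))" for \<omega>
    proof -
      have "(\<Sum>j\<in>{1..<m}. x (\<xi> \<omega>) j (upto_n n W \<omega> j)) = (\<Sum>j\<in>{1..<m}. x (\<xi> \<omega>) j (W j \<omega>))"
        "(\<Sum>j\<in>{m<..n}. s (\<xi> \<omega>) j (pr (upto_n n W \<omega> j))) = (\<Sum>j\<in>{m<..n}. s (\<xi> \<omega>) j (pr (W j \<omega>)))"
        using m by (auto intro!: sum.cong simp: upto_n_apply)
      then show ?thesis by (simp only: Zm_def)
    qed
    have T_m: "T m = (\<lambda>\<omega>. Zm m (\<xi> \<omega>) (upto_n n W \<omega>) * iexp (u * x (\<xi> \<omega>) m (W m \<omega>)))"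
      unfolding T_def[abs_def] apply_W sets
      by (rule ext) (simp add: distrib_left exp_add ac_simps)
    have T_m1: "T (m - 1) = (\<lambda>\<omega>. Zm m (\<xi> \<omega>) (upto_n n W \<omega>) * complex_of_real (exp (- (u\<^sup>2 / 2 * s (\<xi> \<omega>) m (pr (W m \<omega>))))))"
    proof
      fix \<omega>
      have "(\<Sum>j\<in>insert m {m<..n}. s (\<xi> \<omega>) j (pr (W j \<omega>)))
          = s (\<xi> \<omega>) m (pr (W m \<omega>)) + (\<Sum>j\<in>{m<..n}. s (\<xi> \<omega>) j (pr (W j \<omega>)))" by simp
      then show "T (m - 1) \<omega> = Zm m (\<xi> \<omega>) (upto_n n W \<omega>) * complex_of_real (exp (- (u\<^sup>2 / 2 * s (\<xi> \<omega>) m (pr (W m \<omega>)))))"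
        unfolding T_def apply_W sets by (simp only: exp_neg_sum of_real_mult ac_simps)
    qed
    have "norm (expectation (T m) - expectation (T (m - 1)))
      \<le> expectation (\<lambda>\<omega>. rem_iexp (u * x (\<xi> \<omega>) m (W m \<omega>)))
        + expectation (\<lambda>\<omega>. rem_exp (u\<^sup>2 / 2 * s (\<xi> \<omega>) m (pr (W m \<omega>))))"
      unfolding T_m T_m1
      by (rule replace_one[OF m, of "\<lambda>z. x z m" "\<lambda>z. s z m" "Zm m" u]) (use ce1 ce2 m s_nonneg ad[OF m] in auto)
    also have "expectation (\<lambda>\<omega>. rem_iexp (u * x (\<xi> \<omega>) m (W m \<omega>))) \<le> expectation (\<lambda>\<omega>. rem_iexp (u * g (W m \<omega>)))"
    proof (rule integral_mono)
      show "integrable M (\<lambda>\<omega>. rem_iexp (u * x (\<xi> \<omega>) m (W m \<omega>)))"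
        using ce1[OF _ m] ce2[OF _ m] integrable_choice_W[OF m, of "\<lambda>z. x z m"]
          integrable_choice_W[OF m, of "\<lambda>z w. (x z m w)\<^sup>2"]
        by (intro integrable_rem_iexp integrable_power2_cmult borel_measurable_times)
           (auto simp: cond_exp_fn_def)
      show "integrable M (\<lambda>\<omega>. rem_iexp (u * g (W m \<omega>)))"
        using g by (intro integrable_W[OF m] integrable_rem_iexp integrable_power2_cmult) auto
      show "rem_iexp (u * x (\<xi> \<omega>) m (W m \<omega>)) \<le> rem_iexp (u * g (W m \<omega>))" for \<omega>
        using xG by (intro rem_iexp_mono) (simp add: abs_mult mult_left_mono)
    qed
    also have "expectation (\<lambda>\<omega>. rem_exp (u\<^sup>2 / 2 * s (\<xi> \<omega>) m (pr (W m \<omega>)))) \<le> expectation (\<lambda>\<omega>. rem_exp (u\<^sup>2 / 2 * h (W m \<omega>)))"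
    proof (rule integral_mono)
      show "integrable M (\<lambda>\<omega>. rem_exp (u\<^sup>2 / 2 * s (\<xi> \<omega>) m (pr (W m \<omega>))))"
        using ce2[OF _ m] integrable_choice_W[OF m, of "\<lambda>z w. s z m (pr w)"] s_nonneg
        by (intro integrable_rem_exp integrable_mult_right) (auto simp: cond_exp_fn_def)
      show "integrable M (\<lambda>\<omega>. rem_exp (u\<^sup>2 / 2 * h (W m \<omega>)))"
        using h h_nonneg by (intro integrable_W[OF m] integrable_rem_exp) auto
      show "rem_exp (u\<^sup>2 / 2 * s (\<xi> \<omega>) m (pr (W m \<omega>))) \<le> rem_exp (u\<^sup>2 / 2 * h (W m \<omega>))" for \<omega>
        using sG s_nonneg by (intro rem_exp_mono mult_left_mono) auto
    qed
    also have "expectation (\<lambda>\<omega>. rem_iexp (u * g (W m \<omega>))) = (\<integral>w. rem_iexp (u * g w) \<partial>\<mu>)"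
      using g by (intro expectation_W[OF m]) auto
    also have "expectation (\<lambda>\<omega>. rem_exp (u\<^sup>2 / 2 * h (W m \<omega>))) = (\<integral>w. rem_exp (u\<^sup>2 / 2 * h w) \<partial>\<mu>)"
      using h by (intro expectation_W[OF m]) auto
    finally show ?thesis by simp
  qed
  have "norm (expectation (T m) - expectation (T 0)) \<le> real m * ?b" if "m \<le> n" for m
    using that
  proof (induction m)
    case (Suc m)
    have "norm (expectation (T (Suc m)) - expectation (T m)) \<le> ?b" using step[of "Suc m"] Suc.prems by simp
    moreover have "norm (expectation (T m) - expectation (T 0)) \<le> real m * ?b" using Suc by simp
    moreover have "norm (expectation (T (Suc m)) - expectation (T 0))
        \<le> norm (expectation (T (Suc m)) - expectation (T m)) + norm (expectation (T m) - expectation (T 0))"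
      using norm_triangle_ineq[of "expectation (T (Suc m)) - expectation (T m)" "expectation (T m) - expectation (T 0)"]
      by simp
    ultimately show ?case by (simp add: distrib_right)
  qed simp
  from this[OF order_refl] show ?thesis by (simp add: T_def[abs_def] atLeastSucAtMost_greaterThanAtMost)
qed

end

section \<open>Limits\<close>

lemma (in prob_space) iid_second_moment:
  fixes f :: "'w \<Rightarrow> real" and W :: "nat \<Rightarrow> 'a \<Rightarrow> 'w"
  assumes ind: "indep_vars (\<lambda>_. \<mu>) W {1..}" and law: "\<And>i. i \<ge> 1 \<Longrightarrow> distr M \<mu> (W i) = \<mu>"
    and f[measurable]: "f \<in> borel_measurable \<mu>" and f2: "integrable \<mu> (\<lambda>w. (f w)\<^sup>2)"
    and mean: "(\<integral>w. f w \<partial>\<mu>) = 0"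
  shows "integrable M (\<lambda>\<omega>. (\<Sum>i=1..n. f (W i \<omega>))\<^sup>2)"
    and "expectation (\<lambda>\<omega>. (\<Sum>i=1..n. f (W i \<omega>))\<^sup>2) = n * (\<integral>w. (f w)\<^sup>2 \<partial>\<mu>)"
proof -
  have W: "W i \<in> measurable M \<mu>" if "i \<ge> 1" for i
    using ind that by (auto simp: indep_vars_def)
  have trans: "integrable M (\<lambda>\<omega>. g (W i \<omega>)) = integrable \<mu> g"
    "expectation (\<lambda>\<omega>. g (W i \<omega>)) = (\<integral>w. g w \<partial>\<mu>)"
    if "i \<ge> 1" "g \<in> borel_measurable \<mu>" for g :: "'w \<Rightarrow> real" and i
    using integrable_distr_eq[OF W[OF that(1)] that(2)] integral_distr[OF W[OF that(1)] that(2)] law[OF that(1)]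
    by simp_all
  have i2: "integrable M (\<lambda>\<omega>. (f (W i \<omega>))\<^sup>2)" if "i \<ge> 1" for i
    using trans(1)[OF that, of "\<lambda>w. (f w)\<^sup>2"] f2 by simp
  have mW: "(\<lambda>\<omega>. f (W i \<omega>)) \<in> borel_measurable M" if "i \<ge> 1" for i
    using measurable_compose[OF W[OF that] f] .
  have ij: "integrable M (\<lambda>\<omega>. f (W i \<omega>) * f (W j \<omega>))" if "i \<ge> 1" "j \<ge> 1" for i j
    using i2 mW that by (intro integrable_mult_of_squares) auto
  have zero: "expectation (\<lambda>\<omega>. f (W i \<omega>) * f (W j \<omega>)) = 0" if "i \<ge> 1" "j \<ge> 1" "i \<noteq> j" for i j
  proof -
    have "indep_vars (\<lambda>_. borel) (\<lambda>i \<omega>. f (W i \<omega>)) {i, j}"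
      using that by (intro indep_vars_compose2[OF indep_vars_subset[OF ind]]) auto
    moreover have "integrable M (\<lambda>\<omega>. f (W i \<omega>))" if "i \<ge> 1" for i
      using expectation_abs_le_sqrt(1)[OF mW i2] that by auto
    ultimately have "expectation (\<lambda>\<omega>. \<Prod>i\<in>{i, j}. f (W i \<omega>)) = (\<Prod>i\<in>{i, j}. expectation (\<lambda>\<omega>. f (W i \<omega>)))"
      using that by (intro indep_vars_lebesgue_integral) auto
    then show ?thesis using that mean trans(2)[OF that(1) f] by simp
  qed
  have eq: "(\<Sum>i=1..n. f (W i \<omega>))\<^sup>2 = (\<Sum>i=1..n. \<Sum>j=1..n. f (W i \<omega>) * f (W j \<omega>))" for \<omega>
    by (simp add: power2_eq_square sum_product)
  show "integrable M (\<lambda>\<omega>. (\<Sum>i=1..n. f (W i \<omega>))\<^sup>2)"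
    unfolding eq using ij by (intro Bochner_Integration.integrable_sum) auto
  have "expectation (\<lambda>\<omega>. (\<Sum>i=1..n. f (W i \<omega>))\<^sup>2)
      = (\<Sum>i=1..n. \<Sum>j=1..n. expectation (\<lambda>\<omega>. f (W i \<omega>) * f (W j \<omega>)))"
    unfolding eq using ij
    by (subst Bochner_Integration.integral_sum; (intro Bochner_Integration.integrable_sum sum.cong refl)?)
       (auto intro!: Bochner_Integration.integral_sum)
  also have "\<dots> = (\<Sum>i=1..n. \<Sum>j=1..n. if i = j then (\<integral>w. (f w)\<^sup>2 \<partial>\<mu>) else 0)"
    using zero trans(2)[of _ "\<lambda>w. (f w)\<^sup>2"] by (intro sum.cong refl) (auto simp: power2_eq_square)
  also have "\<dots> = n * (\<integral>w. (f w)\<^sup>2 \<partial>\<mu>)" by simp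
  finally show "expectation (\<lambda>\<omega>. (\<Sum>i=1..n. f (W i \<omega>))\<^sup>2) = n * (\<integral>w. (f w)\<^sup>2 \<partial>\<mu>)" .
qed

text \<open>Truncation reduces the law of large numbers for integrable functions to bounded ones.\<close>
lemma (in prob_space) weighted_weak_law:
  fixes A :: "nat \<Rightarrow> nat \<Rightarrow> 'a \<Rightarrow> real" and f :: "'w \<Rightarrow> real" and c :: real
  assumes W: "\<And>i. i \<ge> 1 \<Longrightarrow> W i \<in> measurable M \<mu>" and law: "\<And>i. i \<ge> 1 \<Longrightarrow> distr M \<mu> (W i) = \<mu>"
    and A: "\<And>n i. i \<in> {1..n} \<Longrightarrow> A n i \<in> borel_measurable M" "\<And>n i \<omega>. \<bar>A n i \<omega>\<bar> \<le> 1" and c: "\<bar>c\<bar> \<le> 1"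
    and bounded: "\<And>f B. f \<in> borel_measurable \<mu> \<Longrightarrow> (\<And>w. \<bar>f w\<bar> \<le> B) \<Longrightarrow>
      (\<lambda>n. expectation (\<lambda>\<omega>. ((\<Sum>i=1..n. A n i \<omega> * f (W i \<omega>)) / n - c * (\<integral>w. f w \<partial>\<mu>))\<^sup>2)) \<longlonglongrightarrow> 0"
    and f: "integrable \<mu> f"
  shows "(\<lambda>n. expectation (\<lambda>\<omega>. \<bar>(\<Sum>i=1..n. A n i \<omega> * f (W i \<omega>)) / n - c * (\<integral>w. f w \<partial>\<mu>)\<bar>)) \<longlonglongrightarrow> 0"
proof -
  interpret \<mu>: prob_space \<mu> using prob_space_distr[OF W[of 1]] law[of 1] by simp
  define L where "L f n \<omega> = (\<Sum>i=1..n. A n i \<omega> * f (W i \<omega>)) / n - c * (\<integral>w. f w \<partial>\<mu>)" for f n \<omega>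
  have int_i: "integrable M (\<lambda>\<omega>. A n i \<omega> * g (W i \<omega>))"
    and le_i: "expectation (\<lambda>\<omega>. \<bar>A n i \<omega> * g (W i \<omega>)\<bar>) \<le> (\<integral>w. \<bar>g w\<bar> \<partial>\<mu>)"
    if g: "integrable \<mu> g" and i: "i \<in> {1..n}" for g n i
  proof -
    have gW: "integrable M (\<lambda>\<omega>. g (W i \<omega>))"
      using integrable_distr[OF W, of i g] law[of i] g i by simp
    have le: "\<bar>A n i \<omega> * g (W i \<omega>)\<bar> \<le> \<bar>g (W i \<omega>)\<bar>" for \<omega>
      using mult_right_mono[OF A(2), of "\<bar>g (W i \<omega>)\<bar>" n i \<omega>] by (simp add: abs_mult)
    show I: "integrable M (\<lambda>\<omega>. A n i \<omega> * g (W i \<omega>))"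
      by (rule Bochner_Integration.integrable_bound[OF gW])
         (use le A(1)[OF i] gW in \<open>auto intro!: borel_measurable_times\<close>)
    have "expectation (\<lambda>\<omega>. \<bar>A n i \<omega> * g (W i \<omega>)\<bar>) \<le> expectation (\<lambda>\<omega>. \<bar>g (W i \<omega>)\<bar>)"
      using I gW le by (intro integral_mono) auto
    also have "\<dots> = (\<integral>w. \<bar>g w\<bar> \<partial>\<mu>)"
      using integral_distr[OF W, of i "\<lambda>w. \<bar>g w\<bar>"] law[of i] i borel_measurable_integrable[OF g] by simp
    finally show "expectation (\<lambda>\<omega>. \<bar>A n i \<omega> * g (W i \<omega>)\<bar>) \<le> (\<integral>w. \<bar>g w\<bar> \<partial>\<mu>)" .
  qed
  have L_int: "integrable M (L g n)" if "integrable \<mu> g" for g n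
    unfolding L_def[abs_def] using int_i[OF that] by (intro Bochner_Integration.integrable_diff integrable_divide_zero Bochner_Integration.integrable_sum) auto
  \<comment> \<open>One norm for the weighted average and one for its limit. The bound is uniform in
    n, so the truncation level can be fixed before n grows.\<close>
  have L_bound: "expectation (\<lambda>\<omega>. \<bar>L g n \<omega>\<bar>) \<le> 2 * (\<integral>w. \<bar>g w\<bar> \<partial>\<mu>)" if g: "integrable \<mu> g" for g n
  proof -
    have "expectation (\<lambda>\<omega>. \<bar>L g n \<omega>\<bar>)
        \<le> expectation (\<lambda>\<omega>. (\<Sum>i=1..n. \<bar>A n i \<omega> * g (W i \<omega>)\<bar>) / n + (\<integral>w. \<bar>g w\<bar> \<partial>\<mu>))"
    proof (rule integral_mono)
      show "integrable M (\<lambda>\<omega>. (\<Sum>i=1..n. \<bar>A n i \<omega> * g (W i \<omega>)\<bar>) / n + (\<integral>w. \<bar>g w\<bar> \<partial>\<mu>))"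
        using int_i[OF g] by (intro Bochner_Integration.integrable_add integrable_divide_zero Bochner_Integration.integrable_sum integrable_abs) auto
      fix \<omega>
      have "\<bar>(\<Sum>i=1..n. A n i \<omega> * g (W i \<omega>)) / n\<bar> \<le> (\<Sum>i=1..n. \<bar>A n i \<omega> * g (W i \<omega>)\<bar>) / n"
        using sum_abs[of "\<lambda>i. A n i \<omega> * g (W i \<omega>)" "{1..n}"] by (simp add: divide_right_mono)
      moreover have "\<bar>c * (\<integral>w. g w \<partial>\<mu>)\<bar> \<le> (\<integral>w. \<bar>g w\<bar> \<partial>\<mu>)"
      proof -
        have "\<bar>c * (\<integral>w. g w \<partial>\<mu>)\<bar> \<le> 1 * \<bar>\<integral>w. g w \<partial>\<mu>\<bar>"
          unfolding abs_mult using c by (intro mult_right_mono) auto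
        then show ?thesis using integral_abs_bound[of \<mu> g] by linarith
      qed
      ultimately show "\<bar>L g n \<omega>\<bar> \<le> (\<Sum>i=1..n. \<bar>A n i \<omega> * g (W i \<omega>)\<bar>) / n + (\<integral>w. \<bar>g w\<bar> \<partial>\<mu>)"
        unfolding L_def by linarith
    qed (use L_int[OF g] in auto)
    also have "\<dots> = (\<Sum>i=1..n. expectation (\<lambda>\<omega>. \<bar>A n i \<omega> * g (W i \<omega>)\<bar>)) / n + (\<integral>w. \<bar>g w\<bar> \<partial>\<mu>)"
    proof -
      have "integrable M (\<lambda>\<omega>. (\<Sum>i=1..n. \<bar>A n i \<omega> * g (W i \<omega>)\<bar>) / n)"
        using int_i[OF g] by (intro integrable_divide_zero Bochner_Integration.integrable_sum integrable_abs) auto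
      then show ?thesis
        using int_i[OF g] by (subst Bochner_Integration.integral_add) (auto simp: prob_space Bochner_Integration.integral_sum)
    qed
    also have "\<dots> \<le> (\<Sum>i=1..n. (\<integral>w. \<bar>g w\<bar> \<partial>\<mu>)) / n + (\<integral>w. \<bar>g w\<bar> \<partial>\<mu>)"
      using le_i[OF g] by (intro add_right_mono divide_right_mono sum_mono) auto
    also have "\<dots> \<le> 2 * (\<integral>w. \<bar>g w\<bar> \<partial>\<mu>)" by (cases "n = 0") simp_all
    finally show ?thesis .
  qed
  note [measurable] = borel_measurable_integrable[OF f]
  define tr where "tr K w = max (- real K) (min (real K) (f w))" for K :: nat and w
  have tr[measurable]: "tr K \<in> borel_measurable \<mu>" and tr_le: "\<bar>tr K w\<bar> \<le> real K" for K w
    unfolding tr_def by (auto simp: abs_le_iff)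
  have tr_int: "integrable \<mu> (tr K)" for K
    by (rule \<mu>.integrable_const_bound[where B = "real K"]) (use tr_le in auto)
  have "(\<lambda>K. \<integral>w. \<bar>f w - tr K w\<bar> \<partial>\<mu>) \<longlonglongrightarrow> (\<integral>w. 0 \<partial>\<mu>)"
  proof (rule integral_dominated_convergence[where w = "\<lambda>w. \<bar>f w\<bar>"])
    show "AE w in \<mu>. (\<lambda>K. \<bar>f w - tr K w\<bar>) \<longlonglongrightarrow> 0"
    proof (rule AE_I2)
      fix w
      obtain K0 :: nat where "\<bar>f w\<bar> \<le> real K0" using real_arch_simple by blast
      then have "\<bar>f w - tr K w\<bar> = 0" if "K \<ge> K0" for K using that by (simp add: tr_def)
      then show "(\<lambda>K. \<bar>f w - tr K w\<bar>) \<longlonglongrightarrow> 0"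
        by (intro tendsto_eventually) (auto simp: eventually_sequentially)
    qed
    show "AE w in \<mu>. norm \<bar>f w - tr K w\<bar> \<le> \<bar>f w\<bar>" for K
      by (rule AE_I2) (auto simp: tr_def)
  qed (use f in auto)
  then have tail: "(\<lambda>K. \<integral>w. \<bar>f w - tr K w\<bar> \<partial>\<mu>) \<longlonglongrightarrow> 0" by simp
  show ?thesis unfolding L_def[symmetric]
  proof (rule LIMSEQ_I)
    fix e :: real assume e: "e > 0"
    \<comment> \<open>Twice this bound, by \<open>L_bound\<close>, leaves e / 2 for the truncated
      part, where \<open>bounded\<close> applies.\<close>
    from order_tendstoD(2)[OF tail, of "e / 4"] e obtain K where K: "(\<integral>w. \<bar>f w - tr K w\<bar> \<partial>\<mu>) < e / 4"
      by (auto simp: eventually_sequentially)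
    have "(\<lambda>n. sqrt (expectation (\<lambda>\<omega>. (L (tr K) n \<omega>)\<^sup>2))) \<longlonglongrightarrow> sqrt 0"
      unfolding L_def by (intro tendsto_real_sqrt bounded[OF tr tr_le])
    then have "\<forall>\<^sub>F n in sequentially. sqrt (expectation (\<lambda>\<omega>. (L (tr K) n \<omega>)\<^sup>2)) < e / 2"
      using e by (intro order_tendstoD(2)[where y = "sqrt 0"]) auto
    then obtain n0 where n0: "\<And>n. n \<ge> n0 \<Longrightarrow> sqrt (expectation (\<lambda>\<omega>. (L (tr K) n \<omega>)\<^sup>2)) < e / 2"
      by (auto simp: eventually_sequentially)
    have "norm (expectation (\<lambda>\<omega>. \<bar>L f n \<omega>\<bar>) - 0) < e" if n: "n \<ge> n0" for n
    proof -
      have trL: "\<bar>L (tr K) n \<omega>\<bar> \<le> 2 * real K" for \<omega>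
      proof -
        have "\<bar>\<Sum>i=1..n. A n i \<omega> * tr K (W i \<omega>)\<bar> \<le> (\<Sum>i=1..n. real K)"
        proof (rule order_trans[OF sum_abs sum_mono])
          show "\<bar>A n i \<omega> * tr K (W i \<omega>)\<bar> \<le> real K" for i
            using mult_mono[OF A(2)[of n i \<omega>] tr_le[of K "W i \<omega>"]] by (simp add: abs_mult)
        qed
        then have "\<bar>(\<Sum>i=1..n. A n i \<omega> * tr K (W i \<omega>)) / n\<bar> \<le> real K"
          by (cases "n = 0") (auto simp: field_simps)
        moreover have "\<bar>c * (\<integral>w. tr K w \<partial>\<mu>)\<bar> \<le> 1 * real K"
        proof -
          have "(\<integral>w. \<bar>tr K w\<bar> \<partial>\<mu>) \<le> real K"
            using tr_int tr_le by (intro \<mu>.integral_le_const) auto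
          then have "\<bar>\<integral>w. tr K w \<partial>\<mu>\<bar> \<le> real K" using integral_abs_bound[of \<mu> "tr K"] by linarith
          then show ?thesis unfolding abs_mult using c by (intro mult_mono) auto
        qed
        ultimately show ?thesis unfolding L_def by linarith
      qed
      have sq: "integrable M (\<lambda>\<omega>. (L (tr K) n \<omega>)\<^sup>2)"
      proof (rule integrable_const_bound[where B = "(2 * real K)\<^sup>2"])
        have "(L (tr K) n \<omega>)\<^sup>2 \<le> (2 * real K)\<^sup>2" for \<omega>
          using order_trans[OF trL abs_ge_self, of \<omega>] unfolding abs_le_square_iff .
        then show "AE \<omega> in M. norm ((L (tr K) n \<omega>)\<^sup>2) \<le> (2 * real K)\<^sup>2" by simp
        show "(\<lambda>\<omega>. (L (tr K) n \<omega>)\<^sup>2) \<in> borel_measurable M"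
          using borel_measurable_integrable[OF L_int[OF tr_int]] by measurable
      qed
      have split: "L f n \<omega> = L (\<lambda>w. f w - tr K w) n \<omega> + L (tr K) n \<omega>" for \<omega>
        using f tr_int[of K] unfolding L_def
        by (simp add: right_diff_distrib sum_subtractf diff_divide_distrib)
      have fd: "integrable \<mu> (\<lambda>w. f w - tr K w)" using f tr_int by auto
      have "expectation (\<lambda>\<omega>. \<bar>L f n \<omega>\<bar>) \<le> expectation (\<lambda>\<omega>. \<bar>L (\<lambda>w. f w - tr K w) n \<omega>\<bar> + \<bar>L (tr K) n \<omega>\<bar>)"
        using L_int[OF f] L_int[OF fd] L_int[OF tr_int] unfolding split
        by (intro integral_mono) auto
      also have "\<dots> = expectation (\<lambda>\<omega>. \<bar>L (\<lambda>w. f w - tr K w) n \<omega>\<bar>) + expectation (\<lambda>\<omega>. \<bar>L (tr K) n \<omega>\<bar>)"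
        using L_int[OF fd] L_int[OF tr_int] by simp
      also have "\<dots> \<le> 2 * (\<integral>w. \<bar>f w - tr K w\<bar> \<partial>\<mu>) + sqrt (expectation (\<lambda>\<omega>. (L (tr K) n \<omega>)\<^sup>2))"
        using L_bound[OF fd] expectation_abs_le_sqrt(2)[OF borel_measurable_integrable[OF L_int[OF tr_int]] sq]
        by (intro add_mono) auto
      also have "\<dots> < e" using K n0[OF n] by linarith
      finally show ?thesis by (simp add: Bochner_Integration.integral_nonneg)
    qed
    then show "\<exists>n0. \<forall>n\<ge>n0. norm (expectation (\<lambda>\<omega>. \<bar>L f n \<omega>\<bar>) - 0) < e" by blast
  qed
qed

lemma abs_exp_neg_diff_le:
  assumes "0 \<le> a" "0 \<le> (b::real)"
  shows "\<bar>exp (- a) - exp (- b)\<bar> \<le> \<bar>a - b\<bar>"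
proof -
  have *: "exp (- a) - exp (- b) \<le> b - a" if "a \<le> b" "0 \<le> a" for a b :: real
  proof -
    have "exp (- a) - exp (- b) = exp (- a) * (1 - exp (a - b))"
      by (simp add: right_diff_distrib flip: exp_add)
    also have "\<dots> \<le> 1 * (b - a)"
    proof (rule mult_mono)
      show "1 - exp (a - b) \<le> b - a" using exp_ge_add_one_self[of "a - b"] by linarith
    qed (use that in auto)
    finally show ?thesis by simp
  qed
  show ?thesis
    using *[of a b] *[of b a] assms exp_le_cancel_iff[of "-a" "-b"] exp_le_cancel_iff[of "-b" "-a"]
    by (cases "a \<le> b") auto
qed

text \<open>One stage of conditioning. \<open>clt_bound\<close> with \<open>u = t / sqrt n\<close>
  leaves the exponential of a random average variance; as that average tends to v in mean and
  \<open>exp (- a)\<close> is 1-Lipschitz for nonnegative a, it can be replaced by a constant. The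
  constant leaves the expectation, and \<zeta> passes to the next stage.\<close>

lemma (in prob_space) clt_stage:
  fixes x :: "nat \<Rightarrow> 'd \<Rightarrow> nat \<Rightarrow> 'w \<Rightarrow> real" and s :: "nat \<Rightarrow> 'd \<Rightarrow> nat \<Rightarrow> 'v \<Rightarrow> real" and v :: real
    and \<zeta> :: "nat \<Rightarrow> 'd \<Rightarrow> (nat \<Rightarrow> 'w) \<Rightarrow> complex"
  assumes D: "\<And>n. n \<ge> 1 \<Longrightarrow> finite_design M \<mu> W (R n) (\<pi> n) n N pr (\<xi> n) (S n) (\<kappa> n)"
    and ce1: "\<And>n z i. n \<ge> 1 \<Longrightarrow> z \<in> S n \<Longrightarrow> i \<in> {1..n} \<Longrightarrow> cond_exp_fn \<mu> N pr (x n z i) (\<lambda>_. 0)"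
    and ce2: "\<And>n z i. n \<ge> 1 \<Longrightarrow> z \<in> S n \<Longrightarrow> i \<in> {1..n} \<Longrightarrow> cond_exp_fn \<mu> N pr (\<lambda>w. (x n z i w)\<^sup>2) (s n z i)"
    and s_nonneg: "\<And>n z i v. 0 \<le> s n z i v"
    and xG: "\<And>n z i w. \<bar>x n z i w\<bar> \<le> \<bar>g w\<bar>" and sG: "\<And>n z i w. s n z i (pr w) \<le> h w"
    and g: "g \<in> borel_measurable \<mu>" "integrable \<mu> (\<lambda>w. (g w)\<^sup>2)" and h: "integrable \<mu> h"
    and \<zeta>: "\<And>n i. n \<ge> 1 \<Longrightarrow> i \<in> {1..n} \<Longrightarrow> finite_design.adapted \<mu> n N pr (S n) i (\<zeta> n)"
    and v: "0 \<le> v" "(\<lambda>n. expectation (\<lambda>\<omega>. \<bar>(\<Sum>i=1..n. s n (\<xi> n \<omega>) i (pr (W i \<omega>))) / n - v\<bar>)) \<longlonglongrightarrow> 0"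
  shows "(\<lambda>n. expectation (\<lambda>\<omega>. \<zeta> n (\<xi> n \<omega>) (upto_n n W \<omega>) * iexp (t / sqrt n * (\<Sum>i=1..n. x n (\<xi> n \<omega>) i (W i \<omega>))))
     - exp (- (t\<^sup>2 / 2 * v)) * expectation (\<lambda>\<omega>. \<zeta> n (\<xi> n \<omega>) (upto_n n W \<omega>))) \<longlonglongrightarrow> 0"
proof -
  define a where "a n \<omega> = t\<^sup>2 / 2 * ((\<Sum>i=1..n. s n (\<xi> n \<omega>) i (pr (W i \<omega>))) / n)" for n \<omega>
  define Z where "Z n \<omega> = \<zeta> n (\<xi> n \<omega>) (upto_n n W \<omega>)" for n \<omega>
  define P where "P n = expectation (\<lambda>\<omega>. Z n \<omega> * iexp (t / sqrt n * (\<Sum>i=1..n. x n (\<xi> n \<omega>) i (W i \<omega>))))" for n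
  define Q where "Q n = expectation (\<lambda>\<omega>. Z n \<omega> * complex_of_real (exp (- a n \<omega>)))" for n
  define b where "b n = real n * (\<integral>w. rem_iexp (t / sqrt n * g w) \<partial>\<mu>) + real n * (\<integral>w. rem_exp ((t / sqrt n)\<^sup>2 / 2 * h w) \<partial>\<mu>)" for n
  define e where "e n = expectation (\<lambda>\<omega>. \<bar>(\<Sum>i=1..n. s n (\<xi> n \<omega>) i (pr (W i \<omega>))) / n - v\<bar>)" for n
  have h_nonneg: "0 \<le> h w" for w using s_nonneg sG[of undefined undefined undefined w] order_trans by blast
  have "b \<longlonglongrightarrow> 0 + 0"
    unfolding b_def[abs_def] using rem_iexp_vanishes[OF g] rem_exp_vanishes[OF h h_nonneg] by (intro tendsto_add)
  have first: "norm (P n - Q n) \<le> b n" if n: "n \<ge> 1" for n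
  proof -
    interpret fd: finite_design M \<mu> W "R n" "\<pi> n" n N pr "\<xi> n" "S n" "\<kappa> n" by (rule D[OF n])
    have eq: "a n \<omega> = (t / sqrt n)\<^sup>2 / 2 * (\<Sum>i=1..n. s n (\<xi> n \<omega>) i (pr (W i \<omega>)))" for \<omega>
      using n by (simp add: a_def power_divide)
    show ?thesis
      unfolding P_def Q_def Z_def b_def eq distrib_left[symmetric]
      by (rule fd.clt_bound[where x = "x n" and s = "s n"])
         (use ce1[OF n] ce2[OF n] s_nonneg xG sG g h \<zeta>[OF n] in auto)
  qed
  have second: "norm (Q n - exp (- (t\<^sup>2 / 2 * v)) * expectation (Z n)) \<le> t\<^sup>2 / 2 * e n" if n: "n \<ge> 1" for n
  proof -
    interpret fd: finite_design M \<mu> W "R n" "\<pi> n" n N pr "\<xi> n" "S n" "\<kappa> n" by (rule D[OF n])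
    have a_nonneg: "0 \<le> a n \<omega>" for \<omega> by (simp add: a_def sum_nonneg s_nonneg)
    have si: "integrable M (\<lambda>\<omega>. s n (\<xi> n \<omega>) i (pr (W i \<omega>)))" if "i \<in> {1..n}" for i
      using fd.integrable_choice_W[OF that, of "\<lambda>z w. s n z i (pr w)"] ce2[OF n _ that]
      by (auto simp: cond_exp_fn_def)
    then have S_int: "integrable M (\<lambda>\<omega>. (\<Sum>i=1..n. s n (\<xi> n \<omega>) i (pr (W i \<omega>))) / n)"
      by (intro integrable_divide_zero Bochner_Integration.integrable_sum) auto
    then have a_int: "integrable M (a n)" unfolding a_def[abs_def] by (rule integrable_mult_right)
    note [measurable] = borel_measurable_integrable[OF a_int]
    have ad: "fd.adapted 1 (\<zeta> n)" using \<zeta>[OF n, of 1] n by simp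
    have [measurable]: "Z n \<in> borel_measurable M"
      using fd.adapted_measurable[OF ad] by (simp add: Z_def[abs_def])
    have Zle: "norm (Z n \<omega>) \<le> 1" for \<omega> using ad by (auto simp: fd.adapted_def Z_def)
    have iZ: "integrable M (\<lambda>\<omega>. Z n \<omega> * h \<omega>)" if [measurable]: "h \<in> borel_measurable M" and "\<And>\<omega>. norm (h \<omega>) \<le> 1" for h
      by (rule integrable_const_bound[where B = 1]) (use that Zle in \<open>auto simp: norm_mult intro!: AE_I2 mult_le_one\<close>)
    have i1: "integrable M (\<lambda>\<omega>. Z n \<omega> * complex_of_real (exp (- a n \<omega>)))"
      by (rule iZ) (auto simp: a_nonneg simp del: of_real_exp)
    have i2: "integrable M (\<lambda>\<omega>. complex_of_real (exp (- (t\<^sup>2 / 2 * v))) * Z n \<omega>)"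
      using iZ[of "\<lambda>_. 1"] by (intro integrable_mult_right) auto
    have "Q n - exp (- (t\<^sup>2 / 2 * v)) * expectation (Z n)
      = expectation (\<lambda>\<omega>. Z n \<omega> * complex_of_real (exp (- a n \<omega>)) - complex_of_real (exp (- (t\<^sup>2 / 2 * v))) * Z n \<omega>)"
      unfolding Q_def using i1 i2 by (simp del: of_real_exp)
    also have "norm \<dots> \<le> expectation (\<lambda>\<omega>. t\<^sup>2 / 2 * \<bar>(\<Sum>i=1..n. s n (\<xi> n \<omega>) i (pr (W i \<omega>))) / n - v\<bar>)"
    proof (rule integral_norm_le)
      show "integrable M (\<lambda>\<omega>. t\<^sup>2 / 2 * \<bar>(\<Sum>i=1..n. s n (\<xi> n \<omega>) i (pr (W i \<omega>))) / n - v\<bar>)"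
        using S_int by (intro integrable_mult_right integrable_abs Bochner_Integration.integrable_diff) auto
      fix \<omega>
      have "norm (Z n \<omega> * complex_of_real (exp (- a n \<omega>)) - complex_of_real (exp (- (t\<^sup>2 / 2 * v))) * Z n \<omega>)
          = norm (Z n \<omega> * complex_of_real (exp (- a n \<omega>) - exp (- (t\<^sup>2 / 2 * v))))"
        by (simp add: right_diff_distrib mult.commute)
      also have "\<dots> = norm (Z n \<omega>) * \<bar>exp (- a n \<omega>) - exp (- (t\<^sup>2 / 2 * v))\<bar>"
        by (simp only: norm_mult norm_of_real)
      also have "\<dots> \<le> 1 * \<bar>a n \<omega> - t\<^sup>2 / 2 * v\<bar>"
        using Zle a_nonneg v(1) by (intro mult_mono abs_exp_neg_diff_le) auto
      also have "\<dots> = t\<^sup>2 / 2 * \<bar>(\<Sum>i=1..n. s n (\<xi> n \<omega>) i (pr (W i \<omega>))) / n - v\<bar>"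
      proof -
        have eq: "a n \<omega> - t\<^sup>2 / 2 * v = t\<^sup>2 / 2 * ((\<Sum>i=1..n. s n (\<xi> n \<omega>) i (pr (W i \<omega>))) / n - v)"
          by (simp only: a_def right_diff_distrib)
        show ?thesis unfolding eq abs_mult by simp
      qed
      finally show "norm (Z n \<omega> * complex_of_real (exp (- a n \<omega>)) - complex_of_real (exp (- (t\<^sup>2 / 2 * v))) * Z n \<omega>)
        \<le> t\<^sup>2 / 2 * \<bar>(\<Sum>i=1..n. s n (\<xi> n \<omega>) i (pr (W i \<omega>))) / n - v\<bar>" .
    qed (use i1 i2 in simp)
    also have "\<dots> = t\<^sup>2 / 2 * e n" by (simp add: e_def)
    finally show ?thesis .
  qed
  have lim: "(\<lambda>n. b n + t\<^sup>2 / 2 * e n) \<longlonglongrightarrow> 0"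
    using tendsto_add[OF \<open>b \<longlonglongrightarrow> 0 + 0\<close> tendsto_mult[OF tendsto_const[of "t\<^sup>2 / 2"] v(2)[folded e_def]]] by simp
  have "(\<lambda>n. P n - exp (- (t\<^sup>2 / 2 * v)) * expectation (Z n)) \<longlonglongrightarrow> 0"
  proof (rule Lim_null_comparison[OF _ lim])
    have "norm (P n - exp (- (t\<^sup>2 / 2 * v)) * expectation (Z n)) \<le> b n + t\<^sup>2 / 2 * e n" if "n \<ge> 1" for n
      using norm_triangle_ineq[of "P n - Q n" "Q n - exp (- (t\<^sup>2 / 2 * v)) * expectation (Z n)"] first[OF that] second[OF that]
      by simp
    then show "\<forall>\<^sub>F n in sequentially. norm (P n - exp (- (t\<^sup>2 / 2 * v)) * expectation (Z n)) \<le> b n + t\<^sup>2 / 2 * e n"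
      by (auto simp: eventually_sequentially)
  qed
  then show ?thesis by (simp add: P_def Z_def[abs_def])
qed

section \<open>Conditional expectations and matched sums\<close>

context
  fixes \<mu> :: "'w measure" and N :: "'v measure" and pr :: "'w \<Rightarrow> 'v"
  assumes prob_\<mu>: "prob_space \<mu>" and pr: "pr \<in> measurable \<mu> N"
begin

interpretation prob_space \<mu> by (rule prob_\<mu>)

interpretation sigma_finite_subalgebra \<mu> "sigma_of \<mu> N pr"
  by (rule sigma_finite_subalgebra_sigma_of[OF pr])

lemma pr_space: "pr \<in> space \<mu> \<rightarrow> space N"
  using pr by (auto simp: measurable_def)

lemma measurable_pr_sigma: "H \<in> borel_measurable N \<Longrightarrow> (\<lambda>w. H (pr w)) \<in> borel_measurable (sigma_of \<mu> N pr)"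
  by (rule measurable_compose[OF measurable_vimage_algebra1[OF pr_space]])

text \<open>The conditional expectation is measurable for the sigma-algebra generated by pr, so it
  factors through pr.\<close>

lemma cond_exp_fn_exists:
  assumes g: "integrable \<mu> g"
  shows "\<exists>m. cond_exp_fn \<mu> N pr g m"
proof -
  have "real_cond_exp \<mu> (sigma_of \<mu> N pr) g \<in> borel_measurable (sigma_of \<mu> N pr)" by simp
  then obtain m where m: "m \<in> borel_measurable N"
      "\<And>w. w \<in> space \<mu> \<Longrightarrow> real_cond_exp \<mu> (sigma_of \<mu> N pr) g w = m (pr w)"
    using factor_through_vimage_algebra[OF pr_space] by blast
  have "integrable \<mu> (real_cond_exp \<mu> (sigma_of \<mu> N pr) g)" by (rule real_cond_exp_int(1)[OF g])
  then have "integrable \<mu> (\<lambda>w. m (pr w))"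
    by (rule Bochner_Integration.integrable_cong[THEN iffD1, OF refl, rotated]) (simp add: m(2))
  moreover have "(\<integral>w. g w * H (pr w) \<partial>\<mu>) = (\<integral>w. m (pr w) * H (pr w) \<partial>\<mu>)"
    if H: "H \<in> borel_measurable N" "\<And>v. \<bar>H v\<bar> \<le> B" for H B
  proof -
    have "integrable \<mu> (\<lambda>w. H (pr w) * g w)"
      by (rule Bochner_Integration.integrable_bound[OF integrable_mult_right[of "B" \<mu> g, OF g]])
         (use g H pr in \<open>auto simp: abs_mult intro!: AE_I2 mult_right_mono order_trans[OF H(2) abs_ge_self]
            borel_measurable_times measurable_compose[OF pr H(1)]\<close>)
    from real_cond_exp_intg(2)[OF this measurable_pr_sigma[OF H(1)] borel_measurable_integrable[OF g]]
    have "(\<integral>w. H (pr w) * g w \<partial>\<mu>) = (\<integral>w. H (pr w) * real_cond_exp \<mu> (sigma_of \<mu> N pr) g w \<partial>\<mu>)" by simp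
    also have "\<dots> = (\<integral>w. H (pr w) * m (pr w) \<partial>\<mu>)"
      by (intro Bochner_Integration.integral_cong refl) (simp add: m(2))
    finally show ?thesis by (simp add: mult.commute)
  qed
  ultimately show ?thesis using m(1) g unfolding cond_exp_fn_def by blast
qed

text \<open>Sets of the generated sigma-algebra are preimages, and their indicators are bounded
  functions of pr; so the test identity in \<open>cond_exp_fn\<close> already characterizes the
  conditional expectation.\<close>

lemma cond_exp_fn_AE:
  assumes ce: "cond_exp_fn \<mu> N pr g m"
  shows "AE w in \<mu>. real_cond_exp \<mu> (sigma_of \<mu> N pr) g w = m (pr w)"
proof (rule real_cond_exp_charact)
  have g: "integrable \<mu> g" and m: "m \<in> borel_measurable N" "integrable \<mu> (\<lambda>w. m (pr w))"
    using ce by (auto simp: cond_exp_fn_def)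
  show "integrable \<mu> g" "integrable \<mu> (\<lambda>w. m (pr w))" by (rule g, rule m(2))
  show "(\<lambda>w. m (pr w)) \<in> borel_measurable (sigma_of \<mu> N pr)" by (rule measurable_pr_sigma[OF m(1)])
  fix A assume "A \<in> sets (sigma_of \<mu> N pr)"
  then obtain B where B: "B \<in> sets N" "A = pr -` B \<inter> space \<mu>"
    unfolding sets_vimage_algebra2[OF pr_space] by auto
  have "(\<integral>w. g w * indicator B (pr w) \<partial>\<mu>) = (\<integral>w. m (pr w) * indicator B (pr w) \<partial>\<mu>)"
    using B by (intro cond_exp_fnD[OF ce, of "indicator B" 1]) (auto simp: indicator_def)
  moreover have "set_lebesgue_integral \<mu> A h = (\<integral>w. h w * indicator B (pr w) \<partial>\<mu>)" for h :: "'w \<Rightarrow> real"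
    unfolding set_lebesgue_integral_def by (intro Bochner_Integration.integral_cong refl) (auto simp: B indicator_def)
  ultimately show "set_lebesgue_integral \<mu> A g = (\<integral>w\<in>A. m (pr w) \<partial>\<mu>)" by simp
qed

text \<open>Conditional variances must be nonnegative at every point, since the factors
  \<open>exp (- ...)\<close> are bounded by 1 pointwise. Clipping a version at 0 alters it only
  where it is almost surely not evaluated.\<close>

lemma cond_exp_fn_nonneg_exists:
  assumes g: "integrable \<mu> g" and nn: "\<And>w. 0 \<le> g w"
  shows "\<exists>m. cond_exp_fn \<mu> N pr g m \<and> (\<forall>v. 0 \<le> m v)"
proof -
  obtain m where m: "cond_exp_fn \<mu> N pr g m" using cond_exp_fn_exists[OF g] by auto
  have [measurable]: "m \<in> borel_measurable N" "pr \<in> measurable \<mu> N" using m pr by (auto simp: cond_exp_fn_def)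
  have "AE w in \<mu>. 0 \<le> real_cond_exp \<mu> (sigma_of \<mu> N pr) g w"
    using g nn by (intro real_cond_exp_pos) auto
  with cond_exp_fn_AE[OF m] have ae: "AE w in \<mu>. m (pr w) = max 0 (m (pr w))"
    by eventually_elim auto
  have "cond_exp_fn \<mu> N pr g (\<lambda>v. max 0 (m v))"
    unfolding cond_exp_fn_def
  proof (intro conjI ballI impI)
    have "integrable \<mu> (\<lambda>w. m (pr w))" using m by (auto simp: cond_exp_fn_def)
    then show "integrable \<mu> (\<lambda>w. max 0 (m (pr w)))"
      by (rule integrable_cong_AE_imp) (use ae in auto)
    fix H :: "'v \<Rightarrow> real" assume [measurable]: "H \<in> borel_measurable N" and "\<exists>B. \<forall>v. \<bar>H v\<bar> \<le> B"
    then obtain B where "\<And>v. \<bar>H v\<bar> \<le> B" by auto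
    from cond_exp_fnD[OF m, of H B, OF \<open>H \<in> _\<close> this]
    have "(\<integral>w. g w * H (pr w) \<partial>\<mu>) = (\<integral>w. m (pr w) * H (pr w) \<partial>\<mu>)" .
    also have "\<dots> = (\<integral>w. max 0 (m (pr w)) * H (pr w) \<partial>\<mu>)"
      by (rule integral_cong_AE) (use ae in auto)
    finally show "(\<integral>w. g w * H (pr w) \<partial>\<mu>) = (\<integral>w. max 0 (m (pr w)) * H (pr w) \<partial>\<mu>)" .
  qed (use g in auto)
  then show ?thesis by (intro exI[of _ "\<lambda>v. max 0 (m v)"]) auto
qed

text \<open>Passing through \<open>real_cond_exp\<close> admits unbounded H, as needed for
  square-integrable functions in the orthogonality relation.\<close>

lemma cond_exp_fn_mult:
  assumes ce: "cond_exp_fn \<mu> N pr g m" and H: "H \<in> borel_measurable N" and int: "integrable \<mu> (\<lambda>w. H (pr w) * g w)"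
  shows "(\<integral>w. H (pr w) * g w \<partial>\<mu>) = (\<integral>w. H (pr w) * m (pr w) \<partial>\<mu>)"
proof -
  have g: "g \<in> borel_measurable \<mu>" and [measurable]: "m \<in> borel_measurable N" "pr \<in> measurable \<mu> N" "H \<in> borel_measurable N"
    using ce pr H by (auto simp: cond_exp_fn_def)
  have "(\<integral>w. H (pr w) * g w \<partial>\<mu>) = (\<integral>w. H (pr w) * real_cond_exp \<mu> (sigma_of \<mu> N pr) g w \<partial>\<mu>)"
    by (rule real_cond_exp_intg(2)[OF int measurable_pr_sigma[OF H] g, symmetric])
  also have "\<dots> = (\<integral>w. H (pr w) * m (pr w) \<partial>\<mu>)"
    by (rule integral_cong_AE) (use cond_exp_fn_AE[OF ce] in auto)
  finally show ?thesis .
qed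

text \<open>Conditional Jensen inequality for the square.\<close>

lemma cond_exp_fn_square:
  assumes ce: "cond_exp_fn \<mu> N pr g m" and g2: "integrable \<mu> (\<lambda>w. (g w)\<^sup>2)"
  shows "integrable \<mu> (\<lambda>w. (m (pr w))\<^sup>2)"
proof -
  have g: "integrable \<mu> g" and [measurable]: "m \<in> borel_measurable N" "pr \<in> measurable \<mu> N"
    using ce pr by (auto simp: cond_exp_fn_def)
  have "integrable \<mu> (\<lambda>w. (real_cond_exp \<mu> (sigma_of \<mu> N pr) g w)\<^sup>2)"
    by (rule integrable_convex_cond_exp[where I = UNIV]) (use g g2 in \<open>auto intro: convex_power2\<close>)
  then show ?thesis
    by (rule integrable_cong_AE_imp) (use cond_exp_fn_AE[OF ce] in auto)
qed

text \<open>Pythagoras: the residual \<open>g - m\<close> is orthogonal to every square-integrable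
  function of pr, here to \<open>m - H\<close>. With constant H, or H a coarser regression, this is
  the law of total variance.\<close>

lemma cond_exp_fn_orthogonal:
  assumes ce: "cond_exp_fn \<mu> N pr g m" and g2: "integrable \<mu> (\<lambda>w. (g w)\<^sup>2)"
    and H: "H \<in> borel_measurable N" and H2: "integrable \<mu> (\<lambda>w. (H (pr w))\<^sup>2)"
  shows "(\<integral>w. (g w - H (pr w))\<^sup>2 \<partial>\<mu>) = (\<integral>w. (g w - m (pr w))\<^sup>2 \<partial>\<mu>) + (\<integral>w. (m (pr w) - H (pr w))\<^sup>2 \<partial>\<mu>)"
proof -
  have [measurable]: "g \<in> borel_measurable \<mu>" "m \<in> borel_measurable N" "pr \<in> measurable \<mu> N" "H \<in> borel_measurable N"
    using ce pr H by (auto simp: cond_exp_fn_def)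
  note m2 = cond_exp_fn_square[OF ce g2]
  define d where "d v = m v - H v" for v
  have [measurable]: "d \<in> borel_measurable N" unfolding d_def by measurable
  have d2: "integrable \<mu> (\<lambda>w. (d (pr w))\<^sup>2)"
    unfolding d_def using m2 H2 by (intro integrable_power2_diff) auto
  have e2: "integrable \<mu> (\<lambda>w. (g w - m (pr w))\<^sup>2)" using m2 g2 by (intro integrable_power2_diff) auto
  have dg: "integrable \<mu> (\<lambda>w. d (pr w) * g w)" and dm: "integrable \<mu> (\<lambda>w. d (pr w) * m (pr w))"
    using d2 g2 m2 by (auto intro!: integrable_mult_of_squares)
  have cross: "(\<integral>w. d (pr w) * (g w - m (pr w)) \<partial>\<mu>) = 0"
    using cond_exp_fn_mult[OF ce _ dg] dg dm by (simp add: right_diff_distrib)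
  have "(g w - H (pr w))\<^sup>2 = (g w - m (pr w))\<^sup>2 + (d (pr w))\<^sup>2 + 2 * (d (pr w) * (g w - m (pr w)))" for w
    by (simp add: d_def power2_eq_square algebra_simps)
  then have "(\<integral>w. (g w - H (pr w))\<^sup>2 \<partial>\<mu>)
      = (\<integral>w. (g w - m (pr w))\<^sup>2 + (d (pr w))\<^sup>2 + 2 * (d (pr w) * (g w - m (pr w))) \<partial>\<mu>)" by simp
  also have "\<dots> = (\<integral>w. (g w - m (pr w))\<^sup>2 \<partial>\<mu>) + (\<integral>w. (d (pr w))\<^sup>2 \<partial>\<mu>) + 2 * (\<integral>w. d (pr w) * (g w - m (pr w)) \<partial>\<mu>)"
    using e2 d2 dg dm by (simp add: right_diff_distrib)
  finally show ?thesis using cross by (simp add: d_def)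
qed

end

text \<open>Links the conditional variance on M, with respect to the sigma-algebra of
  \<open>pr (X \<omega>)\<close>, to an integral over the law of X. On preimages of sets of N the
  regression m passes the defining test, so \<open>m (pr (X \<omega>))\<close> is the conditional
  expectation on M.\<close>

lemma (in prob_space) expectation_cond_var:
  assumes X: "X \<in> measurable M \<mu>" and law: "distr M \<mu> X = \<mu>" and pr: "pr \<in> measurable \<mu> N"
    and ce: "cond_exp_fn \<mu> N pr g m" and g2: "integrable \<mu> (\<lambda>w. (g w)\<^sup>2)"
  shows "expectation (cond_var M (sigma_of M N (\<lambda>\<omega>. pr (X \<omega>))) (\<lambda>\<omega>. g (X \<omega>))) = (\<integral>w. (g w - m (pr w))\<^sup>2 \<partial>\<mu>)"
proof -
  have prob_\<mu>: "prob_space \<mu>" using prob_space_distr[OF X] law by simp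
  have prX[measurable]: "(\<lambda>\<omega>. pr (X \<omega>)) \<in> measurable M N" using measurable_compose[OF X pr] .
  let ?F = "sigma_of M N (\<lambda>\<omega>. pr (X \<omega>))"
  interpret sigma_finite_subalgebra M ?F by (rule sigma_finite_subalgebra_sigma_of[OF prX])
  have g: "integrable \<mu> g" and m: "integrable \<mu> (\<lambda>w. m (pr w))"
    and meas[measurable]: "g \<in> borel_measurable \<mu>" "m \<in> borel_measurable N" "X \<in> measurable M \<mu>" "pr \<in> measurable \<mu> N"
    using ce X pr by (auto simp: cond_exp_fn_def)
  note m2 = cond_exp_fn_square[OF prob_\<mu> pr ce g2]
  have tr: "integrable M (\<lambda>\<omega>. h (X \<omega>)) \<longleftrightarrow> integrable \<mu> h" "expectation (\<lambda>\<omega>. h (X \<omega>)) = (\<integral>w. h w \<partial>\<mu>)"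
    if "h \<in> borel_measurable \<mu>" for h :: "'b \<Rightarrow> real"
    using integrable_distr_eq[OF X that] integral_distr[OF X that] law by simp_all
  have Xs: "(\<lambda>\<omega>. pr (X \<omega>)) \<in> space M \<rightarrow> space N" using prX by (auto simp: measurable_def)
  have ae: "AE \<omega> in M. real_cond_exp M ?F (\<lambda>\<omega>. g (X \<omega>)) \<omega> = m (pr (X \<omega>))"
  proof (rule real_cond_exp_charact)
    show "integrable M (\<lambda>\<omega>. g (X \<omega>))" "integrable M (\<lambda>\<omega>. m (pr (X \<omega>)))"
      using tr(1)[of g] tr(1)[of "\<lambda>w. m (pr w)"] g m by auto
    show "(\<lambda>\<omega>. m (pr (X \<omega>))) \<in> borel_measurable ?F"
      by (rule measurable_compose[OF measurable_vimage_algebra1[OF Xs] meas(2)])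
    fix A assume "A \<in> sets ?F"
    then obtain B where B[measurable]: "B \<in> sets N" and A: "A = (\<lambda>\<omega>. pr (X \<omega>)) -` B \<inter> space M"
      unfolding sets_vimage_algebra2[OF Xs] by auto
    have "(\<integral>w. g w * indicator B (pr w) \<partial>\<mu>) = (\<integral>w. m (pr w) * indicator B (pr w) \<partial>\<mu>)"
      using B by (intro cond_exp_fnD[OF ce, of "indicator B" 1]) (auto simp: indicator_def)
    moreover note this
    have "set_lebesgue_integral M A (\<lambda>\<omega>. h (X \<omega>)) = (\<integral>w. h w * indicator B (pr w) \<partial>\<mu>)"
      if [measurable]: "h \<in> borel_measurable \<mu>" for h :: "'b \<Rightarrow> real"
    proof -
      have "set_lebesgue_integral M A (\<lambda>\<omega>. h (X \<omega>)) = expectation (\<lambda>\<omega>. h (X \<omega>) * indicator B (pr (X \<omega>)))"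
        unfolding set_lebesgue_integral_def
        by (intro Bochner_Integration.integral_cong refl) (auto simp: A indicator_def)
      then show ?thesis using tr(2)[of "\<lambda>w. h w * indicator B (pr w)"] by simp
    qed
    from this[of g] this[of "\<lambda>w. m (pr w)"] calculation
    show "(\<integral>\<omega>\<in>A. g (X \<omega>) \<partial>M) = (\<integral>\<omega>\<in>A. m (pr (X \<omega>)) \<partial>M)" by simp
  qed
  have d2: "integrable \<mu> (\<lambda>w. (g w - m (pr w))\<^sup>2)" using m2 g2 by (intro integrable_power2_diff) auto
  have D2: "integrable M (\<lambda>\<omega>. (g (X \<omega>) - m (pr (X \<omega>)))\<^sup>2)"
    using tr(1)[of "\<lambda>w. (g w - m (pr w))\<^sup>2"] d2 by simp
  have E2: "integrable M (\<lambda>\<omega>. (g (X \<omega>) - real_cond_exp M ?F (\<lambda>\<omega>. g (X \<omega>)) \<omega>)\<^sup>2)"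
    by (rule integrable_cong_AE_imp[OF D2]) (use ae in auto)
  have "expectation (cond_var M ?F (\<lambda>\<omega>. g (X \<omega>))) = expectation (\<lambda>\<omega>. (g (X \<omega>) - real_cond_exp M ?F (\<lambda>\<omega>. g (X \<omega>)) \<omega>)\<^sup>2)"
    unfolding cond_var_def by (rule real_cond_exp_int(2)[OF E2])
  also have "\<dots> = expectation (\<lambda>\<omega>. (g (X \<omega>) - m (pr (X \<omega>)))\<^sup>2)"
    by (rule integral_cong_AE) (use ae in auto)
  finally show ?thesis using tr(2)[of "\<lambda>w. (g w - m (pr w))\<^sup>2"] by simp
qed

section \<open>Bounds on the mass functions, and vanishing of matched sums\<close>

lemma group_mass_bounds:
  assumes "1 \<le> a" "a \<le> k"
  shows "0 \<le> group_mass a k g B" "group_mass a k g B \<le> 1"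
proof -
  have "0 \<le> real a / real k" "real a / real k \<le> 1" using assms by (auto simp: divide_simps)
  moreover have "1 \<le> real (k choose a)" using assms by (simp add: Suc_leI zero_less_binomial)
  then have "1 / real (k choose a) \<le> 1" by (metis divide_le_eq_1 not_one_le_zero zero_less_one order.strict_trans2)
  ultimately show "0 \<le> group_mass a k g B" "group_mass a k g B \<le> 1"
    by (auto simp: group_mass_def intro!: prod_nonneg prod_le_1)
qed

lemma partition_mass_bounds:
  assumes "1 \<le> a" "a \<le> k"
  shows "0 \<le> partition_mass a k P A" "partition_mass a k P A \<le> 1"
  using group_mass_bounds[OF assms] by (auto simp: partition_mass_def intro!: prod_nonneg prod_le_1)

text \<open>Convergence to 0 in probability becomes convergence in mean after capping: below the
  level d the variable costs at most \<open>C * d\<close>, above it B times a vanishing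
  probability.\<close>

lemma (in prob_space) expectation_truncated_vanishes:
  assumes X: "\<And>n. X n \<in> borel_measurable M" "\<And>n \<omega>. 0 \<le> X n \<omega>" and op: "small_op_1 M X"
    and C: "0 \<le> C" "0 \<le> B"
  shows "(\<lambda>n. expectation (\<lambda>\<omega>. min (C * X n \<omega>) B)) \<longlonglongrightarrow> 0"
proof (rule LIMSEQ_I)
  note [measurable] = X(1)
  fix e :: real assume e: "e > 0"
  \<comment> \<open>Chosen so that \<open>C * d \<le> e / 2\<close>, with \<open>C + 1\<close> to
    allow C = 0.\<close>
  define d where "d = e / (2 * (C + 1))"
  have d: "d > 0" "C * d < e / 2 + e / 4"
  proof -
    show "d > 0" using e C by (simp add: d_def)
    have "C * d \<le> e / 2" using e C by (simp add: d_def field_simps)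
    then show "C * d < e / 2 + e / 4" using e by simp
  qed
  have "(\<lambda>n. B * measure M {\<omega> \<in> space M. \<bar>X n \<omega>\<bar> > d}) \<longlonglongrightarrow> B * 0"
    using op d(1) unfolding small_op_1_def by (intro tendsto_mult tendsto_const) auto
  then have "\<forall>\<^sub>F n in sequentially. B * measure M {\<omega> \<in> space M. \<bar>X n \<omega>\<bar> > d} < e / 4"
    using e by (intro order_tendstoD(2)) auto
  then obtain n0 where n0: "\<And>n. n \<ge> n0 \<Longrightarrow> B * measure M {\<omega> \<in> space M. \<bar>X n \<omega>\<bar> > d} < e / 4"
    by (auto simp: eventually_sequentially)
  have "norm (expectation (\<lambda>\<omega>. min (C * X n \<omega>) B) - 0) < e" if n: "n \<ge> n0" for n
  proof -
    have "expectation (\<lambda>\<omega>. min (C * X n \<omega>) B) \<le> expectation (\<lambda>\<omega>. C * d + B * indicator {\<omega> \<in> space M. \<bar>X n \<omega>\<bar> > d} \<omega>)"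
    proof (rule integral_mono)
      show "integrable M (\<lambda>\<omega>. min (C * X n \<omega>) B)"
        by (rule integrable_const_bound[where B = B]) (use X(2) C in auto)
      show "integrable M (\<lambda>\<omega>. C * d + B * indicator {\<omega> \<in> space M. \<bar>X n \<omega>\<bar> > d} \<omega>)"
        by (intro Bochner_Integration.integrable_add integrable_mult_right) (auto intro!: integrable_const_bound[where B = 1])
      fix \<omega> assume "\<omega> \<in> space M"
      have "0 \<le> C * d" using C d(1) by simp
      show "min (C * X n \<omega>) B \<le> C * d + B * indicator {\<omega> \<in> space M. \<bar>X n \<omega>\<bar> > d} \<omega>"
      proof (cases "X n \<omega> > d")
        case True
        then have "B * indicator {\<omega> \<in> space M. \<bar>X n \<omega>\<bar> > d} \<omega> = B" using \<open>\<omega> \<in> space M\<close> by simp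
        then show ?thesis using \<open>0 \<le> C * d\<close> by linarith
      next
        case False
        then have "C * X n \<omega> \<le> C * d" using C by (intro mult_left_mono) auto
        moreover have "0 \<le> B * indicator {\<omega> \<in> space M. \<bar>X n \<omega>\<bar> > d} \<omega>" using C by simp
        ultimately show ?thesis by linarith
      qed
    qed
    also have "\<dots> = C * d + B * measure M {\<omega> \<in> space M. \<bar>X n \<omega>\<bar> > d}"
      by (subst Bochner_Integration.integral_add) (auto simp: prob_space intro!: integrable_const_bound[where B = 1] integrable_mult_right)
    also have "\<dots> < e" using d(2) n0[OF n] by linarith
    finally show ?thesis using X(2) C by (simp add: Bochner_Integration.integral_nonneg)
  qed
  then show "\<exists>n0. \<forall>n\<ge>n0. norm (expectation (\<lambda>\<omega>. min (C * X n \<omega>) B) - 0) < e" by blast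
qed

text \<open>A group is centred at the value of h at the group mean, so the Lipschitz constant turns
  the spread of h within groups into the matching statistic X. The difference c - h is paid for by
  \<open>second_moment_le\<close>, whose bound does not depend on the quality of the
  matching.\<close>

lemma (in prob_space) matched_sum_vanishes:
  fixes \<psi> :: "nat \<Rightarrow> 'a \<Rightarrow> 'v::euclidean_space" and c :: "'v \<Rightarrow> real"
  assumes RG: "\<And>n. randomized_groups M (F n) (U n) (G n) (Z n) a k n"
    and \<psi>F: "\<And>n i. i \<in> {1..n} \<Longrightarrow> \<psi> i \<in> borel_measurable (F n)"
    and law: "\<And>i. i \<ge> 1 \<Longrightarrow> distr M borel (\<psi> i) = \<nu>"
    and tight: "tight_matching M \<psi> G"
    and c[measurable]: "c \<in> borel_measurable borel" and c2: "integrable \<nu> (\<lambda>v. (c v)\<^sup>2)"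
  shows "(\<lambda>n. expectation (\<lambda>\<omega>. (\<Sum>i\<in>U n \<omega>. (of_bool (Z n i \<omega>) - real a / real k) * c (\<psi> i \<omega>))\<^sup>2) / n) \<longlonglongrightarrow> 0"
proof -
  define S where "S h n \<omega> = (\<Sum>i\<in>U n \<omega>. (of_bool (Z n i \<omega>) - real a / real k) * h (\<psi> i \<omega>))" for h n \<omega>
  have gs: "S h n \<omega>
      = randomized_groups.group_sum (Z n) a k (\<lambda>i \<omega>. h (\<psi> i \<omega>)) (U n \<omega>) \<omega>" for n \<omega> and h :: "'v \<Rightarrow> real"
  proof -
    interpret rg: randomized_groups M "F n" "U n" "G n" "Z n" a k n by (rule RG)
    show ?thesis by (simp add: S_def rg.group_sum_def rg.share_def)
  qed
  have \<psi>M[measurable]: "\<psi> i \<in> borel_measurable M" if "i \<ge> 1" for i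
  proof -
    \<comment> \<open>Unit i is part of the sample of size n = i, whose sigma-algebra gives its
      measurability.\<close>
    interpret rg: randomized_groups M "F i" "U i" "G i" "Z i" a k i by (rule RG)
    show ?thesis using measurable_from_subalg[OF rg.subalg \<psi>F[of i i]] that by simp
  qed
  have sets_\<nu>: "sets \<nu> = sets borel" using law[of 1] by (metis le_refl sets_distr)
  have prob_\<nu>: "prob_space \<nu>" using prob_space_distr[OF \<psi>M[of 1]] law[of 1] by simp
  have tr: "integrable M (\<lambda>\<omega>. h (\<psi> i \<omega>)) = integrable \<nu> h" "expectation (\<lambda>\<omega>. h (\<psi> i \<omega>)) = (\<integral>v. h v \<partial>\<nu>)"
    if "i \<ge> 1" "h \<in> borel_measurable borel" for h :: "'v \<Rightarrow> real" and i
    using integrable_distr_eq[OF \<psi>M[OF that(1)] that(2)] integral_distr[OF \<psi>M[OF that(1)] that(2)] law[OF that(1)] by simp_all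
  define E where "E h n = expectation (\<lambda>\<omega>. (S h n \<omega>)\<^sup>2)" for h n
  have gen: "E h n \<le> k * n * (\<integral>v. (h v)\<^sup>2 \<partial>\<nu>)"
    and gen_int: "integrable M (\<lambda>\<omega>. (S h n \<omega>)\<^sup>2)"
    if [measurable]: "h \<in> borel_measurable borel" and h2: "integrable \<nu> (\<lambda>v. (h v)\<^sup>2)" for h :: "'v \<Rightarrow> real" and n
  proof -
    interpret rg: randomized_groups M "F n" "U n" "G n" "Z n" a k n by (rule RG)
    have hF: "(\<lambda>\<omega>. h (\<psi> i \<omega>)) \<in> borel_measurable (F n)" if "i \<in> {1..n}" for i
      using measurable_compose[OF \<psi>F[OF that], of h borel] by simp
    have hi: "integrable M (\<lambda>\<omega>. (h (\<psi> i \<omega>))\<^sup>2)" if "i \<in> {1..n}" for i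
      using tr(1)[of i "\<lambda>v. (h v)\<^sup>2"] h2 that by simp
    show "integrable M (\<lambda>\<omega>. (S h n \<omega>)\<^sup>2)"
      unfolding gs using rg.second_moment(1)[OF hF hi] .
    have "E h n \<le> k * (\<Sum>i\<in>{1..n}. expectation (\<lambda>\<omega>. (h (\<psi> i \<omega>))\<^sup>2))"
      unfolding E_def gs by (rule rg.second_moment_le[OF hF hi])
    also have "(\<Sum>i\<in>{1..n}. expectation (\<lambda>\<omega>. (h (\<psi> i \<omega>))\<^sup>2)) = (\<Sum>i\<in>{1..n}. (\<integral>v. (h v)\<^sup>2 \<partial>\<nu>))"
      using tr(2)[of _ "\<lambda>v. (h v)\<^sup>2"] by (intro sum.cong refl) auto
    finally show "E h n \<le> k * n * (\<integral>v. (h v)\<^sup>2 \<partial>\<nu>)" by simp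
  qed
  define X where "X n \<omega> = (1 / real n) * (\<Sum>g\<in>G n \<omega>. \<Sum>i\<in>g. (norm (\<psi> i \<omega> - group_mean (\<lambda>j. \<psi> j \<omega>) g))\<^sup>2)" for n \<omega>
  have X_meas: "X n \<in> borel_measurable M" for n
  proof -
    interpret rg: randomized_groups M "F n" "U n" "G n" "Z n" a k n by (rule RG)
    have GM: "G n \<in> measurable M (count_space (Pow (Pow {1..n})))" by (rule measurable_from_subalg[OF rg.subalg rg.G])
    have "(\<lambda>\<omega>. \<Sum>g\<in>P. \<Sum>i\<in>g. (norm (\<psi> i \<omega> - group_mean (\<lambda>j. \<psi> j \<omega>) g))\<^sup>2) \<in> borel_measurable M"
      if P: "P \<in> Pow (Pow {1..n})" for P
    proof (rule borel_measurable_sum)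
      fix g assume "g \<in> P"
      then have "g \<subseteq> {1..n}" using P by blast
      then have g: "\<And>i. i \<in> g \<Longrightarrow> i \<ge> 1" by auto
      have [measurable]: "(\<lambda>\<omega>. group_mean (\<lambda>j. \<psi> j \<omega>) g) \<in> borel_measurable M"
        unfolding group_mean_def by (intro borel_measurable_scaleR borel_measurable_const borel_measurable_sum \<psi>M g)
      show "(\<lambda>\<omega>. \<Sum>i\<in>g. (norm (\<psi> i \<omega> - group_mean (\<lambda>j. \<psi> j \<omega>) g))\<^sup>2) \<in> borel_measurable M"
        by (rule borel_measurable_sum) (use g in measurable)
    qed
    from measurable_compose_countable'[OF this GM countable_finite]
    show ?thesis unfolding X_def by simp
  qed
  have X_nonneg: "0 \<le> X n \<omega>" for n \<omega> by (simp add: X_def sum_nonneg)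
  have op: "small_op_1 M X" using tight by (simp add: tight_matching_def X_def[abs_def])
  \<comment> \<open>X is small in probability only and its expectation is not controlled; the cap
    \<open>(2 * B)\<^sup>2\<close> bounds each squared difference of h directly. The last term is
    the remainder group.\<close>
  have lip: "E h n \<le> k * (n * expectation (\<lambda>\<omega>. min (L\<^sup>2 * X n \<omega>) ((2 * B)\<^sup>2))) + (k * B)\<^sup>2"
    if h[measurable]: "h \<in> borel_measurable borel" and L: "\<And>x y. \<bar>h x - h y\<bar> \<le> L * dist x y" and B: "\<And>x. \<bar>h x\<bar> \<le> B"
      and n: "n \<ge> 1" for h :: "'v \<Rightarrow> real" and L B :: real and n
  proof -
    interpret rg: randomized_groups M "F n" "U n" "G n" "Z n" a k n by (rule RG)
    have hF: "(\<lambda>\<omega>. h (\<psi> i \<omega>)) \<in> borel_measurable (F n)" if "i \<in> {1..n}" for i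
      using measurable_compose[OF \<psi>F[OF that], of h borel] by simp
    have int: "integrable M (\<lambda>\<omega>. n * min (L\<^sup>2 * X n \<omega>) ((2 * B)\<^sup>2))"
    proof (intro integrable_mult_right integrable_const_bound[where B = "(2 * B)\<^sup>2"])
      show "(\<lambda>\<omega>. min (L\<^sup>2 * X n \<omega>) ((2 * B)\<^sup>2)) \<in> borel_measurable M" using X_meas by measurable
    qed (use X_nonneg in auto)
    have "E h n \<le> k * expectation (\<lambda>\<omega>. n * min (L\<^sup>2 * X n \<omega>) ((2 * B)\<^sup>2)) + (k * B)\<^sup>2"
      unfolding E_def gs
    proof (rule rg.second_moment_matched[OF hF B int])
      fix \<omega> assume \<omega>: "\<omega> \<in> space M"
      let ?m = "\<lambda>g. group_mean (\<lambda>j. \<psi> j \<omega>) g"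
      have "(\<Sum>g\<in>G n \<omega>. \<Sum>i\<in>g. (h (\<psi> i \<omega>) - h (?m g))\<^sup>2) \<le> (\<Sum>g\<in>G n \<omega>. \<Sum>i\<in>g. L\<^sup>2 * (norm (\<psi> i \<omega> - ?m g))\<^sup>2)"
      proof (intro sum_mono)
        fix g i
        have "\<bar>h (\<psi> i \<omega>) - h (?m g)\<bar> \<le> \<bar>L * norm (\<psi> i \<omega> - ?m g)\<bar>"
          using order_trans[OF L[of "\<psi> i \<omega>" "?m g"] abs_ge_self] by (simp add: dist_norm)
        then show "(h (\<psi> i \<omega>) - h (?m g))\<^sup>2 \<le> L\<^sup>2 * (norm (\<psi> i \<omega> - ?m g))\<^sup>2"
          unfolding abs_le_square_iff by (simp add: power_mult_distrib)
      qed
      also have "\<dots> = n * (L\<^sup>2 * X n \<omega>)" using n by (simp add: X_def sum_distrib_left)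
      finally have 1: "(\<Sum>g\<in>G n \<omega>. \<Sum>i\<in>g. (h (\<psi> i \<omega>) - h (?m g))\<^sup>2) \<le> n * (L\<^sup>2 * X n \<omega>)" .
      have "(\<Sum>g\<in>G n \<omega>. \<Sum>i\<in>g. (h (\<psi> i \<omega>) - h (?m g))\<^sup>2) \<le> (\<Sum>g\<in>G n \<omega>. \<Sum>i\<in>g. (2 * B)\<^sup>2)"
      proof (intro sum_mono)
        fix g i
        have "\<bar>h (\<psi> i \<omega>) - h (?m g)\<bar> \<le> \<bar>2 * B\<bar>" using B[of "\<psi> i \<omega>"] B[of "?m g"] by linarith
        then show "(h (\<psi> i \<omega>) - h (?m g))\<^sup>2 \<le> (2 * B)\<^sup>2" unfolding abs_le_square_iff .
      qed
      also have "\<dots> = (\<Sum>i\<in>U n \<omega>. (2 * B)\<^sup>2)" by (rule rg.sum_U[OF \<omega>, symmetric])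
      also have "\<dots> \<le> (\<Sum>i\<in>{1..n}. (2 * B)\<^sup>2)" using rg.U_subset[OF \<omega>] by (intro sum_mono2) auto
      finally have "(\<Sum>g\<in>G n \<omega>. \<Sum>i\<in>g. (h (\<psi> i \<omega>) - h (?m g))\<^sup>2) \<le> n * (2 * B)\<^sup>2" by simp
      with 1 show "(\<Sum>g\<in>G n \<omega>. \<Sum>i\<in>g. (h (\<psi> i \<omega>) - h (?m g))\<^sup>2) \<le> n * min (L\<^sup>2 * X n \<omega>) ((2 * B)\<^sup>2)"
        by (simp add: min_def)
    qed
    then show ?thesis by simp
  qed
  show ?thesis unfolding S_def[symmetric] E_def[symmetric]
  proof (rule LIMSEQ_I)
    fix e :: real assume e: "e > 0"
    interpret rg1: randomized_groups M "F 1" "U 1" "G 1" "Z 1" a k 1 by (rule RG)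
    have k: "real k > 0" using rg1.ak by simp
    have "lipschitz_approximable \<nu> c"
      by (rule lipschitz_approximable_square_integrable[OF prob_space.finite_measure[OF prob_\<nu>] sets_\<nu> _ c2])
         (simp add: measurable_cong_sets[OF sets_\<nu> refl])
    \<comment> \<open>The error of c - h enters \<open>E c n / n\<close> with the factor 2 k, so e /
      2 remains for r.\<close>
    moreover have "e / (4 * k) > 0" using e k by simp
    ultimately obtain h L B where h\<nu>: "h \<in> borel_measurable \<nu>" and L: "\<And>x y. \<bar>h x - h y\<bar> \<le> L * dist x y"
      and B: "\<And>x. \<bar>h x\<bar> \<le> B" and hc: "(\<integral>v. (c v - h v)\<^sup>2 \<partial>\<nu>) < e / (4 * k)"
      by (rule lipschitz_approximableE) (rule that)
    have h[measurable]: "h \<in> borel_measurable borel" using h\<nu> by (simp add: measurable_cong_sets[OF sets_\<nu> refl])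
    have h2: "integrable \<nu> (\<lambda>v. (h v)\<^sup>2)"
      by (rule bounded_square_integrable[OF prob_space.finite_measure[OF prob_\<nu>] sets_\<nu> h\<nu> B])
    have d2: "integrable \<nu> (\<lambda>v. (c v - h v)\<^sup>2)"
      using c2 h2 by (intro integrable_power2_diff) (simp_all add: measurable_cong_sets[OF sets_\<nu> refl])
    \<comment> \<open>Twice the bound \<open>lip\<close> divided by n; the factor 2 comes from
      splitting c into c - h and h.\<close>
    define r where "r n = 2 * real k * expectation (\<lambda>\<omega>. min (L\<^sup>2 * X n \<omega>) ((2 * B)\<^sup>2)) + 2 * (k * B)\<^sup>2 * (1 / real n)" for n
    have "r \<longlonglongrightarrow> 2 * real k * 0 + 2 * (k * B)\<^sup>2 * 0"
    proof -
      have "(\<lambda>n. expectation (\<lambda>\<omega>. min (L\<^sup>2 * X n \<omega>) ((2 * B)\<^sup>2))) \<longlonglongrightarrow> 0"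
        by (rule expectation_truncated_vanishes[OF X_meas X_nonneg op]) auto
      from tendsto_add[OF tendsto_mult[OF tendsto_const this] tendsto_mult[OF tendsto_const lim_1_over_n]]
      show ?thesis unfolding r_def[abs_def] .
    qed
    then have "\<forall>\<^sub>F n in sequentially. r n < e / 2" using e by (intro order_tendstoD(2)) auto
    then obtain n0 where n0: "\<And>n. n \<ge> n0 \<Longrightarrow> r n < e / 2" by (auto simp: eventually_sequentially)
    have "norm (E c n / n - 0) < e" if n: "n \<ge> max 1 n0" for n
    proof -
      have split: "S c n \<omega>
          = S (\<lambda>v. c v - h v) n \<omega>
          + S h n \<omega>" for \<omega>
        by (simp add: S_def sum.distrib[symmetric] right_diff_distrib)
      have "E c n \<le> expectation (\<lambda>\<omega>.
            2 * (S (\<lambda>v. c v - h v) n \<omega>)\<^sup>2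
          + 2 * (S h n \<omega>)\<^sup>2)"
        unfolding E_def
      proof (rule integral_mono)
        show "integrable M (\<lambda>\<omega>. (S c n \<omega>)\<^sup>2)"
          by (rule gen_int[OF c c2])
        show "integrable M (\<lambda>\<omega>. 2 * (S (\<lambda>v. c v - h v) n \<omega>)\<^sup>2
            + 2 * (S h n \<omega>)\<^sup>2)"
          using gen_int[OF _ d2] gen_int[OF h h2]
          by (intro Bochner_Integration.integrable_add integrable_mult_right) auto
      qed (unfold split, rule sum_squared_le)
      also have "\<dots> = 2 * E (\<lambda>v. c v - h v) n + 2 * E h n"
        unfolding E_def using gen_int[OF _ d2, of n] gen_int[OF h h2, of n] by simp
      also have "\<dots> \<le> 2 * (k * n * (\<integral>v. (c v - h v)\<^sup>2 \<partial>\<nu>))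
          + 2 * (k * (n * expectation (\<lambda>\<omega>. min (L\<^sup>2 * X n \<omega>) ((2 * B)\<^sup>2))) + (k * B)\<^sup>2)"
        using gen[OF _ d2, of n] lip[OF h L B, of n] n by (intro add_mono mult_left_mono) auto
      finally have "E c n / n \<le> (2 * (k * n * (\<integral>v. (c v - h v)\<^sup>2 \<partial>\<nu>))
          + 2 * (k * (n * expectation (\<lambda>\<omega>. min (L\<^sup>2 * X n \<omega>) ((2 * B)\<^sup>2))) + (k * B)\<^sup>2)) / n"
        by (intro divide_right_mono) auto
      also have "\<dots> = 2 * k * (\<integral>v. (c v - h v)\<^sup>2 \<partial>\<nu>) + r n"
        using n by (simp add: r_def add_divide_distrib)
      also have "\<dots> < e"
      proof -
        have "2 * k * (\<integral>v. (c v - h v)\<^sup>2 \<partial>\<nu>) < e / 2" using hc k by (simp add: field_simps)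
        then show ?thesis using n0[of n] n by linarith
      qed
      finally show ?thesis by (simp add: E_def Bochner_Integration.integral_nonneg)
    qed
    then show "\<exists>n0. \<forall>n\<ge>n0. norm (E c n / n - 0) < e" by blast
  qed
qed

section \<open>The experiment\<close>

text \<open>The witnesses hidden in the two \<open>local_randomization\<close> hypotheses, namely
  the grouping functions and the numerators and denominators, are fixed as parameters. Covariates
  and outcomes are read off as coordinates of W, so every quantity is a function of W, the
  tie-breaker and the design.\<close>

locale local_experiment = prob_space M for M :: "'o measure" +
  fixes W :: "nat \<Rightarrow> 'o \<Rightarrow> 'v::euclidean_space \<times> real \<times> real" and f :: "'v \<Rightarrow> 'u::euclidean_space"
    and R :: "nat \<Rightarrow> 'r measure" and \<pi> :: "nat \<Rightarrow> 'o \<Rightarrow> 'r" and T D :: "nat \<Rightarrow> nat \<Rightarrow> 'o \<Rightarrow> bool"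
    and aT kT aD kD :: nat and hT :: "nat \<Rightarrow> (nat \<Rightarrow> 'u) \<times> 'r \<Rightarrow> nat set set"
    and hD :: "nat \<Rightarrow> (nat \<Rightarrow> 'v) \<times> (nat \<Rightarrow> bool) \<times> 'r \<Rightarrow> nat set set"
  assumes W_indep: "indep_vars (\<lambda>_. borel) W {1..}"
    and W_ident: "\<And>i. i \<ge> 1 \<Longrightarrow> distr M borel (W i) = distr M borel (W 1)"
    and f[measurable]: "f \<in> borel_measurable borel"
    and \<pi>[measurable]: "\<And>n. \<pi> n \<in> measurable M (R n)"
    and \<pi>_indep: "\<And>n. indep_set (sets (sigma_of M (PiM {1..n} (\<lambda>_. borel)) (upto_n n W)))
          (sets (sigma_of M (R n) (\<pi> n)))"
    and T_meas: "\<And>n i. i \<in> {1..n} \<Longrightarrow> T n i \<in> measurable M (count_space UNIV)"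
    and D_meas: "\<And>n i. i \<in> {1..n} \<Longrightarrow> D n i \<in> measurable M (count_space UNIV)"
    and aT: "1 \<le> aT" "aT \<le> kT" and aD: "1 \<le> aD" "aD \<le> kD"
    and hT[measurable]: "\<And>n. hT n \<in> measurable (PiM {1..n} (\<lambda>_. borel) \<Otimes>\<^sub>M R n) (count_space (Pow (Pow {1..n})))"
    and hT_part: "\<And>n \<omega>. \<omega> \<in> space M \<Longrightarrow> partition_on {1..n} (hT n (upto_n n (\<lambda>i \<omega>. f (fst (W i \<omega>))) \<omega>, \<pi> n \<omega>))"
    and hT_tight: "tight_matching M (\<lambda>i \<omega>. f (fst (W i \<omega>))) (\<lambda>n \<omega>. hT n (upto_n n (\<lambda>i \<omega>. f (fst (W i \<omega>))) \<omega>, \<pi> n \<omega>))"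
    and hT_rand: "\<And>n. complete_randomization M
        (sigma_of M (PiM {1..n} (\<lambda>_. borel) \<Otimes>\<^sub>M R n) (\<lambda>\<omega>. (upto_n n W \<omega>, \<pi> n \<omega>)))
        (\<lambda>\<omega>. hT n (upto_n n (\<lambda>i \<omega>. f (fst (W i \<omega>))) \<omega>, \<pi> n \<omega>)) (T n) aT kT"
    and hD[measurable]: "\<And>n. hD n \<in> measurable (PiM {1..n} (\<lambda>_. borel) \<Otimes>\<^sub>M (PiM {1..n} (\<lambda>_. count_space UNIV) \<Otimes>\<^sub>M R n))
        (count_space (Pow (Pow {1..n})))"
    and hD_part: "\<And>n \<omega>. \<omega> \<in> space M \<Longrightarrow>
        partition_on {i \<in> {1..n}. T n i \<omega>} (hD n (upto_n n (\<lambda>i \<omega>. fst (W i \<omega>)) \<omega>, upto_n n (T n) \<omega>, \<pi> n \<omega>))"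
    and hD_tight: "tight_matching M (\<lambda>i \<omega>. fst (W i \<omega>))
        (\<lambda>n \<omega>. hD n (upto_n n (\<lambda>i \<omega>. fst (W i \<omega>)) \<omega>, upto_n n (T n) \<omega>, \<pi> n \<omega>))"
    and hD_rand: "\<And>n. complete_randomization M
        (sigma_of M (PiM {1..n} (\<lambda>_. borel) \<Otimes>\<^sub>M (PiM {1..n} (\<lambda>_. count_space UNIV) \<Otimes>\<^sub>M R n))
          (\<lambda>\<omega>. (upto_n n W \<omega>, upto_n n (T n) \<omega>, \<pi> n \<omega>)))
        (\<lambda>\<omega>. hD n (upto_n n (\<lambda>i \<omega>. fst (W i \<omega>)) \<omega>, upto_n n (T n) \<omega>, \<pi> n \<omega>)) (D n) aD kD"
begin

definition "\<mu> = distr M borel (W 1)"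
definition "psi = (\<lambda>i \<omega>. fst (W i \<omega>))"
definition "phi = (\<lambda>i \<omega>. f (fst (W i \<omega>)))"
definition "GrT n \<omega> = hT n (upto_n n phi \<omega>, \<pi> n \<omega>)"
definition "GrD n \<omega> = hD n (upto_n n psi \<omega>, upto_n n (T n) \<omega>, \<pi> n \<omega>)"
definition "FT n = sigma_of M (PiM {1..n} (\<lambda>_. borel) \<Otimes>\<^sub>M R n) (\<lambda>\<omega>. (upto_n n W \<omega>, \<pi> n \<omega>))"
definition "FD n = sigma_of M (PiM {1..n} (\<lambda>_. borel) \<Otimes>\<^sub>M (PiM {1..n} (\<lambda>_. count_space UNIV) \<Otimes>\<^sub>M R n))
          (\<lambda>\<omega>. (upto_n n W \<omega>, upto_n n (T n) \<omega>, \<pi> n \<omega>))"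
definition "sampled n \<omega> = {i \<in> {1..n}. T n i \<omega>}"
definition "treated n \<omega> = {i \<in> sampled n \<omega>. D n i \<omega>}"

lemma W_meas: "i \<ge> 1 \<Longrightarrow> W i \<in> borel_measurable M"
  using W_indep by (auto simp: indep_vars_def)

lemma sets_\<mu>[measurable_cong]: "sets \<mu> = sets borel" by (simp add: \<mu>_def)

lemma space_\<mu>[simp]: "space \<mu> = UNIV" by (simp add: \<mu>_def)

lemma W_\<mu>: "i \<ge> 1 \<Longrightarrow> W i \<in> measurable M \<mu>"
  using W_meas by (simp add: measurable_cong_sets[OF refl sets_\<mu>])

lemma law_W: "i \<ge> 1 \<Longrightarrow> distr M \<mu> (W i) = \<mu>"
  using W_ident[of i] by (simp add: \<mu>_def cong: distr_cong)

lemma prob_\<mu>: "prob_space \<mu>"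
  unfolding \<mu>_def by (rule prob_space_distr) (rule W_meas, simp)

lemma fst_borel[measurable]: "(fst :: 'v \<times> real \<times> real \<Rightarrow> 'v) \<in> borel_measurable borel"
  by (intro borel_measurable_continuous_onI continuous_intros)

lemma snd_borel[measurable]:
  "(\<lambda>w :: 'v \<times> real \<times> real. fst (snd w)) \<in> borel_measurable borel"
  "(\<lambda>w :: 'v \<times> real \<times> real. snd (snd w)) \<in> borel_measurable borel"
  by (intro borel_measurable_continuous_onI continuous_intros)+

lemma upto_n_measurable:
  "(\<And>i. i \<in> {1..n} \<Longrightarrow> X i \<in> measurable L N) \<Longrightarrow> upto_n n X \<in> measurable L (PiM {1..n} (\<lambda>_. N))"
  unfolding upto_n_def[abs_def] by (rule measurable_restrict)

lemma upto_W[measurable]: "upto_n n W \<in> measurable M (PiM {1..n} (\<lambda>_. borel))"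
  by (rule upto_n_measurable) (simp add: W_meas)

lemma upto_T[measurable]: "upto_n n (T n) \<in> measurable M (PiM {1..n} (\<lambda>_. count_space UNIV))"
  by (rule upto_n_measurable) (rule T_meas)

lemma subalgebra_FT: "subalgebra M (FT n)"
  unfolding FT_def by (rule subalgebra_sigma_of) measurable

lemma subalgebra_FD: "subalgebra M (FD n)"
  unfolding FD_def by (rule subalgebra_sigma_of) measurable

lemma measurable_FT:
  assumes "h \<in> measurable (PiM {1..n} (\<lambda>_. borel) \<Otimes>\<^sub>M R n) N"
  shows "(\<lambda>\<omega>. h (upto_n n W \<omega>, \<pi> n \<omega>)) \<in> measurable (FT n) N"
proof -
  have "(\<lambda>\<omega>. (upto_n n W \<omega>, \<pi> n \<omega>)) \<in> measurable M (PiM {1..n} (\<lambda>_. borel) \<Otimes>\<^sub>M R n)" by measurable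
  then have "(\<lambda>\<omega>. (upto_n n W \<omega>, \<pi> n \<omega>)) \<in> space M \<rightarrow> space (PiM {1..n} (\<lambda>_. borel) \<Otimes>\<^sub>M R n)"
    by (auto simp: measurable_def)
  from measurable_compose[OF measurable_vimage_algebra1[OF this] assms] show ?thesis by (simp add: FT_def)
qed

lemma measurable_FD:
  assumes "h \<in> measurable (PiM {1..n} (\<lambda>_. borel) \<Otimes>\<^sub>M (PiM {1..n} (\<lambda>_. count_space UNIV) \<Otimes>\<^sub>M R n)) N"
  shows "(\<lambda>\<omega>. h (upto_n n W \<omega>, upto_n n (T n) \<omega>, \<pi> n \<omega>)) \<in> measurable (FD n) N"
proof -
  have "(\<lambda>\<omega>. (upto_n n W \<omega>, upto_n n (T n) \<omega>, \<pi> n \<omega>)) \<in> measurable M (PiM {1..n} (\<lambda>_. borel) \<Otimes>\<^sub>M (PiM {1..n} (\<lambda>_. count_space UNIV) \<Otimes>\<^sub>M R n))"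
    by measurable
  then have "(\<lambda>\<omega>. (upto_n n W \<omega>, upto_n n (T n) \<omega>, \<pi> n \<omega>))
      \<in> space M \<rightarrow> space (PiM {1..n} (\<lambda>_. borel) \<Otimes>\<^sub>M (PiM {1..n} (\<lambda>_. count_space UNIV) \<Otimes>\<^sub>M R n))"
    by (auto simp: measurable_def)
  from measurable_compose[OF measurable_vimage_algebra1[OF this] assms] show ?thesis by (simp add: FD_def)
qed

lemma measurable_map_borel:
  assumes "h \<in> measurable borel N"
  shows "(\<lambda>w. \<lambda>i\<in>{1..n}. h (w i)) \<in> measurable (PiM {1..n} (\<lambda>_. borel)) (PiM {1..n} (\<lambda>_. N))"
  by (rule measurable_restrict)
     (rule measurable_compose[OF measurable_component_singleton[where M = "\<lambda>_. borel"] assms])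

lemma measurable_map_first:
  assumes "h \<in> measurable borel N"
  shows "(\<lambda>x. (\<lambda>i\<in>{1..n}. h (fst x i), snd x)) \<in> measurable (PiM {1..n} (\<lambda>_. borel) \<Otimes>\<^sub>M L) (PiM {1..n} (\<lambda>_. N) \<Otimes>\<^sub>M L)"
  by (rule measurable_Pair[OF measurable_compose[OF measurable_fst measurable_map_borel[OF assms]] measurable_snd])

lemma W_component_FT: "i \<in> {1..n} \<Longrightarrow> h \<in> borel_measurable borel \<Longrightarrow> (\<lambda>\<omega>. h (W i \<omega>)) \<in> borel_measurable (FT n)"
  using measurable_FT[of "\<lambda>(w, r). h (w i)" n borel]
  by (simp add: upto_n_def case_prod_unfold measurable_compose[OF measurable_fst measurable_compose[OF measurable_component_singleton]])

lemma W_component_FD: "i \<in> {1..n} \<Longrightarrow> h \<in> borel_measurable borel \<Longrightarrow> (\<lambda>\<omega>. h (W i \<omega>)) \<in> borel_measurable (FD n)"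
  using measurable_FD[of "\<lambda>(w, r). h (w i)" n borel]
  by (simp add: upto_n_def case_prod_unfold measurable_compose[OF measurable_fst measurable_compose[OF measurable_component_singleton]])

lemma upto_phi: "upto_n n phi \<omega> = (\<lambda>i\<in>{1..n}. f (fst (upto_n n W \<omega> i)))"
  by (auto simp: upto_n_def phi_def fun_eq_iff)

lemma upto_psi: "upto_n n psi \<omega> = (\<lambda>i\<in>{1..n}. fst (upto_n n W \<omega> i))"
  by (auto simp: upto_n_def psi_def fun_eq_iff)

lemma groups_T: "randomized_groups M (FT n) (\<lambda>_. {1..n}) (GrT n) (T n) aT kT n"
proof unfold_locales
  show "subalgebra M (FT n)" by (rule subalgebra_FT)
  have "(\<lambda>w :: 'v \<times> real \<times> real. f (fst w)) \<in> borel_measurable borel" by measurable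
  from measurable_FT[OF measurable_compose[OF measurable_map_first[OF this] hT[of n]]]
  show "GrT n \<in> measurable (FT n) (count_space (Pow (Pow {1..n})))"
    by (simp add: GrT_def[abs_def] upto_phi)
  show "partition_on {1..n} (GrT n \<omega>)" if "\<omega> \<in> space M" for \<omega>
    using hT_part[OF that] by (simp add: GrT_def phi_def)
  show "complete_randomization M (FT n) (GrT n) (T n) aT kT"
    using hT_rand by (simp add: FT_def GrT_def[abs_def] phi_def)
qed (use aT T_meas in auto)

lemma groups_D: "randomized_groups M (FD n) (sampled n) (GrD n) (D n) aD kD n"
proof unfold_locales
  show "subalgebra M (FD n)" by (rule subalgebra_FD)
  from measurable_FD[OF measurable_compose[OF measurable_map_first[OF fst_borel] hD[of n]]]
  show "GrD n \<in> measurable (FD n) (count_space (Pow (Pow {1..n})))"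
    by (simp add: GrD_def[abs_def] upto_psi)
  show "partition_on (sampled n \<omega>) (GrD n \<omega>)" if "\<omega> \<in> space M" for \<omega>
    using hD_part[OF that] by (simp add: GrD_def psi_def sampled_def)
  show "complete_randomization M (FD n) (GrD n) (D n) aD kD"
    using hD_rand by (simp add: FD_def GrD_def[abs_def] psi_def)
qed (use aD D_meas in auto)

text \<open>Independence of the tie-breaker gives the product form on rectangles, and the i.i.d.
  assumption identifies the first factor. This is the measure to which Fubini is applied in
  \<open>swap_kernel\<close>.\<close>

lemma joint_law:
  assumes n: "n \<ge> 1"
  shows "distr M (PiM {1..n} (\<lambda>_. \<mu>) \<Otimes>\<^sub>M R n) (\<lambda>\<omega>. (upto_n n W \<omega>, \<pi> n \<omega>)) =
      PiM {1..n} (\<lambda>_. \<mu>) \<Otimes>\<^sub>M distr M (R n) (\<pi> n)"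
proof -
  have sets_P: "sets (PiM {1..n} (\<lambda>_. \<mu>)) = sets (PiM {1..n} (\<lambda>_. borel))"
    by (rule sets_PiM_cong) (simp_all add: sets_\<mu>)
  interpret X: prob_space "distr M (PiM {1..n} (\<lambda>_. borel)) (upto_n n W)" by (rule prob_space_distr) measurable
  interpret Y: prob_space "distr M (R n) (\<pi> n)" by (rule prob_space_distr) measurable
  have "distr M (PiM {1..n} (\<lambda>_. borel)) (upto_n n W) \<Otimes>\<^sub>M distr M (R n) (\<pi> n)
      = distr M (PiM {1..n} (\<lambda>_. borel) \<Otimes>\<^sub>M R n) (\<lambda>\<omega>. (upto_n n W \<omega>, \<pi> n \<omega>))"
  proof (rule pair_measure_eqI)
    fix A B assume "A \<in> sets (distr M (PiM {1..n} (\<lambda>_. borel)) (upto_n n W))" "B \<in> sets (distr M (R n) (\<pi> n))"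
    then have A[measurable]: "A \<in> sets (PiM {1..n} (\<lambda>_. borel))" and B[measurable]: "B \<in> sets (R n)" by auto
    have "prob ((upto_n n W -` A \<inter> space M) \<inter> (\<pi> n -` B \<inter> space M))
        = prob (upto_n n W -` A \<inter> space M) * prob (\<pi> n -` B \<inter> space M)"
      by (rule indep_setD[OF \<pi>_indep[of n] in_vimage_algebra[OF A] in_vimage_algebra[OF B]])
    moreover have "A \<times> B \<in> sets (PiM {1..n} (\<lambda>_. borel) \<Otimes>\<^sub>M R n)" by measurable
    then have "emeasure (distr M (PiM {1..n} (\<lambda>_. borel) \<Otimes>\<^sub>M R n) (\<lambda>\<omega>. (upto_n n W \<omega>, \<pi> n \<omega>))) (A \<times> B)
        = emeasure M ((\<lambda>\<omega>. (upto_n n W \<omega>, \<pi> n \<omega>)) -` (A \<times> B) \<inter> space M)"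
      by (intro emeasure_distr) measurable
    moreover have "(\<lambda>\<omega>. (upto_n n W \<omega>, \<pi> n \<omega>)) -` (A \<times> B) \<inter> space M
        = (upto_n n W -` A \<inter> space M) \<inter> (\<pi> n -` B \<inter> space M)" by auto
    ultimately show "emeasure (distr M (PiM {1..n} (\<lambda>_. borel)) (upto_n n W)) A * emeasure (distr M (R n) (\<pi> n)) B
        = emeasure (distr M (PiM {1..n} (\<lambda>_. borel) \<Otimes>\<^sub>M R n) (\<lambda>\<omega>. (upto_n n W \<omega>, \<pi> n \<omega>))) (A \<times> B)"
      unfolding emeasure_distr[OF upto_W A] emeasure_distr[OF \<pi> B]
      by (simp only: emeasure_eq_measure ennreal_mult measure_nonneg)
  qed (unfold_locales, simp cong: sets_pair_measure_cong)
  also have "\<dots> = distr M (PiM {1..n} (\<lambda>_. \<mu>) \<Otimes>\<^sub>M R n) (\<lambda>\<omega>. (upto_n n W \<omega>, \<pi> n \<omega>))"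
    by (rule distr_cong[OF refl sets_pair_measure_cong[OF sets_P[symmetric] refl] refl])
  finally have 1: "distr M (PiM {1..n} (\<lambda>_. \<mu>) \<Otimes>\<^sub>M R n) (\<lambda>\<omega>. (upto_n n W \<omega>, \<pi> n \<omega>)) =
      distr M (PiM {1..n} (\<lambda>_. borel)) (upto_n n W) \<Otimes>\<^sub>M distr M (R n) (\<pi> n)" by simp
  have ind: "indep_vars (\<lambda>_. borel) W {1..n}" by (rule indep_vars_subset[OF W_indep]) auto
  \<comment> \<open>\<open>n \<ge> 1\<close> makes the index set nonempty, as the characterization
    of independence requires.\<close>
  have "distr M (PiM {1..n} (\<lambda>_. borel)) (upto_n n W) = PiM {1..n} (\<lambda>i. distr M borel (W i))"
    unfolding upto_n_def[abs_def]
    by (rule indep_vars_iff_distr_eq_PiM'[THEN iffD1, OF _ _ ind]) (use n W_meas in simp_all)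
  also have "\<dots> = PiM {1..n} (\<lambda>_. \<mu>)"
    unfolding \<mu>_def by (rule PiM_cong[OF refl]) (rule W_ident, simp)
  finally show ?thesis using 1 by simp
qed

lemma finite_designI:
  assumes n: "n \<ge> 1" and pr: "pr \<in> measurable borel N" and S: "finite S" "\<And>\<omega>. \<omega> \<in> space M \<Longrightarrow> \<xi> \<omega> \<in> S"
    and ev: "\<And>z. z \<in> S \<Longrightarrow> {\<omega> \<in> space M. \<xi> \<omega> = z} \<in> sets M"
    and \<kappa>: "\<And>z. z \<in> S \<Longrightarrow> \<kappa> z \<in> borel_measurable (PiM {1..n} (\<lambda>_. N) \<Otimes>\<^sub>M R n)" "\<And>z x. \<bar>\<kappa> z x\<bar> \<le> 1"
    and des: "\<And>z \<Phi>. z \<in> S \<Longrightarrow> \<Phi> \<in> borel_measurable (PiM {1..n} (\<lambda>_. borel) \<Otimes>\<^sub>M R n) \<Longrightarrow>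
      integrable M (\<lambda>\<omega>. \<Phi> (upto_n n W \<omega>, \<pi> n \<omega>)) \<Longrightarrow>
      expectation (\<lambda>\<omega>. of_bool (\<xi> \<omega> = z) * \<Phi> (upto_n n W \<omega>, \<pi> n \<omega>)) =
      expectation (\<lambda>\<omega>. \<kappa> z (\<lambda>i\<in>{1..n}. pr (W i \<omega>), \<pi> n \<omega>) * \<Phi> (upto_n n W \<omega>, \<pi> n \<omega>))"
  shows "finite_design M \<mu> W (R n) (\<pi> n) n N pr \<xi> S \<kappa>"
proof (intro finite_design.intro finite_design_axioms.intro prob_space_axioms)
  have sets_P: "sets (PiM {1..n} (\<lambda>_. \<mu>)) = sets (PiM {1..n} (\<lambda>_. borel))"
    by (rule sets_PiM_cong) (simp_all add: sets_\<mu>)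
  have eq: "borel_measurable (PiM {1..n} (\<lambda>_. \<mu>) \<Otimes>\<^sub>M R n) = borel_measurable (PiM {1..n} (\<lambda>_. borel) \<Otimes>\<^sub>M R n)"
    by (intro measurable_cong_sets sets_pair_measure_cong sets_P refl)
  show "expectation (\<lambda>\<omega>. of_bool (\<xi> \<omega> = z) * \<Phi> (upto_n n W \<omega>, \<pi> n \<omega>)) =
      expectation (\<lambda>\<omega>. \<kappa> z (\<lambda>i\<in>{1..n}. pr (W i \<omega>), \<pi> n \<omega>) * \<Phi> (upto_n n W \<omega>, \<pi> n \<omega>))"
    if "z \<in> S" "\<Phi> \<in> borel_measurable (PiM {1..n} (\<lambda>_. \<mu>) \<Otimes>\<^sub>M R n)" "integrable M (\<lambda>\<omega>. \<Phi> (upto_n n W \<omega>, \<pi> n \<omega>))"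
    for z \<Phi> using des that unfolding eq by auto
  show "prob_space \<mu>" by (rule prob_\<mu>)
  show "pr \<in> measurable \<mu> N" using pr by (simp add: measurable_cong_sets[OF sets_\<mu> refl])
  show "distr M (PiM {1..n} (\<lambda>_. \<mu>) \<Otimes>\<^sub>M R n) (\<lambda>\<omega>. (upto_n n W \<omega>, \<pi> n \<omega>)) =
      PiM {1..n} (\<lambda>_. \<mu>) \<Otimes>\<^sub>M distr M (R n) (\<pi> n)" by (rule joint_law[OF n])
qed (use n S ev \<kappa> W_\<mu> law_W in auto)

lemma sampled_event: "{\<omega> \<in> space M. sampled n \<omega> = A} \<in> sets M"
proof (cases "A \<subseteq> {1..n}")
  case True
  interpret rg: randomized_groups M "FT n" "\<lambda>_. {1..n}" "GrT n" "T n" aT kT n by (rule groups_T)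
  have "{\<omega> \<in> space M. \<forall>i\<in>{1..n}. T n i \<omega> = (i \<in> A)} \<in> sets M" by (rule rg.Z_event) simp
  also have "{\<omega> \<in> space M. \<forall>i\<in>{1..n}. T n i \<omega> = (i \<in> A)} = {\<omega> \<in> space M. sampled n \<omega> = A}"
    using True by (auto simp: sampled_def)
  finally show ?thesis .
next
  case False
  then have "{\<omega> \<in> space M. sampled n \<omega> = A} = {}" by (auto simp: sampled_def)
  then show ?thesis by (simp only: sets.empty_sets)
qed

lemma treated_event: "{\<omega> \<in> space M. sampled n \<omega> = A \<and> treated n \<omega> = B} \<in> sets M"
proof (cases "A \<subseteq> {1..n} \<and> B \<subseteq> A")
  case True
  interpret rg: randomized_groups M "FD n" "sampled n" "GrD n" "D n" aD kD n by (rule groups_D)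
  have "{\<omega> \<in> space M. \<forall>i\<in>A. D n i \<omega> = (i \<in> B)} \<in> sets M" by (rule rg.Z_event) (use True in auto)
  then have "{\<omega> \<in> space M. sampled n \<omega> = A} \<inter> {\<omega> \<in> space M. \<forall>i\<in>A. D n i \<omega> = (i \<in> B)} \<in> sets M"
    by (intro sets.Int sampled_event)
  also have "{\<omega> \<in> space M. sampled n \<omega> = A} \<inter> {\<omega> \<in> space M. \<forall>i\<in>A. D n i \<omega> = (i \<in> B)}
      = {\<omega> \<in> space M. sampled n \<omega> = A \<and> treated n \<omega> = B}"
    using True by (auto simp: treated_def)
  finally show ?thesis .
next
  case False
  then have "{\<omega> \<in> space M. sampled n \<omega> = A \<and> treated n \<omega> = B} = {}"
    by (auto simp: treated_def sampled_def)
  then show ?thesis by (simp only: sets.empty_sets)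
qed

lemma Zset_T: "randomized_groups.Zset (\<lambda>_. {1..n}) (T n) = sampled n"
proof -
  interpret rg: randomized_groups M "FT n" "\<lambda>_. {1..n}" "GrT n" "T n" aT kT n by (rule groups_T)
  show ?thesis by (rule ext) (simp only: rg.Zset_def sampled_def)
qed

lemma Zset_D: "randomized_groups.Zset (sampled n) (D n) = treated n"
proof -
  interpret rg: randomized_groups M "FD n" "sampled n" "GrD n" "D n" aD kD n by (rule groups_D)
  show ?thesis by (rule ext) (simp only: rg.Zset_def treated_def)
qed

text \<open>The probability of drawing the sample A given the data: v stands for the values of
  \<psi>1 and r for the tie-breaker.\<close>

definition "kappaT n A = (\<lambda>(v, r). partition_mass aT kT (hT n (v, r)) A)"
text \<open>The probability of sampling A and treating B, now with v the values of \<psi>2. The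
  relation \<psi>1 = f \<psi>2 makes the sampling factor a function of v, and on the event in
  question the vector T is the indicator of A.\<close>

definition "kappaD n = (\<lambda>(A, B). \<lambda>(v, r). kappaT n A (\<lambda>i\<in>{1..n}. f (v i), r) *
   partition_mass aD kD (hD n (v, \<lambda>i\<in>{1..n}. i \<in> A, r)) B)"

lemma kappaT_le: "\<bar>kappaT n A x\<bar> \<le> 1"
  using partition_mass_bounds[OF aT] by (auto simp: kappaT_def split: prod.split)

lemma kappaD_le: "\<bar>kappaD n z x\<bar> \<le> 1"
proof -
  have "\<bar>partition_mass aD kD P B\<bar> \<le> 1" for P B using partition_mass_bounds[OF aD] by auto
  then show ?thesis
    using mult_mono[OF kappaT_le] by (auto simp: kappaD_def abs_mult split: prod.split)
qed

lemma kappaT_measurable[measurable]: "kappaT n A \<in> borel_measurable (PiM {1..n} (\<lambda>_. borel) \<Otimes>\<^sub>M R n)"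
proof -
  have "(\<lambda>x. partition_mass aT kT (hT n x) A) \<in> borel_measurable (PiM {1..n} (\<lambda>_. borel) \<Otimes>\<^sub>M R n)"
    by (rule measurable_compose[OF hT]) simp
  then show ?thesis by (simp add: kappaT_def case_prod_unfold)
qed

lemma hD_slice_measurable:
  "(\<lambda>(v, r). partition_mass aD kD (hD n (v, \<lambda>i\<in>{1..n}. i \<in> A, r)) B) \<in> borel_measurable (PiM {1..n} (\<lambda>_. borel) \<Otimes>\<^sub>M R n)"
proof -
  have [measurable]: "(\<lambda>i\<in>{1..n}. i \<in> A) \<in> space (PiM {1..n} (\<lambda>_. count_space UNIV))" by (simp add: space_PiM)
  have "(\<lambda>(v, r). hD n (v, \<lambda>i\<in>{1..n}. i \<in> A, r)) \<in> measurable (PiM {1..n} (\<lambda>_. borel) \<Otimes>\<^sub>M R n) (count_space (Pow (Pow {1..n})))"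
    by measurable
  from measurable_compose[OF this, of "\<lambda>P. partition_mass aD kD P B" borel] show ?thesis
    by (simp add: case_prod_unfold)
qed

lemma kappaD_measurable: "kappaD n z \<in> borel_measurable (PiM {1..n} (\<lambda>_. borel) \<Otimes>\<^sub>M R n)"
proof -
  obtain A B where z: "z = (A, B)" by (cases z)
  from measurable_compose[OF measurable_map_first[OF f] kappaT_measurable[of n A]]
  have "(\<lambda>x. kappaT n A (\<lambda>i\<in>{1..n}. f (fst x i), snd x)) \<in> borel_measurable (PiM {1..n} (\<lambda>_. borel) \<Otimes>\<^sub>M R n)" .
  from borel_measurable_times[OF this hD_slice_measurable[of n A B]] show ?thesis
    by (simp add: z kappaD_def case_prod_unfold)
qed

lemma design_T:
  assumes \<Phi>: "\<Phi> \<in> borel_measurable (PiM {1..n} (\<lambda>_. borel) \<Otimes>\<^sub>M R n)"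
    and int: "integrable M (\<lambda>\<omega>. \<Phi> (upto_n n W \<omega>, \<pi> n \<omega>))"
  shows "expectation (\<lambda>\<omega>. of_bool (sampled n \<omega> = A) * \<Phi> (upto_n n W \<omega>, \<pi> n \<omega>)) =
      expectation (\<lambda>\<omega>. kappaT n A (upto_n n phi \<omega>, \<pi> n \<omega>) * \<Phi> (upto_n n W \<omega>, \<pi> n \<omega>))"
proof -
  interpret rg: randomized_groups M "FT n" "\<lambda>_. {1..n}" "GrT n" "T n" aT kT n by (rule groups_T)
  show ?thesis
    using rg.expectation_Zset[OF measurable_FT[OF \<Phi>] int, of A]
    unfolding Zset_T by (simp add: kappaT_def GrT_def)
qed

text \<open>The conditioning is undone in reverse order: the assignment given T first, with the
  event that A is sampled as part of the integrand, and then the sampling by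
  \<open>design_T\<close>.\<close>

lemma design_D:
  assumes \<Phi>: "\<Phi> \<in> borel_measurable (PiM {1..n} (\<lambda>_. borel) \<Otimes>\<^sub>M R n)"
    and int: "integrable M (\<lambda>\<omega>. \<Phi> (upto_n n W \<omega>, \<pi> n \<omega>))" and A: "A \<subseteq> {1..n}"
  shows "expectation (\<lambda>\<omega>. of_bool (sampled n \<omega> = A \<and> treated n \<omega> = B) * \<Phi> (upto_n n W \<omega>, \<pi> n \<omega>)) =
      expectation (\<lambda>\<omega>. kappaD n (A, B) (upto_n n psi \<omega>, \<pi> n \<omega>) * \<Phi> (upto_n n W \<omega>, \<pi> n \<omega>))"
proof -
  interpret rg: randomized_groups M "FD n" "sampled n" "GrD n" "D n" aD kD n by (rule groups_D)
  let ?\<Phi> = "\<lambda>\<omega>. \<Phi> (upto_n n W \<omega>, \<pi> n \<omega>)"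
  \<comment> \<open>On this event T is a constant vector, so the assignment groups become a function
    of the data and the tie-breaker alone.\<close>
  have samp: "sampled n \<omega> = A \<longleftrightarrow> upto_n n (T n) \<omega> = (\<lambda>i\<in>{1..n}. i \<in> A)" for \<omega>
    using A by (auto simp: sampled_def upto_n_def fun_eq_iff)
  have iA: "integrable M (\<lambda>\<omega>. of_bool (sampled n \<omega> = A) * ?\<Phi> \<omega>)"
  proof -
    have "integrable M (\<lambda>\<omega>. indicator {\<omega> \<in> space M. sampled n \<omega> = A} \<omega> *\<^sub>R ?\<Phi> \<omega>)"
      by (intro integrable_mult_indicator sampled_event int)
    then show ?thesis by (rule Bochner_Integration.integrable_cong[THEN iffD1, rotated -1]) auto
  qed
  have [measurable]: "\<Phi> \<in> borel_measurable (PiM {1..n} (\<lambda>_. borel) \<Otimes>\<^sub>M R n)" by (rule \<Phi>)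
  have mA: "(\<lambda>\<omega>. of_bool (sampled n \<omega> = A) * ?\<Phi> \<omega>) \<in> borel_measurable (FD n)"
  proof -
    have [measurable]: "{t \<in> space (PiM {1..n} (\<lambda>_. count_space UNIV :: bool measure)). t = (\<lambda>i\<in>{1..n}. i \<in> A)} \<in> sets (PiM {1..n} (\<lambda>_. count_space UNIV))"
    proof -
      have "{t \<in> space (PiM {1..n} (\<lambda>_. count_space UNIV :: bool measure)). t = (\<lambda>i\<in>{1..n}. i \<in> A)}
          = PiE {1..n} (\<lambda>i. {i \<in> A})"
        by (auto simp: space_PiM PiE_def extensional_def fun_eq_iff)
      then show ?thesis by (simp add: sets_PiM_I_finite)
    qed
    have "(\<lambda>(w, t, r). of_bool (t = (\<lambda>i\<in>{1..n}. i \<in> A)) * \<Phi> (w, r))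
       \<in> borel_measurable (PiM {1..n} (\<lambda>_. borel) \<Otimes>\<^sub>M (PiM {1..n} (\<lambda>_. count_space UNIV) \<Otimes>\<^sub>M R n))"
      by measurable
    from measurable_FD[OF this] show ?thesis by (simp add: samp)
  qed
  have "expectation (\<lambda>\<omega>. of_bool (sampled n \<omega> = A \<and> treated n \<omega> = B) * ?\<Phi> \<omega>)
      = expectation (\<lambda>\<omega>. of_bool (treated n \<omega> = B) * (of_bool (sampled n \<omega> = A) * ?\<Phi> \<omega>))"
    by (simp add: of_bool_conj ac_simps)
  also have "\<dots> = expectation (\<lambda>\<omega>. partition_mass aD kD (GrD n \<omega>) B * (of_bool (sampled n \<omega> = A) * ?\<Phi> \<omega>))"
    using rg.expectation_Zset[OF mA iA, of B] by (simp add: Zset_D)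
  also have "\<dots> = expectation (\<lambda>\<omega>. of_bool (sampled n \<omega> = A) *
      (partition_mass aD kD (hD n (upto_n n psi \<omega>, \<lambda>i\<in>{1..n}. i \<in> A, \<pi> n \<omega>)) B * ?\<Phi> \<omega>))"
    by (intro Bochner_Integration.integral_cong refl) (auto simp: GrD_def samp)
  also have "\<dots> = expectation (\<lambda>\<omega>. kappaT n A (upto_n n phi \<omega>, \<pi> n \<omega>) *
      (partition_mass aD kD (hD n (upto_n n psi \<omega>, \<lambda>i\<in>{1..n}. i \<in> A, \<pi> n \<omega>)) B * ?\<Phi> \<omega>))"
  proof -
    from borel_measurable_times[OF measurable_compose[OF measurable_map_first[OF fst_borel] hD_slice_measurable[of n A B]] \<Phi>]
    have m: "(\<lambda>x. partition_mass aD kD (hD n (\<lambda>i\<in>{1..n}. fst (fst x i), \<lambda>i\<in>{1..n}. i \<in> A, snd x)) B * \<Phi> x)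
        \<in> borel_measurable (PiM {1..n} (\<lambda>_. borel) \<Otimes>\<^sub>M R n)" by simp
    have "integrable M (\<lambda>\<omega>. partition_mass aD kD (hD n (\<lambda>i\<in>{1..n}. fst (upto_n n W \<omega> i), \<lambda>i\<in>{1..n}. i \<in> A, \<pi> n \<omega>)) B * ?\<Phi> \<omega>)"
    proof (rule Bochner_Integration.integrable_bound[OF int])
      show "(\<lambda>\<omega>. partition_mass aD kD (hD n (\<lambda>i\<in>{1..n}. fst (upto_n n W \<omega> i), \<lambda>i\<in>{1..n}. i \<in> A, \<pi> n \<omega>)) B * ?\<Phi> \<omega>) \<in> borel_measurable M"
        using measurable_from_subalg[OF subalgebra_FT measurable_FT[OF m]] by simp
      show "AE \<omega> in M. norm (partition_mass aD kD (hD n (\<lambda>i\<in>{1..n}. fst (upto_n n W \<omega> i), \<lambda>i\<in>{1..n}. i \<in> A, \<pi> n \<omega>)) B * ?\<Phi> \<omega>) \<le> norm (?\<Phi> \<omega>)"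
        using partition_mass_bounds[OF aD] by (auto simp: abs_mult intro!: AE_I2 mult_left_le_one_le)
    qed
    then show ?thesis using design_T[OF m, of A] by (simp add: upto_psi)
  qed
  also have "\<dots> = expectation (\<lambda>\<omega>. kappaD n (A, B) (upto_n n psi \<omega>, \<pi> n \<omega>) * ?\<Phi> \<omega>)"
  proof -
    have "(\<lambda>i\<in>{1..n}. f (upto_n n psi \<omega> i)) = upto_n n phi \<omega>" for \<omega>
      by (auto simp: upto_n_def phi_def psi_def fun_eq_iff)
    then show ?thesis by (simp add: kappaD_def ac_simps)
  qed
  finally show ?thesis .
qed

text \<open>The degenerate design: pr forgets the data, regressions are plain means, and
  \<open>clt_stage\<close> reduces to the central limit theorem for i.i.d. summands.\<close>

lemma finite_design_const:
  "n \<ge> 1 \<Longrightarrow> finite_design M \<mu> W (R n) (\<pi> n) n (count_space UNIV) (\<lambda>_. ()) (\<lambda>_. ()) {()} (\<lambda>_ _. 1)"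
  by (rule finite_designI) auto

lemma finite_design_T:
  assumes "n \<ge> 1"
  shows "finite_design M \<mu> W (R n) (\<pi> n) n borel (\<lambda>w. f (fst w)) (sampled n) (Pow {1..n}) (kappaT n)"
proof (rule finite_designI[OF assms])
  show "sampled n \<omega> \<in> Pow {1..n}" for \<omega> by (auto simp: sampled_def)
  show "(\<lambda>w::'v \<times> real \<times> real. f (fst w)) \<in> borel_measurable borel" by measurable
  fix A and \<Phi> :: "(nat \<Rightarrow> 'v \<times> real \<times> real) \<times> 'r \<Rightarrow> real" assume "\<Phi> \<in> borel_measurable (PiM {1..n} (\<lambda>_. borel) \<Otimes>\<^sub>M R n)" "integrable M (\<lambda>\<omega>. \<Phi> (upto_n n W \<omega>, \<pi> n \<omega>))"
  from design_T[OF this, of A]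
  show "expectation (\<lambda>\<omega>. of_bool (sampled n \<omega> = A) * \<Phi> (upto_n n W \<omega>, \<pi> n \<omega>)) =
    expectation (\<lambda>\<omega>. kappaT n A (\<lambda>i\<in>{1..n}. f (fst (W i \<omega>)), \<pi> n \<omega>) * \<Phi> (upto_n n W \<omega>, \<pi> n \<omega>))"
    by (simp add: upto_n_def phi_def)
qed (rule sampled_event kappaT_le kappaT_measurable | simp)+

lemma finite_design_D:
  assumes "n \<ge> 1"
  shows "finite_design M \<mu> W (R n) (\<pi> n) n borel fst (\<lambda>\<omega>. (sampled n \<omega>, treated n \<omega>)) (Pow {1..n} \<times> Pow {1..n}) (kappaD n)"
proof (rule finite_designI[OF assms])
  show "(sampled n \<omega>, treated n \<omega>) \<in> Pow {1..n} \<times> Pow {1..n}" for \<omega> by (auto simp: sampled_def treated_def)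
  fix z assume z: "z \<in> Pow {1..n} \<times> Pow {1..n}"
  then obtain A B where AB: "z = (A, B)" "A \<subseteq> {1..n}" by auto
  show "{\<omega> \<in> space M. (sampled n \<omega>, treated n \<omega>) = z} \<in> sets M"
    using treated_event[of n A B] by (simp add: AB)
  fix \<Phi> :: "(nat \<Rightarrow> 'v \<times> real \<times> real) \<times> 'r \<Rightarrow> real" assume "\<Phi> \<in> borel_measurable (PiM {1..n} (\<lambda>_. borel) \<Otimes>\<^sub>M R n)" "integrable M (\<lambda>\<omega>. \<Phi> (upto_n n W \<omega>, \<pi> n \<omega>))"
  from design_D[OF this AB(2), of B]
  show "expectation (\<lambda>\<omega>. of_bool ((sampled n \<omega>, treated n \<omega>) = z) * \<Phi> (upto_n n W \<omega>, \<pi> n \<omega>)) =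
    expectation (\<lambda>\<omega>. kappaD n z (\<lambda>i\<in>{1..n}. fst (W i \<omega>), \<pi> n \<omega>) * \<Phi> (upto_n n W \<omega>, \<pi> n \<omega>))"
    by (simp add: AB upto_n_def psi_def)
qed (use kappaD_le kappaD_measurable in auto)

end

section \<open>Operations on regression functions\<close>

lemma cond_exp_fn_residual:
  assumes ce: "cond_exp_fn \<mu> N pr g m" and pr: "pr \<in> measurable \<mu> N"
  shows "cond_exp_fn \<mu> N pr (\<lambda>w. c * (g w - m (pr w))) (\<lambda>_. 0)"
  unfolding cond_exp_fn_def
proof (intro conjI ballI impI)
  have g: "integrable \<mu> g" and mi: "integrable \<mu> (\<lambda>w. m (pr w))" and [measurable]: "m \<in> borel_measurable N"
    using ce by (auto simp: cond_exp_fn_def)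
  note [measurable] = borel_measurable_integrable[OF g] pr
  show "integrable \<mu> (\<lambda>w. c * (g w - m (pr w)))" using g mi by auto
  fix H :: "'b \<Rightarrow> real" assume H[measurable]: "H \<in> borel_measurable N" and "\<exists>B. \<forall>v. \<bar>H v\<bar> \<le> B"
  then obtain B where B: "\<And>v. \<bar>H v\<bar> \<le> B" by auto
  have i: "integrable \<mu> (\<lambda>w. h w * H (pr w))" if h: "integrable \<mu> h" for h
  proof (rule Bochner_Integration.integrable_bound[OF integrable_mult_right[of B, OF h]])
    note [measurable] = borel_measurable_integrable[OF h]
    show "(\<lambda>w. h w * H (pr w)) \<in> borel_measurable \<mu>" by measurable
    have "\<bar>h w\<bar> * \<bar>H (pr w)\<bar> \<le> \<bar>h w\<bar> * \<bar>B\<bar>" for w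
      using B[of "pr w"] by (intro mult_left_mono) auto
    then show "AE w in \<mu>. norm (h w * H (pr w)) \<le> norm (B * h w)" by (auto simp: abs_mult mult.commute)
  qed
  have "(\<integral>w. c * (g w - m (pr w)) * H (pr w) \<partial>\<mu>) = c * ((\<integral>w. g w * H (pr w) \<partial>\<mu>) - (\<integral>w. m (pr w) * H (pr w) \<partial>\<mu>))"
    using i[OF g] i[OF mi] by (simp add: left_diff_distrib mult.assoc)
  then show "(\<integral>w. c * (g w - m (pr w)) * H (pr w) \<partial>\<mu>) = (\<integral>w. 0 * H (pr w) \<partial>\<mu>)"
    using cond_exp_fnD[OF ce, of H B, OF H B] by simp
qed simp_all

lemma cond_exp_fn_lincomb:
  assumes ce: "cond_exp_fn \<mu> N pr g m" and ce': "cond_exp_fn \<mu> N pr g' m'" and pr: "pr \<in> measurable \<mu> N"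
  shows "cond_exp_fn \<mu> N pr (\<lambda>w. c * g w + d * g' w) (\<lambda>v. c * m v + d * m' v)"
  unfolding cond_exp_fn_def
proof (intro conjI ballI impI)
  have g: "integrable \<mu> g" "integrable \<mu> g'" and mi: "integrable \<mu> (\<lambda>w. m (pr w))" "integrable \<mu> (\<lambda>w. m' (pr w))"
    and [measurable]: "m \<in> borel_measurable N" "m' \<in> borel_measurable N"
    using ce ce' by (auto simp: cond_exp_fn_def)
  note [measurable] = pr
  show "integrable \<mu> (\<lambda>w. c * g w + d * g' w)" "integrable \<mu> (\<lambda>w. c * m (pr w) + d * m' (pr w))"
    "(\<lambda>v. c * m v + d * m' v) \<in> borel_measurable N" using g mi by auto
  fix H :: "'b \<Rightarrow> real" assume H[measurable]: "H \<in> borel_measurable N" and "\<exists>B. \<forall>v. \<bar>H v\<bar> \<le> B"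
  then obtain B where B: "\<And>v. \<bar>H v\<bar> \<le> B" by auto
  have i: "integrable \<mu> (\<lambda>w. h w * H (pr w))" if h: "integrable \<mu> h" for h
  proof (rule Bochner_Integration.integrable_bound[OF integrable_mult_right[of B, OF h]])
    note [measurable] = borel_measurable_integrable[OF h]
    show "(\<lambda>w. h w * H (pr w)) \<in> borel_measurable \<mu>" by measurable
    have "\<bar>h w\<bar> * \<bar>H (pr w)\<bar> \<le> \<bar>h w\<bar> * \<bar>B\<bar>" for w
      using B[of "pr w"] by (intro mult_left_mono) auto
    then show "AE w in \<mu>. norm (h w * H (pr w)) \<le> norm (B * h w)" by (auto simp: abs_mult mult.commute)
  qed
  have e: "(\<integral>w. (c * h w + d * h' w) * H (pr w) \<partial>\<mu>) = c * (\<integral>w. h w * H (pr w) \<partial>\<mu>) + d * (\<integral>w. h' w * H (pr w) \<partial>\<mu>)"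
    if "integrable \<mu> h" "integrable \<mu> h'" for h h'
    using i[OF that(1)] i[OF that(2)] by (simp add: distrib_right mult.assoc)
  show "(\<integral>w. (c * g w + d * g' w) * H (pr w) \<partial>\<mu>) = (\<integral>w. (c * m (pr w) + d * m' (pr w)) * H (pr w) \<partial>\<mu>)"
    unfolding e[OF g] e[OF mi] cond_exp_fnD[OF ce, of H B, OF H B] cond_exp_fnD[OF ce', of H B, OF H B] ..
qed

text \<open>A bounded function of \<open>f (pr w)\<close> is also a bounded function of
  \<open>pr w\<close>, so both regressions of g can be tested against it.\<close>

lemma cond_exp_fn_tower:
  assumes ce: "cond_exp_fn \<mu> N pr g m" and ce': "cond_exp_fn \<mu> L (\<lambda>w. f (pr w)) g c"
    and f: "f \<in> measurable N L"
  shows "cond_exp_fn \<mu> L (\<lambda>w. f (pr w)) (\<lambda>w. m (pr w)) c"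
  unfolding cond_exp_fn_def
proof (intro conjI ballI impI)
  show "integrable \<mu> (\<lambda>w. m (pr w))" "c \<in> borel_measurable L" "integrable \<mu> (\<lambda>w. c (f (pr w)))"
    using ce ce' by (auto simp: cond_exp_fn_def)
  fix H :: "'c \<Rightarrow> real" assume H: "H \<in> borel_measurable L" and "\<exists>B. \<forall>v. \<bar>H v\<bar> \<le> B"
  then obtain B where B: "\<And>v. \<bar>H v\<bar> \<le> B" by auto
  have "(\<integral>w. g w * H (f (pr w)) \<partial>\<mu>) = (\<integral>w. m (pr w) * H (f (pr w)) \<partial>\<mu>)"
    using cond_exp_fnD[OF ce, of "\<lambda>v. H (f v)" B, OF measurable_compose[OF f H] B] .
  then show "(\<integral>w. m (pr w) * H (f (pr w)) \<partial>\<mu>) = (\<integral>w. c (f (pr w)) * H (f (pr w)) \<partial>\<mu>)"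
    using cond_exp_fnD[OF ce', of H B, OF H B] by simp
qed

lemma cond_exp_fn_zero: "cond_exp_fn \<mu> N pr (\<lambda>_. 0) (\<lambda>_. 0)"
  by (simp add: cond_exp_fn_def)

lemma cond_exp_fn_integral:
  assumes "cond_exp_fn \<mu> N pr g m"
  shows "(\<integral>w. g w \<partial>\<mu>) = (\<integral>w. m (pr w) \<partial>\<mu>)"
  using cond_exp_fnD[OF assms, of "\<lambda>_. 1" 1] by simp

text \<open>Changing coordinate i alters a single summand, and that summand is a function of the
  projection.\<close>

lemma (in finite_design) adapted_iexp:
  assumes r: "\<And>z j. z \<in> S \<Longrightarrow> j \<in> {1..n} \<Longrightarrow> r z j \<in> borel_measurable N" and i: "i \<in> {1..n}"
  shows "adapted i (\<lambda>z w. iexp (c * (\<Sum>j=1..n. r z j (pr (w j)))))"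
  unfolding adapted_def
proof (intro conjI ballI allI)
  fix z assume z: "z \<in> S"
  have cm: "(\<lambda>w. r z j (pr (w j))) \<in> borel_measurable (PiM {1..n} (\<lambda>_. \<mu>))" if "j \<in> {1..n}" for j
    by (rule measurable_compose[OF measurable_compose[OF measurable_component_singleton[OF that] pr] r[OF z that]])
  have [measurable]: "(\<lambda>w. \<Sum>j=1..n. r z j (pr (w j))) \<in> borel_measurable (PiM {1..n} (\<lambda>_. \<mu>))"
    by (rule borel_measurable_sum, rule cm)
  show "(\<lambda>w. iexp (c * (\<Sum>j=1..n. r z j (pr (w j))))) \<in> borel_measurable (PiM {1..n} (\<lambda>_. \<mu>))" by measurable
  fix w
  have [measurable]: "r z i \<in> borel_measurable N" by (rule r[OF z i])
  let ?H = "\<lambda>v. iexp (c * (r z i v + (\<Sum>j\<in>{1..n} - {i}. r z j (pr (w j)))))"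
  have "(\<Sum>j=1..n. r z j (pr ((w(i := y)) j))) = r z i (pr y) + (\<Sum>j\<in>{1..n} - {i}. r z j (pr (w j)))" for y
    using i by (subst sum.remove[of _ i]) (auto intro!: sum.cong)
  then show "\<exists>H\<in>borel_measurable N. (\<forall>v. norm (H v) \<le> 1) \<and> (\<forall>y. iexp (c * (\<Sum>j=1..n. r z j (pr ((w(i := y)) j)))) = H (pr y))"
    by (intro bexI[of _ ?H]) simp_all
next
  show "norm (iexp (c * (\<Sum>j=1..n. r z j (pr (w j))))) \<le> 1" for z w by simp
qed

section \<open>Stagewise limits\<close>

locale local_experiment_sq = local_experiment +
  assumes Y0_sq: "integrable M (\<lambda>\<omega>. (fst (snd (W 1 \<omega>)))\<^sup>2)"
    and Y1_sq: "integrable M (\<lambda>\<omega>. (snd (snd (W 1 \<omega>)))\<^sup>2)"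
    and aD_less: "aD < kD"
begin

text \<open>\<open>x1\<close>, \<open>x0\<close>, \<open>dm\<close> and \<open>cate - ate\<close> are the summands of the leading terms, \<open>v1\<close>, \<open>v2\<close>, \<open>v3\<close> the limiting
  variances of the three stages, and \<open>s1\<close>, \<open>s0\<close>, \<open>sdm\<close> the conditional variances.\<close>
definition "q = real aT / real kT"
definition "p = real aD / real kD"

definition y0 :: "'b \<times> real \<times> real \<Rightarrow> real" where "y0 w = fst (snd w)"
definition y1 :: "'b \<times> real \<times> real \<Rightarrow> real" where "y1 w = snd (snd w)"
definition tau :: "'b \<times> real \<times> real \<Rightarrow> real" where "tau w = y1 w - y0 w"
definition ybar :: "'b \<times> real \<times> real \<Rightarrow> real" where "ybar w = (1 - p) * y1 w + p * y0 w"
definition "ate = (\<integral>w. tau w \<partial>\<mu>)"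
definition "m0 = (SOME m. cond_exp_fn \<mu> borel fst y0 m)"
definition "m1 = (SOME m. cond_exp_fn \<mu> borel fst y1 m)"
definition "cate = (SOME m. cond_exp_fn \<mu> borel (\<lambda>w. f (fst w)) tau m)"
definition "x0 w = - (1 / (q * (1 - p))) * (y0 w - m0 (fst w))"
definition "x1 w = 1 / (q * p) * (y1 w - m1 (fst w))"
definition "dm v = 1 / q * (m1 v - m0 v - cate (f v))"
definition "bal v = (1 - p) * m1 v + p * m0 v"
definition "s0 = (SOME s. cond_exp_fn \<mu> borel fst (\<lambda>w. (x0 w)\<^sup>2) s \<and> (\<forall>v. 0 \<le> s v))"
definition "s1 = (SOME s. cond_exp_fn \<mu> borel fst (\<lambda>w. (x1 w)\<^sup>2) s \<and> (\<forall>v. 0 \<le> s v))"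
definition "sdm = (SOME s. cond_exp_fn \<mu> borel (\<lambda>w. f (fst w)) (\<lambda>w. (dm (fst w))\<^sup>2) s \<and> (\<forall>v. 0 \<le> s v))"
definition "v1 = q * (p * (\<integral>w. (x1 w)\<^sup>2 \<partial>\<mu>) + (1 - p) * (\<integral>w. (x0 w)\<^sup>2 \<partial>\<mu>))"
definition "v2 = q * (\<integral>w. (dm (fst w))\<^sup>2 \<partial>\<mu>)"
definition "v3 = (\<integral>w. (cate (f (fst w)) - ate)\<^sup>2 \<partial>\<mu>)"

lemma q_bounds: "0 < q" "q \<le> 1" using aT by (auto simp: q_def divide_simps)
lemma p_bounds: "0 < p" "p < 1" using aD aD_less by (auto simp: p_def divide_simps)

sublocale mu: prob_space \<mu> by (rule prob_\<mu>)

lemma fst_\<mu>[measurable]: "fst \<in> measurable \<mu> borel"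
  by (simp add: measurable_cong_sets[OF sets_\<mu> refl])

lemma ffst_\<mu>[measurable]: "(\<lambda>w. f (fst w)) \<in> measurable \<mu> borel"
  by measurable

lemma y_meas[measurable]: "y0 \<in> borel_measurable borel" "y1 \<in> borel_measurable borel"
  "tau \<in> borel_measurable borel" "ybar \<in> borel_measurable borel"
  unfolding y0_def[abs_def] y1_def[abs_def] tau_def[abs_def] ybar_def[abs_def] by measurable

lemma y_sq: "integrable \<mu> (\<lambda>w. (y0 w)\<^sup>2)" "integrable \<mu> (\<lambda>w. (y1 w)\<^sup>2)"
  using Y0_sq Y1_sq integrable_distr_eq[OF W_meas[of 1], of "\<lambda>w. (y0 w)\<^sup>2"] integrable_distr_eq[OF W_meas[of 1], of "\<lambda>w. (y1 w)\<^sup>2"]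
  by (simp_all add: \<mu>_def y0_def y1_def)

lemma tau_sq: "integrable \<mu> (\<lambda>w. (tau w)\<^sup>2)"
  unfolding tau_def using y_sq by (intro integrable_power2_diff) auto

lemma ybar_sq: "integrable \<mu> (\<lambda>w. (ybar w)\<^sup>2)"
  unfolding ybar_def using y_sq by (intro integrable_power2_add integrable_power2_cmult) auto

lemma y_int: "integrable \<mu> y0" "integrable \<mu> y1" "integrable \<mu> tau"
  using y_sq tau_sq by (auto intro!: mu.expectation_abs_le_sqrt(1))

lemma m0_ce: "cond_exp_fn \<mu> borel fst y0 m0"
  unfolding m0_def by (rule someI_ex[OF cond_exp_fn_exists[OF prob_\<mu> fst_\<mu> y_int(1)]])
lemma m1_ce: "cond_exp_fn \<mu> borel fst y1 m1"
  unfolding m1_def by (rule someI_ex[OF cond_exp_fn_exists[OF prob_\<mu> fst_\<mu> y_int(2)]])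
lemma cate_ce: "cond_exp_fn \<mu> borel (\<lambda>w. f (fst w)) tau cate"
  unfolding cate_def by (rule someI_ex[OF cond_exp_fn_exists[OF prob_\<mu> ffst_\<mu> y_int(3)]])

lemma reg_meas[measurable]: "m0 \<in> borel_measurable borel" "m1 \<in> borel_measurable borel" "cate \<in> borel_measurable borel"
  using m0_ce m1_ce cate_ce by (auto simp: cond_exp_fn_def)

lemma derived_meas[measurable]: "dm \<in> borel_measurable borel" "bal \<in> borel_measurable borel"
  "x0 \<in> borel_measurable borel" "x1 \<in> borel_measurable borel"
  unfolding dm_def[abs_def] bal_def[abs_def] x0_def[abs_def] x1_def[abs_def] by measurable

lemma m_sq: "integrable \<mu> (\<lambda>w. (m0 (fst w))\<^sup>2)" "integrable \<mu> (\<lambda>w. (m1 (fst w))\<^sup>2)"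
  by (rule cond_exp_fn_square[OF prob_\<mu> fst_\<mu> m0_ce y_sq(1)], rule cond_exp_fn_square[OF prob_\<mu> fst_\<mu> m1_ce y_sq(2)])

lemma cate_sq: "integrable \<mu> (\<lambda>w. (cate (f (fst w)))\<^sup>2)"
  by (rule cond_exp_fn_square[OF prob_\<mu> ffst_\<mu> cate_ce tau_sq])

lemma bal_sq: "integrable \<mu> (\<lambda>w. (bal (fst w))\<^sup>2)"
  unfolding bal_def using m_sq by (intro integrable_power2_add integrable_power2_cmult) auto

lemma x_sq: "integrable \<mu> (\<lambda>w. (x0 w)\<^sup>2)" "integrable \<mu> (\<lambda>w. (x1 w)\<^sup>2)"
  unfolding x0_def x1_def using m_sq y_sq by (intro integrable_power2_cmult integrable_power2_diff; simp)+

lemma dm_sq: "integrable \<mu> (\<lambda>w. (dm (fst w))\<^sup>2)"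
  unfolding dm_def using m_sq cate_sq by (intro integrable_power2_cmult integrable_power2_diff) auto

lemma cate_dev_sq: "integrable \<mu> (\<lambda>w. (cate (f (fst w)) - ate)\<^sup>2)"
  using cate_sq by (intro integrable_power2_diff) auto

lemma x_ce: "cond_exp_fn \<mu> borel fst x0 (\<lambda>_. 0)" "cond_exp_fn \<mu> borel fst x1 (\<lambda>_. 0)"
  unfolding x0_def[abs_def] x1_def[abs_def]
  by (rule cond_exp_fn_residual[OF m0_ce fst_\<mu>], rule cond_exp_fn_residual[OF m1_ce fst_\<mu>])

lemma tau_ce: "cond_exp_fn \<mu> borel fst tau (\<lambda>v. m1 v - m0 v)"
  using cond_exp_fn_lincomb[OF m1_ce m0_ce fst_\<mu>, of 1 "-1"] by (simp add: tau_def[abs_def])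

lemma ybar_ce: "cond_exp_fn \<mu> borel fst ybar bal"
  using cond_exp_fn_lincomb[OF m1_ce m0_ce fst_\<mu>, of "1 - p" p] by (simp add: ybar_def[abs_def] bal_def[abs_def])

text \<open>By the tower property \<open>cate\<close> is also the regression of
  \<open>m1 - m0\<close> on \<psi>1, and dm is a multiple of the residual.\<close>

lemma dm_ce: "cond_exp_fn \<mu> borel (\<lambda>w. f (fst w)) (\<lambda>w. dm (fst w)) (\<lambda>_. 0)"
  unfolding dm_def by (rule cond_exp_fn_residual[OF cond_exp_fn_tower[OF tau_ce cate_ce f] ffst_\<mu>])

lemma s0_ce: "cond_exp_fn \<mu> borel fst (\<lambda>w. (x0 w)\<^sup>2) s0" "0 \<le> s0 v"
  using someI_ex[OF cond_exp_fn_nonneg_exists[OF prob_\<mu> fst_\<mu> x_sq(1) zero_le_power2]] by (auto simp: s0_def)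
lemma s1_ce: "cond_exp_fn \<mu> borel fst (\<lambda>w. (x1 w)\<^sup>2) s1" "0 \<le> s1 v"
  using someI_ex[OF cond_exp_fn_nonneg_exists[OF prob_\<mu> fst_\<mu> x_sq(2) zero_le_power2]] by (auto simp: s1_def)
lemma sdm_ce: "cond_exp_fn \<mu> borel (\<lambda>w. f (fst w)) (\<lambda>w. (dm (fst w))\<^sup>2) sdm" "0 \<le> sdm v"
  using someI_ex[OF cond_exp_fn_nonneg_exists[OF prob_\<mu> ffst_\<mu> dm_sq zero_le_power2]] by (auto simp: sdm_def)

lemma s_int: "integrable \<mu> (\<lambda>w. s0 (fst w))" "integrable \<mu> (\<lambda>w. s1 (fst w))" "integrable \<mu> (\<lambda>w. sdm (f (fst w)))"
  using s0_ce s1_ce sdm_ce by (auto simp: cond_exp_fn_def)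

lemma v_nonneg: "0 \<le> v1" "0 \<le> v2" "0 \<le> v3"
  using q_bounds p_bounds by (auto simp: v1_def v2_def v3_def)

lemma integrable_W: "i \<ge> 1 \<Longrightarrow> integrable \<mu> h \<Longrightarrow> integrable M (\<lambda>\<omega>. h (W i \<omega>) :: real)"
  using integrable_distr[OF W_\<mu>, of i h] law_W by simp

lemma expectation_W: "i \<ge> 1 \<Longrightarrow> h \<in> borel_measurable \<mu> \<Longrightarrow> expectation (\<lambda>\<omega>. h (W i \<omega>)) = (\<integral>w. (h w :: real) \<partial>\<mu>)"
  using integral_distr[OF W_\<mu>, of i h] law_W by simp

lemma indep_\<mu>: "indep_vars (\<lambda>_. \<mu>) W {1..}"
proof -
  have "measurable M \<mu> = borel_measurable M" by (rule measurable_cong_sets) (simp_all add: sets_\<mu>)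
  then show ?thesis using W_indep by (simp add: indep_vars_def sets_\<mu>)
qed

definition "devT n h \<omega> = (\<Sum>i=1..n. (of_bool (T n i \<omega>) - q) * h (W i \<omega>))"
definition "devD n h \<omega> = (\<Sum>i=1..n. of_bool (T n i \<omega>) * (of_bool (D n i \<omega>) - p) * h (W i \<omega>))"

lemma T_bool[measurable]: "i \<in> {1..n} \<Longrightarrow> (\<lambda>\<omega>. of_bool (T n i \<omega>) :: real) \<in> borel_measurable M"
  by (rule measurable_compose[OF T_meas]) auto

lemma D_bool[measurable]: "i \<in> {1..n} \<Longrightarrow> (\<lambda>\<omega>. of_bool (D n i \<omega>) :: real) \<in> borel_measurable M"
  by (rule measurable_compose[OF D_meas]) auto

text \<open>\<open>devT\<close> and \<open>devD\<close> are the total \<open>group_sum\<close> of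
  the two randomizations, so \<open>second_moment_le\<close> applies with the group sizes kT and kD.
  The factor T in \<open>devD\<close> restricts it to sampled units.\<close>

lemma dev_bound:
  assumes h[measurable]: "h \<in> borel_measurable borel" and h2: "integrable \<mu> (\<lambda>w. (h w)\<^sup>2)"
  shows "integrable M (\<lambda>\<omega>. (devT n h \<omega>)\<^sup>2)" "expectation (\<lambda>\<omega>. (devT n h \<omega>)\<^sup>2) \<le> kT * (n * (\<integral>w. (h w)\<^sup>2 \<partial>\<mu>))"
    and "integrable M (\<lambda>\<omega>. (devD n h \<omega>)\<^sup>2)" "expectation (\<lambda>\<omega>. (devD n h \<omega>)\<^sup>2) \<le> kD * (n * (\<integral>w. (h w)\<^sup>2 \<partial>\<mu>))"
proof -
  interpret gT: randomized_groups M "FT n" "\<lambda>_. {1..n}" "GrT n" "T n" aT kT n by (rule groups_T)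
  interpret gD: randomized_groups M "FD n" "sampled n" "GrD n" "D n" aD kD n by (rule groups_D)
  have eT: "devT n h \<omega> = gT.group_sum (\<lambda>i \<omega>. h (W i \<omega>)) {1..n} \<omega>" for \<omega>
    by (simp add: devT_def gT.group_sum_def gT.share_def q_def)
  have eD: "devD n h \<omega> = gD.group_sum (\<lambda>i \<omega>. h (W i \<omega>)) (sampled n \<omega>) \<omega>" for \<omega>
    unfolding devD_def gD.group_sum_def gD.share_def p_def sampled_def
    by (rule sum.mono_neutral_cong_right) auto
  have hW: "integrable M (\<lambda>\<omega>. (h (W i \<omega>))\<^sup>2)" if "i \<in> {1..n}" for i
    using integrable_W[of i "\<lambda>w. (h w)\<^sup>2"] h2 that by simp
  have "(\<Sum>i\<in>{1..n}. expectation (\<lambda>\<omega>. (h (W i \<omega>))\<^sup>2)) = (\<Sum>i\<in>{1..n}. (\<integral>w. (h w)\<^sup>2 \<partial>\<mu>))"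
    by (intro sum.cong refl expectation_W) auto
  then have eS: "(\<Sum>i\<in>{1..n}. expectation (\<lambda>\<omega>. (h (W i \<omega>))\<^sup>2)) = n * (\<integral>w. (h w)\<^sup>2 \<partial>\<mu>)" by simp
  show "integrable M (\<lambda>\<omega>. (devT n h \<omega>)\<^sup>2)" "integrable M (\<lambda>\<omega>. (devD n h \<omega>)\<^sup>2)"
    unfolding eT eD by (intro gT.second_moment(1) gD.second_moment(1) W_component_FT W_component_FD h hW; assumption)+
  show "expectation (\<lambda>\<omega>. (devT n h \<omega>)\<^sup>2) \<le> kT * (n * (\<integral>w. (h w)\<^sup>2 \<partial>\<mu>))"
    unfolding eT eS[symmetric] by (intro gT.second_moment_le W_component_FT h hW; assumption)
  show "expectation (\<lambda>\<omega>. (devD n h \<omega>)\<^sup>2) \<le> kD * (n * (\<integral>w. (h w)\<^sup>2 \<partial>\<mu>))"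
    unfolding eD eS[symmetric] by (intro gD.second_moment_le W_component_FD h hW; assumption)
qed

lemma bounded_sq_limit:
  assumes "\<And>n. expectation (\<lambda>\<omega>. (X n \<omega>)\<^sup>2) \<le> C * real n"
  shows "(\<lambda>n. expectation (\<lambda>\<omega>. (X n \<omega> / n - 0)\<^sup>2)) \<longlonglongrightarrow> 0"
proof (rule tendsto_sandwich[of "\<lambda>_. 0" _ _ "\<lambda>n. C * (1 / real n)"])
  show "\<forall>\<^sub>F n in sequentially. expectation (\<lambda>\<omega>. (X n \<omega> / n - 0)\<^sup>2) \<le> C * (1 / real n)"
  proof (rule eventually_sequentiallyI[of 1])
    fix n :: nat assume n: "1 \<le> n"
    have "expectation (\<lambda>\<omega>. (X n \<omega> / n - 0)\<^sup>2) = expectation (\<lambda>\<omega>. (X n \<omega>)\<^sup>2) / (real n)\<^sup>2"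
      by (simp add: power_divide)
    also have "\<dots> \<le> C * real n / (real n)\<^sup>2" by (intro divide_right_mono assms) auto
    also have "\<dots> = C * (1 / real n)" using n by (simp add: power2_eq_square)
    finally show "expectation (\<lambda>\<omega>. (X n \<omega> / n - 0)\<^sup>2) \<le> C * (1 / real n)" .
  qed
  show "(\<lambda>n. C * (1 / real n)) \<longlonglongrightarrow> 0"
    using tendsto_mult[OF tendsto_const[of C] lim_1_over_n] by simp
qed auto

lemma bounded_sq:
  assumes "h \<in> borel_measurable \<mu>" "\<And>w. \<bar>h w\<bar> \<le> (B::real)"
  shows "integrable \<mu> (\<lambda>w. (h w)\<^sup>2)"
proof (rule mu.integrable_const_bound[where B = "B\<^sup>2"])
  have "(h w)\<^sup>2 \<le> B\<^sup>2" for w using order_trans[OF assms(2) abs_ge_self, of w] unfolding abs_le_square_iff .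
  then show "AE w in \<mu>. norm ((h w)\<^sup>2) \<le> B\<^sup>2" by simp
qed (use assms(1) in simp)

lemma borel_\<mu>: "h \<in> borel_measurable \<mu> \<longleftrightarrow> h \<in> borel_measurable borel"
  by (simp add: measurable_cong_sets[OF sets_\<mu> refl])

text \<open>\<open>weighted_weak_law\<close> with weights T - q and c = 0: for bounded functions
  \<open>dev_bound\<close> gives a second moment of order n.\<close>

lemma weak_law_T:
  assumes "integrable \<mu> h"
  shows "(\<lambda>n. expectation (\<lambda>\<omega>. \<bar>devT n h \<omega> / n\<bar>)) \<longlonglongrightarrow> 0"
proof -
  have "(\<lambda>n. expectation (\<lambda>\<omega>. \<bar>(\<Sum>i=1..n. (of_bool (T n i \<omega>) - q) * h (W i \<omega>)) / n - 0 * (\<integral>w. h w \<partial>\<mu>)\<bar>)) \<longlonglongrightarrow> 0"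
  proof (rule weighted_weak_law[where A = "\<lambda>n i \<omega>. of_bool (T n i \<omega>) - q", OF W_\<mu> law_W _ _ _ _ assms])
    show "\<bar>of_bool (T n i \<omega>) - q\<bar> \<le> 1" for n i \<omega> using q_bounds by (cases "T n i \<omega>") auto
    fix g :: "'b \<times> real \<times> real \<Rightarrow> real" and B assume g: "g \<in> borel_measurable \<mu>" "\<And>w. \<bar>g w\<bar> \<le> B"
    have "expectation (\<lambda>\<omega>. (devT n g \<omega>)\<^sup>2) \<le> (kT * (\<integral>w. (g w)\<^sup>2 \<partial>\<mu>)) * real n" for n
      using dev_bound(2)[OF g(1)[unfolded borel_\<mu>] bounded_sq[OF g], of n] by (simp add: ac_simps)
    from bounded_sq_limit[OF this]
    show "(\<lambda>n. expectation (\<lambda>\<omega>. ((\<Sum>i=1..n. (of_bool (T n i \<omega>) - q) * g (W i \<omega>)) / n - 0 * (\<integral>w. g w \<partial>\<mu>))\<^sup>2)) \<longlonglongrightarrow> 0"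
      by (simp add: devT_def)
  qed auto
  then show ?thesis by (simp add: devT_def)
qed

lemma weak_law_D:
  assumes "integrable \<mu> h"
  shows "(\<lambda>n. expectation (\<lambda>\<omega>. \<bar>devD n h \<omega> / n\<bar>)) \<longlonglongrightarrow> 0"
proof -
  have "(\<lambda>n. expectation (\<lambda>\<omega>. \<bar>(\<Sum>i=1..n. (of_bool (T n i \<omega>) * (of_bool (D n i \<omega>) - p)) * h (W i \<omega>)) / n - 0 * (\<integral>w. h w \<partial>\<mu>)\<bar>)) \<longlonglongrightarrow> 0"
  proof (rule weighted_weak_law[where A = "\<lambda>n i \<omega>. of_bool (T n i \<omega>) * (of_bool (D n i \<omega>) - p)", OF W_\<mu> law_W _ _ _ _ assms])
    show "\<bar>of_bool (T n i \<omega>) * (of_bool (D n i \<omega>) - p)\<bar> \<le> 1" for n i \<omega>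
      using p_bounds by (cases "T n i \<omega>"; cases "D n i \<omega>") auto
    fix g :: "'b \<times> real \<times> real \<Rightarrow> real" and B assume g: "g \<in> borel_measurable \<mu>" "\<And>w. \<bar>g w\<bar> \<le> B"
    have "expectation (\<lambda>\<omega>. (devD n g \<omega>)\<^sup>2) \<le> (kD * (\<integral>w. (g w)\<^sup>2 \<partial>\<mu>)) * real n" for n
      using dev_bound(4)[OF g(1)[unfolded borel_\<mu>] bounded_sq[OF g], of n] by (simp add: ac_simps)
    from bounded_sq_limit[OF this]
    show "(\<lambda>n. expectation (\<lambda>\<omega>. ((\<Sum>i=1..n. (of_bool (T n i \<omega>) * (of_bool (D n i \<omega>) - p)) * g (W i \<omega>)) / n - 0 * (\<integral>w. g w \<partial>\<mu>))\<^sup>2)) \<longlonglongrightarrow> 0"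
      by (simp add: devD_def)
  qed auto
  then show ?thesis by (simp add: devD_def)
qed

lemma weak_law_iid:
  assumes "integrable \<mu> h"
  shows "(\<lambda>n. expectation (\<lambda>\<omega>. \<bar>(\<Sum>i=1..n. h (W i \<omega>)) / n - (\<integral>w. h w \<partial>\<mu>)\<bar>)) \<longlonglongrightarrow> 0"
proof -
  have "(\<lambda>n. expectation (\<lambda>\<omega>. \<bar>(\<Sum>i=1..n. 1 * h (W i \<omega>)) / n - 1 * (\<integral>w. h w \<partial>\<mu>)\<bar>)) \<longlonglongrightarrow> 0"
  proof (rule weighted_weak_law[where A = "\<lambda>n i \<omega>. 1", OF W_\<mu> law_W _ _ _ _ assms])
    fix g :: "'b \<times> real \<times> real \<Rightarrow> real" and B assume g: "g \<in> borel_measurable \<mu>" "\<And>w. \<bar>g w\<bar> \<le> B"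
    define h where "h w = g w - (\<integral>w. g w \<partial>\<mu>)" for w
    have gi: "integrable \<mu> g" using mu.expectation_abs_le_sqrt(1)[OF g(1) bounded_sq[OF g]] .
    have h0: "(\<integral>w. h w \<partial>\<mu>) = 0" using gi using mu.prob_space by (simp add: h_def)
    have h2: "integrable \<mu> (\<lambda>w. (h w)\<^sup>2)"
      unfolding h_def using g bounded_sq[OF g] by (intro integrable_power2_diff) auto
    have hm: "h \<in> borel_measurable \<mu>" unfolding h_def[abs_def] using g(1) by simp
    have "expectation (\<lambda>\<omega>. (\<Sum>i=1..n. h (W i \<omega>))\<^sup>2) \<le> (\<integral>w. (h w)\<^sup>2 \<partial>\<mu>) * real n" for n
      using iid_second_moment(2)[OF indep_\<mu> law_W hm h2 h0] by (simp add: mult.commute)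
    from bounded_sq_limit[OF this]
    have "(\<lambda>n. expectation (\<lambda>\<omega>. ((\<Sum>i=1..n. h (W i \<omega>)) / n - 0)\<^sup>2)) \<longlonglongrightarrow> 0" .
    then show "(\<lambda>n. expectation (\<lambda>\<omega>. ((\<Sum>i=1..n. 1 * g (W i \<omega>)) / n - 1 * (\<integral>w. g w \<partial>\<mu>))\<^sup>2)) \<longlonglongrightarrow> 0"
    proof (rule Lim_transform_eventually)
      show "\<forall>\<^sub>F n in sequentially. expectation (\<lambda>\<omega>. ((\<Sum>i=1..n. h (W i \<omega>)) / n - 0)\<^sup>2)
          = expectation (\<lambda>\<omega>. ((\<Sum>i=1..n. 1 * g (W i \<omega>)) / n - 1 * (\<integral>w. g w \<partial>\<mu>))\<^sup>2)"
        by (rule eventually_sequentiallyI[of 1]) (simp add: h_def sum_subtractf diff_divide_distrib)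
    qed
  qed auto
  then show ?thesis by simp
qed

end

section \<open>Laws of large numbers along the design, and the three stages of conditioning\<close>

context local_experiment_sq
begin

text \<open>Written with the sets \<open>sampled\<close> and \<open>treated\<close> in place of T
  and D, so that it is a function of the realized design as \<open>finite_design\<close>
  demands.\<close>

definition "xs n \<omega> = (\<Sum>i=1..n. of_bool (i \<in> sampled n \<omega>) * (if i \<in> treated n \<omega> then x1 (W i \<omega>) else x0 (W i \<omega>)))"
definition "us n \<omega> = (\<Sum>i=1..n. of_bool (i \<in> sampled n \<omega>) * dm (fst (W i \<omega>)))"
definition "cs n \<omega> = (\<Sum>i=1..n. cate (f (fst (W i \<omega>))) - ate)"

lemma W_comp: "i \<in> {1..n} \<Longrightarrow> h \<in> borel_measurable borel \<Longrightarrow> (\<lambda>\<omega>. h (W i \<omega>)) \<in> borel_measurable M"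
  by (rule measurable_compose[OF W_meas]) auto

lemma dev_int:
  assumes h: "integrable \<mu> h"
  shows "integrable M (devT n h)" "integrable M (devD n h)"
proof -
  have hm: "h \<in> borel_measurable borel" using borel_measurable_integrable[OF h] by (simp add: borel_\<mu>)
  have "integrable M (\<lambda>\<omega>. (of_bool (T n i \<omega>) - q) * h (W i \<omega>))"
    "integrable M (\<lambda>\<omega>. of_bool (T n i \<omega>) * (of_bool (D n i \<omega>) - p) * h (W i \<omega>))" if i: "i \<in> {1..n}" for i
  proof -
    have hi: "integrable M (\<lambda>\<omega>. h (W i \<omega>))" using integrable_W[OF _ h] i by simp
    note [measurable] = T_bool[OF i] D_bool[OF i] W_comp[OF i hm]
    have b1: "\<bar>of_bool (T n i \<omega>) - q\<bar> \<le> 1" for \<omega> using q_bounds by (cases "T n i \<omega>") auto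
    have b2: "\<bar>of_bool (T n i \<omega>) * (of_bool (D n i \<omega>) - p)\<bar> \<le> 1" for \<omega>
      using p_bounds by (cases "T n i \<omega>"; cases "D n i \<omega>") auto
    show "integrable M (\<lambda>\<omega>. (of_bool (T n i \<omega>) - q) * h (W i \<omega>))"
    proof (rule Bochner_Integration.integrable_bound[OF hi])
      show "(\<lambda>\<omega>. (of_bool (T n i \<omega>) - q) * h (W i \<omega>)) \<in> borel_measurable M" by measurable
      show "AE \<omega> in M. norm ((of_bool (T n i \<omega>) - q) * h (W i \<omega>)) \<le> norm (h (W i \<omega>))"
        unfolding norm_mult using b1 by (intro AE_I2 mult_left_le_one_le) auto
    qed
    show "integrable M (\<lambda>\<omega>. of_bool (T n i \<omega>) * (of_bool (D n i \<omega>) - p) * h (W i \<omega>))"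
    proof (rule Bochner_Integration.integrable_bound[OF hi])
      show "(\<lambda>\<omega>. of_bool (T n i \<omega>) * (of_bool (D n i \<omega>) - p) * h (W i \<omega>)) \<in> borel_measurable M" by measurable
      show "AE \<omega> in M. norm (of_bool (T n i \<omega>) * (of_bool (D n i \<omega>) - p) * h (W i \<omega>)) \<le> norm (h (W i \<omega>))"
        unfolding norm_mult[of _ "h _"] using b2 by (intro AE_I2 mult_left_le_one_le) auto
    qed
  qed
  then show "integrable M (devT n h)" "integrable M (devD n h)"
    unfolding devT_def[abs_def] devD_def[abs_def] by (auto intro!: Bochner_Integration.integrable_sum)
qed

lemma mean_int: "integrable \<mu> h \<Longrightarrow> integrable M (\<lambda>\<omega>. (\<Sum>i=1..n. h (W i \<omega>)) / n - (\<integral>w. h w \<partial>\<mu>))"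
  by (intro Bochner_Integration.integrable_diff integrable_divide_zero Bochner_Integration.integrable_sum integrable_W) auto

text \<open>Split T as (T - q) + q: the first part vanishes by \<open>weak_law_T\<close>, the second
  is the law of large numbers for i.i.d. variables.\<close>

lemma sampled_law:
  assumes h: "integrable \<mu> h"
  shows "(\<lambda>n. expectation (\<lambda>\<omega>. \<bar>(\<Sum>i=1..n. of_bool (i \<in> sampled n \<omega>) * h (W i \<omega>)) / n - q * (\<integral>w. h w \<partial>\<mu>)\<bar>)) \<longlonglongrightarrow> 0"
proof (rule tendsto_sandwich[of "\<lambda>_. 0"])
  let ?A = "\<lambda>n \<omega>. (\<Sum>i=1..n. of_bool (i \<in> sampled n \<omega>) * h (W i \<omega>)) / n - q * (\<integral>w. h w \<partial>\<mu>)"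
  let ?b = "\<lambda>n. expectation (\<lambda>\<omega>. \<bar>devT n h \<omega> / n\<bar>) + q * expectation (\<lambda>\<omega>. \<bar>(\<Sum>i=1..n. h (W i \<omega>)) / n - (\<integral>w. h w \<partial>\<mu>)\<bar>)"
  show "?b \<longlonglongrightarrow> 0"
    using tendsto_add[OF weak_law_T[OF h] tendsto_mult[OF tendsto_const[of q] weak_law_iid[OF h]]] by simp
  show "\<forall>\<^sub>F n in sequentially. expectation (\<lambda>\<omega>. \<bar>?A n \<omega>\<bar>) \<le> ?b n"
  proof (rule always_eventually, rule allI)
    fix n
    have eq: "?A n \<omega>
        = devT n h \<omega> / n + q * ((\<Sum>i=1..n. h (W i \<omega>)) / n - (\<integral>w. h w \<partial>\<mu>))" for \<omega>
    proof -
      have "(\<Sum>i=1..n. of_bool (i \<in> sampled n \<omega>) * h (W i \<omega>)) = devT n h \<omega> + q * (\<Sum>i=1..n. h (W i \<omega>))"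
        unfolding devT_def sum_distrib_left sum.distrib[symmetric]
        by (intro sum.cong refl) (auto simp: sampled_def algebra_simps)
      then show ?thesis by (simp add: add_divide_distrib right_diff_distrib)
    qed
    have i1: "integrable M (\<lambda>\<omega>. devT n h \<omega> / n)" using dev_int(1)[OF h] by (rule integrable_divide_zero)
    have i2: "integrable M (\<lambda>\<omega>. (\<Sum>i=1..n. h (W i \<omega>)) / n - (\<integral>w. h w \<partial>\<mu>))" by (rule mean_int[OF h])
    have "expectation (\<lambda>\<omega>. \<bar>devT n h \<omega> / n + q * ((\<Sum>i=1..n. h (W i \<omega>)) / n - (\<integral>w. h w \<partial>\<mu>))\<bar>)
        \<le> expectation (\<lambda>\<omega>. \<bar>devT n h \<omega> / n\<bar> + q * \<bar>(\<Sum>i=1..n. h (W i \<omega>)) / n - (\<integral>w. h w \<partial>\<mu>)\<bar>)"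
    proof (rule integral_mono)
      show "\<bar>devT n h \<omega> / n + q * ((\<Sum>i=1..n. h (W i \<omega>)) / n - (\<integral>w. h w \<partial>\<mu>))\<bar>
          \<le> \<bar>devT n h \<omega> / n\<bar> + q * \<bar>(\<Sum>i=1..n. h (W i \<omega>)) / n - (\<integral>w. h w \<partial>\<mu>)\<bar>" for \<omega>
        using q_bounds abs_triangle_ineq[of "devT n h \<omega> / n" "q * ((\<Sum>i=1..n. h (W i \<omega>)) / n - (\<integral>w. h w \<partial>\<mu>))"]
        by (simp only: abs_mult abs_of_pos)
    qed (intro integrable_abs Bochner_Integration.integrable_add integrable_mult_right i1 i2)+
    also have "\<dots> = ?b n"
      unfolding Bochner_Integration.integral_add[OF integrable_abs[OF i1] integrable_mult_right[OF integrable_abs[OF i2]]]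
      by (simp only: integral_mult_right_zero)
    finally show "expectation (\<lambda>\<omega>. \<bar>?A n \<omega>\<bar>) \<le> ?b n"
      unfolding eq .
  qed
qed auto

text \<open>On sampled units,
  \<open>D h1 + (1 - D) h0 = (D - p) (h1 - h0) + p h1 + (1 - p) h0\<close>. The first part vanishes
  by \<open>weak_law_D\<close>, the rest is covered by \<open>sampled_law\<close>.\<close>

lemma treated_law:
  assumes h1: "integrable \<mu> h1" and h0: "integrable \<mu> h0"
  shows "(\<lambda>n. expectation (\<lambda>\<omega>. \<bar>(\<Sum>i=1..n. of_bool (i \<in> sampled n \<omega>) * (if i \<in> treated n \<omega> then h1 (W i \<omega>) else h0 (W i \<omega>))) / n
     - q * (p * (\<integral>w. h1 w \<partial>\<mu>) + (1 - p) * (\<integral>w. h0 w \<partial>\<mu>))\<bar>)) \<longlonglongrightarrow> 0"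
proof (rule tendsto_sandwich[of "\<lambda>_. 0"])
  let ?A = "\<lambda>n \<omega>. (\<Sum>i=1..n. of_bool (i \<in> sampled n \<omega>) * (if i \<in> treated n \<omega> then h1 (W i \<omega>) else h0 (W i \<omega>))) / n
     - q * (p * (\<integral>w. h1 w \<partial>\<mu>) + (1 - p) * (\<integral>w. h0 w \<partial>\<mu>))"
  define hd where "hd w = h1 w - h0 w" for w
  define hm where "hm w = p * h1 w + (1 - p) * h0 w" for w
  have hd: "integrable \<mu> hd" and hm: "integrable \<mu> hm"
    unfolding hd_def[abs_def] hm_def[abs_def] using h1 h0 by auto
  have Ehm: "(\<integral>w. hm w \<partial>\<mu>) = p * (\<integral>w. h1 w \<partial>\<mu>) + (1 - p) * (\<integral>w. h0 w \<partial>\<mu>)"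
    unfolding hm_def using h1 h0 by simp
  let ?S = "\<lambda>n \<omega>. (\<Sum>i=1..n. of_bool (i \<in> sampled n \<omega>) * hm (W i \<omega>)) / n - q * (\<integral>w. hm w \<partial>\<mu>)"
  let ?b = "\<lambda>n. expectation (\<lambda>\<omega>. \<bar>devD n hd \<omega> / n\<bar>) + expectation (\<lambda>\<omega>. \<bar>?S n \<omega>\<bar>)"
  show "?b \<longlonglongrightarrow> 0"
    using tendsto_add[OF weak_law_D[OF hd] sampled_law[OF hm]] by simp
  show "\<forall>\<^sub>F n in sequentially. expectation (\<lambda>\<omega>. \<bar>?A n \<omega>\<bar>) \<le> ?b n"
  proof (rule always_eventually, rule allI)
    fix n
    have eq: "?A n \<omega> = devD n hd \<omega> / n + ?S n \<omega>" for \<omega>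
    proof -
      have "(\<Sum>i=1..n. of_bool (i \<in> sampled n \<omega>) * (if i \<in> treated n \<omega> then h1 (W i \<omega>) else h0 (W i \<omega>)))
          = devD n hd \<omega> + (\<Sum>i=1..n. of_bool (i \<in> sampled n \<omega>) * hm (W i \<omega>))"
        unfolding devD_def sum.distrib[symmetric]
        by (intro sum.cong refl) (auto simp: sampled_def treated_def hd_def hm_def algebra_simps)
      then show ?thesis by (simp add: add_divide_distrib Ehm)
    qed
    have i1: "integrable M (\<lambda>\<omega>. devD n hd \<omega> / n)" using dev_int(2)[OF hd] by (rule integrable_divide_zero)
    have i2: "integrable M (?S n)"
    proof -
      have "integrable M (\<lambda>\<omega>. devT n hm \<omega> + q * (\<Sum>i=1..n. hm (W i \<omega>)))"
        using dev_int(1)[OF hm] integrable_W[OF _ hm]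
        by (intro Bochner_Integration.integrable_add integrable_mult_right Bochner_Integration.integrable_sum) auto
      moreover have "devT n hm \<omega> + q * (\<Sum>i=1..n. hm (W i \<omega>)) = (\<Sum>i=1..n. of_bool (i \<in> sampled n \<omega>) * hm (W i \<omega>))" for \<omega>
        unfolding devT_def sum_distrib_left sum.distrib[symmetric]
        by (intro sum.cong refl) (auto simp: sampled_def algebra_simps)
      ultimately show ?thesis by (intro Bochner_Integration.integrable_diff integrable_divide_zero) auto
    qed
    have "expectation (\<lambda>\<omega>. \<bar>devD n hd \<omega> / n + ?S n \<omega>\<bar>) \<le> expectation (\<lambda>\<omega>. \<bar>devD n hd \<omega> / n\<bar> + \<bar>?S n \<omega>\<bar>)"
      by (rule integral_mono; (intro integrable_abs Bochner_Integration.integrable_add i1 i2 abs_triangle_ineq)?)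
    also have "\<dots> = ?b n"
      by (rule Bochner_Integration.integral_add) (intro integrable_abs i1 i2)+
    finally show "expectation (\<lambda>\<omega>. \<bar>?A n \<omega>\<bar>) \<le> ?b n"
      unfolding eq .
  qed
qed auto

text \<open>Conditioning on \<psi>2 and the whole design. The carried factor contains
  \<open>us + cs\<close>, a function of \<psi>2 and the sampled set; the residuals are centred with
  conditional variance s1 or s0 according to treatment, and \<open>treated_law\<close> identifies
  the limit v1.\<close>

lemma stage_D:
  "(\<lambda>n. expectation (\<lambda>\<omega>. iexp (t / sqrt n * (xs n \<omega> + us n \<omega> + cs n \<omega>)))
     - exp (- (t\<^sup>2 / 2 * v1)) * expectation (\<lambda>\<omega>. iexp (t / sqrt n * (us n \<omega> + cs n \<omega>)))) \<longlonglongrightarrow> 0"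
proof -
  define x where "x n z i w = of_bool (i \<in> fst z) * (if i \<in> snd z then x1 w else x0 w)" for n i :: nat and z :: "nat set \<times> nat set" and w
  define s where "s n z i v = of_bool (i \<in> fst z) * (if i \<in> snd z then s1 v else s0 v)" for n i :: nat and z :: "nat set \<times> nat set" and v
  define r where "r z i v = of_bool (i \<in> fst z) * dm v + (cate (f v) - ate)" for z :: "nat set \<times> nat set" and i :: nat and v
  define \<zeta> where "\<zeta> n z w = iexp (t / sqrt (real n) * (\<Sum>j=1..n. r z j (fst (w j))))" for n :: nat and z :: "nat set \<times> nat set" and w :: "nat \<Rightarrow> 'b \<times> real \<times> real"
  have "(\<lambda>n. expectation (\<lambda>\<omega>. \<zeta> n (sampled n \<omega>, treated n \<omega>) (upto_n n W \<omega>) *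
        iexp (t / sqrt n * (\<Sum>i=1..n. x n (sampled n \<omega>, treated n \<omega>) i (W i \<omega>))))
     - exp (- (t\<^sup>2 / 2 * v1)) * expectation (\<lambda>\<omega>. \<zeta> n (sampled n \<omega>, treated n \<omega>) (upto_n n W \<omega>))) \<longlonglongrightarrow> 0"
  proof (rule clt_stage[OF finite_design_D, where s = s and x = x and g = "\<lambda>w. \<bar>x1 w\<bar> + \<bar>x0 w\<bar>" and h = "\<lambda>w. s1 (fst w) + s0 (fst w)"])
    show "cond_exp_fn \<mu> borel fst (x n z i) (\<lambda>_. 0)" for n z i
      unfolding x_def[abs_def] using x_ce cond_exp_fn_zero
      by (cases "i \<in> fst z"; cases "i \<in> snd z") simp_all
    show "cond_exp_fn \<mu> borel fst (\<lambda>w. (x n z i w)\<^sup>2) (s n z i)" for n z i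
      unfolding x_def s_def[abs_def] using s1_ce s0_ce cond_exp_fn_zero
      by (cases "i \<in> fst z"; cases "i \<in> snd z") simp_all
    show "0 \<le> s n z i v" for n z i v using s1_ce(2) s0_ce(2) by (simp add: s_def)
    show "\<bar>x n z i w\<bar> \<le> \<bar>\<bar>x1 w\<bar> + \<bar>x0 w\<bar>\<bar>" for n z i w by (simp add: x_def)
    show "s n z i (fst w) \<le> s1 (fst w) + s0 (fst w)" for n z i and w :: "'b \<times> real \<times> real"
      using s1_ce(2) s0_ce(2) by (simp add: s_def)
    show "(\<lambda>w. \<bar>x1 w\<bar> + \<bar>x0 w\<bar>) \<in> borel_measurable \<mu>" by measurable
    show "integrable \<mu> (\<lambda>w. (\<bar>x1 w\<bar> + \<bar>x0 w\<bar>)\<^sup>2)"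
      using x_sq by (intro integrable_power2_add) auto
    show "integrable \<mu> (\<lambda>w. s1 (fst w) + s0 (fst w))" using s_int by auto
    show "0 \<le> v1" by (rule v_nonneg)
    show "finite_design.adapted \<mu> n borel fst (Pow {1..n} \<times> Pow {1..n}) i (\<zeta> n)" if "n \<ge> 1" "i \<in> {1..n}" for n i
    proof -
      interpret fd: finite_design M \<mu> W "R n" "\<pi> n" n borel fst "\<lambda>\<omega>. (sampled n \<omega>, treated n \<omega>)" "Pow {1..n} \<times> Pow {1..n}" "kappaD n"
        by (rule finite_design_D[OF that(1)])
      show ?thesis unfolding \<zeta>_def[abs_def]
        by (rule fd.adapted_iexp[OF _ that(2)]) (simp add: r_def[abs_def])
    qed
    have "v1 = q * (p * (\<integral>w. s1 (fst w) \<partial>\<mu>) + (1 - p) * (\<integral>w. s0 (fst w) \<partial>\<mu>))"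
      unfolding v1_def cond_exp_fn_integral[OF s1_ce(1)] cond_exp_fn_integral[OF s0_ce(1)] ..
    then show "(\<lambda>n. expectation (\<lambda>\<omega>. \<bar>(\<Sum>i=1..n. s n (sampled n \<omega>, treated n \<omega>) i (fst (W i \<omega>))) / n - v1\<bar>)) \<longlonglongrightarrow> 0"
      using treated_law[OF s_int(2,1)] by (simp add: s_def)
  qed
  moreover have "\<zeta> n (sampled n \<omega>, treated n \<omega>) (upto_n n W \<omega>) = iexp (t / sqrt n * (us n \<omega> + cs n \<omega>))" for n \<omega>
  proof -
    have "(\<Sum>j=1..n. r (sampled n \<omega>, treated n \<omega>) j (fst (upto_n n W \<omega> j))) = us n \<omega> + cs n \<omega>"
      unfolding us_def cs_def sum.distrib[symmetric] by (intro sum.cong refl) (simp add: r_def upto_n_def)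
    then show ?thesis by (simp only: \<zeta>_def)
  qed
  moreover have "(\<Sum>i=1..n. x n (sampled n \<omega>, treated n \<omega>) i (W i \<omega>)) = xs n \<omega>" for n \<omega>
    by (simp add: x_def xs_def)
  moreover have "iexp (t / sqrt n * (us n \<omega> + cs n \<omega>)) * iexp (t / sqrt n * xs n \<omega>)
      = iexp (t / sqrt n * (xs n \<omega> + us n \<omega> + cs n \<omega>))" for n \<omega>
    by (simp add: distrib_left add_ac flip: exp_add)
  ultimately show ?thesis by (simp only:)
qed

text \<open>Conditioning on \<psi>1 and the sample only. Once the outcome residuals are gone,
  treatment no longer appears; \<open>dm\<close> is centred given \<psi>1, and the carried factor
  \<open>cs\<close> is a function of \<psi>1.\<close>

lemma stage_T:
  "(\<lambda>n. expectation (\<lambda>\<omega>. iexp (t / sqrt n * (us n \<omega> + cs n \<omega>)))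
     - exp (- (t\<^sup>2 / 2 * v2)) * expectation (\<lambda>\<omega>. iexp (t / sqrt n * cs n \<omega>))) \<longlonglongrightarrow> 0"
proof -
  define x where "x n A i w = of_bool (i \<in> A) * dm (fst w)" for n i :: nat and A :: "nat set" and w :: "'b \<times> real \<times> real"
  define s where "s n A i v = of_bool (i \<in> A) * sdm v" for n i :: nat and A :: "nat set" and v
  define \<zeta> where "\<zeta> n A w = iexp (t / sqrt (real n) * (\<Sum>j=1..n. cate (f (fst (w j))) - ate))" for n :: nat and A :: "nat set" and w :: "nat \<Rightarrow> 'b \<times> real \<times> real"
  have "(\<lambda>n. expectation (\<lambda>\<omega>. \<zeta> n (sampled n \<omega>) (upto_n n W \<omega>) *
        iexp (t / sqrt n * (\<Sum>i=1..n. x n (sampled n \<omega>) i (W i \<omega>))))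
     - exp (- (t\<^sup>2 / 2 * v2)) * expectation (\<lambda>\<omega>. \<zeta> n (sampled n \<omega>) (upto_n n W \<omega>))) \<longlonglongrightarrow> 0"
  proof (rule clt_stage[OF finite_design_T, where s = s and x = x and g = "\<lambda>w. dm (fst w)" and h = "\<lambda>w. sdm (f (fst w))"])
    show "cond_exp_fn \<mu> borel (\<lambda>w. f (fst w)) (x n A i) (\<lambda>_. 0)" for n A i
      unfolding x_def[abs_def] using dm_ce cond_exp_fn_zero by (cases "i \<in> A") simp_all
    show "cond_exp_fn \<mu> borel (\<lambda>w. f (fst w)) (\<lambda>w. (x n A i w)\<^sup>2) (s n A i)" for n A i
      unfolding x_def s_def[abs_def] using sdm_ce cond_exp_fn_zero by (cases "i \<in> A") simp_all
    show "0 \<le> s n A i v" for n A i v using sdm_ce(2) by (simp add: s_def)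
    show "\<bar>x n A i w\<bar> \<le> \<bar>dm (fst w)\<bar>" for n A i w by (simp add: x_def)
    show "s n A i (f (fst w)) \<le> sdm (f (fst w))" for n A i and w :: "'b \<times> real \<times> real"
      using sdm_ce(2) by (simp add: s_def)
    show "(\<lambda>w. dm (fst w)) \<in> borel_measurable \<mu>" by measurable
    show "integrable \<mu> (\<lambda>w. (dm (fst w))\<^sup>2)" by (rule dm_sq)
    show "integrable \<mu> (\<lambda>w. sdm (f (fst w)))" by (rule s_int)
    show "0 \<le> v2" by (rule v_nonneg)
    show "finite_design.adapted \<mu> n borel (\<lambda>w. f (fst w)) (Pow {1..n}) i (\<zeta> n)" if "n \<ge> 1" "i \<in> {1..n}" for n i
    proof -
      interpret fd: finite_design M \<mu> W "R n" "\<pi> n" n borel "\<lambda>w. f (fst w)" "sampled n" "Pow {1..n}" "kappaT n"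
        by (rule finite_design_T[OF that(1)])
      show ?thesis unfolding \<zeta>_def[abs_def]
        using fd.adapted_iexp[OF _ that(2), of "\<lambda>A j v. cate v - ate" "t / sqrt (real n)"] by simp
    qed
    have "v2 = q * (\<integral>w. sdm (f (fst w)) \<partial>\<mu>)"
      unfolding v2_def cond_exp_fn_integral[OF sdm_ce(1)] ..
    then show "(\<lambda>n. expectation (\<lambda>\<omega>. \<bar>(\<Sum>i=1..n. s n (sampled n \<omega>) i (f (fst (W i \<omega>)))) / n - v2\<bar>)) \<longlonglongrightarrow> 0"
      using sampled_law[OF s_int(3)] by (simp add: s_def)
  qed
  moreover have "\<zeta> n (sampled n \<omega>) (upto_n n W \<omega>) = iexp (t / sqrt n * cs n \<omega>)" for n \<omega>
  proof -
    have "(\<Sum>j=1..n. cate (f (fst (upto_n n W \<omega> j))) - ate) = cs n \<omega>"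
      unfolding cs_def by (intro sum.cong refl) (simp add: upto_n_def)
    then show ?thesis by (simp only: \<zeta>_def)
  qed
  moreover have "(\<Sum>i=1..n. x n (sampled n \<omega>) i (W i \<omega>)) = us n \<omega>" for n \<omega>
    by (simp add: x_def us_def)
  moreover have "iexp (t / sqrt n * cs n \<omega>) * iexp (t / sqrt n * us n \<omega>) = iexp (t / sqrt n * (us n \<omega> + cs n \<omega>))" for n \<omega>
    by (simp add: distrib_left add_ac flip: exp_add)
  ultimately show ?thesis by (simp only:)
qed

text \<open>The degenerate design serves here: the conditional variance is the constant v3 and the
  carried factor is 1.\<close>

lemma stage_iid:
  "(\<lambda>n. expectation (\<lambda>\<omega>. iexp (t / sqrt n * cs n \<omega>)) - complex_of_real (exp (- (t\<^sup>2 / 2 * v3)))) \<longlonglongrightarrow> 0"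
proof -
  define x where "x n z i w = cate (f (fst w)) - ate" for n i :: nat and z :: unit and w :: "'b \<times> real \<times> real"
  define s where "s n z i v = v3" for n i :: nat and z v :: unit
  define \<zeta> where "\<zeta> n z w = (1 :: complex)" for n :: nat and z :: unit and w :: "nat \<Rightarrow> 'b \<times> real \<times> real"
  have mean: "(\<integral>w. cate (f (fst w)) - ate \<partial>\<mu>) = 0"
    using cond_exp_fn_integral[OF cate_ce] cate_ce mu.prob_space by (simp add: ate_def cond_exp_fn_def)
  have int: "integrable \<mu> (\<lambda>w. cate (f (fst w)) - ate)"
    using cate_ce by (auto simp: cond_exp_fn_def)
  have "(\<lambda>n. expectation (\<lambda>\<omega>. \<zeta> n () (upto_n n W \<omega>) * iexp (t / sqrt n * (\<Sum>i=1..n. x n () i (W i \<omega>))))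
     - exp (- (t\<^sup>2 / 2 * v3)) * expectation (\<lambda>\<omega>. \<zeta> n () (upto_n n W \<omega>))) \<longlonglongrightarrow> 0"
  proof (rule clt_stage[OF finite_design_const, where s = s and x = x and g = "\<lambda>w. cate (f (fst w)) - ate" and h = "\<lambda>w. v3"])
    show "cond_exp_fn \<mu> (count_space UNIV) (\<lambda>_. ()) (x n z i) (\<lambda>_. 0)" for n z i
      unfolding cond_exp_fn_def x_def[abs_def] using int mean by simp
    show "cond_exp_fn \<mu> (count_space UNIV) (\<lambda>_. ()) (\<lambda>w. (x n z i w)\<^sup>2) (s n z i)" for n z i
      unfolding cond_exp_fn_def x_def s_def[abs_def] using cate_dev_sq mu.prob_space by (simp add: v3_def)
    show "finite_design.adapted \<mu> n (count_space UNIV) (\<lambda>_. ()) {()} i (\<zeta> n)" if "n \<ge> 1" "i \<in> {1..n}" for n i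
    proof -
      interpret fd: finite_design M \<mu> W "R n" "\<pi> n" n "count_space UNIV" "\<lambda>_. ()" "\<lambda>_. ()" "{()}" "\<lambda>_ _. 1"
        by (rule finite_design_const[OF that(1)])
      show ?thesis unfolding \<zeta>_def[abs_def]
        using fd.adapted_iexp[OF _ that(2), of "\<lambda>_ _ _. 0" 0] by simp
    qed
    show "(\<lambda>n. expectation (\<lambda>\<omega>. \<bar>(\<Sum>i=1..n. s n () i ()) / n - v3\<bar>)) \<longlonglongrightarrow> 0"
      by (rule tendsto_eventually) (rule eventually_sequentiallyI[of 1], simp add: s_def)
  qed (use v_nonneg cate_dev_sq in \<open>auto simp: x_def s_def\<close>)
  then show ?thesis using prob_space by (simp add: \<zeta>_def x_def cs_def)
qed

lemma main_clt:
  "(\<lambda>n. expectation (\<lambda>\<omega>. iexp (t / sqrt n * (xs n \<omega> + us n \<omega> + cs n \<omega>)))) \<longlonglongrightarrow> complex_of_real (exp (- (t\<^sup>2 / 2 * (v1 + v2 + v3))))"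
proof -
  define e where "e v = complex_of_real (exp (- (t\<^sup>2 / 2 * v)))" for v
  define P1 where "P1 n = expectation (\<lambda>\<omega>. iexp (t / sqrt n * (xs n \<omega> + us n \<omega> + cs n \<omega>)))" for n
  define P2 where "P2 n = expectation (\<lambda>\<omega>. iexp (t / sqrt n * (us n \<omega> + cs n \<omega>)))" for n
  define P3 where "P3 n = expectation (\<lambda>\<omega>. iexp (t / sqrt n * cs n \<omega>))" for n
  have l1: "(\<lambda>n. P1 n - e v1 * P2 n) \<longlonglongrightarrow> 0" and l2: "(\<lambda>n. P2 n - e v2 * P3 n) \<longlonglongrightarrow> 0" and l3: "(\<lambda>n. P3 n - e v3) \<longlonglongrightarrow> 0"
    using stage_D[of t] stage_T[of t] stage_iid[of t] by (simp_all only: P1_def P2_def P3_def e_def)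
  \<comment> \<open>A telescoping form of P1 built from the three stage differences, each multiplied
    by the constants of the earlier stages.\<close>
  have "(\<lambda>n. (P1 n - e v1 * P2 n) + e v1 * (P2 n - e v2 * P3 n) + e v1 * e v2 * (P3 n - e v3) + e v1 * e v2 * e v3)
      \<longlonglongrightarrow> 0 + e v1 * 0 + e v1 * e v2 * 0 + e v1 * e v2 * e v3"
    by (intro tendsto_add tendsto_mult tendsto_const l1 l2 l3)
  also have "(\<lambda>n. (P1 n - e v1 * P2 n) + e v1 * (P2 n - e v2 * P3 n) + e v1 * e v2 * (P3 n - e v3) + e v1 * e v2 * e v3) = P1"
    by (simp add: fun_eq_iff algebra_simps)
  also have "0 + e v1 * 0 + e v1 * e v2 * 0 + e v1 * e v2 * e v3 = e (v1 + v2 + v3)"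
    by (simp add: e_def distrib_left flip: exp_add of_real_mult)
  finally show ?thesis by (simp only: P1_def[abs_def] e_def)
qed

end

section \<open>Decomposition of the estimator, normalization by the sample size, and the variance
  formula\<close>

context local_experiment_sq
begin

lemma law_image:
  assumes "i \<ge> 1" and h: "h \<in> borel_measurable borel"
  shows "distr M borel (\<lambda>\<omega>. h (W i \<omega>)) = distr \<mu> borel h"
proof -
  have "distr (distr M \<mu> (W i)) borel h = distr M borel (h \<circ> W i)"
    by (rule distr_distr) (use W_\<mu>[OF assms(1)] h in \<open>simp_all add: measurable_cong_sets[OF sets_\<mu> refl]\<close>)
  then show ?thesis using law_W[OF assms(1)] by (simp add: o_def)
qed

lemma cate_negligible: "(\<lambda>n. expectation (\<lambda>\<omega>. (devT n (\<lambda>w. cate (f (fst w))) \<omega>)\<^sup>2) / n) \<longlonglongrightarrow> 0"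
proof -
  have ff: "(\<lambda>w :: 'b \<times> real \<times> real. f (fst w)) \<in> borel_measurable borel" by measurable
  have "(\<lambda>n. expectation (\<lambda>\<omega>. (\<Sum>i\<in>{1..n}. (of_bool (T n i \<omega>) - real aT / real kT) * cate (phi i \<omega>))\<^sup>2) / n) \<longlonglongrightarrow> 0"
  proof (rule matched_sum_vanishes[where \<psi> = phi and c = cate and \<nu> = "distr \<mu> borel (\<lambda>w. f (fst w))", OF groups_T])
    show "phi i \<in> borel_measurable (FT n)" if "i \<in> {1..n}" for i n
      unfolding phi_def by (rule W_component_FT[OF that ff])
    show "distr M borel (phi i) = distr \<mu> borel (\<lambda>w. f (fst w))" if "i \<ge> 1" for i
      unfolding phi_def by (rule law_image[OF that ff])
    show "tight_matching M phi GrT"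
      using hT_tight by (simp add: phi_def GrT_def[abs_def])
    show "integrable (distr \<mu> borel (\<lambda>w. f (fst w))) (\<lambda>v. (cate v)\<^sup>2)"
      using cate_sq by (subst integrable_distr_eq) auto
  qed measurable
  then show ?thesis by (simp add: devT_def q_def phi_def)
qed

lemma bal_negligible: "(\<lambda>n. expectation (\<lambda>\<omega>. (devD n (\<lambda>w. bal (fst w)) \<omega>)\<^sup>2) / n) \<longlonglongrightarrow> 0"
proof -
  have "(\<lambda>n. expectation (\<lambda>\<omega>. (\<Sum>i\<in>sampled n \<omega>. (of_bool (D n i \<omega>) - real aD / real kD) * bal (psi i \<omega>))\<^sup>2) / n) \<longlonglongrightarrow> 0"
  proof (rule matched_sum_vanishes[where \<psi> = psi and c = bal and \<nu> = "distr \<mu> borel fst", OF groups_D])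
    show "psi i \<in> borel_measurable (FD n)" if "i \<in> {1..n}" for i n
      unfolding psi_def by (rule W_component_FD[OF that fst_borel])
    show "distr M borel (psi i) = distr \<mu> borel fst" if "i \<ge> 1" for i
      unfolding psi_def by (rule law_image[OF that fst_borel])
    show "tight_matching M psi GrD"
      using hD_tight by (simp add: psi_def GrD_def[abs_def])
    show "integrable (distr \<mu> borel fst) (\<lambda>v. (bal v)\<^sup>2)"
      using bal_sq by (subst integrable_distr_eq) auto
  qed measurable
  moreover have "(\<Sum>i\<in>sampled n \<omega>. (of_bool (D n i \<omega>) - real aD / real kD) * bal (psi i \<omega>)) = devD n (\<lambda>w. bal (fst w)) \<omega>" for n \<omega>
    unfolding devD_def p_def psi_def sampled_def by (rule sum.mono_neutral_cong_left) auto
  ultimately show ?thesis by simp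
qed

text \<open>This is n times the estimation error, with the observed outcome already replaced by the
  potential outcome it reveals; \<open>ate\<close> is subtracted inside the sum.\<close>

definition "score n \<omega> = (\<Sum>i=1..n. of_bool (T n i \<omega>) / q *
   (of_bool (D n i \<omega>) * y1 (W i \<omega>) / p - (1 - of_bool (D n i \<omega>)) * y0 (W i \<omega>) / (1 - p)) - ate)"

definition "remainder n \<omega> = 1 / q * devT n (\<lambda>w. cate (f (fst w))) \<omega> + 1 / (q * p * (1 - p)) * devD n (\<lambda>w. bal (fst w)) \<omega>"

text \<open>An identity for each unit, checked on the four values of (T, D). Outcomes are split into
  regression and residual; the regressions contribute
  \<open>(m1 - m0) + (D - p) bal / (p (1 - p))\<close>, and then
  \<open>T / q = 1 + (T - q) / q\<close> is used on \<open>cate\<close> only, while dm keeps its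
  factor T.\<close>

lemma score_regression: "score n \<omega> = xs n \<omega> + us n \<omega> + cs n \<omega> + remainder n \<omega>"
proof -
  have nz: "q \<noteq> 0" "p \<noteq> 0" "1 - p \<noteq> 0" using q_bounds p_bounds by auto
  have "of_bool (T n i \<omega>) / q * (of_bool (D n i \<omega>) * y1 (W i \<omega>) / p - (1 - of_bool (D n i \<omega>)) * y0 (W i \<omega>) / (1 - p)) - ate
    = of_bool (i \<in> sampled n \<omega>) * (if i \<in> treated n \<omega> then x1 (W i \<omega>) else x0 (W i \<omega>))
      + of_bool (i \<in> sampled n \<omega>) * dm (fst (W i \<omega>)) + (cate (f (fst (W i \<omega>))) - ate)
      + (1 / q * ((of_bool (T n i \<omega>) - q) * cate (f (fst (W i \<omega>))))
         + 1 / (q * p * (1 - p)) * (of_bool (T n i \<omega>) * (of_bool (D n i \<omega>) - p) * bal (fst (W i \<omega>))))"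
    if i: "i \<in> {1..n}" for i
  proof -
    have s: "i \<in> sampled n \<omega> \<longleftrightarrow> T n i \<omega>" "i \<in> treated n \<omega> \<longleftrightarrow> T n i \<omega> \<and> D n i \<omega>"
      using i by (auto simp: sampled_def treated_def)
    \<comment> \<open>Naming 1 - p makes it an atom when denominators are cleared; its value is used
      only afterwards.\<close>
    obtain r where r: "r = 1 - p" by simp
    show ?thesis unfolding s x1_def x0_def dm_def bal_def r[symmetric]
      using nz unfolding r[symmetric]
      by (cases "T n i \<omega>"; cases "D n i \<omega>") (simp_all add: divide_simps, (use r in algebra)+)
  qed
  then show ?thesis
    unfolding score_def xs_def us_def cs_def remainder_def devT_def devD_def sum_distrib_left sum.distrib[symmetric]
    by (intro sum.cong refl) auto
qed

text \<open>The same identity applied to the outcomes themselves. It serves to bound the second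
  moment of the score, where no matching is required.\<close>

lemma score_outcome:
  "score n \<omega> = (\<Sum>i=1..n. tau (W i \<omega>) - ate) + (1 / q * devT n tau \<omega> + 1 / (q * p * (1 - p)) * devD n ybar \<omega>)"
proof -
  have nz: "q \<noteq> 0" "p \<noteq> 0" "1 - p \<noteq> 0" using q_bounds p_bounds by auto
  obtain r where r: "r = 1 - p" by simp
  have "of_bool (T n i \<omega>) / q * (of_bool (D n i \<omega>) * y1 (W i \<omega>) / p - (1 - of_bool (D n i \<omega>)) * y0 (W i \<omega>) / (1 - p)) - ate
    = (tau (W i \<omega>) - ate) + (1 / q * ((of_bool (T n i \<omega>) - q) * tau (W i \<omega>))
         + 1 / (q * p * (1 - p)) * (of_bool (T n i \<omega>) * (of_bool (D n i \<omega>) - p) * ybar (W i \<omega>)))" for i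
    unfolding tau_def ybar_def r[symmetric] using nz unfolding r[symmetric]
    by (cases "T n i \<omega>"; cases "D n i \<omega>") (simp_all add: divide_simps, (use r in algebra)+)
  then show ?thesis
    unfolding score_def devT_def devD_def sum_distrib_left sum.distrib[symmetric]
    by (intro sum.cong refl) auto
qed

lemma dev_meas:
  assumes "h \<in> borel_measurable borel"
  shows "devT n h \<in> borel_measurable M" "devD n h \<in> borel_measurable M"
proof -
  have "(\<lambda>\<omega>. (of_bool (T n i \<omega>) - q) * h (W i \<omega>)) \<in> borel_measurable M"
    "(\<lambda>\<omega>. of_bool (T n i \<omega>) * (of_bool (D n i \<omega>) - p) * h (W i \<omega>)) \<in> borel_measurable M" if i: "i \<in> {1..n}" for i
  proof -
    note [measurable] = T_bool[OF i] D_bool[OF i] W_comp[OF i assms]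
    show "(\<lambda>\<omega>. (of_bool (T n i \<omega>) - q) * h (W i \<omega>)) \<in> borel_measurable M"
      "(\<lambda>\<omega>. of_bool (T n i \<omega>) * (of_bool (D n i \<omega>) - p) * h (W i \<omega>)) \<in> borel_measurable M" by measurable
  qed
  then show "devT n h \<in> borel_measurable M" "devD n h \<in> borel_measurable M"
    unfolding devT_def[abs_def] devD_def[abs_def] by (auto intro!: borel_measurable_sum)
qed

lemma weighted_sq:
  assumes h: "h \<in> borel_measurable borel" "integrable \<mu> (\<lambda>w. (h w)\<^sup>2)"
    and g: "g \<in> borel_measurable borel" "integrable \<mu> (\<lambda>w. (g w)\<^sup>2)"
  shows "integrable M (\<lambda>\<omega>. (c * devT n h \<omega> + d * devD n g \<omega>)\<^sup>2)"
    "expectation (\<lambda>\<omega>. (c * devT n h \<omega> + d * devD n g \<omega>)\<^sup>2)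
      \<le> 2 * (c\<^sup>2 * expectation (\<lambda>\<omega>. (devT n h \<omega>)\<^sup>2)) + 2 * (d\<^sup>2 * expectation (\<lambda>\<omega>. (devD n g \<omega>)\<^sup>2))"
proof -
  note [measurable] = dev_meas[OF h(1)] dev_meas[OF g(1)]
  note i = integrable_power2_cmult[OF dev_bound(1)[OF h], of c n] integrable_power2_cmult[OF dev_bound(3)[OF g], of d n]
  show "integrable M (\<lambda>\<omega>. (c * devT n h \<omega> + d * devD n g \<omega>)\<^sup>2)"
    by (rule integrable_power2_add[OF _ _ i]) measurable
  have "expectation (\<lambda>\<omega>. (c * devT n h \<omega> + d * devD n g \<omega>)\<^sup>2)
      \<le> 2 * expectation (\<lambda>\<omega>. (c * devT n h \<omega>)\<^sup>2) + 2 * expectation (\<lambda>\<omega>. (d * devD n g \<omega>)\<^sup>2)"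
    by (rule integral_power2_add_le[OF _ _ i]) measurable
  then show "expectation (\<lambda>\<omega>. (c * devT n h \<omega> + d * devD n g \<omega>)\<^sup>2)
      \<le> 2 * (c\<^sup>2 * expectation (\<lambda>\<omega>. (devT n h \<omega>)\<^sup>2)) + 2 * (d\<^sup>2 * expectation (\<lambda>\<omega>. (devD n g \<omega>)\<^sup>2))"
    by (simp add: power_mult_distrib)
qed

lemma remainder_meas[measurable]: "remainder n \<in> borel_measurable M"
proof -
  have "(\<lambda>w :: 'b \<times> real \<times> real. cate (f (fst w))) \<in> borel_measurable borel"
    "(\<lambda>w :: 'b \<times> real \<times> real. bal (fst w)) \<in> borel_measurable borel" by measurable
  note [measurable] = dev_meas(1)[OF this(1)] dev_meas(2)[OF this(2)]
  show ?thesis unfolding remainder_def[abs_def] by measurable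
qed

lemma remainder_sq: "integrable M (\<lambda>\<omega>. (remainder n \<omega>)\<^sup>2)"
  unfolding remainder_def using cate_sq bal_sq by (intro weighted_sq) measurable

lemma remainder_negligible: "(\<lambda>n. expectation (\<lambda>\<omega>. (remainder n \<omega>)\<^sup>2) / n) \<longlonglongrightarrow> 0"
proof (rule tendsto_sandwich[of "\<lambda>_. 0"])
  define c d where "c = 1 / q" and "d = 1 / (q * p * (1 - p))"
  let ?b = "\<lambda>n. 2 * c\<^sup>2 * (expectation (\<lambda>\<omega>. (devT n (\<lambda>w. cate (f (fst w))) \<omega>)\<^sup>2) / n)
     + 2 * d\<^sup>2 * (expectation (\<lambda>\<omega>. (devD n (\<lambda>w. bal (fst w)) \<omega>)\<^sup>2) / n)"
  show "?b \<longlonglongrightarrow> 0"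
    using tendsto_add[OF tendsto_mult[OF tendsto_const[of "2 * c\<^sup>2"] cate_negligible]
        tendsto_mult[OF tendsto_const[of "2 * d\<^sup>2"] bal_negligible]] by simp
  show "\<forall>\<^sub>F n in sequentially. expectation (\<lambda>\<omega>. (remainder n \<omega>)\<^sup>2) / n \<le> ?b n"
  proof (rule always_eventually, rule allI)
    fix n
    have m: "(\<lambda>w :: 'b \<times> real \<times> real. cate (f (fst w))) \<in> borel_measurable borel"
      "(\<lambda>w :: 'b \<times> real \<times> real. bal (fst w)) \<in> borel_measurable borel" by measurable
    have "expectation (\<lambda>\<omega>. (remainder n \<omega>)\<^sup>2) / n
      \<le> (2 * (c\<^sup>2 * expectation (\<lambda>\<omega>. (devT n (\<lambda>w. cate (f (fst w))) \<omega>)\<^sup>2))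
         + 2 * (d\<^sup>2 * expectation (\<lambda>\<omega>. (devD n (\<lambda>w. bal (fst w)) \<omega>)\<^sup>2))) / n"
      unfolding remainder_def c_def d_def
      by (intro divide_right_mono weighted_sq(2)[OF m(1) cate_sq m(2) bal_sq]) simp
    then show "expectation (\<lambda>\<omega>. (remainder n \<omega>)\<^sup>2) / n \<le> ?b n" by (simp add: add_divide_distrib)
  qed
qed auto

lemma score_meas[measurable]: "score n \<in> borel_measurable M"
  unfolding score_def[abs_def]
proof (rule borel_measurable_sum)
  fix i assume i: "i \<in> {1..n}"
  note [measurable] = T_bool[OF i] D_bool[OF i] W_comp[OF i y_meas(1)] W_comp[OF i y_meas(2)]
  show "(\<lambda>\<omega>. of_bool (T n i \<omega>) / q * (of_bool (D n i \<omega>) * y1 (W i \<omega>) / p - (1 - of_bool (D n i \<omega>)) * y0 (W i \<omega>) / (1 - p)) - ate)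
      \<in> borel_measurable M" by measurable
qed

text \<open>A second moment of order n is what is needed when the score is multiplied by the
  vanishing error of \<open>sqrt (n_T / n)\<close>.\<close>

lemma score_bound:
  obtains C :: real where "0 \<le> C" "\<And>n. integrable M (\<lambda>\<omega>. (score n \<omega>)\<^sup>2)" "\<And>n. expectation (\<lambda>\<omega>. (score n \<omega>)\<^sup>2) \<le> C * n"
proof -
  define c d where "c = 1 / q" and "d = 1 / (q * p * (1 - p))"
  define C where "C = 2 * (\<integral>w. (tau w - ate)\<^sup>2 \<partial>\<mu>) + 2 * (2 * (c\<^sup>2 * (kT * (\<integral>w. (tau w)\<^sup>2 \<partial>\<mu>))) + 2 * (d\<^sup>2 * (kD * (\<integral>w. (ybar w)\<^sup>2 \<partial>\<mu>))))"
  have dev_sq: "integrable \<mu> (\<lambda>w. (tau w - ate)\<^sup>2)" using tau_sq by (intro integrable_power2_diff) auto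
  have mean: "(\<integral>w. tau w - ate \<partial>\<mu>) = 0" using y_int(3) mu.prob_space by (simp add: ate_def)
  have tm: "(\<lambda>w. tau w - ate) \<in> borel_measurable \<mu>" by measurable
  note iid = iid_second_moment[OF indep_\<mu> law_W tm dev_sq mean]
  note [measurable] = dev_meas(1)[OF y_meas(3)] dev_meas(2)[OF y_meas(4)]
  have m1: "(\<lambda>\<omega>. \<Sum>i=1..n. tau (W i \<omega>) - ate) \<in> borel_measurable M" for n
  proof (rule borel_measurable_sum)
    fix i assume "i \<in> {1..n}"
    from borel_measurable_diff[OF W_comp[OF this y_meas(3)] borel_measurable_const[of ate]]
    show "(\<lambda>\<omega>. tau (W i \<omega>) - ate) \<in> borel_measurable M" .
  qed
  have m2: "(\<lambda>\<omega>. c * devT n tau \<omega> + d * devD n ybar \<omega>) \<in> borel_measurable M" for n by measurable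
  note wsq = weighted_sq[OF y_meas(3) tau_sq y_meas(4) ybar_sq, of c _ d]
  have eq: "score n \<omega> = (\<Sum>i=1..n. tau (W i \<omega>) - ate) + (c * devT n tau \<omega> + d * devD n ybar \<omega>)" for n \<omega>
    unfolding c_def d_def by (rule score_outcome)
  have int: "integrable M (\<lambda>\<omega>. (score n \<omega>)\<^sup>2)" for n
    unfolding eq by (rule integrable_power2_add[OF m1 m2 iid(1) wsq(1)]) auto
  have "expectation (\<lambda>\<omega>. (score n \<omega>)\<^sup>2) \<le> C * n" for n
  proof -
    have "expectation (\<lambda>\<omega>. (score n \<omega>)\<^sup>2) \<le> 2 * expectation (\<lambda>\<omega>. (\<Sum>i=1..n. tau (W i \<omega>) - ate)\<^sup>2)
        + 2 * expectation (\<lambda>\<omega>. (c * devT n tau \<omega> + d * devD n ybar \<omega>)\<^sup>2)"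
      unfolding eq by (rule integral_power2_add_le[OF m1 m2 iid(1) wsq(1)]) auto
    also have "\<dots> \<le> 2 * (n * (\<integral>w. (tau w - ate)\<^sup>2 \<partial>\<mu>))
        + 2 * (2 * (c\<^sup>2 * (kT * (n * (\<integral>w. (tau w)\<^sup>2 \<partial>\<mu>)))) + 2 * (d\<^sup>2 * (kD * (n * (\<integral>w. (ybar w)\<^sup>2 \<partial>\<mu>)))))"
    proof (intro add_mono mult_left_mono order_trans[OF wsq(2)[of n]])
      show "expectation (\<lambda>\<omega>. (\<Sum>i=1..n. tau (W i \<omega>) - ate)\<^sup>2) \<le> n * (\<integral>w. (tau w - ate)\<^sup>2 \<partial>\<mu>)"
        by (rule eq_refl[OF iid(2)])
    qed (rule dev_bound(2)[OF y_meas(3) tau_sq] dev_bound(4)[OF y_meas(4) ybar_sq] | simp)+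
    also have "\<dots> = C * n" by (simp add: C_def algebra_simps)
    finally show ?thesis .
  qed
  moreover have "0 \<le> C" by (simp add: C_def)
  ultimately show ?thesis using int by (rule_tac that) auto
qed

text \<open>Brings the sample size under \<open>dev_bound\<close>, with the constant function
  1.\<close>

lemma num_sampled_eq: "num_sampled T n \<omega> = devT n (\<lambda>_. 1) \<omega> + q * n"
  by (simp add: num_sampled_def devT_def sum_subtractf)

lemma num_sampled_nonneg: "0 \<le> num_sampled T n \<omega>"
  by (simp add: num_sampled_def sum_nonneg)

lemma num_sampled_meas[measurable]: "num_sampled T n \<in> borel_measurable M"
proof -
  have "(\<lambda>_ :: 'b \<times> real \<times> real. 1 :: real) \<in> borel_measurable borel" by simp
  note [measurable] = dev_meas(1)[OF this, of n]
  show ?thesis unfolding num_sampled_eq[abs_def] by measurable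
qed

text \<open>With a the sampled share, \<open>a - q = (sqrt a - sqrt q) (sqrt a + sqrt q)\<close> and
  the second factor is at least \<open>sqrt q\<close>; so the squared error is at most
  \<open>(a - q)\<^sup>2 / q\<close>, whose mean \<open>dev_bound\<close> controls by
  \<open>kT / q * (1 / n)\<close>.\<close>

lemma share_deviation:
  assumes n: "n \<ge> 1"
  shows "integrable M (\<lambda>\<omega>. (sqrt (num_sampled T n \<omega> / n) - sqrt q)\<^sup>2)"
    and "expectation (\<lambda>\<omega>. (sqrt (num_sampled T n \<omega> / n) - sqrt q)\<^sup>2) \<le> kT / q * (1 / n)"
proof -
  have one: "(\<lambda>_ :: 'b \<times> real \<times> real. 1 :: real) \<in> borel_measurable borel" "integrable \<mu> (\<lambda>_. (1::real)\<^sup>2)" by auto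
  note b = dev_bound(1,2)[OF one, of n]
  have le: "(sqrt (num_sampled T n \<omega> / n) - sqrt q)\<^sup>2 \<le> (devT n (\<lambda>_. 1) \<omega>)\<^sup>2 / (q * (real n)\<^sup>2)" for \<omega>
  proof -
    define a where "a = num_sampled T n \<omega> / n"
    have a: "0 \<le> a" using num_sampled_nonneg by (simp add: a_def)
    have "a - q = (sqrt a - sqrt q) * (sqrt a + sqrt q)"
      using a q_bounds by (simp add: algebra_simps)
    then have "(a - q)\<^sup>2 = (sqrt a - sqrt q)\<^sup>2 * (sqrt a + sqrt q)\<^sup>2" by (simp add: power_mult_distrib)
    moreover have "q \<le> (sqrt a + sqrt q)\<^sup>2"
    proof -
      have "(sqrt q)\<^sup>2 \<le> (sqrt a + sqrt q)\<^sup>2" using a q_bounds by (intro power_mono) auto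
      then show ?thesis using q_bounds by simp
    qed
    ultimately have "(sqrt a - sqrt q)\<^sup>2 * q \<le> (a - q)\<^sup>2" by (simp add: mult_left_mono)
    then have "(sqrt a - sqrt q)\<^sup>2 \<le> (a - q)\<^sup>2 / q" using q_bounds by (simp add: pos_le_divide_eq)
    moreover have "a - q = devT n (\<lambda>_. 1) \<omega> / n"
      using n by (simp add: a_def num_sampled_eq add_divide_distrib)
    ultimately show ?thesis by (simp add: a_def power_divide mult.commute)
  qed
  have int2: "integrable M (\<lambda>\<omega>. (devT n (\<lambda>_. 1) \<omega>)\<^sup>2 / (q * (real n)\<^sup>2))" using b(1) by (rule integrable_divide_zero)
  show int: "integrable M (\<lambda>\<omega>. (sqrt (num_sampled T n \<omega> / n) - sqrt q)\<^sup>2)"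
  proof (rule Bochner_Integration.integrable_bound[OF int2])
    show "(\<lambda>\<omega>. (sqrt (num_sampled T n \<omega> / n) - sqrt q)\<^sup>2) \<in> borel_measurable M" by measurable
    show "AE \<omega> in M. norm ((sqrt (num_sampled T n \<omega> / n) - sqrt q)\<^sup>2) \<le> norm ((devT n (\<lambda>_. 1) \<omega>)\<^sup>2 / (q * (real n)\<^sup>2))"
      using order_trans[OF le abs_ge_self] by simp
  qed
  have "expectation (\<lambda>\<omega>. (sqrt (num_sampled T n \<omega> / n) - sqrt q)\<^sup>2) \<le> expectation (\<lambda>\<omega>. (devT n (\<lambda>_. 1) \<omega>)\<^sup>2 / (q * (real n)\<^sup>2))"
    by (rule integral_mono[OF int int2 le])
  also have "\<dots> \<le> (kT * n) / (q * (real n)\<^sup>2)"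
    using b(2) q_bounds mu.prob_space by (auto intro!: divide_right_mono)
  also have "\<dots> = kT / q * (1 / n)" using n by (simp add: power2_eq_square)
  finally show "expectation (\<lambda>\<omega>. (sqrt (num_sampled T n \<omega> / n) - sqrt q)\<^sup>2) \<le> kT / q * (1 / n)" .
qed

lemma iexp_lipschitz: "norm (iexp a - iexp b) \<le> \<bar>a - b\<bar>"
proof -
  have "iexp a - iexp b = iexp b * (iexp (a - b) - 1)"
    by (simp add: right_diff_distrib flip: exp_add)
  then have "norm (iexp a - iexp b) = norm (iexp (a - b) - 1)" by (simp add: norm_mult)
  also have "\<dots> \<le> \<bar>a - b\<bar>" using iexp_approx1[of "a - b" 0] by simp
  finally show ?thesis .
qed

text \<open>Slutsky's argument on characteristic functions: \<open>iexp\<close> is 1-Lipschitz, so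
  replacing \<open>sqrt (n_T / n)\<close> by \<open>sqrt q\<close> and dropping the remainder costs
  the mean absolute change of the argument, and Cauchy-Schwarz bounds this by second
  moments.\<close>

lemma char_limit:
  "(\<lambda>n. expectation (\<lambda>\<omega>. iexp (t * (sqrt (num_sampled T n \<omega> / n) * (score n \<omega> / sqrt n)))))
    \<longlonglongrightarrow> complex_of_real (exp (- (t\<^sup>2 * (q * (v1 + v2 + v3)) / 2)))"
proof -
  obtain C :: real where C: "0 \<le> C" "\<And>n. integrable M (\<lambda>\<omega>. (score n \<omega>)\<^sup>2)" "\<And>n. expectation (\<lambda>\<omega>. (score n \<omega>)\<^sup>2) \<le> C * n"
    by (fact score_bound)
  define \<rho> where "\<rho> n \<omega> = sqrt (num_sampled T n \<omega> / n) - sqrt q" for n \<omega>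
  define L where "L n \<omega> = xs n \<omega> + us n \<omega> + cs n \<omega>" for n \<omega>
  let ?A = "\<lambda>n \<omega>. t * (sqrt (num_sampled T n \<omega> / n) * (score n \<omega> / sqrt n))" and ?B = "\<lambda>n \<omega>. (t * sqrt q) / sqrt n * L n \<omega>"
  have L_eq: "L n \<omega> = score n \<omega> - remainder n \<omega>" for n \<omega> by (simp add: L_def score_regression)
  have [measurable]: "L n \<in> borel_measurable M" for n unfolding L_eq[abs_def] by measurable
  have [measurable]: "\<rho> n \<in> borel_measurable M" for n unfolding \<rho>_def[abs_def] by measurable
  define e where "e n = \<bar>t\<bar> * (sqrt (kT / q * (1 / real n) * C) + sqrt q * sqrt (expectation (\<lambda>\<omega>. (remainder n \<omega>)\<^sup>2) / n))" for n
  have e_lim: "e \<longlonglongrightarrow> 0"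
  proof -
    have "(\<lambda>n. sqrt (kT / q * (1 / real n) * C)) \<longlonglongrightarrow> sqrt (kT / q * 0 * C)"
      by (intro tendsto_real_sqrt tendsto_mult tendsto_const lim_1_over_n)
    moreover have "(\<lambda>n. sqrt (expectation (\<lambda>\<omega>. (remainder n \<omega>)\<^sup>2) / n)) \<longlonglongrightarrow> sqrt 0"
      by (intro tendsto_real_sqrt remainder_negligible)
    ultimately have "e \<longlonglongrightarrow> \<bar>t\<bar> * (sqrt (kT / q * 0 * C) + sqrt q * sqrt 0)"
      unfolding e_def[abs_def] by (intro tendsto_mult tendsto_add tendsto_const)
    then show ?thesis by simp
  qed
  have close: "norm (expectation (\<lambda>\<omega>. iexp (?A n \<omega>))
      - expectation (\<lambda>\<omega>. iexp (?B n \<omega>))) \<le> e n" if n: "n \<ge> 1" for n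
  proof -
    have \<rho>2: "integrable M (\<lambda>\<omega>. (\<rho> n \<omega>)\<^sup>2)" "expectation (\<lambda>\<omega>. (\<rho> n \<omega>)\<^sup>2) \<le> kT / q * (1 / n)"
      unfolding \<rho>_def by (rule share_deviation[OF n])+
    have S2: "integrable M (\<lambda>\<omega>. (score n \<omega> / sqrt n)\<^sup>2)" "expectation (\<lambda>\<omega>. (score n \<omega> / sqrt n)\<^sup>2) \<le> C"
      using C(2)[of n] C(3)[of n] n by (simp_all add: power_divide pos_divide_le_eq)
    have R2: "integrable M (\<lambda>\<omega>. (remainder n \<omega> / sqrt n)\<^sup>2)"
      using remainder_sq[of n] by (simp add: power_divide)
    have m: "\<rho> n \<in> borel_measurable M" "(\<lambda>\<omega>. score n \<omega> / sqrt n) \<in> borel_measurable M"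
      "(\<lambda>\<omega>. remainder n \<omega> / sqrt n) \<in> borel_measurable M" by measurable
    have ii: "integrable M (\<lambda>\<omega>. iexp (h \<omega>))" if [measurable]: "h \<in> borel_measurable M" for h
      by (rule integrable_const_bound[where B = 1]) auto
    have i1: "integrable M (\<lambda>\<omega>. \<bar>\<rho> n \<omega> * (score n \<omega> / sqrt n)\<bar>)"
      by (rule integrable_abs[OF integrable_mult_of_squares[OF m(1,2) \<rho>2(1) S2(1)]])
    have i2: "integrable M (\<lambda>\<omega>. \<bar>remainder n \<omega> / sqrt n\<bar>)"
      by (rule integrable_abs[OF expectation_abs_le_sqrt(1)[OF m(3) R2]])
    have "(\<lambda>\<omega>. ?A n \<omega>) \<in> borel_measurable M"
      "(\<lambda>\<omega>. ?B n \<omega>) \<in> borel_measurable M" by measurable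
    note ii = this[THEN ii]
    have eq: "expectation (\<lambda>\<omega>. iexp (?A n \<omega>))
        - expectation (\<lambda>\<omega>. iexp (?B n \<omega>))
      = expectation (\<lambda>\<omega>. iexp (?A n \<omega>) - iexp (?B n \<omega>))"
      by (rule Bochner_Integration.integral_diff[symmetric, OF ii])
    have "norm (expectation (\<lambda>\<omega>. iexp (?A n \<omega>) - iexp (?B n \<omega>)))
        \<le> expectation (\<lambda>\<omega>. \<bar>t\<bar> * (\<bar>\<rho> n \<omega> * (score n \<omega> / sqrt n)\<bar> + sqrt q * \<bar>remainder n \<omega> / sqrt n\<bar>))"
    proof (rule integral_norm_le)
      show "integrable M (\<lambda>\<omega>. iexp (?A n \<omega>) - iexp (?B n \<omega>))"
        by (rule Bochner_Integration.integrable_diff[OF ii])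
      show "integrable M (\<lambda>\<omega>. \<bar>t\<bar> * (\<bar>\<rho> n \<omega> * (score n \<omega> / sqrt n)\<bar> + sqrt q * \<bar>remainder n \<omega> / sqrt n\<bar>))"
        by (intro integrable_mult_right Bochner_Integration.integrable_add i1 i2)
      fix \<omega>
      \<comment> \<open>The first term is the error of the normalization against the full score, the
        second the neglected remainder at the limiting normalization.\<close>
      have "?A n \<omega> - ?B n \<omega>
          = t * (\<rho> n \<omega> * (score n \<omega> / sqrt n) + sqrt q * (remainder n \<omega> / sqrt n))"
        by (simp add: \<rho>_def L_eq algebra_simps diff_divide_distrib)
      then have "\<bar>?A n \<omega> - ?B n \<omega>\<bar>
          \<le> \<bar>t\<bar> * (\<bar>\<rho> n \<omega> * (score n \<omega> / sqrt n)\<bar> + \<bar>sqrt q * (remainder n \<omega> / sqrt n)\<bar>)"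
        by (simp only: abs_mult[of t]) (intro mult_left_mono abs_triangle_ineq abs_ge_zero)
      also have "\<bar>sqrt q * (remainder n \<omega> / sqrt n)\<bar> = sqrt q * \<bar>remainder n \<omega> / sqrt n\<bar>"
        using q_bounds by (simp only: abs_mult) simp
      finally show "norm (iexp (?A n \<omega>) - iexp (?B n \<omega>))
          \<le> \<bar>t\<bar> * (\<bar>\<rho> n \<omega> * (score n \<omega> / sqrt n)\<bar> + sqrt q * \<bar>remainder n \<omega> / sqrt n\<bar>)"
        by (rule order_trans[OF iexp_lipschitz])
    qed
    also have "\<dots> = \<bar>t\<bar> * (expectation (\<lambda>\<omega>. \<bar>\<rho> n \<omega> * (score n \<omega> / sqrt n)\<bar>) + sqrt q * expectation (\<lambda>\<omega>. \<bar>remainder n \<omega> / sqrt n\<bar>))"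
      unfolding integral_mult_right_zero Bochner_Integration.integral_add[OF i1 integrable_mult_right[OF i2]] ..
    also have "\<dots> \<le> e n"
      unfolding e_def
    proof (intro mult_left_mono add_mono)
      have "expectation (\<lambda>\<omega>. \<bar>\<rho> n \<omega> * (score n \<omega> / sqrt n)\<bar>)
          \<le> sqrt (expectation (\<lambda>\<omega>. (\<rho> n \<omega>)\<^sup>2) * expectation (\<lambda>\<omega>. (score n \<omega> / sqrt n)\<^sup>2))"
        by (rule integral_mult_le_sqrt[OF m(1,2) \<rho>2(1) S2(1)])
      also have "\<dots> \<le> sqrt (kT / q * (1 / real n) * C)"
        using \<rho>2(2) S2(2) q_bounds by (intro real_sqrt_le_mono mult_mono) auto
      finally show "expectation (\<lambda>\<omega>. \<bar>\<rho> n \<omega> * (score n \<omega> / sqrt n)\<bar>) \<le> sqrt (kT / q * (1 / real n) * C)" .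
      have "expectation (\<lambda>\<omega>. \<bar>remainder n \<omega> / sqrt n\<bar>) \<le> sqrt (expectation (\<lambda>\<omega>. (remainder n \<omega> / sqrt n)\<^sup>2))"
        by (rule expectation_abs_le_sqrt(2)[OF m(3) R2])
      then show "expectation (\<lambda>\<omega>. \<bar>remainder n \<omega> / sqrt n\<bar>) \<le> sqrt (expectation (\<lambda>\<omega>. (remainder n \<omega>)\<^sup>2) / n)"
        by (simp add: power_divide)
    qed (use q_bounds in auto)
    finally show ?thesis unfolding eq .
  qed
  have "(\<lambda>n. expectation (\<lambda>\<omega>. iexp (?A n \<omega>))
      - expectation (\<lambda>\<omega>. iexp (?B n \<omega>))) \<longlonglongrightarrow> 0"
    by (rule Lim_null_comparison[OF eventually_sequentiallyI[of 1, OF close] e_lim])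
  \<comment> \<open>Evaluating the limit at \<open>t * sqrt q\<close> produces the factor q in the
    variance.\<close>
  note * = this main_clt[of "t * sqrt q", folded L_def]
  have "(t * sqrt q)\<^sup>2 / 2 * (v1 + v2 + v3) = t\<^sup>2 * (q * (v1 + v2 + v3)) / 2"
    using q_bounds by (simp add: power_mult_distrib)
  with tendsto_add[OF *] show ?thesis by (simp only: diff_add_cancel add_0)
qed

text \<open>By Pythagoras \<open>q v3\<close> is q times the part of Var \<tau> explained by
  \<psi>1, and \<open>q v2 = E Var(\<tau> | \<psi>1) - E Var(\<tau> | \<psi>2)\<close>. By the
  pointwise identity below, \<open>q v1 = E Var(\<tau> | \<psi>2) + E Var(Ybar | \<psi>2) / (p (1 -
  p))\<close>. In the sum the term E Var(\<tau> | \<psi>2) cancels.\<close>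

lemma variance_identity:
  "q * (v1 + v2 + v3) = q * (\<integral>w. (tau w - ate)\<^sup>2 \<partial>\<mu>) + (1 - q) * (\<integral>w. (tau w - cate (f (fst w)))\<^sup>2 \<partial>\<mu>)
     + (\<integral>w. (ybar w - bal (fst w))\<^sup>2 \<partial>\<mu>) / (p * (1 - p))"
proof -
  have nz: "q \<noteq> 0" "p \<noteq> 0" "1 - p \<noteq> 0" using q_bounds p_bounds by auto
  have o1: "(\<integral>w. (tau w - ate)\<^sup>2 \<partial>\<mu>) = (\<integral>w. (tau w - cate (f (fst w)))\<^sup>2 \<partial>\<mu>) + v3"
    unfolding v3_def using cond_exp_fn_orthogonal[OF prob_\<mu> ffst_\<mu> cate_ce tau_sq, of "\<lambda>_. ate"] by simp
  have o2: "(\<integral>w. (tau w - cate (f (fst w)))\<^sup>2 \<partial>\<mu>)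
      = (\<integral>w. (tau w - (m1 (fst w) - m0 (fst w)))\<^sup>2 \<partial>\<mu>) + (\<integral>w. ((m1 (fst w) - m0 (fst w)) - cate (f (fst w)))\<^sup>2 \<partial>\<mu>)"
    using cond_exp_fn_orthogonal[OF prob_\<mu> fst_\<mu> tau_ce tau_sq, of "\<lambda>v. cate (f v)"] cate_sq by simp
  have e2: "v2 = (\<integral>w. ((m1 (fst w) - m0 (fst w)) - cate (f (fst w)))\<^sup>2 \<partial>\<mu>) / q"
    unfolding v2_def dm_def using nz by (simp add: power_divide power2_eq_square)
  define r1 where "r1 w = y1 w - m1 (fst w)" for w
  define r0 where "r0 w = y0 w - m0 (fst w)" for w
  have r_sq: "integrable \<mu> (\<lambda>w. (r1 w)\<^sup>2)" "integrable \<mu> (\<lambda>w. (r0 w)\<^sup>2)"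
    unfolding r1_def r0_def using y_sq m_sq by (auto intro!: integrable_power2_diff)
  have e1: "q * v1 = (\<integral>w. (r1 w)\<^sup>2 \<partial>\<mu>) / p + (\<integral>w. (r0 w)\<^sup>2 \<partial>\<mu>) / (1 - p)"
  proof -
    have "(\<integral>w. (x1 w)\<^sup>2 \<partial>\<mu>) = (\<integral>w. (r1 w)\<^sup>2 \<partial>\<mu>) / (q * p)\<^sup>2" "(\<integral>w. (x0 w)\<^sup>2 \<partial>\<mu>) = (\<integral>w. (r0 w)\<^sup>2 \<partial>\<mu>) / (q * (1 - p))\<^sup>2"
      unfolding x1_def x0_def r1_def r0_def by (simp_all add: power_divide power_mult_distrib)
    then have "q * v1 = q * (q * (p * ((\<integral>w. (r1 w)\<^sup>2 \<partial>\<mu>) / (q * p)\<^sup>2) + (1 - p) * ((\<integral>w. (r0 w)\<^sup>2 \<partial>\<mu>) / (q * (1 - p))\<^sup>2)))"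
      by (simp only: v1_def)
    also have "\<dots> = (\<integral>w. (r1 w)\<^sup>2 \<partial>\<mu>) / p + (\<integral>w. (r0 w)\<^sup>2 \<partial>\<mu>) / (1 - p)"
      using nz by (simp add: power2_eq_square distrib_left)
    finally show ?thesis .
  qed
  have sq: "integrable \<mu> (\<lambda>w. (tau w - (m1 (fst w) - m0 (fst w)))\<^sup>2)" "integrable \<mu> (\<lambda>w. (ybar w - bal (fst w))\<^sup>2)"
    using tau_sq ybar_sq bal_sq m_sq by (auto intro!: integrable_power2_diff)
  have pt: "(tau w - (m1 (fst w) - m0 (fst w)))\<^sup>2 + (ybar w - bal (fst w))\<^sup>2 / (p * (1 - p)) = (r1 w)\<^sup>2 / p + (r0 w)\<^sup>2 / (1 - p)" for w
  proof -
    have "tau w - (m1 (fst w) - m0 (fst w)) = r1 w - r0 w" "ybar w - bal (fst w) = (1 - p) * r1 w + p * r0 w"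
      by (simp_all add: tau_def ybar_def bal_def r1_def r0_def algebra_simps)
    \<comment> \<open>The cross terms -2ab and 2ab cancel, and
      \<open>1 + (1 - p) / p = 1 / p\<close>, \<open>1 + p / (1 - p) = 1 / (1 - p)\<close>.\<close>
    moreover have "(a - b)\<^sup>2 + ((1 - p) * a + p * b)\<^sup>2 / (p * (1 - p)) = a\<^sup>2 / p + b\<^sup>2 / (1 - p)" for a b :: real
      using nz by (simp add: field_simps power2_eq_square)
    ultimately show ?thesis by simp
  qed
  have "(\<integral>w. (tau w - (m1 (fst w) - m0 (fst w)))\<^sup>2 \<partial>\<mu>) + (\<integral>w. (ybar w - bal (fst w))\<^sup>2 \<partial>\<mu>) / (p * (1 - p))
      = (\<integral>w. (tau w - (m1 (fst w) - m0 (fst w)))\<^sup>2 + (ybar w - bal (fst w))\<^sup>2 / (p * (1 - p)) \<partial>\<mu>)"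
    using sq by simp
  also have "\<dots> = (\<integral>w. (r1 w)\<^sup>2 \<partial>\<mu>) / p + (\<integral>w. (r0 w)\<^sup>2 \<partial>\<mu>) / (1 - p)"
    unfolding pt using r_sq by simp
  finally have key: "(\<integral>w. (tau w - (m1 (fst w) - m0 (fst w)))\<^sup>2 \<partial>\<mu>) + (\<integral>w. (ybar w - bal (fst w))\<^sup>2 \<partial>\<mu>) / (p * (1 - p)) = q * v1"
    using e1 by simp
  have "q * v2 = (\<integral>w. ((m1 (fst w) - m0 (fst w)) - cate (f (fst w)))\<^sup>2 \<partial>\<mu>)" using e2 nz by simp
  then show ?thesis using key o1 o2 by (simp add: algebra_simps)
qed

end

section \<open>The limit theorem\<close>

text \<open>For positive v the law is that of \<open>sqrt v\<close> times a standard normal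
  variable; for v = 0, which the limit theorem admits, it is a point mass.\<close>

lemma normal_law_char:
  assumes "0 \<le> v"
  shows "real_distribution (normal_law 0 v)" "char (normal_law 0 v) t = complex_of_real (exp (- (t\<^sup>2 * v / 2)))"
proof -
  have "real_distribution (normal_law 0 v) \<and> char (normal_law 0 v) t = complex_of_real (exp (- (t\<^sup>2 * v / 2)))"
  proof (cases "v = 0")
    case True
    have "real_distribution (return borel (0::real))"
      by (simp add: real_distribution_def real_distribution_axioms_def prob_space_return)
    then show ?thesis using True by (simp add: normal_law_def char_def integral_return)
  next
    case False
    define s where "s = sqrt v"
    have s: "0 < s" "s\<^sup>2 = v" using assms False by (auto simp: s_def)
    interpret N: prob_space "density lborel (normal_density 0 s)" by (rule prob_space_normal_density[OF s(1)])
    have "distr std_normal_distribution borel (\<lambda>x. s * x) = density lborel (normal_density 0 s)"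
    proof -
      interpret S: prob_space std_normal_distribution by (rule prob_space_normal_density) simp
      have "distributed std_normal_distribution lborel (\<lambda>x. x) std_normal_density"
        unfolding distributed_def by (auto simp: distr_id2 sets_lborel)
      from S.normal_density_affine[OF this, of s 0] s show ?thesis
        by (simp add: distributed_def cong: distr_cong)
    qed
    then have eq: "normal_law 0 v = distr std_normal_distribution borel (\<lambda>x. s * x)"
      using False by (simp add: normal_law_def s_def)
    have "char (normal_law 0 v) t = char std_normal_distribution (t * s)"
      unfolding eq char_def by (subst integral_distr) (auto simp: ac_simps)
    also have "\<dots> = complex_of_real (exp (- (t\<^sup>2 * v / 2)))"
      using s by (simp add: char_std_normal_distribution power_mult_distrib)
    finally have "char (normal_law 0 v) t = complex_of_real (exp (- (t\<^sup>2 * v / 2)))" .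
    moreover have "real_distribution (normal_law 0 v)"
      using False N.prob_space_axioms by (simp add: normal_law_def s_def real_distribution_def real_distribution_axioms_def)
    ultimately show ?thesis by simp
  qed
  then show "real_distribution (normal_law 0 v)" "char (normal_law 0 v) t = complex_of_real (exp (- (t\<^sup>2 * v / 2)))" by auto
qed

text \<open>The grouping functions hidden in the two Loc hypotheses instantiate
  \<open>local_experiment_sq\<close>; \<open>variance_identity\<close> matches V with the limit in
  \<open>char_limit\<close>, and Levy's continuity theorem turns the limit of characteristic
  functions into convergence in distribution.\<close>

theorem theorem4p5:
  fixes M :: "'o measure"
    and \<psi>2 :: "nat \<Rightarrow> 'o \<Rightarrow> 'v::euclidean_space"
    and \<psi>1 :: "nat \<Rightarrow> 'o \<Rightarrow> 'u::euclidean_space"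
    and f :: "'v \<Rightarrow> 'u"
    and Y0 Y1 :: "nat \<Rightarrow> 'o \<Rightarrow> real"
    and W :: "nat \<Rightarrow> 'o \<Rightarrow> 'v \<times> real \<times> real"
    and R :: "nat \<Rightarrow> 'r measure"
    and \<pi> :: "nat \<Rightarrow> 'o \<Rightarrow> 'r"
    and T D :: "nat \<Rightarrow> nat \<Rightarrow> 'o \<Rightarrow> bool"
    and Y :: "nat \<Rightarrow> nat \<Rightarrow> 'o \<Rightarrow> real"
    and \<tau> Ybar :: "'o \<Rightarrow> real"
    and q p ATE V :: real
  assumes prob_space: "prob_space M"
    and W_def: "\<And>i \<omega>. W i \<omega> = (\<psi>2 i \<omega>, Y0 i \<omega>, Y1 i \<omega>)"
    and W_indep: "prob_space.indep_vars M (\<lambda>_. borel) W {1..}"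
    and W_ident: "\<And>i. i \<ge> 1 \<Longrightarrow> distr M borel (W i) = distr M borel (W 1)"
    and Y0_sq: "integrable M (\<lambda>\<omega>. (Y0 1 \<omega>)\<^sup>2)"
    and Y1_sq: "integrable M (\<lambda>\<omega>. (Y1 1 \<omega>)\<^sup>2)"
    and f_measurable: "f \<in> borel_measurable borel"
    and \<psi>1_def: "\<And>i \<omega>. \<psi>1 i \<omega> = f (\<psi>2 i \<omega>)"
    and q: "q \<in> \<rat>" "0 < q" "q \<le> 1"
    and p: "p \<in> \<rat>" "0 < p" "p < 1"
    and \<pi>_measurable: "\<And>n. \<pi> n \<in> measurable M (R n)"
    and \<pi>_indep: "\<And>n. prob_space.indep_set M
          (sets (sigma_of M (PiM {1..n} (\<lambda>_. borel)) (upto_n n W)))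
          (sets (sigma_of M (R n) (\<pi> n)))"
    and T_measurable: "\<And>n i. i \<in> {1..n} \<Longrightarrow> T n i \<in> measurable M (count_space UNIV)"
    and D_measurable: "\<And>n i. i \<in> {1..n} \<Longrightarrow> D n i \<in> measurable M (count_space UNIV)"
    and T_Loc: "Loc_sampling M W R \<pi> \<psi>1 T q"
    and D_Loc: "Loc_assignment M W R \<pi> T \<psi>2 D p"
    and Y_def: "Y = observed_outcome T D Y0 Y1"
    and \<tau>_def: "\<tau> = (\<lambda>\<omega>. Y1 1 \<omega> - Y0 1 \<omega>)"
    and Ybar_def: "Ybar = (\<lambda>\<omega>. (1 - p) * Y1 1 \<omega> + p * Y0 1 \<omega>)"
    and ATE_def: "ATE = prob_space.expectation M \<tau>"
    and V_def: "V = q * prob_space.variance M \<tau>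
          + (1 - q) * prob_space.expectation M (cond_var M (sigma_of M borel (\<psi>1 1)) \<tau>)
          + prob_space.expectation M (cond_var M (sigma_of M borel (\<psi>2 1)) Ybar) / (p * (1 - p))"
  shows "weak_conv_m
          (\<lambda>n. distr M borel (\<lambda>\<omega>. sqrt (num_sampled T n \<omega>) * (theta_hat q p T D Y n \<omega> - ATE)))
          (normal_law 0 V)"
proof -
  have \<psi>2_eq: "\<psi>2 = (\<lambda>i \<omega>. fst (W i \<omega>))" and Y0_eq: "Y0 = (\<lambda>i \<omega>. fst (snd (W i \<omega>)))"
    and Y1_eq: "Y1 = (\<lambda>i \<omega>. snd (snd (W i \<omega>)))" and \<psi>1_eq: "\<psi>1 = (\<lambda>i \<omega>. f (fst (W i \<omega>)))"
    by (auto simp: W_def \<psi>1_def fun_eq_iff)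
  obtain aT kT hT where T: "1 \<le> aT" "aT \<le> kT" "q = real aT / real kT"
    "\<And>n. hT n \<in> measurable (PiM {1..n} (\<lambda>_. borel) \<Otimes>\<^sub>M R n) (count_space (Pow (Pow {1..n})))"
    "\<And>n \<omega>. \<omega> \<in> space M \<Longrightarrow> partition_on {1..n} (hT n (upto_n n \<psi>1 \<omega>, \<pi> n \<omega>))"
    "tight_matching M \<psi>1 (\<lambda>n \<omega>. hT n (upto_n n \<psi>1 \<omega>, \<pi> n \<omega>))"
    "\<And>n. complete_randomization M
        (sigma_of M (PiM {1..n} (\<lambda>_. borel) \<Otimes>\<^sub>M R n) (\<lambda>\<omega>. (upto_n n W \<omega>, \<pi> n \<omega>)))
        (\<lambda>\<omega>. hT n (upto_n n \<psi>1 \<omega>, \<pi> n \<omega>)) (T n) aT kT"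
    using T_Loc unfolding Loc_sampling_def local_randomization_def by blast
  obtain aD kD hD where D: "1 \<le> aD" "aD \<le> kD" "p = real aD / real kD"
    "\<And>n. hD n \<in> measurable (PiM {1..n} (\<lambda>_. borel) \<Otimes>\<^sub>M (PiM {1..n} (\<lambda>_. count_space UNIV) \<Otimes>\<^sub>M R n))
        (count_space (Pow (Pow {1..n})))"
    "\<And>n \<omega>. \<omega> \<in> space M \<Longrightarrow>
        partition_on {i \<in> {1..n}. T n i \<omega>} (hD n (upto_n n \<psi>2 \<omega>, upto_n n (T n) \<omega>, \<pi> n \<omega>))"
    "tight_matching M \<psi>2 (\<lambda>n \<omega>. hD n (upto_n n \<psi>2 \<omega>, upto_n n (T n) \<omega>, \<pi> n \<omega>))"
    "\<And>n. complete_randomization M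
        (sigma_of M (PiM {1..n} (\<lambda>_. borel) \<Otimes>\<^sub>M (PiM {1..n} (\<lambda>_. count_space UNIV) \<Otimes>\<^sub>M R n))
          (\<lambda>\<omega>. (upto_n n W \<omega>, upto_n n (T n) \<omega>, \<pi> n \<omega>)))
        (\<lambda>\<omega>. hD n (upto_n n \<psi>2 \<omega>, upto_n n (T n) \<omega>, \<pi> n \<omega>)) (D n) aD kD"
    using D_Loc unfolding Loc_assignment_def local_randomization_def by blast
  \<comment> \<open>Here p < 1 is used; it gives 1 - p > 0 in the locale.\<close>
  have aD_less: "aD < kD" using p(3) D(1,2,3) by (cases "aD = kD") auto
  interpret prob_space M by (rule prob_space)
  interpret E: local_experiment_sq M W f R \<pi> T D aT kT aD kD hT hD
    by (unfold_locales;
        (intro W_indep W_ident f_measurable \<pi>_measurable \<pi>_indep T_measurable D_measurable T(1,2) D(1,2) aD_less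
           Y0_sq[unfolded Y0_eq] Y1_sq[unfolded Y1_eq]
           T(4-7)[unfolded \<psi>1_eq] D(4-7)[unfolded \<psi>2_eq]); assumption?)
  have Eq: "E.q = q" and Ep: "E.p = p" by (simp_all add: E.q_def E.p_def T D)
  have W1: "W 1 \<in> measurable M E.\<mu>" and law: "distr M E.\<mu> (W 1) = E.\<mu>"
    by (rule E.W_\<mu> E.law_W, simp)+
  have tau: "\<tau> = (\<lambda>\<omega>. E.tau (W 1 \<omega>))" and ybar: "Ybar = (\<lambda>\<omega>. E.ybar (W 1 \<omega>))"
    by (simp_all add: \<tau>_def Ybar_def E.tau_def E.ybar_def E.y0_def E.y1_def Ep Y0_eq Y1_eq)
  have ATE: "ATE = E.ate"
    unfolding ATE_def tau E.ate_def by (rule E.expectation_W) (simp_all add: E.y_meas E.borel_\<mu>)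
  have Vv: "V = q * (E.v1 + E.v2 + E.v3)"
  proof -
    have "variance \<tau> = (\<integral>w. (E.tau w - E.ate)\<^sup>2 \<partial>E.\<mu>)"
      unfolding ATE_def[symmetric] ATE unfolding tau
      using E.expectation_W[of 1 "\<lambda>w. (E.tau w - E.ate)\<^sup>2"] E.y_meas(3) by (simp add: E.borel_\<mu>)
    moreover have "expectation (cond_var M (sigma_of M borel (\<psi>1 1)) \<tau>) = (\<integral>w. (E.tau w - E.cate (f (fst w)))\<^sup>2 \<partial>E.\<mu>)"
      unfolding tau \<psi>1_eq by (rule expectation_cond_var[OF W1 law E.ffst_\<mu> E.cate_ce E.tau_sq])
    moreover have "expectation (cond_var M (sigma_of M borel (\<psi>2 1)) Ybar) = (\<integral>w. (E.ybar w - E.bal (fst w))\<^sup>2 \<partial>E.\<mu>)"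
      unfolding ybar \<psi>2_eq by (rule expectation_cond_var[OF W1 law E.fst_\<mu> E.ybar_ce E.ybar_sq])
    ultimately show ?thesis
      using E.variance_identity by (simp add: V_def Eq Ep)
  qed
  have V0: "0 \<le> V" using E.v_nonneg q by (simp add: Vv)
  let ?Z = "\<lambda>n \<omega>. sqrt (num_sampled T n \<omega>) * (theta_hat q p T D Y n \<omega> - ATE)"
  \<comment> \<open>The error is \<open>score / n\<close>, and one factor \<open>sqrt n\<close> is
    moved under the root of the sample size.\<close>
  have stat: "?Z n \<omega> = sqrt (num_sampled T n \<omega> / n) * (E.score n \<omega> / sqrt n)"
    if n: "n \<ge> 1" for n \<omega>
  proof -
    have "theta_hat q p T D Y n \<omega> - ATE = E.score n \<omega> / n"
    proof -
      have eq: "of_bool (T n i \<omega>) / q * (of_bool (D n i \<omega>) * Y n i \<omega> / p - (1 - of_bool (D n i \<omega>)) * Y n i \<omega> / (1 - p))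
        = of_bool (T n i \<omega>) / q * (of_bool (D n i \<omega>) * E.y1 (W i \<omega>) / p - (1 - of_bool (D n i \<omega>)) * E.y0 (W i \<omega>) / (1 - p))" for i
        by (cases "T n i \<omega>"; cases "D n i \<omega>") (simp_all add: Y_def observed_outcome_def E.y0_def E.y1_def Y0_eq Y1_eq)
      show ?thesis
        unfolding theta_hat_def eq using n by (simp add: E.score_def Eq Ep ATE sum_subtractf diff_divide_distrib)
    qed
    then show ?thesis by (simp add: real_sqrt_divide)
  qed
  have meas: "(?Z n) \<in> borel_measurable M" for n
  proof (cases "n = 0")
    case True
    then show ?thesis by (simp add: num_sampled_def)
  next
    case False
    then show ?thesis using E.score_meas[of n] E.num_sampled_meas[of n] stat[of n] by simp
  qed
  show ?thesis
  proof (rule levy_continuity)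
    show "real_distribution (distr M borel (?Z n))" for n
      by (rule real_distribution_distr[OF meas])
    show "real_distribution (normal_law 0 V)" by (rule normal_law_char[OF V0])
    fix t
    have "char (distr M borel (?Z n)) t
        = expectation (\<lambda>\<omega>. iexp (t * (sqrt (num_sampled T n \<omega> / n) * (E.score n \<omega> / sqrt n))))" if "n \<ge> 1" for n
      unfolding char_def by (subst integral_distr[OF meas]) (simp_all add: stat[OF that])
    then have ev: "\<forall>\<^sub>F n in sequentially. expectation (\<lambda>\<omega>. iexp (t * (sqrt (num_sampled T n \<omega> / n) * (E.score n \<omega> / sqrt n))))
        = char (distr M borel (?Z n)) t"
      by (intro eventually_sequentiallyI[of 1]) simp
    from Lim_transform_eventually[OF E.char_limit[of t] ev]
    show "(\<lambda>n. char (distr M borel (?Z n)) t)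
        \<longlonglongrightarrow> char (normal_law 0 V) t"
      unfolding normal_law_char(2)[OF V0] by (simp only: Vv Eq)
  qed
qed

end
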